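(* Let $E=(E^0,E^1,r,s)$ be a strongly connected finite directed graph with no sources, with vertex matrix $B$ of spectral radius $\rho(B)$, and let $(G,E)$ be a self-similar groupoid action. Let $x\in(0,\infty)^{E^0}$ be the Perron-Frobenius eigenvector of $B$ with $\|x\|_1=1$. For $g\in G$, $v\in E^0$ and $k\ge0$ put $F_g^k(v)=\{\mu\in d(g)E^kv: g\cdot\mu=\mu\text{ and }g|_\mu=\mathrm{id}_v\}$ and $c_g=\lim_{k\to\infty}\rho(B)^{-k}\sum_{v\in E^0}|F_g^k(v)|\,x_v$ (this limit exists, and $c_{\mathrm{id}_v}=x_v$ for $v\in E^0$). Let $\sigma$ be the dynamics on $\mathcal{O}(G,E)$ with $\sigma_t(s_\mu u_gs_\nu^* )=e^{it(|\mu|-|\nu|)}s_\mu u_gs_\nu^*$. (1) There is a KMS$_{\ln\rho(B)}$ state $\psi$ of $(\mathcal{O}(G,E),\sigma)$ such that for all $\kappa,\lambda\in E^*$ and $g\in G$ $$\psi(s_\kappa u_gs_\lambda^* )=\begin{cases}\rho(B)^{-|\kappa|}c_g&\text{if }\kappa=\lambda\text{ and }d(g)=c(g)=s(\kappa)\\0&\text{otherwise.}\end{cases}$$ (2) Suppose that for every $g\in G\setminus E^0$ the set $\{g|_\mu:\mu\in d(g)E^*\}$ is finite. Then the state in part (1) is the only KMS state of $(\mathcal{O}(G,E),\sigma)$.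
   Context: Graphs: for a directed graph $E=(E^0,E^1,r,s)$, $E^k$ is the set of paths $\mu=\mu_1\cdots\mu_k$ with $\mu_i\in E^1$ and $s(\mu_i)=r(\mu_{i+1})$; $r(\mu)=r(\mu_1)$, $s(\mu)=s(\mu_k)$, $|\mu|=k$; vertices are paths of length $0$ with $r(v)=s(v)=v$; $E^*=\bigsqcup_{k\ge0}E^k$; $vE^k=\{\mu\in E^k:r(\mu)=v\}$, $vE^kw=\{\mu\in vE^k:s(\mu)=w\}$, $vE^*=\bigsqcup_kvE^k$. "No sources" means $vE^1\ne\emptyset$ for all $v$. The vertex matrix is $B(v,w)=|vE^1w|$; $E$ is strongly connected if for all $v,w$ there is $n$ with $B^n(v,w)\ne0$. Groupoids: a groupoid $G$ with unit space $G^0$ is a small category with inverses with objects $G^0$, domain and codomain maps $d,c:G\to G^0$, and product $gh$ defined when $d(g)=c(h)$; it is discrete, and units $v$ are identified with identity morphisms $\mathrm{id}_v$. Self-similar actions: a partial isomorphism of $E^*$ is a bijection $g:vE^*\to wE^*$ that maps $vE^k$ bijectively onto $wE^k$ for all $k\ge0$ and satisfies $g(\mu e)\in g(\mu)E^1$ for all $\mu e\in vE^*$ with $e\in E^1$; $d(g)=v$, $c(g)=w$. Under composition these form a groupoid $\mathrm{PIso}(E^* )$ with unit space $E^0$. An action of a groupoid $G$ with $G^0=E^0$ is a unit-preserving homomorphism $G\to\mathrm{PIso}(E^* )$, written $g\cdot\mu$; it is faithful if injective. A self-similar groupoid action $(G,E)$ is a faithful action such that for all $g\in G$, $e\in d(g)E^1$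 there is $h\in G$ with $g\cdot(e\mu)=(g\cdot e)(h\cdot\mu)$ for all $\mu\in s(e)E^*$; this unique $h$ is $g|_e$, and $g|_\mu:=(\cdots(g|_{\mu_1})|_{\mu_2}\cdots)|_{\mu_k}$ (with $g|_{d(g)}=g$). Algebras: a unitary representation $U$ of $G$ in a $C^*$-algebra assigns to each $v\in G^0$ a projection $U_v$ and to each $g$ a partial isometry $U_g$ with initial projection $U_{d(g)}$ and final projection $U_{c(g)}$, with $U_gU_h=U_{gh}$ if $d(g)=c(h)$ and $0$ otherwise. A Toeplitz-Cuntz-Krieger $E$-family $(p,s)$ consists of mutually orthogonal projections $p_v$ and partial isometries $s_e$ with $s_e^*s_e=p_{s(e)}$ and $p_v\ge\sum_{e\in vE^1}s_es_e^*$. $\mathcal{T}(G,E)$ is the universal unital $C^*$-algebra generated by a unitary representation $u$ of $G$ and a Toeplitz-Cuntz-Krieger $E$-family $(p,s)$ with $u_v=p_v$, $\sum_vp_v=1$, and $u_gs_e=s_{g\cdot e}u_{g|_e}$ if $d(g)=r(e)$, $u_gs_e=0$ otherwise. $\mathcal{O}(G,E)$ is the quotient of $\mathcal{T}(G,E)$ by the ideal generated by $\{p_v-\sum_{e\in vE^1}s_es_e^*:v\in E^0\}$; the images of the generators are again written $u,p,s$. Write $s_\mu=s_{\mu_1}\cdots s_{\mu_k}$, $s_v=p_v$. KMS states: for an action $\sigma$ of $\mathbb{R}$ on a $C^*$-algebra $A$, $a\in A$ is analytic if $t\mapsto\sigma_t(a)$ extends to an entire function on $\mathbb{C}$; for $\beta\in\mathbb{R}$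 a state $\phi$ is a KMS$_\beta$ state if $\phi(ab)=\phi(b\sigma_{i\beta}(a))$ for all $a,b$ in a set of analytic elements spanning a dense $\sigma$-invariant subspace (for $\beta=0$ one also requires $\sigma$-invariance). A KMS state is a KMS$_\beta$ state for some $\beta\in\mathbb{R}$. *)

theory Defs
  imports
    "HOL-Analysis.Analysis"
    "HOL-Library.Poly_Mapping"
    "HOL-Library.Nonpos_Ints"
    "HOL-Algebra.QuotRing"
    "HOL-Algebra.Module"
begin

unbundle no Formal_Power_Series.fps_syntax

section \<open>Directed graphs and paths\<close>

text \<open>
  The vertex and edge sets are the types \<open>'v\<close> and \<open>'e\<close>; finiteness is imposed by the class
  \<open>finite\<close> where it is needed.
\<close>

record ('v, 'e) digraph =
  rng :: "'e \<Rightarrow> 'v"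
  src :: "'e \<Rightarrow> 'v"

text \<open>
  A path is a pair consisting of its range and its list of edges. The range is redundant unless
  the list is empty; the vertex \<open>v\<close>, as a path of length \<open>0\<close>, is \<open>(v, [])\<close>. Paths are read from
  range to source: in \<open>\<mu> = \<mu>\<^sub>1\<mu>\<^sub>2\<dots>\<close> the source of an edge is the range of the next one.
\<close>

type_synonym ('v, 'e) path = "'v \<times> 'e list"

primrec is_walk :: "('v, 'e) digraph \<Rightarrow> 'v \<Rightarrow> 'e list \<Rightarrow> 'v \<Rightarrow> bool" where
  "is_walk E v [] w \<longleftrightarrow> v = w"
| "is_walk E v (e # es) w \<longleftrightarrow> rng E e = v \<and> is_walk E (src E e) es w"

definition path_src :: "('v, 'e) digraph \<Rightarrow> ('v, 'e) path \<Rightarrow> 'v" where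
  "path_src E \<mu> = (if snd \<mu> = [] then fst \<mu> else src E (last (snd \<mu>)))"

definition path_len :: "('v, 'e) path \<Rightarrow> nat" where
  "path_len \<mu> = length (snd \<mu>)"

text \<open>\<open>paths_from_to E v k w\<close> is \<open>vE\<^sup>kw\<close>, \<open>paths_from E v k\<close> is \<open>vE\<^sup>k\<close>, \<open>vpaths E v\<close> is \<open>vE\<^sup>*\<close>.\<close>

definition paths_from_to :: "('v, 'e) digraph \<Rightarrow> 'v \<Rightarrow> nat \<Rightarrow> 'v \<Rightarrow> ('v, 'e) path set" where
  "paths_from_to E v k w = {\<mu>. fst \<mu> = v \<and> path_len \<mu> = k \<and> is_walk E v (snd \<mu>) w}"

definition paths_from :: "('v, 'e) digraph \<Rightarrow> 'v \<Rightarrow> nat \<Rightarrow> ('v, 'e) path set" where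
  "paths_from E v k = (\<Union>w. paths_from_to E v k w)"

definition vpaths :: "('v, 'e) digraph \<Rightarrow> 'v \<Rightarrow> ('v, 'e) path set" where
  "vpaths E v = (\<Union>k. paths_from E v k)"

definition all_paths :: "('v, 'e) digraph \<Rightarrow> ('v, 'e) path set" where
  "all_paths E = (\<Union>v. vpaths E v)"

definition edge_path :: "('v, 'e) digraph \<Rightarrow> 'e \<Rightarrow> ('v, 'e) path" where
  "edge_path E e = (rng E e, [e])"

definition append_path :: "('v, 'e) path \<Rightarrow> ('v, 'e) path \<Rightarrow> ('v, 'e) path" where
  "append_path \<mu> \<nu> = (fst \<mu>, snd \<mu> @ snd \<nu>)"

definition no_sources :: "('v, 'e) digraph \<Rightarrow> bool" where
  "no_sources E \<longleftrightarrow> (\<forall>v. paths_from E v 1 \<noteq> {})"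

definition vertex_matrix :: "('v::finite, 'e) digraph \<Rightarrow> real^'v^'v" where
  "vertex_matrix E = (\<chi> v w. real (card (paths_from_to E v 1 w)))"

definition strongly_connected :: "('v::finite, 'e) digraph \<Rightarrow> bool" where
  "strongly_connected E \<longleftrightarrow>
     (\<forall>v w. \<exists>n. (((**) (vertex_matrix E)) ^^ n) (mat 1) $ v $ w \<noteq> 0)"

definition spectral_radius :: "real^'n^'n \<Rightarrow> real" where
  "spectral_radius A =
     Max {cmod z | z. \<exists>y. y \<noteq> 0 \<and> map_matrix complex_of_real A *v y = z *s y}"

section \<open>Groupoids and self-similar actions\<close>

text \<open>The unit space is the type \<open>'v\<close> and the set of morphisms is the type \<open>'g\<close>.\<close>

record ('g, 'v) groupoid =
  gdom :: "'g \<Rightarrow> 'v"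
  gcod :: "'g \<Rightarrow> 'v"
  gcomp :: "'g \<Rightarrow> 'g \<Rightarrow> 'g"
  gid :: "'v \<Rightarrow> 'g"

locale groupoid =
  fixes G :: "('g, 'v) groupoid"
  assumes gdom_id: "gdom G (gid G v) = v"
    and gcod_id: "gcod G (gid G v) = v"
    and gdom_comp: "gdom G g = gcod G h \<Longrightarrow> gdom G (gcomp G g h) = gdom G h"
    and gcod_comp: "gdom G g = gcod G h \<Longrightarrow> gcod G (gcomp G g h) = gcod G g"
    and comp_assoc: "gdom G g = gcod G h \<Longrightarrow> gdom G h = gcod G k \<Longrightarrow>
      gcomp G (gcomp G g h) k = gcomp G g (gcomp G h k)"
    and comp_id_right: "gcomp G g (gid G (gdom G g)) = g"
    and comp_id_left: "gcomp G (gid G (gcod G g)) g = g"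
    and ex_inverse: "\<exists>h. gdom G h = gcod G g \<and> gcod G h = gdom G g \<and>
      gcomp G h g = gid G (gdom G g) \<and> gcomp G g h = gid G (gcod G g)"

text \<open>Only the values of \<open>f\<close> on \<open>vE\<^sup>*\<close> matter in \<open>partial_iso E v w f\<close>.\<close>

definition partial_iso ::
  "('v, 'e) digraph \<Rightarrow> 'v \<Rightarrow> 'v \<Rightarrow> (('v, 'e) path \<Rightarrow> ('v, 'e) path) \<Rightarrow> bool" where
  "partial_iso E v w f \<longleftrightarrow>
     bij_betw f (vpaths E v) (vpaths E w) \<and>
     (\<forall>k. bij_betw f (paths_from E v k) (paths_from E w k)) \<and>
     (\<forall>\<mu>\<in>vpaths E v. \<forall>e. rng E e = path_src E \<mu> \<longrightarrow>
        (\<exists>e'. rng E e' = path_src E (f \<mu>) \<and>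
              f (append_path \<mu> (edge_path E e)) = append_path (f \<mu>) (edge_path E e')))"

definition is_restriction ::
  "('v, 'e) digraph \<Rightarrow> ('g, 'v) groupoid \<Rightarrow> ('g \<Rightarrow> ('v, 'e) path \<Rightarrow> ('v, 'e) path) \<Rightarrow>
   'g \<Rightarrow> 'e \<Rightarrow> 'g \<Rightarrow> bool" where
  "is_restriction E G act g e h \<longleftrightarrow>
     gdom G h = src E e \<and> gcod G h = path_src E (act g (edge_path E e)) \<and>
     (\<forall>\<mu>\<in>vpaths E (src E e).
        act g (append_path (edge_path E e) \<mu>) = append_path (act g (edge_path E e)) (act h \<mu>))"

locale self_similar_action = groupoid G
  for E :: "('v, 'e) digraph" and G :: "('g, 'v) groupoid"
    and act :: "'g \<Rightarrow> ('v, 'e) path \<Rightarrow> ('v, 'e) path" +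
  assumes act_piso: "partial_iso E (gdom G g) (gcod G g) (act g)"
    and act_id: "\<mu> \<in> vpaths E v \<Longrightarrow> act (gid G v) \<mu> = \<mu>"
    and act_comp: "gdom G g = gcod G h \<Longrightarrow> \<mu> \<in> vpaths E (gdom G h) \<Longrightarrow>
      act (gcomp G g h) \<mu> = act g (act h \<mu>)"
    and faithful: "inj (\<lambda>g. (gdom G g, gcod G g, restrict (act g) (vpaths E (gdom G g))))"
    and self_similar: "rng E e = gdom G g \<Longrightarrow> \<exists>h. is_restriction E G act g e h"

definition restrict_edge ::
  "('v, 'e) digraph \<Rightarrow> ('g, 'v) groupoid \<Rightarrow> ('g \<Rightarrow> ('v, 'e) path \<Rightarrow> ('v, 'e) path) \<Rightarrow>
   'g \<Rightarrow> 'e \<Rightarrow> 'g" where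
  "restrict_edge E G act g e = (THE h. is_restriction E G act g e h)"

definition restrict_path ::
  "('v, 'e) digraph \<Rightarrow> ('g, 'v) groupoid \<Rightarrow> ('g \<Rightarrow> ('v, 'e) path \<Rightarrow> ('v, 'e) path) \<Rightarrow>
   'g \<Rightarrow> ('v, 'e) path \<Rightarrow> 'g" where
  "restrict_path E G act g \<mu> = foldl (restrict_edge E G act) g (snd \<mu>)"

definition edge_act ::
  "('v, 'e) digraph \<Rightarrow> ('g \<Rightarrow> ('v, 'e) path \<Rightarrow> ('v, 'e) path) \<Rightarrow> 'g \<Rightarrow> 'e \<Rightarrow> 'e" where
  "edge_act E act g e = hd (snd (act g (edge_path E e)))"

definition fixed_paths ::
  "('v, 'e) digraph \<Rightarrow> ('g, 'v) groupoid \<Rightarrow> ('g \<Rightarrow> ('v, 'e) path \<Rightarrow> ('v, 'e) path) \<Rightarrow>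
   'g \<Rightarrow> nat \<Rightarrow> 'v \<Rightarrow> ('v, 'e) path set" where
  "fixed_paths E G act g k v =
     {\<mu> \<in> paths_from_to E (gdom G g) k v. act g \<mu> = \<mu> \<and> restrict_path E G act g \<mu> = gid G v}"

definition fixed_seq ::
  "('v::finite, 'e) digraph \<Rightarrow> ('g, 'v) groupoid \<Rightarrow> ('g \<Rightarrow> ('v, 'e) path \<Rightarrow> ('v, 'e) path) \<Rightarrow>
   real^'v \<Rightarrow> 'g \<Rightarrow> nat \<Rightarrow> real" where
  "fixed_seq E G act x g k =
     (\<Sum>v\<in>UNIV. real (card (fixed_paths E G act g k v)) * x $ v)
       / spectral_radius (vertex_matrix E) ^ k"

definition fixed_lim ::
  "('v::finite, 'e) digraph \<Rightarrow> ('g, 'v) groupoid \<Rightarrow> ('g \<Rightarrow> ('v, 'e) path \<Rightarrow> ('v, 'e) path) \<Rightarrow>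
   real^'v \<Rightarrow> 'g \<Rightarrow> real" where
  "fixed_lim E G act x g = lim (fixed_seq E G act x g)"

section \<open>C*-algebraic data\<close>

definition complex_ring :: "complex ring" where
  "complex_ring = \<lparr>carrier = UNIV, mult = (*), one = 1, zero = 0, add = (+)\<rparr>"

text \<open>
  The operations of a unital C*-algebra with carrier set, over the complex numbers as scalars.
\<close>

record 'a cstar = "(complex, 'a) module" +
  star :: "'a \<Rightarrow> 'a"
  cnorm :: "'a \<Rightarrow> real"

locale cstar_algebra = ring A + module complex_ring A
  for A :: "'a cstar" (structure) +
  assumes smult_mult_left: "x \<in> carrier A \<Longrightarrow> y \<in> carrier A \<Longrightarrow> (z \<odot> x) \<otimes> y = z \<odot> (x \<otimes> y)"
    and smult_mult_right: "x \<in> carrier A \<Longrightarrow> y \<in> carrier A \<Longrightarrow> x \<otimes> (z \<odot> y) = z \<odot> (x \<otimes> y)"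
    and star_closed: "x \<in> carrier A \<Longrightarrow> star A x \<in> carrier A"
    and star_star: "x \<in> carrier A \<Longrightarrow> star A (star A x) = x"
    and star_add: "x \<in> carrier A \<Longrightarrow> y \<in> carrier A \<Longrightarrow> star A (x \<oplus> y) = star A x \<oplus> star A y"
    and star_smult: "x \<in> carrier A \<Longrightarrow> star A (z \<odot> x) = cnj z \<odot> star A x"
    and star_mult: "x \<in> carrier A \<Longrightarrow> y \<in> carrier A \<Longrightarrow> star A (x \<otimes> y) = star A y \<otimes> star A x"
    and cnorm_eq_0: "x \<in> carrier A \<Longrightarrow> cnorm A x = 0 \<longleftrightarrow> x = \<zero>"
    and cnorm_smult: "x \<in> carrier A \<Longrightarrow> cnorm A (z \<odot> x) = cmod z * cnorm A x"
    and cnorm_add: "x \<in> carrier A \<Longrightarrow> y \<in> carrier A \<Longrightarrow> cnorm A (x \<oplus> y) \<le> cnorm A x + cnorm A y"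
    and cnorm_mult: "x \<in> carrier A \<Longrightarrow> y \<in> carrier A \<Longrightarrow> cnorm A (x \<otimes> y) \<le> cnorm A x * cnorm A y"
    and cstar_identity: "x \<in> carrier A \<Longrightarrow> cnorm A (star A x \<otimes> x) = (cnorm A x)\<^sup>2"
    and complete: "(\<And>n. f n \<in> carrier A) \<Longrightarrow>
      (\<forall>\<epsilon>>0. \<exists>N. \<forall>m\<ge>N. \<forall>n\<ge>N. cnorm A (f m \<ominus> f n) < \<epsilon>) \<Longrightarrow>
      \<exists>x\<in>carrier A. (\<lambda>n. cnorm A (f n \<ominus> x)) \<longlonglongrightarrow> 0"

definition cstar_positive :: "'a cstar \<Rightarrow> 'a \<Rightarrow> bool" where
  "cstar_positive A x \<longleftrightarrow> (\<exists>y\<in>carrier A. x = star A y \<otimes>\<^bsub>A\<^esub> y)"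

definition cstar_le :: "'a cstar \<Rightarrow> 'a \<Rightarrow> 'a \<Rightarrow> bool" where
  "cstar_le A x y \<longleftrightarrow> cstar_positive A (y \<ominus>\<^bsub>A\<^esub> x)"

definition is_projection :: "'a cstar \<Rightarrow> 'a \<Rightarrow> bool" where
  "is_projection A p \<longleftrightarrow> p \<in> carrier A \<and> star A p = p \<and> p \<otimes>\<^bsub>A\<^esub> p = p"

definition is_unitary_rep :: "('g, 'v) groupoid \<Rightarrow> 'a cstar \<Rightarrow> ('g \<Rightarrow> 'a) \<Rightarrow> bool" where
  "is_unitary_rep G A u \<longleftrightarrow>
     (\<forall>v. is_projection A (u (gid G v))) \<and>
     (\<forall>g. u g \<in> carrier A \<and>
          star A (u g) \<otimes>\<^bsub>A\<^esub> u g = u (gid G (gdom G g)) \<and>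
          u g \<otimes>\<^bsub>A\<^esub> star A (u g) = u (gid G (gcod G g))) \<and>
     (\<forall>g h. u g \<otimes>\<^bsub>A\<^esub> u h = (if gdom G g = gcod G h then u (gcomp G g h) else \<zero>\<^bsub>A\<^esub>))"

text \<open>Partial isometry is automatic for \<open>s e\<close>, because \<open>(s e)\<^sup>*(s e)\<close> is a projection.\<close>

definition is_tck_family ::
  "('v, 'e::finite) digraph \<Rightarrow> 'a cstar \<Rightarrow> ('v \<Rightarrow> 'a) \<Rightarrow> ('e \<Rightarrow> 'a) \<Rightarrow> bool" where
  "is_tck_family E A p s \<longleftrightarrow>
     (\<forall>v. is_projection A (p v)) \<and>
     (\<forall>v w. v \<noteq> w \<longrightarrow> p v \<otimes>\<^bsub>A\<^esub> p w = \<zero>\<^bsub>A\<^esub>) \<and>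
     (\<forall>e. s e \<in> carrier A \<and> star A (s e) \<otimes>\<^bsub>A\<^esub> s e = p (src E e)) \<and>
     (\<forall>v. cstar_le A (\<Oplus>\<^bsub>A\<^esub>e\<in>{e. rng E e = v}. s e \<otimes>\<^bsub>A\<^esub> star A (s e)) (p v))"

definition is_toeplitz_rep ::
  "('v::finite, 'e::finite) digraph \<Rightarrow> ('g, 'v) groupoid \<Rightarrow>
   ('g \<Rightarrow> ('v, 'e) path \<Rightarrow> ('v, 'e) path) \<Rightarrow>
   'a cstar \<Rightarrow> ('g \<Rightarrow> 'a) \<Rightarrow> ('v \<Rightarrow> 'a) \<Rightarrow> ('e \<Rightarrow> 'a) \<Rightarrow> bool" where
  "is_toeplitz_rep E G act A u p s \<longleftrightarrow>
     is_unitary_rep G A u \<and> is_tck_family E A p s \<and>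
     (\<forall>v. u (gid G v) = p v) \<and>
     (\<Oplus>\<^bsub>A\<^esub>v\<in>UNIV. p v) = \<one>\<^bsub>A\<^esub> \<and>
     (\<forall>g e. u g \<otimes>\<^bsub>A\<^esub> s e =
        (if gdom G g = rng E e
         then s (edge_act E act g e) \<otimes>\<^bsub>A\<^esub> u (restrict_edge E G act g e) else \<zero>\<^bsub>A\<^esub>))"

section \<open>The free unital *-algebra and its C*-completions\<close>

text \<open>A letter \<open>(x, True)\<close> stands for the adjoint of the generator \<open>x\<close>.\<close>

datatype 'x star_word = Word (letters: "('x \<times> bool) list")

instantiation star_word :: (type) monoid_add
begin

definition zero_star_word :: "'a star_word" where
  "zero_star_word = Word []"

definition plus_star_word :: "'a star_word \<Rightarrow> 'a star_word \<Rightarrow> 'a star_word" where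
  "plus_star_word a b = Word (letters a @ letters b)"

instance
  by standard (simp_all add: zero_star_word_def plus_star_word_def)

end

definition word_star :: "'x star_word \<Rightarrow> 'x star_word" where
  "word_star w = Word (rev (map (\<lambda>(x, b). (x, \<not> b)) (letters w)))"

text \<open>
  The monoid algebra of the free monoid on letters; words are added by concatenation, so the
  convolution product of the type \<open>\<Rightarrow>\<^sub>0\<close> is the product of the free algebra.
\<close>

type_synonym 'x free_alg = "'x star_word \<Rightarrow>\<^sub>0 complex"

definition free_gen :: "'x \<Rightarrow> 'x free_alg" where
  "free_gen x = Poly_Mapping.single (Word [(x, False)]) 1"

definition free_scale :: "complex \<Rightarrow> 'x free_alg \<Rightarrow> 'x free_alg" where
  "free_scale z a = Poly_Mapping.single 0 z * a"

definition free_star :: "'x free_alg \<Rightarrow> 'x free_alg" where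
  "free_star a =
     (\<Sum>w\<in>Poly_Mapping.keys a. Poly_Mapping.single (word_star w) (cnj (Poly_Mapping.lookup a w)))"

definition cstar_seminorm :: "('x free_alg \<Rightarrow> real) \<Rightarrow> bool" where
  "cstar_seminorm N \<longleftrightarrow>
     (\<forall>a b. N (a + b) \<le> N a + N b) \<and> (\<forall>z a. N (free_scale z a) = cmod z * N a) \<and>
     (\<forall>a b. N (a * b) \<le> N a * N b) \<and> (\<forall>a. N (free_star a * a) = (N a)\<^sup>2)"

definition cauchy_seqs :: "('x free_alg \<Rightarrow> real) \<Rightarrow> (nat \<Rightarrow> 'x free_alg) set" where
  "cauchy_seqs N = {xs. \<forall>\<epsilon>>0. \<exists>M. \<forall>m\<ge>M. \<forall>n\<ge>M. N (xs m - xs n) < \<epsilon>}"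

definition cauchy_class ::
  "('x free_alg \<Rightarrow> real) \<Rightarrow> (nat \<Rightarrow> 'x free_alg) \<Rightarrow> (nat \<Rightarrow> 'x free_alg) set" where
  "cauchy_class N xs = {ys \<in> cauchy_seqs N. (\<lambda>n. N (xs n - ys n)) \<longlonglongrightarrow> 0}"

text \<open>
  The Hausdorff completion of the free *-algebra for the seminorm \<open>N\<close>: Cauchy sequences modulo
  null sequences, which also divides out the null space of \<open>N\<close>.
\<close>

definition cstar_completion :: "('x free_alg \<Rightarrow> real) \<Rightarrow> (nat \<Rightarrow> 'x free_alg) set cstar" where
  "cstar_completion N =
     \<lparr>carrier = cauchy_class N ` cauchy_seqs N,
      mult = (\<lambda>x y. \<Union>xs\<in>x. \<Union>ys\<in>y. cauchy_class N (\<lambda>n. xs n * ys n)),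
      one = cauchy_class N (\<lambda>n. 1),
      zero = cauchy_class N (\<lambda>n. 0),
      add = (\<lambda>x y. \<Union>xs\<in>x. \<Union>ys\<in>y. cauchy_class N (\<lambda>n. xs n + ys n)),
      smult = (\<lambda>z x. \<Union>xs\<in>x. cauchy_class N (\<lambda>n. free_scale z (xs n))),
      star = (\<lambda>x. \<Union>xs\<in>x. cauchy_class N (\<lambda>n. free_star (xs n))),
      cnorm = (\<lambda>x. the_elem ((\<lambda>xs. lim (\<lambda>n. N (xs n))) ` x))\<rparr>"

definition to_completion ::
  "('x free_alg \<Rightarrow> real) \<Rightarrow> 'x free_alg \<Rightarrow> (nat \<Rightarrow> 'x free_alg) set" where
  "to_completion N a = cauchy_class N (\<lambda>n. a)"

lemma word_star_word_star [simp]: "word_star (word_star w) = w"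
  by (cases w) (simp add: word_star_def rev_map comp_def case_prod_beta)

lemma word_star_add: "word_star (v + w) = word_star w + word_star v"
  by (simp add: word_star_def plus_star_word_def)

lemma lookup_free_star: "Poly_Mapping.lookup (free_star a) w = cnj (Poly_Mapping.lookup a (word_star w))"
proof -
  have "Poly_Mapping.lookup (free_star a) w =
      (\<Sum>k\<in>Poly_Mapping.keys a. if k = word_star w then cnj (Poly_Mapping.lookup a k) else 0)"
    unfolding free_star_def lookup_sum
    by (intro sum.cong refl) (auto simp: lookup_single when_def)
  also have "\<dots> = cnj (Poly_Mapping.lookup a (word_star w))"
    by (auto simp: sum.delta in_keys_iff)
  finally show ?thesis .
qed

lemma free_star_add: "free_star (a + b) = free_star a + free_star b"
  by (rule poly_mapping_eqI) (simp add: lookup_free_star lookup_add)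

lemma free_star_free_star [simp]: "free_star (free_star a) = a"
  by (rule poly_mapping_eqI) (simp add: lookup_free_star)

lemma free_star_0 [simp]: "free_star 0 = 0"
  by (rule poly_mapping_eqI) (simp add: lookup_free_star)

lemma free_star_uminus: "free_star (- a) = - free_star a"
  by (rule poly_mapping_eqI) (simp add: lookup_free_star lookup_uminus)

lemma free_star_diff: "free_star (a - b) = free_star a - free_star b"
  by (rule poly_mapping_eqI) (simp add: lookup_free_star lookup_minus)

lemma free_star_sum: "free_star (sum f S) = (\<Sum>i\<in>S. free_star (f i))"
  by (induction S rule: infinite_finite_induct) (auto simp: free_star_add)

lemma free_star_single: "free_star (Poly_Mapping.single w z) = Poly_Mapping.single (word_star w) (cnj z)"
  by (rule poly_mapping_eqI) (auto simp: lookup_free_star lookup_single when_def)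

lemma free_star_mult: "free_star (a * b) = free_star b * free_star a"
proof -
  define A where "A = Poly_Mapping.keys a"
  define B where "B = Poly_Mapping.keys b"
  have a: "a = (\<Sum>w\<in>A. Poly_Mapping.single w (Poly_Mapping.lookup a w))"
    unfolding A_def by (rule poly_mapping_eqI) (auto simp: lookup_sum lookup_single when_def in_keys_iff sum.delta)
  have b: "b = (\<Sum>w\<in>B. Poly_Mapping.single w (Poly_Mapping.lookup b w))"
    unfolding B_def by (rule poly_mapping_eqI) (auto simp: lookup_sum lookup_single when_def in_keys_iff sum.delta)
  have "free_star (a * b) = (\<Sum>v\<in>A. \<Sum>w\<in>B. Poly_Mapping.single (word_star w + word_star v)
      (cnj (Poly_Mapping.lookup a v) * cnj (Poly_Mapping.lookup b w)))"
  proof -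
    have "free_star (a * b) = free_star ((\<Sum>w\<in>A. Poly_Mapping.single w (Poly_Mapping.lookup a w)) *
       (\<Sum>w\<in>B. Poly_Mapping.single w (Poly_Mapping.lookup b w)))"
      by (simp only: a[symmetric] b[symmetric])
    then show ?thesis
      by (simp add: sum_product free_star_sum mult_single free_star_single word_star_add)
  qed
  also have "\<dots> = free_star b * free_star a"
  proof -
    have "free_star b * free_star a =
       free_star (\<Sum>w\<in>B. Poly_Mapping.single w (Poly_Mapping.lookup b w)) *
       free_star (\<Sum>w\<in>A. Poly_Mapping.single w (Poly_Mapping.lookup a w))"
      by (simp only: a[symmetric] b[symmetric])
    then show ?thesis
      by (subst sum.swap)
        (simp add: sum_product free_star_sum mult_single free_star_single mult.commute)
  qed
  finally show ?thesis .
qed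

lemma free_scale_add: "free_scale z (a + b) = free_scale z a + free_scale z b"
  by (simp add: free_scale_def distrib_left)

lemma free_scale_add_left: "free_scale (y + z) a = free_scale y a + free_scale z a"
  by (simp add: free_scale_def single_add distrib_right)

lemma free_scale_diff: "free_scale z (a - b) = free_scale z a - free_scale z b"
  by (simp add: free_scale_def right_diff_distrib)

lemma free_scale_one [simp]: "free_scale 1 a = a"
  by (simp add: free_scale_def)

lemma free_scale_scale: "free_scale y (free_scale z a) = free_scale (y * z) a"
  by (simp add: free_scale_def mult_single flip: mult.assoc)

lemma free_scale_minus_one: "free_scale (-1) a = - a"
proof -
  have "free_scale (-1) a + a = free_scale (-1 + 1) a"
    by (simp only: free_scale_add_left free_scale_one)
  also have "\<dots> = 0" by (simp add: free_scale_def)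
  finally show ?thesis by (simp add: eq_neg_iff_add_eq_0)
qed

lemma scalar_commute: "Poly_Mapping.single 0 z * a = a * Poly_Mapping.single 0 (z::complex)"
proof -
  have a: "a = (\<Sum>w\<in>Poly_Mapping.keys a. Poly_Mapping.single w (Poly_Mapping.lookup a w))"
    by (rule poly_mapping_eqI) (auto simp: lookup_sum lookup_single when_def in_keys_iff sum.delta)
  have "Poly_Mapping.single 0 z * (\<Sum>w\<in>Poly_Mapping.keys a. Poly_Mapping.single w (Poly_Mapping.lookup a w)) =
      (\<Sum>w\<in>Poly_Mapping.keys a. Poly_Mapping.single w (Poly_Mapping.lookup a w)) * Poly_Mapping.single 0 z"
    by (simp add: sum_distrib_left sum_distrib_right mult_single mult.commute)
  then show ?thesis by (simp only: a[symmetric])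
qed

lemma free_scale_mult_left: "free_scale z a * b = free_scale z (a * b)"
  by (simp add: free_scale_def mult.assoc)

lemma free_scale_mult_right: "a * free_scale z b = free_scale z (a * b)"
  by (simp only: free_scale_def scalar_commute[of z a] flip: mult.assoc)

lemma free_star_scale: "free_star (free_scale z a) = free_scale (cnj z) (free_star a)"
proof -
  have "word_star 0 = (0 :: 'a star_word)" by (simp add: word_star_def zero_star_word_def)
  then show ?thesis
    by (simp add: free_scale_def free_star_mult free_star_single scalar_commute)
qed

locale free_seminorm =
  fixes N :: "'x free_alg \<Rightarrow> real"
  assumes seminorm: "cstar_seminorm N"
begin

lemma N_add: "N (a + b) \<le> N a + N b"
  and N_scale: "N (free_scale z a) = cmod z * N a"
  and N_mult: "N (a * b) \<le> N a * N b"
  and N_star_self: "N (free_star a * a) = (N a)\<^sup>2"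
  using seminorm by (auto simp: cstar_seminorm_def)

lemma N_0 [simp]: "N 0 = 0"
  using N_scale[of 0 0] by (simp add: free_scale_def)

lemma N_uminus [simp]: "N (- a) = N a"
  using N_scale[of "-1" a] by (simp add: free_scale_minus_one)

lemma N_nonneg [simp]: "0 \<le> N a"
  using N_add[of a "- a"] by simp

lemma N_commute: "N (a - b) = N (b - a)"
  using N_uminus[of "a - b"] by simp

lemma N_triangle: "N (a - c) \<le> N (a - b) + N (b - c)"
  using N_add[of "a - b" "b - c"] by simp

lemma N_diff_abs: "\<bar>N a - N b\<bar> \<le> N (a - b)"
  using N_add[of "a - b" b] N_add[of "b - a" a] N_commute[of a b] by simp

lemma N_star [simp]: "N (free_star a) = N a"
proof -
  have *: "N a \<le> N (free_star a)" for a
  proof (cases "N a = 0")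
    case False
    have "N a * N a \<le> N (free_star a) * N a"
      using N_mult[of "free_star a" a] N_star_self[of a] by (simp add: power2_eq_square)
    then show ?thesis using False N_nonneg[of a] by (simp del: N_nonneg)
  qed auto
  show ?thesis using *[of a] *[of "free_star a"] by simp
qed

lemma cauchyD: "xs \<in> cauchy_seqs N \<Longrightarrow> 0 < \<epsilon> \<Longrightarrow> \<exists>M. \<forall>m\<ge>M. \<forall>n\<ge>M. N (xs m - xs n) < \<epsilon>"
  by (simp add: cauchy_seqs_def)

lemma cauchy_const [simp]: "(\<lambda>n. a) \<in> cauchy_seqs N"
  by (simp add: cauchy_seqs_def)

lemma cauchy_add [simp]:
  assumes "xs \<in> cauchy_seqs N" "ys \<in> cauchy_seqs N"
  shows "(\<lambda>n. xs n + ys n) \<in> cauchy_seqs N"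
  unfolding cauchy_seqs_def
proof (intro CollectI allI impI)
  fix \<epsilon> :: real assume e: "\<epsilon> > 0"
  obtain M1 M2 where M: "\<forall>m\<ge>M1. \<forall>n\<ge>M1. N (xs m - xs n) < \<epsilon>/2" "\<forall>m\<ge>M2. \<forall>n\<ge>M2. N (ys m - ys n) < \<epsilon>/2"
    using cauchyD[OF assms(1), of "\<epsilon>/2"] cauchyD[OF assms(2), of "\<epsilon>/2"] e by auto
  have "N (xs m + ys m - (xs n + ys n)) < \<epsilon>" if "m \<ge> max M1 M2" "n \<ge> max M1 M2" for m n
  proof -
    have "N (xs m + ys m - (xs n + ys n)) \<le> N (xs m - xs n) + N (ys m - ys n)"
      using N_add[of "xs m - xs n" "ys m - ys n"] by (simp add: algebra_simps)
    moreover have "N (xs m - xs n) < \<epsilon>/2" "N (ys m - ys n) < \<epsilon>/2" using M that by auto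
    ultimately show ?thesis by linarith
  qed
  then show "\<exists>M. \<forall>m\<ge>M. \<forall>n\<ge>M. N (xs m + ys m - (xs n + ys n)) < \<epsilon>" by blast
qed

lemma cauchy_convergent: assumes "xs \<in> cauchy_seqs N" shows "convergent (\<lambda>n. N (xs n))"
proof -
  have "Cauchy (\<lambda>n. N (xs n))"
    unfolding Cauchy_def dist_real_def using cauchyD[OF assms] N_diff_abs by (meson order_le_less_trans)
  then show ?thesis by (simp add: Cauchy_convergent_iff)
qed

lemma cauchy_bdd: assumes "xs \<in> cauchy_seqs N" obtains K where "K > 0" "\<And>n. N (xs n) \<le> K"
proof -
  have "Bseq (\<lambda>n. N (xs n))" using cauchy_convergent[OF assms] by (simp add: convergent_imp_Bseq)
  then obtain K where "K > 0" "\<forall>n. norm (N (xs n)) \<le> K" by (auto simp: Bseq_def)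
  then show ?thesis using that by auto
qed

lemma N_mult_diff: "N (a * b - c * d) \<le> N a * N (b - d) + N (a - c) * N d"
proof -
  have "a * b - c * d = a * (b - d) + (a - c) * d" by (simp add: algebra_simps)
  then show ?thesis using N_add[of "a * (b - d)" "(a - c) * d"] N_mult[of a "b - d"] N_mult[of "a - c" d] by simp
qed

lemma cauchy_mult [simp]:
  assumes "xs \<in> cauchy_seqs N" "ys \<in> cauchy_seqs N"
  shows "(\<lambda>n. xs n * ys n) \<in> cauchy_seqs N"
  unfolding cauchy_seqs_def
proof (intro CollectI allI impI)
  fix \<epsilon> :: real assume e: "\<epsilon> > 0"
  obtain K where K: "K > 0" "\<And>n. N (xs n) \<le> K" using cauchy_bdd[OF assms(1)] by blast
  obtain L where L: "L > 0" "\<And>n. N (ys n) \<le> L" using cauchy_bdd[OF assms(2)] by blast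
  obtain M1 where M1: "\<forall>m\<ge>M1. \<forall>n\<ge>M1. N (xs m - xs n) < \<epsilon>/(2*L)"
    using cauchyD[OF assms(1), of "\<epsilon>/(2*L)"] e L by auto
  obtain M2 where M2: "\<forall>m\<ge>M2. \<forall>n\<ge>M2. N (ys m - ys n) < \<epsilon>/(2*K)"
    using cauchyD[OF assms(2), of "\<epsilon>/(2*K)"] e K by auto
  have "N (xs m * ys m - xs n * ys n) < \<epsilon>" if "m \<ge> max M1 M2" "n \<ge> max M1 M2" for m n
  proof -
    have a: "N (xs m - xs n) < \<epsilon>/(2*L)" "N (ys m - ys n) < \<epsilon>/(2*K)" using M1 M2 that by auto
    have "N (xs m) * N (ys m - ys n) \<le> K * N (ys m - ys n)" by (intro mult_right_mono K) simp
    also have "\<dots> < K * (\<epsilon>/(2*K))" using a K by (intro mult_strict_left_mono) auto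
    also have "\<dots> = \<epsilon>/2" using K by simp
    finally have 1: "N (xs m) * N (ys m - ys n) < \<epsilon>/2" .
    have "N (xs m - xs n) * N (ys n) \<le> N (xs m - xs n) * L" by (intro mult_left_mono L) simp
    also have "\<dots> < (\<epsilon>/(2*L)) * L" using a L by (intro mult_strict_right_mono) auto
    also have "\<dots> = \<epsilon>/2" using L by simp
    finally have 2: "N (xs m - xs n) * N (ys n) < \<epsilon>/2" .
    show ?thesis using 1 2 N_mult_diff[of "xs m" "ys m" "xs n" "ys n"] by linarith
  qed
  then show "\<exists>M. \<forall>m\<ge>M. \<forall>n\<ge>M. N (xs m * ys m - xs n * ys n) < \<epsilon>" by blast
qed

lemma cauchy_scale [simp]: "xs \<in> cauchy_seqs N \<Longrightarrow> (\<lambda>n. free_scale z (xs n)) \<in> cauchy_seqs N"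
  using cauchy_mult[of "\<lambda>n. Poly_Mapping.single 0 z" xs] by (simp add: free_scale_def)

lemma cauchy_uminus [simp]: "xs \<in> cauchy_seqs N \<Longrightarrow> (\<lambda>n. - xs n) \<in> cauchy_seqs N"
  using cauchy_scale[of xs "-1"] by (simp add: free_scale_minus_one)

lemma cauchy_star [simp]: "xs \<in> cauchy_seqs N \<Longrightarrow> (\<lambda>n. free_star (xs n)) \<in> cauchy_seqs N"
  by (simp add: cauchy_seqs_def flip: free_star_diff)

lemma tendsto0_le: "f \<longlonglongrightarrow> 0 \<Longrightarrow> (\<And>n. N (xs n) \<le> f n) \<Longrightarrow> (\<lambda>n. N (xs n)) \<longlonglongrightarrow> 0"
  by (rule tendsto_sandwich[of "\<lambda>n. 0" _ _ f]) auto

lemma class_self [simp]: "xs \<in> cauchy_seqs N \<Longrightarrow> xs \<in> cauchy_class N xs"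
  by (simp add: cauchy_class_def)

lemma class_eq_iff:
  assumes "xs \<in> cauchy_seqs N" "ys \<in> cauchy_seqs N"
  shows "cauchy_class N xs = cauchy_class N ys \<longleftrightarrow> (\<lambda>n. N (xs n - ys n)) \<longlonglongrightarrow> 0"
proof
  assume "cauchy_class N xs = cauchy_class N ys"
  then have "ys \<in> cauchy_class N xs" using assms by simp
  then show "(\<lambda>n. N (xs n - ys n)) \<longlonglongrightarrow> 0" by (simp add: cauchy_class_def)
next
  assume *: "(\<lambda>n. N (xs n - ys n)) \<longlonglongrightarrow> 0"
  then have **: "(\<lambda>n. N (ys n - xs n)) \<longlonglongrightarrow> 0" by (simp add: N_commute)
  have "(\<lambda>n. N (xs n - zs n)) \<longlonglongrightarrow> 0 \<longleftrightarrow> (\<lambda>n. N (ys n - zs n)) \<longlonglongrightarrow> 0" for zs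
  proof
    assume z: "(\<lambda>n. N (xs n - zs n)) \<longlonglongrightarrow> 0"
    show "(\<lambda>n. N (ys n - zs n)) \<longlonglongrightarrow> 0"
      by (rule tendsto0_le[OF tendsto_add_zero[OF ** z]]) (rule N_triangle)
  next
    assume z: "(\<lambda>n. N (ys n - zs n)) \<longlonglongrightarrow> 0"
    show "(\<lambda>n. N (xs n - zs n)) \<longlonglongrightarrow> 0"
      by (rule tendsto0_le[OF tendsto_add_zero[OF * z]]) (rule N_triangle)
  qed
  then show "cauchy_class N xs = cauchy_class N ys" by (auto simp: cauchy_class_def)
qed

lemma classD: "ys \<in> cauchy_class N xs \<Longrightarrow> ys \<in> cauchy_seqs N"
  "ys \<in> cauchy_class N xs \<Longrightarrow> (\<lambda>n. N (ys n - xs n)) \<longlonglongrightarrow> 0"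
  by (auto simp: cauchy_class_def N_commute)

lemma carrier_completion: "carrier (cstar_completion N) = cauchy_class N ` cauchy_seqs N"
  and one_completion: "\<one>\<^bsub>cstar_completion N\<^esub> = cauchy_class N (\<lambda>n. 1)"
  and zero_completion: "\<zero>\<^bsub>cstar_completion N\<^esub> = cauchy_class N (\<lambda>n. 0)"
  by (simp_all add: cstar_completion_def)

lemma UN_const2: "x0 \<in> x \<Longrightarrow> y0 \<in> y \<Longrightarrow> (\<And>a b. a \<in> x \<Longrightarrow> b \<in> y \<Longrightarrow> f a b = c) \<Longrightarrow>
   (\<Union>a\<in>x. \<Union>b\<in>y. f a b) = c"
  by blast

lemma UN_const1: "x0 \<in> x \<Longrightarrow> (\<And>a. a \<in> x \<Longrightarrow> f a = c) \<Longrightarrow> (\<Union>a\<in>x. f a) = c"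
  by blast

context
  fixes xs assumes xs: "xs \<in> cauchy_seqs N"
begin

lemma smult_class: "z \<odot>\<^bsub>cstar_completion N\<^esub> cauchy_class N xs = cauchy_class N (\<lambda>n. free_scale z (xs n))"
  unfolding cstar_completion_def
proof (simp, rule UN_const1[OF class_self[OF xs]])
  fix a assume a: "a \<in> cauchy_class N xs"
  have "(\<lambda>n. cmod z * N (a n - xs n)) \<longlonglongrightarrow> 0" using tendsto_mult_right_zero[OF classD(2)[OF a]] .
  then show "cauchy_class N (\<lambda>n. free_scale z (a n)) = cauchy_class N (\<lambda>n. free_scale z (xs n))"
    using classD[OF a] xs by (simp add: class_eq_iff N_scale flip: free_scale_diff)
qed

lemma star_class: "star (cstar_completion N) (cauchy_class N xs) = cauchy_class N (\<lambda>n. free_star (xs n))"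
  unfolding cstar_completion_def
proof (simp, rule UN_const1[OF class_self[OF xs]])
  fix a assume a: "a \<in> cauchy_class N xs"
  show "cauchy_class N (\<lambda>n. free_star (a n)) = cauchy_class N (\<lambda>n. free_star (xs n))"
    using classD[OF a] xs by (simp add: class_eq_iff flip: free_star_diff)
qed

lemma cnorm_class_lim: "(\<lambda>n. N (xs n)) \<longlonglongrightarrow> cnorm (cstar_completion N) (cauchy_class N xs)"
proof -
  have "lim (\<lambda>n. N (a n)) = lim (\<lambda>n. N (xs n))" if a: "a \<in> cauchy_class N xs" for a
  proof -
    have "(\<lambda>n. N (a n) - N (xs n)) \<longlonglongrightarrow> 0"
      by (rule Lim_null_comparison[OF _ classD(2)[OF a]]) (auto simp: N_diff_abs)
    moreover have "(\<lambda>n. N (xs n)) \<longlonglongrightarrow> lim (\<lambda>n. N (xs n))" using cauchy_convergent[OF xs] by (simp add: convergent_LIMSEQ_iff)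
    ultimately have "(\<lambda>n. N (a n) - N (xs n) + N (xs n)) \<longlonglongrightarrow> 0 + lim (\<lambda>n. N (xs n))" by (rule tendsto_add)
    then show ?thesis by (simp add: limI)
  qed
  then have "(\<lambda>a. lim (\<lambda>n. N (a n))) ` cauchy_class N xs = {lim (\<lambda>n. N (xs n))}"
    using class_self[OF xs] by blast
  then have "cnorm (cstar_completion N) (cauchy_class N xs) = lim (\<lambda>n. N (xs n))"
    by (simp add: cstar_completion_def)
  then show ?thesis using cauchy_convergent[OF xs] by (simp add: convergent_LIMSEQ_iff)
qed

context
  fixes ys assumes ys: "ys \<in> cauchy_seqs N"
begin

lemma add_class: "cauchy_class N xs \<oplus>\<^bsub>cstar_completion N\<^esub> cauchy_class N ys = cauchy_class N (\<lambda>n. xs n + ys n)"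
  unfolding cstar_completion_def
proof (simp, rule UN_const2[OF class_self[OF xs] class_self[OF ys]])
  fix a b assume a: "a \<in> cauchy_class N xs" and b: "b \<in> cauchy_class N ys"
  have "(\<lambda>n. N (a n + b n - (xs n + ys n))) \<longlonglongrightarrow> 0"
    by (rule tendsto0_le[OF tendsto_add_zero[OF classD(2)[OF a] classD(2)[OF b]]])
      (metis add_diff_add N_add)
  then show "cauchy_class N (\<lambda>n. a n + b n) = cauchy_class N (\<lambda>n. xs n + ys n)"
    using classD(1)[OF a] classD(1)[OF b] xs ys by (simp add: class_eq_iff)
qed

lemma mult_class: "cauchy_class N xs \<otimes>\<^bsub>cstar_completion N\<^esub> cauchy_class N ys = cauchy_class N (\<lambda>n. xs n * ys n)"
  unfolding cstar_completion_def
proof (simp, rule UN_const2[OF class_self[OF xs] class_self[OF ys]])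
  fix a b assume a: "a \<in> cauchy_class N xs" and b: "b \<in> cauchy_class N ys"
  obtain K where K: "K > 0" "\<And>n. N (a n) \<le> K" using cauchy_bdd[OF classD(1)[OF a]] by blast
  obtain L where L: "L > 0" "\<And>n. N (ys n) \<le> L" using cauchy_bdd[OF ys] by blast
  have "(\<lambda>n. K * N (b n - ys n) + N (a n - xs n) * L) \<longlonglongrightarrow> 0"
    by (intro tendsto_add_zero tendsto_mult_right_zero tendsto_mult_left_zero classD(2) a b)
  then have "(\<lambda>n. N (a n * b n - xs n * ys n)) \<longlonglongrightarrow> 0"
  proof (rule tendsto0_le)
    fix n
    have "N (a n) * N (b n - ys n) \<le> K * N (b n - ys n)" by (intro mult_right_mono K) simp
    moreover have "N (a n - xs n) * N (ys n) \<le> N (a n - xs n) * L" by (intro mult_left_mono L) simp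
    ultimately show "N (a n * b n - xs n * ys n) \<le> K * N (b n - ys n) + N (a n - xs n) * L"
      using N_mult_diff[of "a n" "b n" "xs n" "ys n"] by linarith
  qed
  then show "cauchy_class N (\<lambda>n. a n * b n) = cauchy_class N (\<lambda>n. xs n * ys n)"
    using classD(1)[OF a] classD(1)[OF b] xs ys by (simp add: class_eq_iff)
qed

end
end

lemmas class_simps = smult_class star_class add_class mult_class
  carrier_completion one_completion zero_completion

lemma ring_completion: "ring (cstar_completion N)"
proof (rule ringI)
  show "abelian_group (cstar_completion N)"
  proof (rule abelian_groupI)
    fix x assume "x \<in> carrier (cstar_completion N)"
    then obtain xs where xs: "xs \<in> cauchy_seqs N" "x = cauchy_class N xs" by (auto simp: class_simps)
    show "\<exists>y\<in>carrier (cstar_completion N). y \<oplus>\<^bsub>cstar_completion N\<^esub> x = \<zero>\<^bsub>cstar_completion N\<^esub>"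
      using xs by (auto simp: class_simps intro!: bexI[of _ "\<lambda>n. - xs n"])
  qed (auto simp: class_simps ac_simps intro!: imageI)
  show "Group.monoid (cstar_completion N)"
    by (rule monoidI) (auto simp: class_simps ac_simps intro!: imageI)
qed (auto simp: class_simps algebra_simps)

lemma minus_class:
  assumes xs: "xs \<in> cauchy_seqs N" and ys: "ys \<in> cauchy_seqs N"
  shows "cauchy_class N xs \<ominus>\<^bsub>cstar_completion N\<^esub> cauchy_class N ys = cauchy_class N (\<lambda>n. xs n - ys n)"
proof -
  interpret ring "cstar_completion N" by (rule ring_completion)
  have "\<ominus>\<^bsub>cstar_completion N\<^esub> cauchy_class N ys = cauchy_class N (\<lambda>n. - ys n)"
    by (rule minus_equality) (use ys in \<open>auto simp: class_simps\<close>)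
  then show ?thesis using xs ys by (simp add: a_minus_def add_class)
qed

lemma cnorm_classI: "xs \<in> cauchy_seqs N \<Longrightarrow> (\<lambda>n. N (xs n)) \<longlonglongrightarrow> l \<Longrightarrow> cnorm (cstar_completion N) (cauchy_class N xs) = l"
  using cnorm_class_lim LIMSEQ_unique by blast

lemma cauchy_diff [simp]:
  "xs \<in> cauchy_seqs N \<Longrightarrow> ys \<in> cauchy_seqs N \<Longrightarrow> (\<lambda>n. xs n - ys n) \<in> cauchy_seqs N"
  using cauchy_add[of xs "\<lambda>n. - ys n"] by simp

lemma complete_completion:
  assumes f: "\<And>n. f n \<in> carrier (cstar_completion N)"
    and C: "\<forall>\<epsilon>>0. \<exists>M. \<forall>m\<ge>M. \<forall>n\<ge>M. cnorm (cstar_completion N) (f m \<ominus>\<^bsub>cstar_completion N\<^esub> f n) < \<epsilon>"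
  shows "\<exists>x\<in>carrier (cstar_completion N). (\<lambda>n. cnorm (cstar_completion N) (f n \<ominus>\<^bsub>cstar_completion N\<^esub> x)) \<longlonglongrightarrow> 0"
proof -
  let ?A = "cstar_completion N"
  let ?n = "cnorm ?A"
  let ?i = "\<lambda>a. cauchy_class N (\<lambda>n. a)"
  obtain Z where Z: "\<And>n. Z n \<in> cauchy_seqs N" "\<And>n. f n = cauchy_class N (Z n)"
    using f unfolding class_simps image_iff by metis
  have nn: "?n (cauchy_class N u \<ominus>\<^bsub>?A\<^esub> cauchy_class N v) \<le> 
      ?n (cauchy_class N u \<ominus>\<^bsub>?A\<^esub> cauchy_class N w) + ?n (cauchy_class N w \<ominus>\<^bsub>?A\<^esub> cauchy_class N v)"
    if "u \<in> cauchy_seqs N" "v \<in> cauchy_seqs N" "w \<in> cauchy_seqs N" for u v w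
    unfolding minus_class[OF that(1,2)] minus_class[OF that(1,3)] minus_class[OF that(3,2)]
    by (rule LIMSEQ_le[OF cnorm_class_lim tendsto_add[OF cnorm_class_lim cnorm_class_lim]])
      (use that N_triangle in auto)
  have sym: "?n (cauchy_class N u \<ominus>\<^bsub>?A\<^esub> cauchy_class N v) = ?n (cauchy_class N v \<ominus>\<^bsub>?A\<^esub> cauchy_class N u)"
    if "u \<in> cauchy_seqs N" "v \<in> cauchy_seqs N" for u v
    unfolding minus_class[OF that(1,2)] minus_class[OF that(2,1)]
    by (rule cnorm_classI) (use cnorm_class_lim[OF cauchy_diff[OF that(2,1)]] that in \<open>auto simp: N_commute\<close>)
  have "\<exists>a. ?n (f n \<ominus>\<^bsub>?A\<^esub> ?i a) \<le> inverse (Suc n)" for n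
  proof -
    obtain M where M: "\<forall>m\<ge>M. \<forall>k\<ge>M. N (Z n m - Z n k) < inverse (Suc n)"
      using cauchyD[OF Z(1)[of n], of "inverse (Suc n)"] by auto
    have "?n (f n \<ominus>\<^bsub>?A\<^esub> ?i (Z n M)) \<le> inverse (Suc n)"
      unfolding Z(2) minus_class[OF Z(1) cauchy_const]
      by (rule LIMSEQ_le_const2[OF cnorm_class_lim])
        (use M Z in \<open>auto intro!: exI[of _ M] less_imp_le\<close>)
    then show ?thesis by blast
  qed
  then obtain a where a: "\<And>n. ?n (f n \<ominus>\<^bsub>?A\<^esub> ?i (a n)) \<le> inverse (Suc n)" by metis
  have inv0: "(\<lambda>n. inverse (real (Suc n))) \<longlonglongrightarrow> 0" by (rule LIMSEQ_inverse_real_of_nat)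
  have ca: "a \<in> cauchy_seqs N"
    unfolding cauchy_seqs_def
  proof (intro CollectI allI impI)
    fix \<epsilon> :: real assume e: "\<epsilon> > 0"
    obtain M1 where M1: "\<forall>m\<ge>M1. \<forall>n\<ge>M1. ?n (f m \<ominus>\<^bsub>?A\<^esub> f n) < \<epsilon>/3" using C e by (meson divide_pos_pos zero_less_numeral)
    obtain M2 where M2: "\<And>n. n \<ge> M2 \<Longrightarrow> inverse (real (Suc n)) < \<epsilon>/3"
      using order_tendstoD(2)[OF inv0, of "\<epsilon>/3"] e by (auto simp: eventually_sequentially)
    have "N (a m - a n) < \<epsilon>" if "m \<ge> max M1 M2" "n \<ge> max M1 M2" for m n
    proof -
      have 1: "?n (?i (a m) \<ominus>\<^bsub>?A\<^esub> ?i (a n)) = N (a m - a n)"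
        by (subst minus_class) (auto intro!: cnorm_classI)
      have 2: "?n (?i (a m) \<ominus>\<^bsub>?A\<^esub> ?i (a n)) \<le> ?n (?i (a m) \<ominus>\<^bsub>?A\<^esub> f m) + ?n (f m \<ominus>\<^bsub>?A\<^esub> ?i (a n))"
        unfolding Z(2) by (rule nn) (simp_all add: Z(1))
      have 3: "?n (f m \<ominus>\<^bsub>?A\<^esub> ?i (a n)) \<le> ?n (f m \<ominus>\<^bsub>?A\<^esub> f n) + ?n (f n \<ominus>\<^bsub>?A\<^esub> ?i (a n))"
        unfolding Z(2) by (rule nn) (simp_all add: Z(1))
      have 4: "?n (?i (a m) \<ominus>\<^bsub>?A\<^esub> f m) = ?n (f m \<ominus>\<^bsub>?A\<^esub> ?i (a m))"
        unfolding Z(2) by (rule sym) (simp_all add: Z(1))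
      have 5: "?n (f m \<ominus>\<^bsub>?A\<^esub> f n) < \<epsilon>/3" "inverse (real (Suc m)) < \<epsilon>/3" "inverse (real (Suc n)) < \<epsilon>/3"
        using M1 M2 that by auto
      show ?thesis using a[of m] a[of n] 1 2 3 4 5 by linarith
    qed
    then show "\<exists>M. \<forall>m\<ge>M. \<forall>n\<ge>M. N (a m - a n) < \<epsilon>" by blast
  qed
  let ?x = "cauchy_class N a"
  have lim: "(\<lambda>n. ?n (?i (a n) \<ominus>\<^bsub>?A\<^esub> ?x)) \<longlonglongrightarrow> 0"
  proof (rule LIMSEQ_I)
    fix r :: real assume r: "r > 0"
    obtain M where M: "\<forall>m\<ge>M. \<forall>n\<ge>M. N (a m - a n) < r/2" using cauchyD[OF ca, of "r/2"] r by auto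
    have "norm (?n (?i (a n) \<ominus>\<^bsub>?A\<^esub> ?x) - 0) < r" if "n \<ge> M" for n
    proof -
      note L = cnorm_class_lim[OF cauchy_diff[OF cauchy_const[of "a n"] ca]]
      have "?n (?i (a n) \<ominus>\<^bsub>?A\<^esub> ?x) \<le> r/2"
        unfolding minus_class[OF cauchy_const ca]
        by (rule LIMSEQ_le_const2[OF L]) (use M that in \<open>auto intro!: exI[of _ M] less_imp_le\<close>)
      moreover have "0 \<le> ?n (?i (a n) \<ominus>\<^bsub>?A\<^esub> ?x)"
        unfolding minus_class[OF cauchy_const ca] by (rule LIMSEQ_le_const[OF L]) auto
      ultimately show ?thesis using r by simp
    qed
    then show "\<exists>no. \<forall>n\<ge>no. norm (?n (?i (a n) \<ominus>\<^bsub>?A\<^esub> ?x) - 0) < r" by blast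
  qed
  have "(\<lambda>n. ?n (f n \<ominus>\<^bsub>?A\<^esub> ?x)) \<longlonglongrightarrow> 0"
  proof (rule tendsto_sandwich[OF _ _ tendsto_const tendsto_add_zero[OF inv0 lim]])
    have "0 \<le> ?n (f n \<ominus>\<^bsub>?A\<^esub> ?x)" for n
      unfolding Z minus_class[OF Z(1) ca] by (rule LIMSEQ_le_const[OF cnorm_class_lim]) (auto simp: Z ca)
    then show "\<forall>\<^sub>F n in sequentially. 0 \<le> ?n (f n \<ominus>\<^bsub>?A\<^esub> ?x)" by simp
    have "?n (f n \<ominus>\<^bsub>?A\<^esub> ?x) \<le> inverse (real (Suc n)) + ?n (?i (a n) \<ominus>\<^bsub>?A\<^esub> ?x)" for n
      using nn[OF Z(1)[of n] ca cauchy_const[of "a n"]] a[of n] unfolding Z by linarith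
    then show "\<forall>\<^sub>F n in sequentially. ?n (f n \<ominus>\<^bsub>?A\<^esub> ?x) \<le> inverse (real (Suc n)) + ?n (?i (a n) \<ominus>\<^bsub>?A\<^esub> ?x)" by simp
  qed
  then show ?thesis using ca by (auto simp: class_simps)
qed

lemma cstar_algebra_completion: "cstar_algebra (cstar_completion N)"
proof -
  interpret ring "cstar_completion N" by (rule ring_completion)
  have rc: "cring complex_ring" 
  proof (rule cringI)
    show "abelian_group (complex_ring)"
      by (rule abelian_groupI) (auto simp: complex_ring_def intro: exI[of _ "- _"] add.left_inverse)
    show "Group.comm_monoid (complex_ring)"
      by (rule comm_monoidI) (auto simp: complex_ring_def)
  qed (auto simp: complex_ring_def algebra_simps)
  show ?thesis
  proof (intro cstar_algebra.intro)
    show "ring (cstar_completion N)" by (rule ring_completion)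
    show "module complex_ring (cstar_completion N)"
      by (rule moduleI[OF rc abelian_group_axioms])
        (auto simp: complex_ring_def class_simps free_scale_add free_scale_add_left free_scale_scale)
    show "cstar_algebra_axioms (cstar_completion N)"
    proof
      fix x y z assume "x \<in> carrier (cstar_completion N)"
      then obtain xs where xs: "xs \<in> cauchy_seqs N" "x = cauchy_class N xs" by (auto simp: class_simps)
      show "star (cstar_completion N) x \<in> carrier (cstar_completion N)"
        "star (cstar_completion N) (star (cstar_completion N) x) = x"
        "star (cstar_completion N) (z \<odot>\<^bsub>cstar_completion N\<^esub> x) = cnj z \<odot>\<^bsub>cstar_completion N\<^esub> star (cstar_completion N) x"
        using xs by (auto simp: class_simps free_star_scale)
      show "cnorm (cstar_completion N) x = 0 \<longleftrightarrow> x = \<zero>\<^bsub>cstar_completion N\<^esub>"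
        using xs cnorm_class_lim[OF xs(1)] by (auto simp: class_simps class_eq_iff intro: cnorm_classI)
      show "cnorm (cstar_completion N) (z \<odot>\<^bsub>cstar_completion N\<^esub> x) = cmod z * cnorm (cstar_completion N) x"
        using xs tendsto_mult_left[OF cnorm_class_lim[OF xs(1)], of "cmod z"]
        by (auto simp: class_simps N_scale intro!: cnorm_classI)
      show "cnorm (cstar_completion N) (star (cstar_completion N) x \<otimes>\<^bsub>cstar_completion N\<^esub> x) = (cnorm (cstar_completion N) x)\<^sup>2"
        using xs tendsto_power[OF cnorm_class_lim[OF xs(1)], of 2]
        by (auto simp: class_simps N_star_self intro!: cnorm_classI)
      assume "y \<in> carrier (cstar_completion N)"
      then obtain ys where ys: "ys \<in> cauchy_seqs N" "y = cauchy_class N ys" by (auto simp: class_simps)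
      show "(z \<odot>\<^bsub>cstar_completion N\<^esub> x) \<otimes>\<^bsub>cstar_completion N\<^esub> y = z \<odot>\<^bsub>cstar_completion N\<^esub> (x \<otimes>\<^bsub>cstar_completion N\<^esub> y)"
        "x \<otimes>\<^bsub>cstar_completion N\<^esub> (z \<odot>\<^bsub>cstar_completion N\<^esub> y) = z \<odot>\<^bsub>cstar_completion N\<^esub> (x \<otimes>\<^bsub>cstar_completion N\<^esub> y)"
        "star (cstar_completion N) (x \<oplus>\<^bsub>cstar_completion N\<^esub> y) = star (cstar_completion N) x \<oplus>\<^bsub>cstar_completion N\<^esub> star (cstar_completion N) y"
        "star (cstar_completion N) (x \<otimes>\<^bsub>cstar_completion N\<^esub> y) = star (cstar_completion N) y \<otimes>\<^bsub>cstar_completion N\<^esub> star (cstar_completion N) x"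
        using xs ys by (auto simp: class_simps free_scale_mult_left free_scale_mult_right free_star_add free_star_mult)
      show "cnorm (cstar_completion N) (x \<oplus>\<^bsub>cstar_completion N\<^esub> y) \<le> cnorm (cstar_completion N) x + cnorm (cstar_completion N) y"
        unfolding xs(2) ys(2) add_class[OF xs(1) ys(1)]
        by (rule LIMSEQ_le[OF cnorm_class_lim tendsto_add[OF cnorm_class_lim cnorm_class_lim]])
          (use xs ys N_add in auto)
      show "cnorm (cstar_completion N) (x \<otimes>\<^bsub>cstar_completion N\<^esub> y) \<le> cnorm (cstar_completion N) x * cnorm (cstar_completion N) y"
        unfolding xs(2) ys(2) mult_class[OF xs(1) ys(1)]
        by (rule LIMSEQ_le[OF cnorm_class_lim tendsto_mult[OF cnorm_class_lim cnorm_class_lim]])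
          (use xs ys N_mult in auto)
    qed (rule complete_completion)
  qed
qed

end


section \<open>The Toeplitz algebra of a self-similar action\<close>

datatype ('v, 'e, 'g) generator = GenP 'v | GenS 'e | GenU 'g

type_synonym ('v, 'e, 'g) toeplitz_elem = "(nat \<Rightarrow> ('v, 'e, 'g) generator free_alg) set"

text \<open>
  A family of generators satisfying the relations in any unital C*-algebra \<open>A\<close> induces a unital
  *-homomorphism from the free *-algebra to \<open>A\<close>. Pulling back the norm of \<open>A\<close> gives a
  C*-seminorm \<open>N\<close>, and the C*-subalgebra of \<open>A\<close> generated by the family is the completion for
  \<open>N\<close>. So the seminorms in the following definition account for all families in all unital
  C*-algebras, and the completion for their supremum is the universal C*-algebra.
\<close>

definition toeplitz_seminorms ::
  "('v::finite, 'e::finite) digraph \<Rightarrow> ('g, 'v) groupoid \<Rightarrow>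
   ('g \<Rightarrow> ('v, 'e) path \<Rightarrow> ('v, 'e) path) \<Rightarrow>
   (('v, 'e, 'g) generator free_alg \<Rightarrow> real) set" where
  "toeplitz_seminorms E G act =
     {N. cstar_seminorm N \<and>
         is_toeplitz_rep E G act (cstar_completion N)
           (\<lambda>g. to_completion N (free_gen (GenU g)))
           (\<lambda>v. to_completion N (free_gen (GenP v)))
           (\<lambda>e. to_completion N (free_gen (GenS e)))}"

definition toeplitz_norm ::
  "('v::finite, 'e::finite) digraph \<Rightarrow> ('g, 'v) groupoid \<Rightarrow>
   ('g \<Rightarrow> ('v, 'e) path \<Rightarrow> ('v, 'e) path) \<Rightarrow>
   ('v, 'e, 'g) generator free_alg \<Rightarrow> real" where
  "toeplitz_norm E G act a = (SUP N\<in>toeplitz_seminorms E G act. N a)"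

definition toeplitz_alg ::
  "('v::finite, 'e::finite) digraph \<Rightarrow> ('g, 'v) groupoid \<Rightarrow>
   ('g \<Rightarrow> ('v, 'e) path \<Rightarrow> ('v, 'e) path) \<Rightarrow> ('v, 'e, 'g) toeplitz_elem cstar" where
  "toeplitz_alg E G act = cstar_completion (toeplitz_norm E G act)"

text \<open>The supremum is over a nonempty set that is bounded above, and it is a C*-seminorm.\<close>

lemma cnorm_to_completion: "cstar_seminorm N \<Longrightarrow> cnorm (cstar_completion N) (to_completion N a) = N a"
proof -
  assume N: "cstar_seminorm N"
  interpret free_seminorm N by unfold_locales (rule N)
  show ?thesis unfolding to_completion_def by (rule cnorm_classI) auto
qed

lemma (in cstar_algebra) projection_norm: "is_projection A p \<Longrightarrow> cnorm A p \<le> 1"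
proof -
  assume p: "is_projection A p"
  then have "cnorm A p = (cnorm A p)\<^sup>2" using cstar_identity[of p] by (simp add: is_projection_def)
  then have "cnorm A p = 0 \<or> cnorm A p = 1" by (simp add: power2_eq_square)
  then show ?thesis by auto
qed

lemma (in cstar_algebra) partial_isometry_norm:
  "x \<in> carrier A \<Longrightarrow> is_projection A (star A x \<otimes> x) \<Longrightarrow> cnorm A x \<le> 1"
  using projection_norm[of "star A x \<otimes> x"] cstar_identity[of x]
    power2_le_imp_le[of "cnorm A x" 1] by simp

lemma toeplitz_seminorm_gen_le_1:
  assumes N: "N \<in> toeplitz_seminorms E G act"
  shows "N (free_gen x) \<le> 1"
proof -
  let ?A = "cstar_completion N"
  let ?g = "\<lambda>x. to_completion N (free_gen x)"
  have sn: "cstar_seminorm N" using N by (simp add: toeplitz_seminorms_def)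
  interpret free_seminorm N by unfold_locales (rule sn)
  interpret cstar_algebra ?A by (rule cstar_algebra_completion)
  have rep: "is_toeplitz_rep E G act ?A (\<lambda>g. ?g (GenU g)) (\<lambda>v. ?g (GenP v)) (\<lambda>e. ?g (GenS e))"
    using N by (simp add: toeplitz_seminorms_def)
  have "cnorm ?A (?g x) \<le> 1"
  proof (cases x)
    case (GenP v)
    have "is_projection ?A (?g (GenP v))" using rep by (simp add: is_toeplitz_rep_def is_tck_family_def)
    then show ?thesis using projection_norm GenP by simp
  next
    case (GenS e)
    have "?g (GenS e) \<in> carrier ?A" "is_projection ?A (star ?A (?g (GenS e)) \<otimes>\<^bsub>?A\<^esub> ?g (GenS e))"
      using rep by (auto simp: is_toeplitz_rep_def is_tck_family_def)
    then show ?thesis using partial_isometry_norm GenS by simp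
  next
    case (GenU g)
    have "?g (GenU g) \<in> carrier ?A" "is_projection ?A (star ?A (?g (GenU g)) \<otimes>\<^bsub>?A\<^esub> ?g (GenU g))"
      using rep by (auto simp: is_toeplitz_rep_def is_unitary_rep_def)
    then show ?thesis using partial_isometry_norm GenU by simp
  qed
  then show ?thesis by (simp add: cnorm_to_completion[OF sn])
qed

lemma toeplitz_seminorm_word_le_1:
  assumes N: "N \<in> toeplitz_seminorms E G act"
  shows "N (Poly_Mapping.single (Word l) 1) \<le> 1"
proof -
  have sn: "cstar_seminorm N" using N by (simp add: toeplitz_seminorms_def)
  interpret free_seminorm N by unfold_locales (rule sn)
  show ?thesis
  proof (induction l)
    case Nil
    have "free_star 1 = (1 :: ('a, 'b, 'c) generator free_alg)"
      using free_star_single[of 0 1] by (simp add: word_star_def zero_star_word_def flip: single_one)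
    then have "N 1 = (N 1)\<^sup>2" using N_star_self[of 1] by simp
    then have "N 1 = 0 \<or> N 1 = 1" by (simp add: power2_eq_square)
    then show ?case using single_one by (auto simp flip: zero_star_word_def)
  next
    case (Cons c l)
    obtain x b where c: "c = (x, b)" by force
    have "N (Poly_Mapping.single (Word [c]) 1) \<le> 1"
    proof (cases b)
      case True
      then have "Poly_Mapping.single (Word [c]) 1 = free_star (free_gen x)"
        by (simp add: c free_gen_def free_star_single word_star_def)
      then show ?thesis using toeplitz_seminorm_gen_le_1[OF N, of x] by simp
    next
      case False
      then show ?thesis using toeplitz_seminorm_gen_le_1[OF N, of x] by (simp add: c free_gen_def)
    qed
    moreover have "Poly_Mapping.single (Word (c # l)) 1 =
        Poly_Mapping.single (Word [c]) 1 * (Poly_Mapping.single (Word l) 1 :: ('a, 'b, 'c) generator free_alg)"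
      by (simp add: mult_single plus_star_word_def)
    ultimately show ?case
      using N_mult[of "Poly_Mapping.single (Word [c]) 1" "Poly_Mapping.single (Word l) 1"] Cons
        mult_le_one[of "N (Poly_Mapping.single (Word [c]) 1)" "N (Poly_Mapping.single (Word l) 1)"] by simp
  qed
qed

lemma toeplitz_seminorm_bound:
  assumes N: "N \<in> toeplitz_seminorms E G act"
  shows "N a \<le> (\<Sum>w\<in>Poly_Mapping.keys a. cmod (Poly_Mapping.lookup a w))"
proof -
  have sn: "cstar_seminorm N" using N by (simp add: toeplitz_seminorms_def)
  interpret free_seminorm N by unfold_locales (rule sn)
  have sum: "N (sum f S) \<le> (\<Sum>i\<in>S. N (f i))" for f :: "('a, 'b, 'c) generator star_word \<Rightarrow> _" and S
  proof (induction S rule: infinite_finite_induct)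
    case (insert i S)
    then show ?case using N_add[of "f i" "sum f S"] by simp
  qed auto
  have a: "a = (\<Sum>w\<in>Poly_Mapping.keys a. Poly_Mapping.single w (Poly_Mapping.lookup a w))"
    by (rule poly_mapping_eqI) (auto simp: lookup_sum lookup_single when_def in_keys_iff sum.delta)
  have "N a = N (\<Sum>w\<in>Poly_Mapping.keys a. Poly_Mapping.single w (Poly_Mapping.lookup a w))"
    by (simp only: a[symmetric])
  also have "\<dots> \<le> (\<Sum>w\<in>Poly_Mapping.keys a. N (Poly_Mapping.single w (Poly_Mapping.lookup a w)))"
    by (rule sum)
  also have "\<dots> \<le> (\<Sum>w\<in>Poly_Mapping.keys a. cmod (Poly_Mapping.lookup a w))"
  proof (rule sum_mono)
    fix w :: "('a, 'b, 'c) generator star_word"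
    let ?z = "Poly_Mapping.lookup a w"
    have "Poly_Mapping.single w ?z = free_scale ?z (Poly_Mapping.single w 1)"
      by (simp add: free_scale_def mult_single)
    then have "N (Poly_Mapping.single w ?z) = cmod ?z * N (Poly_Mapping.single w 1)" by (simp add: N_scale)
    also have "\<dots> \<le> cmod ?z * 1"
      using toeplitz_seminorm_word_le_1[OF N, of "letters w"] by (intro mult_left_mono) auto
    finally show "N (Poly_Mapping.single w ?z) \<le> cmod ?z" by simp
  qed
  finally show ?thesis .
qed

lemma bdd_above_toeplitz_seminorms: "bdd_above ((\<lambda>N. N a) ` toeplitz_seminorms E G act)"
  using toeplitz_seminorm_bound by (meson bdd_aboveI2)

lemma zero_in_toeplitz_seminorms:
  fixes E :: "('v::finite, 'e::finite) digraph" and G :: "('g, 'v) groupoid"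
  shows "(\<lambda>a. 0) \<in> toeplitz_seminorms E G act"
proof -
  define N :: "('v, 'e, 'g) generator free_alg \<Rightarrow> real" where "N = (\<lambda>a. 0)"
  have N: "N a = 0" for a by (simp add: N_def)
  let ?A = "cstar_completion N"
  have sn: "cstar_seminorm N" by (simp add: cstar_seminorm_def N)
  have alg: "cstar_algebra ?A"
    by (rule free_seminorm.cstar_algebra_completion) (simp add: free_seminorm_def sn)
  note star_closed = cstar_algebra.star_closed[OF alg]
  interpret A: ring ?A
    by (rule free_seminorm.ring_completion) (simp add: free_seminorm_def sn)
  have cls: "cauchy_class N xs = UNIV" for xs by (simp add: cauchy_class_def cauchy_seqs_def N)
  have "cauchy_seqs N = UNIV" by (simp add: cauchy_seqs_def N)
  then have carrier: "carrier ?A = {UNIV}"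
    by (auto simp: cstar_completion_def cls)
  have eq: "x = y" if "x \<in> carrier ?A" "y \<in> carrier ?A" for x y using that by (simp add: carrier)
  have in_c: "to_completion N a \<in> carrier ?A" for a by (simp add: to_completion_def cls carrier)
  have z: "to_completion N a = \<zero>\<^bsub>?A\<^esub>" for a by (rule eq[OF in_c A.zero_closed])
  have star_z: "star ?A \<zero>\<^bsub>?A\<^esub> = \<zero>\<^bsub>?A\<^esub>"
    by (rule eq[OF star_closed[OF A.zero_closed] A.zero_closed])
  have mult_z: "\<zero>\<^bsub>?A\<^esub> \<otimes>\<^bsub>?A\<^esub> \<zero>\<^bsub>?A\<^esub> = \<zero>\<^bsub>?A\<^esub>" by (rule A.l_null[OF A.zero_closed])
  have one_z: "\<one>\<^bsub>?A\<^esub> = \<zero>\<^bsub>?A\<^esub>" by (rule eq[OF A.one_closed A.zero_closed])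
  have proj_z: "is_projection ?A \<zero>\<^bsub>?A\<^esub>" by (simp only: is_projection_def A.zero_closed star_z mult_z simp_thms)
  have minus_z: "\<zero>\<^bsub>?A\<^esub> \<ominus>\<^bsub>?A\<^esub> \<zero>\<^bsub>?A\<^esub> = \<zero>\<^bsub>?A\<^esub>"
    by (rule eq[OF A.minus_closed[OF A.zero_closed A.zero_closed] A.zero_closed])
  have le_z: "cstar_le ?A \<zero>\<^bsub>?A\<^esub> \<zero>\<^bsub>?A\<^esub>"
    unfolding cstar_le_def cstar_positive_def minus_z
    by (rule bexI[OF _ A.zero_closed]) (simp only: star_z mult_z)
  have "is_toeplitz_rep E G act ?A (\<lambda>g. to_completion N (free_gen (GenU g)))
      (\<lambda>v. to_completion N (free_gen (GenP v))) (\<lambda>e. to_completion N (free_gen (GenS e)))"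
    by (simp only: is_toeplitz_rep_def is_unitary_rep_def is_tck_family_def
        z star_z mult_z one_z proj_z le_z A.zero_closed A.finsum_zero if_cancel simp_thms)
  then show ?thesis using sn by (simp add: toeplitz_seminorms_def flip: N_def)
qed

lemma cstar_seminorm_toeplitz_norm: "cstar_seminorm (toeplitz_norm E G act)"
proof -
  let ?S = "toeplitz_seminorms E G act"
  let ?T = "toeplitz_norm E G act"
  have le: "N a \<le> ?T a" if "N \<in> ?S" for N a
    unfolding toeplitz_norm_def by (rule cSUP_upper[OF that bdd_above_toeplitz_seminorms])
  have least: "?T a \<le> M" if "\<And>N. N \<in> ?S \<Longrightarrow> N a \<le> M" for a M
    unfolding toeplitz_norm_def by (rule cSUP_least) (use that zero_in_toeplitz_seminorms[of E G act] in auto)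
  have sn: "free_seminorm N" if "N \<in> ?S" for N
    using that by (simp add: free_seminorm_def toeplitz_seminorms_def)
  have nonneg: "0 \<le> ?T a" for a
    using le[OF zero_in_toeplitz_seminorms] by simp
  have "?T (a + b) \<le> ?T a + ?T b" for a b
    by (rule least) (meson add_mono free_seminorm.N_add le order_trans sn)
  moreover have mult: "?T (a * b) \<le> ?T a * ?T b" for a b
  proof (rule least)
    fix N assume N: "N \<in> ?S"
    interpret free_seminorm N by (rule sn[OF N])
    have "N (a * b) \<le> N a * N b" by (rule N_mult)
    also have "\<dots> \<le> ?T a * ?T b" using le[OF N] nonneg by (intro mult_mono) auto
    finally show "N (a * b) \<le> ?T a * ?T b" .
  qed
  moreover have "?T (free_scale z a) = cmod z * ?T a" for z a
  proof -
    have *: "?T (free_scale z a) \<le> cmod z * ?T a" for z a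
      by (rule least) (simp add: free_seminorm.N_scale[OF sn] mult_left_mono le)
    show ?thesis
    proof (cases "z = 0")
      case True
      then show ?thesis using *[of 0 a] nonneg[of "free_scale 0 a"] by simp
    next
      case False
      have "?T a \<le> cmod (inverse z) * ?T (free_scale z a)"
        using *[of "inverse z" "free_scale z a"] False by (simp add: free_scale_scale)
      then show ?thesis using *[of z a] False by (simp add: norm_divide field_simps)
    qed
  qed
  moreover have "?T (free_star a * a) = (?T a)\<^sup>2" for a
  proof (rule antisym)
    show "?T (free_star a * a) \<le> (?T a)\<^sup>2"
      by (rule least) (simp add: free_seminorm.N_star_self[OF sn] free_seminorm.N_nonneg[OF sn] le power_mono)
    have "?T a \<le> sqrt (?T (free_star a * a))"
    proof (rule least)
      fix N assume N: "N \<in> ?S"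
      interpret free_seminorm N by (rule sn[OF N])
      show "N a \<le> sqrt (?T (free_star a * a))"
        using le[OF N, of "free_star a * a"] by (simp add: N_star_self real_le_rsqrt)
    qed
    then show "(?T a)\<^sup>2 \<le> ?T (free_star a * a)"
      using nonneg by (metis power_mono real_sqrt_pow2)
  qed
  ultimately show ?thesis by (simp add: cstar_seminorm_def)
qed

lemma cstar_algebra_toeplitz_alg: "cstar_algebra (toeplitz_alg E G act)"
  unfolding toeplitz_alg_def
  by (rule free_seminorm.cstar_algebra_completion)
    (simp add: free_seminorm_def cstar_seminorm_toeplitz_norm)

definition toeplitz_gen ::
  "('v::finite, 'e::finite) digraph \<Rightarrow> ('g, 'v) groupoid \<Rightarrow>
   ('g \<Rightarrow> ('v, 'e) path \<Rightarrow> ('v, 'e) path) \<Rightarrow>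
   ('v, 'e, 'g) generator \<Rightarrow> ('v, 'e, 'g) toeplitz_elem" where
  "toeplitz_gen E G act x = to_completion (toeplitz_norm E G act) (free_gen x)"

section \<open>Quotients by closed ideals and the Cuntz-Pimsner algebra\<close>

definition cstar_closed :: "'a cstar \<Rightarrow> 'a set \<Rightarrow> bool" where
  "cstar_closed A C \<longleftrightarrow>
     (\<forall>xs x. (\<forall>n. xs n \<in> C) \<and> x \<in> carrier A \<and> (\<lambda>n. cnorm A (xs n \<ominus>\<^bsub>A\<^esub> x)) \<longlonglongrightarrow> 0 \<longrightarrow> x \<in> C)"

text \<open>Ideals of C*-algebras are understood to be closed and two-sided.\<close>

definition cstar_ideal_gen :: "'a cstar \<Rightarrow> 'a set \<Rightarrow> 'a set" where
  "cstar_ideal_gen A R = \<Inter>{I. ideal I A \<and> cstar_closed A I \<and> R \<subseteq> I}"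

definition cstar_quot :: "'a cstar \<Rightarrow> 'a set \<Rightarrow> 'a set cstar" where
  "cstar_quot A I =
     \<lparr>carrier = carrier (A Quot I), mult = mult (A Quot I), one = one (A Quot I),
      zero = zero (A Quot I), add = add (A Quot I),
      smult = (\<lambda>z xs. \<Union>x\<in>xs. I +>\<^bsub>A\<^esub> (z \<odot>\<^bsub>A\<^esub> x)),
      star = (\<lambda>xs. \<Union>x\<in>xs. I +>\<^bsub>A\<^esub> star A x),
      cnorm = (\<lambda>xs. INF x\<in>xs. cnorm A x)\<rparr>"

definition cuntz_ideal ::
  "('v::finite, 'e::finite) digraph \<Rightarrow> ('g, 'v) groupoid \<Rightarrow>
   ('g \<Rightarrow> ('v, 'e) path \<Rightarrow> ('v, 'e) path) \<Rightarrow> ('v, 'e, 'g) toeplitz_elem set" where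
  "cuntz_ideal E G act =
     (let T = toeplitz_alg E G act; gen = toeplitz_gen E G act in
      cstar_ideal_gen T
        {gen (GenP v) \<ominus>\<^bsub>T\<^esub> (\<Oplus>\<^bsub>T\<^esub>e\<in>{e. rng E e = v}. gen (GenS e) \<otimes>\<^bsub>T\<^esub> star T (gen (GenS e))) | v. True})"

type_synonym ('v, 'e, 'g) cuntz_elem = "('v, 'e, 'g) toeplitz_elem set"

definition cuntz_alg ::
  "('v::finite, 'e::finite) digraph \<Rightarrow> ('g, 'v) groupoid \<Rightarrow>
   ('g \<Rightarrow> ('v, 'e) path \<Rightarrow> ('v, 'e) path) \<Rightarrow> ('v, 'e, 'g) cuntz_elem cstar" where
  "cuntz_alg E G act = cstar_quot (toeplitz_alg E G act) (cuntz_ideal E G act)"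

definition cuntz_gen ::
  "('v::finite, 'e::finite) digraph \<Rightarrow> ('g, 'v) groupoid \<Rightarrow>
   ('g \<Rightarrow> ('v, 'e) path \<Rightarrow> ('v, 'e) path) \<Rightarrow>
   ('v, 'e, 'g) generator \<Rightarrow> ('v, 'e, 'g) cuntz_elem" where
  "cuntz_gen E G act x =
     cuntz_ideal E G act +>\<^bsub>toeplitz_alg E G act\<^esub> toeplitz_gen E G act x"

definition cuntz_path ::
  "('v::finite, 'e::finite) digraph \<Rightarrow> ('g, 'v) groupoid \<Rightarrow>
   ('g \<Rightarrow> ('v, 'e) path \<Rightarrow> ('v, 'e) path) \<Rightarrow> ('v, 'e) path \<Rightarrow> ('v, 'e, 'g) cuntz_elem" where
  "cuntz_path E G act \<mu> =
     (let A = cuntz_alg E G act; gen = cuntz_gen E G act in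
      if snd \<mu> = [] then gen (GenP (fst \<mu>))
      else foldr (\<lambda>e a. gen (GenS e) \<otimes>\<^bsub>A\<^esub> a) (snd \<mu>) \<one>\<^bsub>A\<^esub>)"

text \<open>\<open>cuntz_elt E G act \<kappa> g \<eta>\<close> is \<open>s\<^sub>\<kappa>u\<^sub>gs\<^sub>\<eta>\<^sup>*\<close>.\<close>

definition cuntz_elt ::
  "('v::finite, 'e::finite) digraph \<Rightarrow> ('g, 'v) groupoid \<Rightarrow>
   ('g \<Rightarrow> ('v, 'e) path \<Rightarrow> ('v, 'e) path) \<Rightarrow>
   ('v, 'e) path \<Rightarrow> 'g \<Rightarrow> ('v, 'e) path \<Rightarrow> ('v, 'e, 'g) cuntz_elem" where
  "cuntz_elt E G act \<kappa> g \<eta> =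
     (let A = cuntz_alg E G act in
      cuntz_path E G act \<kappa> \<otimes>\<^bsub>A\<^esub> cuntz_gen E G act (GenU g) \<otimes>\<^bsub>A\<^esub> star A (cuntz_path E G act \<eta>))"

section \<open>Dynamics and KMS states\<close>

definition is_dynamics :: "'a cstar \<Rightarrow> (real \<Rightarrow> 'a \<Rightarrow> 'a) \<Rightarrow> bool" where
  "is_dynamics A \<sigma> \<longleftrightarrow>
     (\<forall>t. \<sigma> t \<in> ring_iso A A \<and>
          (\<forall>a\<in>carrier A. (\<forall>z. \<sigma> t (z \<odot>\<^bsub>A\<^esub> a) = z \<odot>\<^bsub>A\<^esub> \<sigma> t a) \<and> \<sigma> t (star A a) = star A (\<sigma> t a))) \<and>
     (\<forall>a\<in>carrier A. \<sigma> 0 a = a \<and> (\<forall>t u. \<sigma> (t + u) a = \<sigma> t (\<sigma> u a)) \<and>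
          (\<forall>t. ((\<lambda>u. cnorm A (\<sigma> u a \<ominus>\<^bsub>A\<^esub> \<sigma> t a)) \<longlongrightarrow> 0) (at t)))"

definition is_state :: "'a cstar \<Rightarrow> ('a \<Rightarrow> complex) \<Rightarrow> bool" where
  "is_state A \<phi> \<longleftrightarrow>
     (\<forall>a\<in>carrier A. \<forall>b\<in>carrier A. \<phi> (a \<oplus>\<^bsub>A\<^esub> b) = \<phi> a + \<phi> b) \<and>
     (\<forall>a\<in>carrier A. \<forall>z. \<phi> (z \<odot>\<^bsub>A\<^esub> a) = z * \<phi> a) \<and>
     (\<forall>a\<in>carrier A. \<phi> (star A a \<otimes>\<^bsub>A\<^esub> a) \<in> \<real>\<^sub>\<ge>\<^sub>0) \<and>
     \<phi> \<one>\<^bsub>A\<^esub> = 1"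

definition is_entire :: "'a cstar \<Rightarrow> (complex \<Rightarrow> 'a) \<Rightarrow> bool" where
  "is_entire A f \<longleftrightarrow>
     (\<forall>z. f z \<in> carrier A) \<and>
     (\<forall>z. \<exists>D\<in>carrier A.
        ((\<lambda>h. cnorm A (inverse h \<odot>\<^bsub>A\<^esub> (f (z + h) \<ominus>\<^bsub>A\<^esub> f z) \<ominus>\<^bsub>A\<^esub> D)) \<longlongrightarrow> 0) (at 0))"

text \<open>\<open>f\<close> is the map \<open>z \<mapsto> \<sigma>\<^sub>z(a)\<close>; entire extensions are unique when they exist.\<close>

definition is_entire_extension ::
  "'a cstar \<Rightarrow> (real \<Rightarrow> 'a \<Rightarrow> 'a) \<Rightarrow> 'a \<Rightarrow> (complex \<Rightarrow> 'a) \<Rightarrow> bool" where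
  "is_entire_extension A \<sigma> a f \<longleftrightarrow> is_entire A f \<and> (\<forall>t. f (complex_of_real t) = \<sigma> t a)"

definition cstar_span :: "'a cstar \<Rightarrow> 'a set \<Rightarrow> 'a set" where
  "cstar_span A S = \<Inter>{V. submodule V complex_ring A \<and> S \<subseteq> V}"

definition cstar_dense :: "'a cstar \<Rightarrow> 'a set \<Rightarrow> bool" where
  "cstar_dense A V \<longleftrightarrow> (\<forall>a\<in>carrier A. \<forall>\<epsilon>>0. \<exists>b\<in>V. cnorm A (a \<ominus>\<^bsub>A\<^esub> b) < \<epsilon>)"

definition is_kms_state ::
  "'a cstar \<Rightarrow> (real \<Rightarrow> 'a \<Rightarrow> 'a) \<Rightarrow> real \<Rightarrow> ('a \<Rightarrow> complex) \<Rightarrow> bool" where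
  "is_kms_state A \<sigma> \<beta> \<phi> \<longleftrightarrow>
     is_state A \<phi> \<and>
     (\<exists>S\<subseteq>carrier A.
        cstar_dense A (cstar_span A S) \<and> (\<forall>t. \<sigma> t ` cstar_span A S \<subseteq> cstar_span A S) \<and>
        (\<forall>a\<in>S. \<exists>f. is_entire_extension A \<sigma> a f \<and>
           (\<forall>b\<in>S. \<phi> (a \<otimes>\<^bsub>A\<^esub> b) = \<phi> (b \<otimes>\<^bsub>A\<^esub> f (\<i> * complex_of_real \<beta>))))) \<and>
     (\<beta> = 0 \<longrightarrow> (\<forall>t. \<forall>a\<in>carrier A. \<phi> (\<sigma> t a) = \<phi> a))"

end

theory Submission
  imports Defs "HOL-Complex_Analysis.Complex_Analysis"
begin

unbundle no Formal_Power_Series.fps_syntax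

text \<open>
  Words in the generators act by partial injections on the pairs \<open>(\<mu>, g)\<close> of a path and a groupoid
  element. Counting the fixed points of a word over the paths of length \<open>k\<close>, weighted by the
  Perron-Frobenius eigenvector, and letting \<open>k\<close> tend to infinity gives a positive functional on the
  free *-algebra with the KMS trace property. Its Gelfand-Naimark-Segal seminorm is one of the
  seminorms that define the Toeplitz algebra, so it extends to a state there, and it annihilates the
  Cuntz ideal.

  For uniqueness, the functions \<open>t \<mapsto> \<phi>(b \<sigma>\<^sub>t(a))\<close> of a KMS state \<open>\<phi>\<close> extend to entire functions of
  period \<open>2\<pi>\<close>. Shifting the contour of their Fourier integrals gives
  \<open>\<phi>(ab) = exp(-n\<beta>) \<phi>(ba)\<close> for words \<open>a\<close> of degree \<open>n\<close>. Perron-Frobenius theory then forces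
  \<open>exp \<beta> = \<rho>(B)\<close> and \<open>\<phi>(p\<^sub>v) = x\<^sub>v\<close>. Two such states agree as soon as they agree on all \<open>u\<^sub>g\<close>. Their
  difference at \<open>u\<^sub>g\<close> is a weighted average of its values at restrictions of \<open>g\<close>. Where its modulus,
  divided by the eigenvector, is maximal over the finite set of restrictions, a nonzero value forces
  the restriction to act trivially on all paths; by faithfulness it is then a unit, at which the
  difference vanishes.
\<close>

section \<open>Positive functionals on the free *-algebra\<close>

text \<open>The Toeplitz norm is a supremum of seminorms, so a functional is extended by bounding it
  by one of them. Left multiplication on the GNS space of a positive functional on a free *-algebra
  can be unbounded; here every word acts as a partial isometry and is therefore a contraction.
  Points carry a groupoid element because a path fixed by \<open>g\<close> counts only if the
  restriction is a unit. At level \<open>k\<close> the Cuntz-Krieger relation fails on short paths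
  and cyclic permutation of a word shifts the level; both defects disappear in the limit. The limit
  exists because extensions of fixed paths are fixed. Cyclic permutation also moves sources of paths
  inside their orbits, which is why \<open>x\<close> must be constant on orbits of the groupoid. The
  definition of a KMS state provides its condition only on some set that spans a dense invariant
  subspace and need not contain any word. Words are approximated from the subspace, and state bounds
  uniform in time control the errors under the Fourier integral. Relations absent from the
  presentation, such as orthogonality of the ranges of the \<open>s_e\<close>, come from vanishing
  sums of positive terms.\<close>

definition mon :: "'x star_word \<Rightarrow> 'x free_alg" where
  "mon w = Poly_Mapping.single w 1"

lemma mon_0: "mon 0 = 1"
  by (simp add: mon_def single_one)

lemma mon_add: "mon (u + v) = mon u * mon v"
  by (simp add: mon_def mult_single)

lemma free_star_mon: "free_star (mon w) = mon (word_star w)"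
  by (simp add: mon_def free_star_single)

lemma free_star_1 [simp]: "free_star 1 = (1 :: 'x free_alg)"
proof -
  have "word_star 0 = (0 :: 'x star_word)" by (simp add: word_star_def zero_star_word_def)
  then show ?thesis using free_star_mon[of "0 :: 'x star_word"] by (simp add: mon_0)
qed

lemma free_alg_expand:
  "a = (\<Sum>w\<in>Poly_Mapping.keys a. free_scale (Poly_Mapping.lookup a w) (mon w))"
  by (rule poly_mapping_eqI)
    (auto simp: mon_def free_scale_def mult_single lookup_sum lookup_single when_def in_keys_iff sum.delta)

lemma free_scale_0 [simp]: "free_scale 0 a = 0"
  by (simp add: free_scale_def)

locale free_functional =
  fixes \<phi> :: "'x free_alg \<Rightarrow> complex"
  assumes add: "\<phi> (a + b) = \<phi> a + \<phi> b"
    and scale: "\<phi> (free_scale z a) = z * \<phi> a"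
begin

lemma zero [simp]: "\<phi> 0 = 0"
  using scale[of 0 0] by simp

lemma uminus: "\<phi> (- a) = - \<phi> a"
  using scale[of "-1" a] by (simp add: free_scale_minus_one)

lemma diff: "\<phi> (a - b) = \<phi> a - \<phi> b"
  using add[of a "- b"] by (simp add: uminus)

lemma sum: "\<phi> (sum f A) = (\<Sum>i\<in>A. \<phi> (f i))"
  by (induction A rule: infinite_finite_induct) (auto simp: add)

lemma expand: "\<phi> a = (\<Sum>w\<in>Poly_Mapping.keys a. Poly_Mapping.lookup a w * \<phi> (mon w))"
  by (subst free_alg_expand[of a]) (simp only: sum scale)

lemma free_functional_translate: "free_functional (\<lambda>a. \<phi> (x * a * y))"
  by unfold_locales
    (simp_all add: add distrib_left distrib_right free_scale_mult_left free_scale_mult_right scale)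

end

lemma free_functional_eqI:
  assumes "free_functional \<phi>" "free_functional \<psi>" "\<And>w. \<phi> (mon w) = \<psi> (mon w)"
  shows "\<phi> a = \<psi> a"
  by (simp only: free_functional.expand[OF assms(1), of a] free_functional.expand[OF assms(2), of a] assms(3))

definition word_ext :: "('x star_word \<Rightarrow> complex) \<Rightarrow> 'x free_alg \<Rightarrow> complex" where
  "word_ext f a = (\<Sum>w\<in>Poly_Mapping.keys a. Poly_Mapping.lookup a w * f w)"

lemma word_ext_superset:
  "finite A \<Longrightarrow> Poly_Mapping.keys a \<subseteq> A \<Longrightarrow> word_ext f a = (\<Sum>w\<in>A. Poly_Mapping.lookup a w * f w)"
  unfolding word_ext_def by (intro sum.mono_neutral_left) (auto simp: in_keys_iff)

lemma word_ext_mon [simp]: "word_ext f (mon w) = f w"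
  by (simp add: word_ext_def mon_def)

lemma lookup_free_scale: "Poly_Mapping.lookup (free_scale z a) w = z * Poly_Mapping.lookup a w"
proof -
  have "free_scale z a = (\<Sum>v\<in>Poly_Mapping.keys a. Poly_Mapping.single v (z * Poly_Mapping.lookup a v))"
    unfolding free_scale_def
    by (subst free_alg_expand[of a]) (simp add: sum_distrib_left mon_def free_scale_def mult_single)
  then show ?thesis
    by (auto simp: lookup_sum lookup_single when_def in_keys_iff sum.delta)
qed

lemma free_functional_word_ext: "free_functional (word_ext f)"
proof
  fix a b :: "'a free_alg" and z
  let ?A = "Poly_Mapping.keys a \<union> Poly_Mapping.keys b"
  have "Poly_Mapping.keys (a + b) \<subseteq> ?A" by (rule Poly_Mapping.keys_add)
  then show "word_ext f (a + b) = word_ext f a + word_ext f b"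
    by (simp add: word_ext_superset[of ?A] lookup_add distrib_right sum.distrib)
  have "Poly_Mapping.keys (free_scale z a) \<subseteq> Poly_Mapping.keys a"
    by (auto simp: in_keys_iff lookup_free_scale)
  then show "word_ext f (free_scale z a) = z * word_ext f a"
    by (simp add: word_ext_superset[of "Poly_Mapping.keys a"] lookup_free_scale sum_distrib_left mult.assoc)
qed

text \<open>
  \<open>eqv \<phi> a b\<close> says that \<open>a\<close> and \<open>b\<close> have the same image in every representation built from
  \<open>\<phi>\<close>; it is how the relations of the universal algebras are stated for functionals.
\<close>

definition eqv :: "('x free_alg \<Rightarrow> complex) \<Rightarrow> 'x free_alg \<Rightarrow> 'x free_alg \<Rightarrow> bool" where
  "eqv \<phi> a b \<longleftrightarrow> (\<forall>x y. \<phi> (x * a * y) = \<phi> (x * b * y))"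

lemma eqv_refl [simp]: "eqv \<phi> a a"
  by (simp add: eqv_def)

lemma eqv_sym: "eqv \<phi> a b \<Longrightarrow> eqv \<phi> b a"
  by (simp add: eqv_def)

lemma eqv_trans [trans]: "eqv \<phi> a b \<Longrightarrow> eqv \<phi> b c \<Longrightarrow> eqv \<phi> a c"
  by (simp add: eqv_def)

lemma eqv_mult: "eqv \<phi> a b \<Longrightarrow> eqv \<phi> c d \<Longrightarrow> eqv \<phi> (a * c) (b * d)"
  unfolding eqv_def by (metis mult.assoc)

lemma eqvD: assumes "eqv \<phi> a b" shows "\<phi> a = \<phi> b"
proof -
  have "\<phi> (1 * a * 1) = \<phi> (1 * b * 1)" using assms unfolding eqv_def by blast
  then show ?thesis by simp
qed

lemma (in free_functional) eqv_add: "eqv \<phi> a b \<Longrightarrow> eqv \<phi> c d \<Longrightarrow> eqv \<phi> (a + c) (b + d)"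
  by (simp add: eqv_def distrib_left distrib_right add)

lemma (in free_functional) eqv_diff: "eqv \<phi> a b \<Longrightarrow> eqv \<phi> c d \<Longrightarrow> eqv \<phi> (a - c) (b - d)"
  by (simp add: eqv_def left_diff_distrib right_diff_distrib diff)

lemma (in free_functional) eqv_sum: "(\<And>i. i \<in> A \<Longrightarrow> eqv \<phi> (f i) (g i)) \<Longrightarrow> eqv \<phi> (sum f A) (sum g A)"
  by (induction A rule: infinite_finite_induct) (auto intro: eqv_add)

lemma (in free_functional) eqv_diff_iff: "eqv \<phi> (a - b) 0 \<longleftrightarrow> eqv \<phi> a b"
  by (simp add: eqv_def left_diff_distrib right_diff_distrib diff)

text \<open>Both sides are linear in each outer factor, so testing against words is enough.\<close>

lemma (in free_functional) eqvI_mon: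
  assumes "\<And>u v. \<phi> (mon u * a * mon v) = \<phi> (mon u * b * mon v)"
  shows "eqv \<phi> a b"
  unfolding eqv_def
proof (intro allI)
  fix x y
  have 1: "\<phi> (x * a * mon v) = \<phi> (x * b * mon v)" for v
  proof -
    have f: "free_functional (\<lambda>x. \<phi> (1 * x * (c * mon v)))" for c by (rule free_functional_translate)
    show ?thesis
      using free_functional_eqI[OF f[of a] f[of b], of x] assms by (simp add: mult.assoc)
  qed
  have f: "free_functional (\<lambda>y. \<phi> ((x * c) * y * 1))" for c by (rule free_functional_translate)
  show "\<phi> (x * a * y) = \<phi> (x * b * y)"
    using free_functional_eqI[OF f[of a] f[of b], of y] 1 by simp
qed

text \<open>The four numbers are the coefficients in the expansion of a positive form at a vector
  \<open>u + z v\<close>. Real values at \<open>z = 1\<close> and \<open>z = \<i>\<close> give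
  symmetry; the direction \<open>z = - t * cnj b\<close> gives Cauchy-Schwarz. Stated for numbers,
  it serves both the free *-algebra and abstract C*-algebras.\<close>

lemma nonneg_Reals_sesquilinear:
  fixes a b c d :: complex
  assumes "\<And>z. a + z * b + cnj z * c + of_real ((cmod z)\<^sup>2) * d \<in> \<real>\<^sub>\<ge>\<^sub>0" and a: "a \<in> \<real>\<^sub>\<ge>\<^sub>0" and d: "d \<in> \<real>\<^sub>\<ge>\<^sub>0"
  shows "c = cnj b" and "(cmod b)\<^sup>2 \<le> Re a * Re d"
proof -
  have im: "Im a = 0" "Im d = 0" and re: "0 \<le> Re a" "0 \<le> Re d"
    using a d by (auto simp: complex_nonneg_Reals_iff)
  have i: "Im (a + z * b + cnj z * c + of_real ((cmod z)\<^sup>2) * d) = 0"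
    and r: "0 \<le> Re (a + z * b + cnj z * c + of_real ((cmod z)\<^sup>2) * d)" for z
    using assms(1)[of z] by (auto simp: complex_nonneg_Reals_iff)
  show c: "c = cnj b"
    using i[of 1] i[of "\<i>"] by (simp add: complex_eq_iff im)
  have ineq: "0 \<le> Re a - 2 * t * (cmod b)\<^sup>2 + t\<^sup>2 * (cmod b)\<^sup>2 * Re d" for t :: real
  proof -
    have n: "(cmod (of_real (-t) * cnj b))\<^sup>2 = t\<^sup>2 * (cmod b)\<^sup>2"
      by (simp add: norm_mult power_mult_distrib)
    have e: "of_real (-t) * cnj b * b = of_real (-t * (cmod b)\<^sup>2)"
      "cnj (of_real (-t) * cnj b) * cnj b = of_real (-t * (cmod b)\<^sup>2)"
      by (simp_all only: of_real_mult complex_norm_square complex_cnj_mult complex_cnj_complex_of_real complex_cnj_cnj mult_ac)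
    show ?thesis using r[of "of_real (-t) * cnj b"] unfolding n c e by simp
  qed
  show "(cmod b)\<^sup>2 \<le> Re a * Re d"
  proof (cases "Re d = 0")
    case True
    show ?thesis
    proof (cases "b = 0")
      case False
      \<comment> \<open>With \<open>Re d = 0\<close> the inequality is affine in \<open>t\<close>;
        at this value its right side is \<open>- Re a - 2\<close>, which is negative.\<close>
      then have "(Re a + 1) / (cmod b)\<^sup>2 * (cmod b)\<^sup>2 = Re a + 1" by simp
      then show ?thesis using ineq[of "(Re a + 1) / (cmod b)\<^sup>2"] True re False by (simp add: mult.assoc)
    qed (simp add: True)
  next
    case False
    then have d0: "Re d > 0" using re by simp
    \<comment> \<open>\<open>1 / Re d\<close> is where the quadratic in \<open>t\<close> is
      smallest.\<close>
    have "0 \<le> Re a - (cmod b)\<^sup>2 / Re d"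
      using ineq[of "1 / Re d"] d0 by (simp add: field_simps power2_eq_square)
    then show ?thesis using d0 by (simp add: field_simps)
  qed
qed

section \<open>Positive functionals and Cauchy-Schwarz\<close>

locale pos_functional = free_functional +
  assumes pos: "\<phi> (free_star a * a) \<in> \<real>\<^sub>\<ge>\<^sub>0"
begin

lemma cauchy_schwarz_aux:
  shows hermitian_form: "\<phi> (free_star b * a) = cnj (\<phi> (free_star a * b))"
    and cauchy_schwarz_form:
      "(cmod (\<phi> (free_star a * b)))\<^sup>2 \<le> Re (\<phi> (free_star a * a)) * Re (\<phi> (free_star b * b))"
proof -
  have *: "\<phi> (free_star a * a) + z * \<phi> (free_star a * b) + cnj z * \<phi> (free_star b * a)
      + of_real ((cmod z)\<^sup>2) * \<phi> (free_star b * b) \<in> \<real>\<^sub>\<ge>\<^sub>0" for z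
  proof -
    have "\<phi> (free_star (a + free_scale z b) * (a + free_scale z b)) =
       \<phi> (free_star a * a) + z * \<phi> (free_star a * b) + cnj z * \<phi> (free_star b * a)
      + (z * cnj z) * \<phi> (free_star b * b)"
      by (simp add: free_star_add free_star_scale distrib_left distrib_right add scale
          free_scale_mult_left free_scale_mult_right free_scale_scale)
    then show ?thesis using pos[of "a + free_scale z b"]
      by (simp only: complex_norm_square)
  qed
  show "\<phi> (free_star b * a) = cnj (\<phi> (free_star a * b))"
    "(cmod (\<phi> (free_star a * b)))\<^sup>2 \<le> Re (\<phi> (free_star a * a)) * Re (\<phi> (free_star b * b))"
    using nonneg_Reals_sesquilinear[OF * pos pos] by auto
qed

lemma hermitian: "\<phi> (free_star a) = cnj (\<phi> a)"
  using hermitian_form[of a 1] by simp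

text \<open>Seminorm of \<open>a\<close> regarded as a vector of the GNS pre-Hilbert space.\<close>

definition hn :: "'a free_alg \<Rightarrow> real" where
  "hn a = sqrt (Re (\<phi> (free_star a * a)))"

lemma Re_pos: "0 \<le> Re (\<phi> (free_star a * a))" and Im_pos: "Im (\<phi> (free_star a * a)) = 0"
  using pos[of a] by (auto simp: complex_nonneg_Reals_iff)

lemma hn_nonneg: "0 \<le> hn a"
  by (simp add: hn_def Re_pos)

lemma hn_square: "(hn a)\<^sup>2 = Re (\<phi> (free_star a * a))"
  by (simp add: hn_def Re_pos)

lemma cauchy_schwarz: "cmod (\<phi> (free_star a * b)) \<le> hn a * hn b"
  by (rule power2_le_imp_le)
    (use cauchy_schwarz_form[of a b] in \<open>simp_all add: power_mult_distrib hn_square hn_nonneg\<close>)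

lemma hn_add: "hn (a + b) \<le> hn a + hn b"
proof (rule power2_le_imp_le)
  have "(hn (a + b))\<^sup>2 = (hn a)\<^sup>2 + (hn b)\<^sup>2 + Re (\<phi> (free_star a * b)) + Re (\<phi> (free_star b * a))"
    by (simp add: hn_square free_star_add distrib_left distrib_right add)
  also have "\<dots> \<le> (hn a)\<^sup>2 + (hn b)\<^sup>2 + hn a * hn b + hn b * hn a"
    using cauchy_schwarz[of a b] cauchy_schwarz[of b a] complex_Re_le_cmod
    by (intro add_mono order_refl) (meson order_trans)+
  finally show "(hn (a + b))\<^sup>2 \<le> (hn a + hn b)\<^sup>2" by (simp add: power2_sum mult_ac)
qed (simp add: hn_nonneg)

lemma hn_scale: "hn (free_scale z a) = cmod z * hn a"
proof -
  have "\<phi> (free_star (free_scale z a) * free_scale z a) = of_real ((cmod z)\<^sup>2) * \<phi> (free_star a * a)"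
    by (simp add: free_star_scale free_scale_mult_left free_scale_mult_right free_scale_scale scale)
      (simp add: mult.assoc[symmetric] mult.commute[of _ "cnj z"] flip: complex_norm_square)
  then show ?thesis by (simp add: hn_def real_sqrt_mult)
qed

lemma hn_0 [simp]: "hn 0 = 0"
  by (simp add: hn_def)

lemma hn_eqv_0: "eqv \<phi> d 0 \<Longrightarrow> hn (d * b) = 0"
  by (simp add: hn_def free_star_mult eqv_def flip: mult.assoc)

text \<open>If every \<open>d * y\<close> is a null vector, Cauchy-Schwarz kills all its inner
  products \<open>\<phi> (x * d * y)\<close>. This replaces the C*-algebraic inference from
  \<open>d* d = 0\<close> to \<open>d = 0\<close>.\<close>

lemma eqv_0I:
  assumes "\<And>y. \<phi> (free_star (d * y) * (d * y)) = 0"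
  shows "eqv \<phi> d 0"
proof -
  have "hn (d * y) = 0" for y using assms by (simp add: hn_def)
  then have "\<phi> (x * (d * y)) = 0" for x y using cauchy_schwarz[of "free_star x" "d * y"] by simp
  then show ?thesis by (simp add: eqv_def mult.assoc)
qed

lemma eqv_star: assumes "eqv \<phi> a b" shows "eqv \<phi> (free_star a) (free_star b)"
  unfolding eqv_def
proof (intro allI)
  fix x y
  have "cnj (\<phi> (free_star y * a * free_star x)) = cnj (\<phi> (free_star y * b * free_star x))"
    using assms by (simp add: eqv_def)
  then show "\<phi> (x * free_star a * y) = \<phi> (x * free_star b * y)"
    by (simp add: free_star_mult mult.assoc flip: hermitian)
qed

end

section \<open>The Gelfand-Naimark-Segal seminorm\<close>

locale gns_functional = pos_functional +
  assumes partial_isometry: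
    "eqv \<phi> (mon (word_star w) * mon w * (mon (word_star w) * mon w)) (mon (word_star w) * mon w)"
begin

text \<open>\<open>mon (word_star w) * mon w\<close> acts as an orthogonal projection
  \<open>e\<close>, so the square of \<open>hn b\<close> minus the square of
  \<open>hn (mon w * b)\<close> is the square of \<open>hn (b - e * b)\<close>.\<close>

lemma hn_mon: "hn (mon w * b) \<le> hn b"
proof -
  let ?e = "mon (word_star w) * mon w"
  have star_e: "free_star ?e = ?e" by (simp add: free_star_mult free_star_mon)
  let ?d = "b - ?e * b"
  have pi: "\<phi> (free_star b * (?e * (?e * b))) = \<phi> (free_star b * (?e * b))"
    using partial_isometry[of w] by (auto simp: eqv_def mult.assoc)
  have "free_star ?d * ?d = free_star b * b - free_star b * (?e * b) - (free_star b * (?e * b) - free_star b * (?e * (?e * b)))"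
    by (simp only: free_star_diff free_star_mult[of ?e b] star_e left_diff_distrib right_diff_distrib)
      (simp only: mult.assoc)
  then have "\<phi> (free_star ?d * ?d) = \<phi> (free_star b * b) - \<phi> (free_star b * (?e * b))"
    by (simp only: diff pi) simp
  then have "(hn (mon w * b))\<^sup>2 \<le> (hn b)\<^sup>2"
    using Re_pos[of ?d] by (simp add: hn_square free_star_mult free_star_mon mult.assoc)
  then show ?thesis using hn_nonneg power2_le_imp_le by blast
qed

lemma hn_sum: "hn (sum f A) \<le> (\<Sum>i\<in>A. hn (f i))"
  by (induction A rule: infinite_finite_induct) (auto intro: order_trans[OF hn_add])

text \<open>Makes the supremum in \<open>gns\<close> finite and shows that left multiplication
  preserves null vectors.\<close>

lemma hn_bound: "hn (a * b) \<le> (\<Sum>w\<in>Poly_Mapping.keys a. cmod (Poly_Mapping.lookup a w)) * hn b"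
proof -
  have "a * b = (\<Sum>w\<in>Poly_Mapping.keys a. free_scale (Poly_Mapping.lookup a w) (mon w * b))"
    by (subst free_alg_expand[of a]) (simp only: sum_distrib_right free_scale_mult_left)
  then have "hn (a * b) \<le> (\<Sum>w\<in>Poly_Mapping.keys a. hn (free_scale (Poly_Mapping.lookup a w) (mon w * b)))"
    by (simp add: hn_sum)
  also have "\<dots> \<le> (\<Sum>w\<in>Poly_Mapping.keys a. cmod (Poly_Mapping.lookup a w) * hn b)"
    by (intro sum_mono) (simp add: hn_scale mult_left_mono hn_mon)
  finally show ?thesis by (simp add: sum_distrib_right)
qed

text \<open>Operator norm of left multiplication by \<open>a\<close> on the GNS space.\<close>

definition gns :: "'a free_alg \<Rightarrow> real" where
  "gns a = (SUP b\<in>{b. hn b \<le> 1}. hn (a * b))"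

lemma gns_bdd: "bdd_above ((\<lambda>b. hn (a * b)) ` {b. hn b \<le> 1})"
proof (rule bdd_aboveI2)
  fix b assume "b \<in> {b. hn b \<le> 1}"
  then show "hn (a * b) \<le> (\<Sum>w\<in>Poly_Mapping.keys a. cmod (Poly_Mapping.lookup a w))"
    using hn_bound[of a b] mult_left_le[of "hn b" "\<Sum>w\<in>Poly_Mapping.keys a. cmod (Poly_Mapping.lookup a w)"]
    by (simp add: sum_nonneg)
qed

lemma hn_gns: "hn (a * b) \<le> gns a * hn b"
proof (cases "hn b = 0")
  case True
  then show ?thesis using hn_bound[of a b] by simp
next
  case False
  then have p: "hn b > 0" using hn_nonneg[of b] by simp
  let ?c = "free_scale (of_real (1 / hn b)) b"
  have "hn ?c \<le> 1" using p by (simp only: hn_scale norm_of_real) simp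
  then have "hn (a * ?c) \<le> gns a" unfolding gns_def by (intro cSUP_upper gns_bdd) simp
  then show ?thesis
    using p by (simp add: free_scale_mult_right hn_scale field_simps del: of_real_divide)
qed

lemma gns_leI: "(\<And>b. hn b \<le> 1 \<Longrightarrow> hn (a * b) \<le> M) \<Longrightarrow> gns a \<le> M"
  unfolding gns_def by (rule cSUP_least) (auto intro: exI[of _ 0])

lemma gns_nonneg: "0 \<le> gns a"
  using cSUP_upper[OF _ gns_bdd, of 0 a] by (simp add: gns_def)

lemma gns_unit: "hn b \<le> 1 \<Longrightarrow> hn (a * b) \<le> gns a"
  unfolding gns_def by (intro cSUP_upper gns_bdd) simp

lemma gns_mult: "gns (a * b) \<le> gns a * gns b"
proof (rule gns_leI)
  fix c assume c: "hn c \<le> 1"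
  have "hn (a * b * c) \<le> gns a * hn (b * c)" using hn_gns[of a "b * c"] by (simp add: mult.assoc)
  also have "\<dots> \<le> gns a * gns b" by (intro mult_left_mono gns_unit c gns_nonneg)
  finally show "hn (a * b * c) \<le> gns a * gns b" .
qed

text \<open>The inner product of \<open>b\<close> with \<open>a* a b\<close> is the squared norm of
  \<open>a b\<close>. The opposite inequality is submultiplicativity combined with
  \<open>gns_star_le\<close>.\<close>

lemma gns_square_le: "(gns a)\<^sup>2 \<le> gns (free_star a * a)"
proof -
  have "gns a \<le> sqrt (gns (free_star a * a))"
  proof (rule gns_leI)
    fix b assume b: "hn b \<le> 1"
    have "(hn (a * b))\<^sup>2 \<le> cmod (\<phi> (free_star b * (free_star a * a * b)))"
      using complex_Re_le_cmod by (simp add: hn_square free_star_mult mult.assoc)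
    also have "\<dots> \<le> hn b * hn (free_star a * a * b)" by (rule cauchy_schwarz)
    also have "\<dots> \<le> 1 * gns (free_star a * a)" by (intro mult_mono b gns_unit) (auto simp: hn_nonneg)
    finally show "hn (a * b) \<le> sqrt (gns (free_star a * a))" by (simp add: real_le_rsqrt)
  qed
  then show ?thesis using gns_nonneg by (metis power_mono real_sqrt_pow2)
qed

lemma gns_scale: "gns (free_scale z a) = cmod z * gns a"
proof -
  have *: "gns (free_scale z a) \<le> cmod z * gns a" for z a
    by (rule gns_leI) (simp add: free_scale_mult_left hn_scale mult_left_mono gns_unit)
  show ?thesis
  proof (cases "z = 0")
    case True
    then show ?thesis using *[of 0 a] gns_nonneg[of 0] by simp
  next
    case False
    have "gns a \<le> cmod (inverse z) * gns (free_scale z a)"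
      using *[of "inverse z" "free_scale z a"] False by (simp add: free_scale_scale)
    then show ?thesis using *[of z a] False by (simp add: norm_divide field_simps)
  qed
qed

lemma gns_star_le: "gns a \<le> gns (free_star a)"
proof (cases "gns a = 0")
  case False
  then have "gns a > 0" using gns_nonneg[of a] by simp
  moreover have "gns a * gns a \<le> gns (free_star a) * gns a"
    using gns_square_le[of a] gns_mult[of "free_star a" a] by (simp add: power2_eq_square)
  ultimately show ?thesis by (metis mult_le_cancel_right_pos)
next
  case True
  then show ?thesis by (metis gns_nonneg)
qed

lemma cstar_seminorm_gns: "cstar_seminorm gns"
proof -
  have "gns (a + b) \<le> gns a + gns b" for a b
  proof (rule gns_leI)
    fix c assume "hn c \<le> 1"
    then have "hn (a * c) + hn (b * c) \<le> gns a + gns b" by (intro add_mono gns_unit)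
    then show "hn ((a + b) * c) \<le> gns a + gns b"
      using hn_add[of "a * c" "b * c"] by (simp add: distrib_right)
  qed
  moreover have "gns (free_star a * a) = (gns a)\<^sup>2" for a
  proof (rule antisym)
    have "gns (free_star a) = gns a" using gns_star_le[of a] gns_star_le[of "free_star a"] by simp
    then show "gns (free_star a * a) \<le> (gns a)\<^sup>2"
      using gns_mult[of "free_star a" a] by (simp add: power2_eq_square)
  qed (rule gns_square_le)
  ultimately show ?thesis by (simp add: cstar_seminorm_def gns_scale gns_mult)
qed

lemma gns_eqv_0: "eqv \<phi> d 0 \<Longrightarrow> gns d = 0"
  using gns_leI[of d 0] gns_nonneg[of d] by (simp add: hn_eqv_0)

text \<open>\<open>\<phi>\<close> is the vector functional of the vector \<open>1\<close>.\<close>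

lemma functional_le_gns: "cmod (\<phi> a) \<le> (hn 1)\<^sup>2 * gns a"
proof -
  have "cmod (\<phi> a) \<le> hn 1 * hn (a * 1)" using cauchy_schwarz[of 1 a] by simp
  also have "\<dots> \<le> hn 1 * (gns a * hn 1)" by (intro mult_left_mono hn_gns hn_nonneg)
  finally show ?thesis by (simp add: power2_eq_square mult.commute mult.left_commute)
qed

end


section \<open>Self-similar actions on lists of edges\<close>

lemma is_walk_src: "is_walk E v es w \<Longrightarrow> path_src E (v, es) = w"
  by (induction es arbitrary: v) (auto simp: path_src_def split: if_splits)

lemma is_walk_append: "is_walk E v (xs @ ys) w \<longleftrightarrow> (\<exists>u. is_walk E v xs u \<and> is_walk E u ys w)"
  by (induction xs arbitrary: v) auto

lemma in_paths_from_iff: "(v, es) \<in> paths_from E u k \<longleftrightarrow> v = u \<and> length es = k \<and> (\<exists>w. is_walk E v es w)"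
  by (auto simp: paths_from_def paths_from_to_def path_len_def)

lemma in_vpaths_iff: "(v, es) \<in> vpaths E u \<longleftrightarrow> v = u \<and> (\<exists>w. is_walk E v es w)"
  by (auto simp: vpaths_def in_paths_from_iff)

lemma in_all_paths_iff: "(v, es) \<in> all_paths E \<longleftrightarrow> (\<exists>w. is_walk E v es w)"
  by (auto simp: all_paths_def in_vpaths_iff)

text \<open>Inverse of a partial map. The choice by \<open>SOME\<close> is harmless only for
  injective \<open>f\<close>, the case of \<open>pinv_iff\<close>.\<close>

definition pinv :: "('a \<Rightarrow> 'b option) \<Rightarrow> 'b \<Rightarrow> 'a option" where
  "pinv f y = (if \<exists>x. f x = Some y then Some (SOME x. f x = Some y) else None)"

lemma pinv_iff:
  assumes "\<And>x x' y. f x = Some y \<Longrightarrow> f x' = Some y \<Longrightarrow> x = x'"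
  shows "pinv f y = Some x \<longleftrightarrow> f x = Some y"
proof -
  have "f (SOME x. f x = Some y) = Some y" if "f x = Some y" for x
    using that by (rule someI)
  then show ?thesis using assms unfolding pinv_def by (metis option.inject option.distinct(1))
qed

context self_similar_action
begin

abbreviation ea :: "'g \<Rightarrow> 'e \<Rightarrow> 'e" where "ea \<equiv> edge_act E act"
abbreviation rs :: "'g \<Rightarrow> 'e \<Rightarrow> 'g" where "rs \<equiv> restrict_edge E G act"

lemma act_in_vpaths: "\<mu> \<in> vpaths E (gdom G g) \<Longrightarrow> act g \<mu> \<in> vpaths E (gcod G g)"
  using act_piso[of g] by (auto simp: partial_iso_def bij_betw_def)

lemma act_in_paths_from: "\<mu> \<in> paths_from E (gdom G g) k \<Longrightarrow> act g \<mu> \<in> paths_from E (gcod G g) k"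
  using act_piso[of g] unfolding partial_iso_def bij_betw_def by blast

lemma edge_in_paths_from: "(rng E e, [e]) \<in> paths_from E (rng E e) 1"
  by (simp add: in_paths_from_iff)

lemma act_edge:
  assumes "rng E e = gdom G g"
  shows "act g (edge_path E e) = (gcod G g, [ea g e])" and "rng E (ea g e) = gcod G g"
proof -
  have "act g (edge_path E e) \<in> paths_from E (gcod G g) 1"
    using act_in_paths_from edge_in_paths_from[of e] assms by (simp add: edge_path_def)
  moreover obtain v es where ves: "act g (edge_path E e) = (v, es)" by force
  ultimately have *: "v = gcod G g" "length es = 1" "\<exists>w. is_walk E v es w" by (auto simp: in_paths_from_iff)
  then obtain f where f: "es = [f]" by (auto simp: length_Suc_conv)
  show "act g (edge_path E e) = (gcod G g, [ea g e])" and "rng E (ea g e) = gcod G g"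
    using * ves f by (auto simp: edge_act_def)
qed

lemma groupoid_ext:
  assumes "gdom G g = gdom G h" "gcod G g = gcod G h"
    and "\<And>\<mu>. \<mu> \<in> vpaths E (gdom G g) \<Longrightarrow> act g \<mu> = act h \<mu>"
  shows "g = h"
  using assms by (intro injD[OF faithful]) (auto simp: restrict_def)

text \<open>The defining equation determines the action of \<open>h\<close> on all tails, and
  faithfulness then determines \<open>h\<close>.\<close>

lemma restriction_unique:
  assumes "is_restriction E G act g e h" "is_restriction E G act g e h'"
  shows "h = h'"
proof (rule groupoid_ext)
  show dom: "gdom G h = gdom G h'" and cod: "gcod G h = gcod G h'"
    using assms by (auto simp: is_restriction_def)
  fix \<mu> assume mu: "\<mu> \<in> vpaths E (gdom G h)"
  have "act h \<mu> \<in> vpaths E (gcod G h)" "act h' \<mu> \<in> vpaths E (gcod G h)"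
    using act_in_vpaths[OF mu] act_in_vpaths[of \<mu> h'] mu dom cod by auto
  then have "fst (act h \<mu>) = fst (act h' \<mu>)"
    by (metis in_vpaths_iff prod.collapse)
  moreover have "snd (act h \<mu>) = snd (act h' \<mu>)"
    using assms mu by (auto simp: is_restriction_def append_path_def)
  ultimately show "act h \<mu> = act h' \<mu>" by (rule prod_eqI)
qed

lemma restriction_rs:
  assumes "rng E e = gdom G g"
  shows "is_restriction E G act g e (rs g e)"
  unfolding restrict_edge_def
  by (rule theI') (use self_similar[OF assms] restriction_unique in blast)

lemma rs_eqI:
  assumes "rng E e = gdom G g" "is_restriction E G act g e h"
  shows "rs g e = h"
  using restriction_unique[OF restriction_rs[OF assms(1)] assms(2)] .

lemma gdom_rs: "rng E e = gdom G g \<Longrightarrow> gdom G (rs g e) = src E e"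
  and gcod_rs: "rng E e = gdom G g \<Longrightarrow> gcod G (rs g e) = src E (ea g e)"
  using restriction_rs[of e g] by (auto simp: is_restriction_def act_edge path_src_def)

lemma act_Cons:
  assumes "rng E e = gdom G g" "is_walk E (src E e) es w"
  shows "act g (gdom G g, e # es) = (gcod G g, ea g e # snd (act (rs g e) (src E e, es)))"
proof -
  have "act g (append_path (edge_path E e) (src E e, es)) =
      append_path (act g (edge_path E e)) (act (rs g e) (src E e, es))"
    using restriction_rs[OF assms(1)] assms(2) by (auto simp: is_restriction_def in_vpaths_iff)
  then show ?thesis using act_edge[OF assms(1)] assms(1) by (simp add: append_path_def edge_path_def)
qed

text \<open>The action on edge lists without their range vertex. It is total; its values on lists
  that are not walks from \<open>gdom G g\<close> have no meaning.\<close>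

primrec la :: "'g \<Rightarrow> 'e list \<Rightarrow> 'e list" where
  "la g [] = []"
| "la g (e # es) = ea g e # la (rs g e) es"

abbreviation lr :: "'g \<Rightarrow> 'e list \<Rightarrow> 'g" where "lr \<equiv> foldl rs"

lemma act_walk: "is_walk E (gdom G g) es w \<Longrightarrow> act g (gdom G g, es) = (gcod G g, la g es)"
proof (induction es arbitrary: g)
  case Nil
  have "(gdom G g, []) \<in> paths_from E (gdom G g) 0" by (simp add: in_paths_from_iff)
  then have "act g (gdom G g, []) \<in> paths_from E (gcod G g) 0" by (rule act_in_paths_from)
  then show ?case by (cases "act g (gdom G g, [])") (auto simp: in_paths_from_iff)
next
  case (Cons e es)
  then have e: "rng E e = gdom G g" and w: "is_walk E (src E e) es w" by auto
  have "act (rs g e) (gdom G (rs g e), es) = (gcod G (rs g e), la (rs g e) es)"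
    by (rule Cons.IH) (use w gdom_rs[OF e] in simp)
  then show ?case by (simp add: act_Cons[OF e w] gdom_rs[OF e])
qed

lemma length_la [simp]: "length (la g es) = length es"
  by (induction es arbitrary: g) auto

lemma la_append: "la g (xs @ ys) = la g xs @ la (lr g xs) ys"
  by (induction xs arbitrary: g) auto

lemma walk_lr:
  assumes "is_walk E (gdom G g) es w"
  shows "gdom G (lr g es) = w" and "is_walk E (gcod G g) (la g es) (gcod G (lr g es))"
proof -
  have "gdom G (lr g es) = w \<and> is_walk E (gcod G g) (la g es) (gcod G (lr g es))"
    using assms
  proof (induction es arbitrary: g)
    case (Cons e es)
    then have e: "rng E e = gdom G g" and w: "is_walk E (gdom G (rs g e)) es w" by (auto simp: gdom_rs)
    show ?case using Cons.IH[OF w] act_edge(2)[OF e] by (simp add: gcod_rs[OF e])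
  qed simp
  then show "gdom G (lr g es) = w" "is_walk E (gcod G g) (la g es) (gcod G (lr g es))" by auto
qed

lemma ea_comp:
  assumes "gdom G g = gcod G h" "rng E e = gdom G h"
  shows "ea (gcomp G g h) e = ea g (ea h e)"
proof -
  have "act (gcomp G g h) (edge_path E e) = act g (act h (edge_path E e))"
    by (rule act_comp) (use assms in \<open>auto simp: edge_path_def in_vpaths_iff\<close>)
  then show ?thesis
    using act_edge[of e h] act_edge[of e "gcomp G g h"] act_edge[of "ea h e" g] assms
    by (simp add: gdom_comp gcod_comp edge_path_def)
qed

text \<open>Cocycle identity for restrictions. Uniqueness reduces it to computing the action of the
  product on paths beginning with \<open>e\<close> in two ways.\<close>

lemma rs_comp:
  assumes "gdom G g = gcod G h" "rng E e = gdom G h"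
  shows "rs (gcomp G g h) e = gcomp G (rs g (ea h e)) (rs h e)"
proof (rule rs_eqI)
  have e': "rng E (ea h e) = gdom G g" using act_edge(2)[of e h] assms by simp
  have m: "gdom G (rs g (ea h e)) = gcod G (rs h e)" using assms e' by (simp add: gdom_rs gcod_rs)
  show e: "rng E e = gdom G (gcomp G g h)" using assms by (simp add: gdom_comp)
  have "act (gcomp G g h) (append_path (edge_path E e) \<mu>) =
     append_path (act (gcomp G g h) (edge_path E e)) (act (gcomp G (rs g (ea h e)) (rs h e)) \<mu>)"
    if mu: "\<mu> \<in> vpaths E (src E e)" for \<mu>
  proof -
    obtain es w where es: "\<mu> = (src E e, es)" "is_walk E (src E e) es w"
      using mu by (cases \<mu>) (auto simp: in_vpaths_iff)
    have p: "append_path (edge_path E e) \<mu> = (gdom G h, e # es)"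
      using es assms by (simp add: append_path_def edge_path_def)
    have wh: "is_walk E (gdom G h) (e # es) w" using es assms by simp
    have w1: "is_walk E (gdom G (rs h e)) es w" using es assms by (simp add: gdom_rs)
    have "act (gcomp G g h) (gdom G h, e # es) = act g (act h (gdom G h, e # es))"
      by (rule act_comp) (use assms wh in \<open>auto simp: in_vpaths_iff\<close>)
    also have "\<dots> = act g (gdom G g, la h (e # es))"
      using act_walk[OF wh] assms by simp
    also have "\<dots> = (gcod G g, la g (la h (e # es)))"
      using act_walk[of g "la h (e # es)"] walk_lr(2)[OF wh] assms by metis
    also have "act (gcomp G (rs g (ea h e)) (rs h e)) \<mu> = act (rs g (ea h e)) (act (rs h e) \<mu>)"
      by (rule act_comp) (use assms es m in \<open>auto simp: in_vpaths_iff gdom_rs\<close>)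
    then have "act (gcomp G (rs g (ea h e)) (rs h e)) \<mu> = (gcod G (rs g (ea h e)), la (rs g (ea h e)) (la (rs h e) es))"
      using act_walk[OF w1] act_walk[of "rs g (ea h e)" "la (rs h e) es"] walk_lr(2)[OF w1] es assms m
      by (simp add: gdom_rs)
    then have "(gcod G g, la g (la h (e # es))) =
       append_path (act (gcomp G g h) (edge_path E e)) (act (gcomp G (rs g (ea h e)) (rs h e)) \<mu>)"
      using act_edge(1)[OF e] assms by (simp add: append_path_def gcod_comp ea_comp)
    finally show ?thesis by (simp only: p)
  qed
  then show "is_restriction E G act (gcomp G g h) e (gcomp G (rs g (ea h e)) (rs h e))"
    using m assms e e' act_edge(1)[OF e]
    by (simp add: is_restriction_def gdom_comp gcod_comp gdom_rs gcod_rs path_src_def ea_comp)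
qed

lemma ea_id: "rng E e = v \<Longrightarrow> ea (gid G v) e = e"
  using act_id[of "edge_path E e" v] by (auto simp: edge_path_def in_vpaths_iff edge_act_def)

lemma rs_id: "rng E e = v \<Longrightarrow> rs (gid G v) e = gid G (src E e)"
  by (rule rs_eqI)
    (auto simp: is_restriction_def gdom_id gcod_id act_id in_vpaths_iff edge_path_def append_path_def path_src_def)

lemma la_id: "is_walk E v es w \<Longrightarrow> la (gid G v) es = es"
  and lr_id: "is_walk E v es w \<Longrightarrow> lr (gid G v) es = gid G w"
  by (induction es arbitrary: v) (auto simp: ea_id rs_id)

lemma la_comp: "gdom G g = gcod G h \<Longrightarrow> is_walk E (gdom G h) es w \<Longrightarrow> la (gcomp G g h) es = la g (la h es)"
  and lr_comp: "gdom G g = gcod G h \<Longrightarrow> is_walk E (gdom G h) es w \<Longrightarrow>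
     lr (gcomp G g h) es = gcomp G (lr g (la h es)) (lr h es)"
  by (induction es arbitrary: g h) (auto simp: ea_comp rs_comp gdom_rs gcod_rs act_edge)

text \<open>Walks exhaust the paths from \<open>v\<close>, so faithfulness applies. Uniqueness of
  the KMS state ends with this passage from a trivial action to a unit.\<close>

lemma eq_gidI:
  assumes "gdom G g = v" "gcod G g = v" "\<And>es w. is_walk E v es w \<Longrightarrow> la g es = es"
  shows "g = gid G v"
proof (rule groupoid_ext)
  fix \<mu> assume "\<mu> \<in> vpaths E (gdom G g)"
  then obtain es w where "\<mu> = (v, es)" "is_walk E v es w"
    using assms(1) by (cases \<mu>) (auto simp: in_vpaths_iff)
  then show "act g \<mu> = act (gid G v) \<mu>"
    using act_walk[of g es w] assms by (simp add: act_id in_vpaths_iff) (metis act_id in_vpaths_iff)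
qed (simp_all add: assms gdom_id gcod_id)

definition ginv :: "'g \<Rightarrow> 'g" where
  "ginv g = (SOME h. gdom G h = gcod G g \<and> gcod G h = gdom G g \<and>
      gcomp G h g = gid G (gdom G g) \<and> gcomp G g h = gid G (gcod G g))"

lemma gdom_ginv [simp]: "gdom G (ginv g) = gcod G g"
  and gcod_ginv [simp]: "gcod G (ginv g) = gdom G g"
  and ginv_left: "gcomp G (ginv g) g = gid G (gdom G g)"
  and ginv_right: "gcomp G g (ginv g) = gid G (gcod G g)"
  using someI_ex[OF ex_inverse[of g]] unfolding ginv_def by blast+

section \<open>The partial action of words on pairs of a path and a groupoid element\<close>

text \<open>
  The point \<open>(\<mu>, g)\<close> stands for \<open>s\<^sub>\<mu>u\<^sub>g\<close>, and letters act on points by left multiplication. The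
  range of an empty path is recovered as the codomain of \<open>g\<close>.
\<close>

definition pr :: "'e list \<times> 'g \<Rightarrow> 'v" where
  "pr \<xi> = (if fst \<xi> = [] then gcod G (snd \<xi>) else rng E (hd (fst \<xi>)))"

definition vld :: "'e list \<times> 'g \<Rightarrow> bool" where
  "vld \<xi> \<longleftrightarrow> is_walk E (pr \<xi>) (fst \<xi>) (gcod G (snd \<xi>))"

lemma pr_eqI: "is_walk E v es (gcod G g) \<Longrightarrow> pr (es, g) = v"
  by (cases es) (auto simp: pr_def)

lemma vldI: "is_walk E v es (gcod G g) \<Longrightarrow> vld (es, g)"
  by (simp add: vld_def pr_eqI)

text \<open>The third case is the relation \<open>u_h s_mu u_g = s_(h.mu) u_(h|mu g)\<close>.
  \<open>None\<close> stands for the zero vector, and invalid pairs are sent there as well.\<close>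

fun gact :: "('v, 'e, 'g) generator \<Rightarrow> 'e list \<times> 'g \<Rightarrow> ('e list \<times> 'g) option" where
  "gact (GenP v) \<xi> = (if vld \<xi> \<and> pr \<xi> = v then Some \<xi> else None)"
| "gact (GenS e) \<xi> = (if vld \<xi> \<and> pr \<xi> = src E e then Some (e # fst \<xi>, snd \<xi>) else None)"
| "gact (GenU h) \<xi> = (if vld \<xi> \<and> pr \<xi> = gdom G h
     then Some (la h (fst \<xi>), gcomp G (lr h (fst \<xi>)) (snd \<xi>)) else None)"

lemma gact_U_walk:
  assumes "vld \<xi>" "pr \<xi> = gdom G h"
  shows "gdom G (lr h (fst \<xi>)) = gcod G (snd \<xi>)" (is ?A)
    and "is_walk E (gcod G h) (la h (fst \<xi>)) (gcod G (gcomp G (lr h (fst \<xi>)) (snd \<xi>)))" (is ?B)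
proof -
  have w: "is_walk E (gdom G h) (fst \<xi>) (gcod G (snd \<xi>))" using assms by (simp add: vld_def)
  show ?A using walk_lr(1)[OF w] .
  then show ?B using walk_lr(2)[OF w] by (simp add: gcod_comp)
qed

lemma gact_Some:
  assumes "gact x \<xi> = Some \<eta>"
  shows "vld \<xi>" "vld \<eta>" "gdom G (snd \<eta>) = gdom G (snd \<xi>)"
proof -
  show "vld \<xi>" using assms by (cases x) (auto split: if_splits)
  show "vld \<eta>"
  proof (cases x)
    case (GenS e)
    then show ?thesis using assms by (auto simp: vld_def[of \<xi>] intro!: vldI[of "rng E e"] split: if_splits)
  qed (use assms in \<open>auto intro: vldI[OF gact_U_walk(2)] split: if_splits\<close>)
  show "gdom G (snd \<eta>) = gdom G (snd \<xi>)"
    using assms by (cases x) (auto simp: gdom_comp gact_U_walk(1) split: if_splits)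
qed

lemma gact_U_comp:
  assumes "gdom G g = gcod G h"
  shows "Option.bind (gact (GenU h) \<xi>) (gact (GenU g)) = gact (GenU (gcomp G g h)) \<xi>"
proof (cases "vld \<xi> \<and> pr \<xi> = gdom G h")
  case True
  then have w: "is_walk E (gdom G h) (fst \<xi>) (gcod G (snd \<xi>))" unfolding vld_def by metis
  note * = gact_U_walk[of \<xi> h] walk_lr[OF w]
  have w': "is_walk E (gdom G g) (la h (fst \<xi>)) (gcod G (lr h (fst \<xi>)))" using * assms by simp
  have "vld (la h (fst \<xi>), gcomp G (lr h (fst \<xi>)) (snd \<xi>))"
    "pr (la h (fst \<xi>), gcomp G (lr h (fst \<xi>)) (snd \<xi>)) = gcod G h"
    using * True by (auto intro: vldI pr_eqI)
  then show ?thesis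
    using True assms * walk_lr[OF w']
    by (simp add: gdom_comp la_comp[OF assms w] lr_comp[OF assms w] comp_assoc)
qed (use assms in \<open>auto simp: gdom_comp\<close>)

lemma gact_U_id: "gact (GenU (gid G v)) \<xi> = gact (GenP v) \<xi>"
proof (cases "vld \<xi> \<and> pr \<xi> = v")
  case True
  then have w: "is_walk E v (fst \<xi>) (gcod G (snd \<xi>))" unfolding vld_def by metis
  then show ?thesis using True by (simp add: gdom_id la_id[OF w] lr_id[OF w] comp_id_left)
qed (auto simp: gdom_id)

lemma gact_U_inverse:
  assumes "gact (GenU h) \<xi> = Some \<eta>"
  shows "gact (GenU (ginv h)) \<eta> = Some \<xi>"
proof -
  have "Option.bind (gact (GenU h) \<xi>) (gact (GenU (ginv h))) = gact (GenP (gdom G h)) \<xi>"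
    by (simp only: gact_U_comp gdom_ginv ginv_left gact_U_id)
  then show ?thesis using assms by (auto split: if_splits)
qed

text \<open>Injectivity is what lets the inverse partial map serve as the adjoint of a generator;
  for \<open>GenU\<close> the inverse is the action of \<open>ginv h\<close>.\<close>

lemma gact_inj: "gact x \<xi> = Some \<eta> \<Longrightarrow> gact x \<xi>' = Some \<eta> \<Longrightarrow> \<xi> = \<xi>'"
proof (cases x)
  case (GenU h)
  then show "gact x \<xi> = Some \<eta> \<Longrightarrow> gact x \<xi>' = Some \<eta> \<Longrightarrow> \<xi> = \<xi>'"
    using gact_U_inverse[of h] by (metis option.inject)
qed (auto split: if_splits intro: prod_eqI)

definition lact :: "('v, 'e, 'g) generator \<times> bool \<Rightarrow> 'e list \<times> 'g \<Rightarrow> ('e list \<times> 'g) option" where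
  "lact l = (if snd l then pinv (gact (fst l)) else gact (fst l))"

lemma lact_star: "lact (x, \<not> b) \<eta> = Some \<xi> \<longleftrightarrow> lact (x, b) \<xi> = Some \<eta>"
  by (auto simp: lact_def pinv_iff[of "gact x", OF gact_inj])

lemma lact_Some:
  assumes "lact l \<xi> = Some \<eta>"
  shows "vld \<xi>" "vld \<eta>" "gdom G (snd \<eta>) = gdom G (snd \<xi>)"
  using assms gact_Some[of "fst l" \<xi> \<eta>] gact_Some[of "fst l" \<eta> \<xi>]
  by (auto simp: lact_def pinv_iff[of "gact (fst l)", OF gact_inj] split: if_splits)

primrec lwact :: "(('v, 'e, 'g) generator \<times> bool) list \<Rightarrow> 'e list \<times> 'g \<Rightarrow> ('e list \<times> 'g) option" where
  "lwact [] \<xi> = Some \<xi>"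
| "lwact (l # ls) \<xi> = Option.bind (lwact ls \<xi>) (lact l)"

definition wact :: "('v, 'e, 'g) generator star_word \<Rightarrow> 'e list \<times> 'g \<Rightarrow> ('e list \<times> 'g) option" where
  "wact w = lwact (letters w)"

lemma lwact_append: "lwact (u @ v) \<xi> = Option.bind (lwact v \<xi>) (lwact u)"
  by (induction u) (auto simp: bind_assoc)

lemma wact_0 [simp]: "wact 0 \<xi> = Some \<xi>"
  by (simp add: wact_def zero_star_word_def)

lemma wact_add: "wact (u + v) \<xi> = Option.bind (wact v \<xi>) (wact u)"
  by (simp add: wact_def plus_star_word_def lwact_append)

lemma wact_star: "wact (word_star w) \<eta> = Some \<xi> \<longleftrightarrow> wact w \<xi> = Some \<eta>"
proof -
  have "lwact (rev (map (\<lambda>(x, b). (x, \<not> b)) ls)) \<eta> = Some \<xi> \<longleftrightarrow> lwact ls \<xi> = Some \<eta>" for ls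
    by (induction ls arbitrary: \<eta>) (auto simp: lwact_append bind_eq_Some_conv lact_star)
  then show ?thesis by (simp add: wact_def word_star_def)
qed

lemma wact_Some:
  assumes "wact w \<xi> = Some \<eta>" "vld \<xi>"
  shows "vld \<eta>" "gdom G (snd \<eta>) = gdom G (snd \<xi>)"
proof -
  have "lwact ls \<xi> = Some \<eta> \<Longrightarrow> vld \<eta> \<and> gdom G (snd \<eta>) = gdom G (snd \<xi>)" for ls
    using assms(2) by (induction ls arbitrary: \<eta>) (auto simp: bind_eq_Some_conv dest: lact_Some)
  then show "vld \<eta>" "gdom G (snd \<eta>) = gdom G (snd \<xi>)" using assms(1) by (auto simp: wact_def)
qed

text \<open>Compatibility with generators passes to their inverses, and letters preserve the domain
  of the groupoid component, so the side condition at \<open>v\<close> survives along the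
  word.\<close>

lemma wact_equivariant:
  assumes gact: "\<And>x \<xi> \<eta>. gact x \<xi> = Some \<eta> \<Longrightarrow> gdom G (snd \<xi>) = v \<Longrightarrow> gact x (t \<xi>) = Some (t \<eta>)"
    and "wact w \<xi> = Some \<eta>" "vld \<xi>" "gdom G (snd \<xi>) = v"
  shows "wact w (t \<xi>) = Some (t \<eta>)"
proof -
  have l: "lact l (t \<xi>) = Some (t \<eta>)" if "lact l \<xi> = Some \<eta>" "gdom G (snd \<xi>) = v" for l \<xi> \<eta>
    using that gact[of "fst l" \<xi> \<eta>] gact[of "fst l" \<eta> \<xi>] lact_Some[OF that(1)]
    by (auto simp: lact_def pinv_iff[of "gact (fst l)", OF gact_inj] split: if_splits)
  have "lwact ls \<xi> = Some \<eta> \<Longrightarrow> lwact ls (t \<xi>) = Some (t \<eta>) \<and> gdom G (snd \<eta>) = v" for ls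
  proof (induction ls arbitrary: \<eta>)
    case (Cons a ls)
    then obtain \<zeta> where z: "lwact ls \<xi> = Some \<zeta>" "lact a \<zeta> = Some \<eta>"
      by (auto simp: bind_eq_Some_conv)
    show ?case using Cons.IH[OF z(1)] l[OF z(2)] lact_Some(3)[OF z(2)] by simp
  qed (use assms(4) in simp)
  then show ?thesis using assms(2) by (simp add: wact_def)
qed

text \<open>Right multiplication by \<open>s_nu\<close>: the product \<open>s_mu u_g s_nu\<close> is
  \<open>s_(mu (g.nu)) u_(g|nu)\<close>.\<close>

definition ext :: "'e list \<Rightarrow> 'e list \<times> 'g \<Rightarrow> 'e list \<times> 'g" where
  "ext \<nu> \<xi> = (fst \<xi> @ la (snd \<xi>) \<nu>, lr (snd \<xi>) \<nu>)"

lemma ext_walk: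
  assumes "vld \<xi>" "is_walk E (gdom G (snd \<xi>)) \<nu> u"
  shows "is_walk E (pr \<xi>) (fst (ext \<nu> \<xi>)) (gcod G (snd (ext \<nu> \<xi>)))"
  using assms walk_lr(2)[OF assms(2)] by (auto simp: ext_def vld_def is_walk_append)

lemma vld_ext: "vld \<xi> \<Longrightarrow> is_walk E (gdom G (snd \<xi>)) \<nu> u \<Longrightarrow> vld (ext \<nu> \<xi>)"
  using vldI[OF ext_walk[of \<xi> \<nu> u]] by simp

lemma pr_ext: "vld \<xi> \<Longrightarrow> is_walk E (gdom G (snd \<xi>)) \<nu> u \<Longrightarrow> pr (ext \<nu> \<xi>) = pr \<xi>"
  using pr_eqI[OF ext_walk[of \<xi> \<nu> u]] by simp

text \<open>Left and right multiplication commute; for unitary letters this is the cocycle identity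
  for \<open>la\<close> and \<open>lr\<close>.\<close>

lemma wact_ext:
  assumes "wact w \<xi> = Some \<eta>" "vld \<xi>" "is_walk E (gdom G (snd \<xi>)) \<nu> u"
  shows "wact w (ext \<nu> \<xi>) = Some (ext \<nu> \<eta>)"
proof (rule wact_equivariant[OF _ assms(1,2) refl])
  fix x \<xi>' \<eta>' assume *: "gact x \<xi>' = Some \<eta>'" "gdom G (snd \<xi>') = gdom G (snd \<xi>)"
  have v: "vld \<xi>'" "is_walk E (gdom G (snd \<xi>')) \<nu> u" using gact_Some(1)[OF *(1)] * assms(3) by auto
  show "gact x (ext \<nu> \<xi>') = Some (ext \<nu> \<eta>')"
  proof (cases x)
    case (GenU h)
    then have eq: "pr \<xi>' = gdom G h" "\<eta>' = (la h (fst \<xi>'), gcomp G (lr h (fst \<xi>')) (snd \<xi>'))"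
      using *(1) by (auto split: if_splits)
    have w: "is_walk E (gdom G h) (fst \<xi>') (gcod G (snd \<xi>'))" using v(1) eq by (simp add: vld_def)
    have d: "gdom G (lr h (fst \<xi>')) = gcod G (snd \<xi>')" by (rule walk_lr(1)[OF w])
    have "lr h (fst \<xi>' @ la (snd \<xi>') \<nu>) = lr (lr h (fst \<xi>')) (la (snd \<xi>') \<nu>)" by simp
    then show ?thesis
      using GenU eq vld_ext[OF v] pr_ext[OF v]
      by (simp add: ext_def la_append la_comp[OF d v(2)] lr_comp[OF d v(2)])
  qed (use * v vld_ext[OF v] pr_ext[OF v] in \<open>auto simp: ext_def split: if_splits\<close>)
qed

lemma wact_right_mult:
  assumes "wact w \<xi> = Some \<eta>" "vld \<xi>" "gcod G k = gdom G (snd \<xi>)"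
  shows "wact w (fst \<xi>, gcomp G (snd \<xi>) k) = Some (fst \<eta>, gcomp G (snd \<eta>) k)"
proof (rule wact_equivariant[OF _ assms(1,2) refl, of "\<lambda>\<xi>. (fst \<xi>, gcomp G (snd \<xi>) k)"])
  fix x \<xi>' \<eta>' assume *: "gact x \<xi>' = Some \<eta>'" "gdom G (snd \<xi>') = gdom G (snd \<xi>)"
  have v: "vld \<xi>'" using gact_Some(1)[OF *(1)] .
  have c: "gdom G (snd \<xi>') = gcod G k" using * assms(3) by simp
  have pv: "pr (fst \<xi>', gcomp G (snd \<xi>') k) = pr \<xi>'" "vld (fst \<xi>', gcomp G (snd \<xi>') k)"
    using v c by (auto simp: pr_def vld_def gcod_comp)
  show "gact x (fst \<xi>', gcomp G (snd \<xi>') k) = Some (fst \<eta>', gcomp G (snd \<eta>') k)"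
    using * pv c gact_U_walk(1)[OF v] by (cases x) (auto simp: comp_assoc split: if_splits)
qed

fun gdeg :: "('v, 'e, 'g) generator \<times> bool \<Rightarrow> int" where
  "gdeg (GenS e, b) = (if b then -1 else 1)"
| "gdeg _ = 0"

definition deg :: "('v, 'e, 'g) generator star_word \<Rightarrow> int" where
  "deg w = sum_list (map gdeg (letters w))"

lemma deg_0 [simp]: "deg 0 = 0"
  by (simp add: deg_def zero_star_word_def)

lemma deg_add: "deg (u + v) = deg u + deg v"
  by (simp add: deg_def plus_star_word_def)

lemma deg_Cons: "deg (Word (l # ls)) = gdeg l + deg (Word ls)"
  by (simp add: deg_def)

lemma wact_length:
  assumes "wact w \<xi> = Some \<eta>"
  shows "int (length (fst \<eta>)) = int (length (fst \<xi>)) + deg w"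
proof -
  have g: "int (length (fst \<eta>)) = int (length (fst \<xi>)) + gdeg (x, False)" if "gact x \<xi> = Some \<eta>" for x \<xi> \<eta>
    using that by (cases x) (auto split: if_splits)
  have l: "int (length (fst \<eta>)) = int (length (fst \<xi>)) + gdeg l" if "lact l \<xi> = Some \<eta>" for l \<xi> \<eta>
  proof (cases "snd l")
    case True
    then have "gact (fst l) \<eta> = Some \<xi>"
      using that by (simp add: lact_def pinv_iff[of "gact (fst l)", OF gact_inj])
    then show ?thesis using g[of "fst l" \<eta> \<xi>] True by (cases l; cases "fst l") auto
  next
    case False
    then have "gact (fst l) \<xi> = Some \<eta>" using that by (simp add: lact_def)
    then show ?thesis using g[of "fst l" \<xi> \<eta>] False by (cases l; cases "fst l") auto
  qed
  have "lwact ls \<xi> = Some \<eta> \<Longrightarrow> int (length (fst \<eta>)) = int (length (fst \<xi>)) + sum_list (map gdeg ls)" for ls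
    by (induction ls arbitrary: \<eta>) (auto simp: bind_eq_Some_conv dest: l)
  then show ?thesis using assms by (simp add: wact_def deg_def)
qed

text \<open>Each letter removes at most one edge, so a word cannot use up a path longer than the
  word itself.\<close>

lemma deg_ge: "- int (length (letters w)) \<le> deg w"
proof -
  have "- 1 \<le> gdeg l" for l by (cases l rule: gdeg.cases) auto
  then have "- int (length ls) \<le> sum_list (map gdeg ls)" for ls
    by (induction ls) (auto, smt (verit))
  then show ?thesis by (simp add: deg_def)
qed

end


section \<open>Perron-Frobenius theory of the graph\<close>

definition esum :: "('v, 'e::finite) digraph \<Rightarrow> ('v \<Rightarrow> real) \<Rightarrow> 'v \<Rightarrow> real" where
  "esum E z v = (\<Sum>e\<in>{e. rng E e = v}. z (src E e))"

lemma card_paths_from_to_1: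
  fixes E :: "('v, 'e::finite) digraph"
  shows "card (paths_from_to E v 1 w) = card {e. rng E e = v \<and> src E e = w}"
proof -
  have "paths_from_to E v 1 w = (\<lambda>e. (v, [e])) ` {e. rng E e = v \<and> src E e = w}"
    by (auto simp: paths_from_to_def path_len_def length_Suc_conv)
  then show ?thesis by (simp add: card_image inj_on_def)
qed

lemma vertex_matrix_mult:
  fixes E :: "('v::finite, 'e::finite) digraph"
  shows "(vertex_matrix E *v x) $ v = esum E (($) x) v"
proof -
  have "(vertex_matrix E *v x) $ v = (\<Sum>w\<in>UNIV. \<Sum>e\<in>{e. rng E e = v \<and> src E e = w}. x $ src E e)"
    by (simp add: matrix_vector_mult_def vertex_matrix_def card_paths_from_to_1[unfolded One_nat_def] card_paths_from_to_1)
  also have "\<dots> = (\<Sum>e\<in>{e. rng E e = v}. x $ src E e)"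
    using sum.group[of "{e. rng E e = v}" "UNIV :: 'v set" "src E" "\<lambda>e. x $ src E e"] by simp
  finally show ?thesis by (simp add: esum_def)
qed

lemma vertex_matrix_nonzero:
  fixes E :: "('v::finite, 'e::finite) digraph"
  assumes "vertex_matrix E $ v $ w \<noteq> 0"
  obtains e where "rng E e = v" "src E e = w"
proof -
  have "card (paths_from_to E v 1 w) \<noteq> 0"
    using assms by (simp add: vertex_matrix_def)
  then have "card {e. rng E e = v \<and> src E e = w} \<noteq> 0" by (simp only: card_paths_from_to_1 not_False_eq_True)
  then have "{e. rng E e = v \<and> src E e = w} \<noteq> {}" by (metis card.empty)
  then show thesis using that by blast
qed

text \<open>Where a nonnegative \<open>z\<close> vanishes, all summands \<open>z (src E e)\<close>
  of \<open>esum E z v\<close> vanish too, so zeros spread along edges and hence everywhere. Strong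
  connectivity enters the proof only through this fact.\<close>

lemma superharmonic_zero:
  fixes E :: "('v::finite, 'e::finite) digraph" and z :: "'v \<Rightarrow> real"
  assumes sc: "strongly_connected E" and nonneg: "\<And>v. 0 \<le> z v" and le: "\<And>v. esum E z v \<le> c * z v"
    and zero: "z v = 0"
  shows "z w = 0"
proof -
  have "(((**) (vertex_matrix E)) ^^ n) (mat 1) $ v $ w \<noteq> 0 \<Longrightarrow> z v = 0 \<Longrightarrow> z w = 0" for n v
  proof (induction n arbitrary: v)
    case 0
    then show ?case by (auto simp: mat_def split: if_splits)
  next
    case (Suc n)
    have "(B ** X) $ v $ w = (\<Sum>u\<in>UNIV. B $ v $ u * X $ u $ w)" for B X :: "real^'v^'v"
      by (simp add: matrix_matrix_mult_def)
    with Suc.prems(1) have "(\<Sum>u\<in>UNIV. vertex_matrix E $ v $ u *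
        (((**) (vertex_matrix E)) ^^ n) (mat 1) $ u $ w) \<noteq> 0" by simp
    then obtain u where u: "vertex_matrix E $ v $ u \<noteq> 0" "(((**) (vertex_matrix E)) ^^ n) (mat 1) $ u $ w \<noteq> 0"
      by (elim sum.not_neutral_contains_not_neutral) auto
    obtain e where e: "rng E e = v" "src E e = u" using vertex_matrix_nonzero[OF u(1)] .
    have "z (src E e) \<le> esum E z v"
      unfolding esum_def by (rule member_le_sum) (use e nonneg in auto)
    then have "z u = 0" using le[of v] Suc.prems(2) nonneg[of u] e by simp
    then show ?case using Suc.IH[OF u(2)] by simp
  qed
  then show ?thesis using sc zero unfolding strongly_connected_def by blast
qed

lemma esum_diff_scale: "esum E (\<lambda>v. m v - c * x v) v = esum E m v - c * esum E x v"
  by (simp add: esum_def sum_subtractf sum_distrib_left)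

text \<open>The largest multiple of \<open>x\<close> below \<open>m\<close>: the two functions touch
  at the vertex where the ratio is smallest.\<close>

lemma ex_min_ratio:
  fixes x m :: "'v::finite \<Rightarrow> real"
  assumes x: "\<And>v. 0 < x v"
  obtains v0 where "\<And>v. 0 \<le> m v - m v0 / x v0 * x v"
proof -
  let ?R = "range (\<lambda>v. m v / x v)"
  have "Min ?R \<in> ?R" by (rule Min_in) auto
  then obtain v0 where v0: "Min ?R = m v0 / x v0" by (rule imageE)
  have le: "m v0 / x v0 \<le> m v / x v" for v unfolding v0[symmetric] by (rule Min_le) auto
  have "0 \<le> m v - m v0 / x v0 * x v" for v
    using le[of v] x[of v] by (simp only: pos_le_divide_eq diff_ge_0_iff_ge)
  then show thesis by (rule that)
qed

text \<open>The vertex matrix maps the nonnegative difference \<open>m - c x\<close> to a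
  nonnegative function, whose value at the touching vertex \<open>v0\<close> is
  \<open>(l - r) * m v0\<close>.\<close>

lemma eigenvalue_le:
  fixes E :: "('v::finite, 'e::finite) digraph" and x m :: "'v \<Rightarrow> real"
  assumes "\<And>v. 0 < x v" "\<And>v. esum E x v = r * x v" "\<And>v. 0 < m v" "\<And>v. esum E m v = l * m v"
  shows "r \<le> l"
proof -
  obtain v0 where v0: "\<And>v. 0 \<le> m v - m v0 / x v0 * x v"
    using ex_min_ratio[where x = x and m = m, OF assms(1)] by blast
  have "0 \<le> esum E (\<lambda>v. m v - m v0 / x v0 * x v) v0"
    unfolding esum_def by (rule sum_nonneg) (rule v0)
  then have "0 \<le> l * m v0 - m v0 / x v0 * (r * x v0)" by (simp only: esum_diff_scale assms)
  then have "r * m v0 \<le> l * m v0" using assms(1)[of v0] by (simp add: mult.commute)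
  then show ?thesis using assms(3)[of v0] by simp
qed

text \<open>\<open>m\<close> is positive because its zeros would spread. Comparing eigenvalues in
  both directions gives \<open>l = r\<close>; then the touching difference \<open>m - c x\<close> is
  an eigenfunction with a zero, so it vanishes, and the normalization gives
  \<open>c = 1\<close>.\<close>

lemma perron_unique:
  fixes E :: "('v::finite, 'e::finite) digraph" and x m :: "'v \<Rightarrow> real"
  assumes sc: "strongly_connected E"
    and x: "\<And>v. 0 < x v" "\<And>v. esum E x v = r * x v" "sum x UNIV = 1"
    and m: "\<And>v. 0 \<le> m v" "\<And>v. esum E m v = l * m v" "sum m UNIV = 1"
  shows "l = r" and "m v = x v"
proof -
  have m_pos: "0 < m v" for v
  proof (rule ccontr)
    assume "\<not> 0 < m v"
    then have "m v = 0" using m(1)[of v] by simp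
    then have "m w = 0" for w
      by (rule superharmonic_zero[where z = m and c = l, OF sc m(1) eq_refl[OF m(2)]])
    then show False using m(3) by simp
  qed
  show lr: "l = r"
    using eigenvalue_le[where x = x and m = m, OF x(1,2) m_pos m(2)]
      eigenvalue_le[where x = m and m = x, OF m_pos m(2) x(1,2)] by simp
  obtain v0 where v0: "\<And>v. 0 \<le> m v - m v0 / x v0 * x v"
    using ex_min_ratio[where x = x and m = m, OF x(1)] by blast
  define c where "c = m v0 / x v0"
  have "m v - c * x v = 0" for v
  proof (rule superharmonic_zero[OF sc, of _ r v0])
    show "m v0 - c * x v0 = 0" using x(1)[of v0] by (simp add: c_def)
    show "esum E (\<lambda>v. m v - c * x v) v \<le> r * (m v - c * x v)" for v
      unfolding esum_diff_scale m(2) x(2) lr by (simp add: algebra_simps)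
  qed (use v0 in \<open>simp add: c_def\<close>)
  then have mc: "m v = c * x v" for v by simp
  then have "sum m UNIV = c * sum x UNIV" by (simp add: sum_distrib_left)
  then show "m v = x v" using x m mc by simp
qed

lemma (in self_similar_action) bij_betw_ea: "bij_betw (ea g) {e. rng E e = gdom G g} {e. rng E e = gcod G g}"
proof (rule bij_betw_byWitness[of _ "ea (ginv g)"])
  show "\<forall>e\<in>{e. rng E e = gdom G g}. ea (ginv g) (ea g e) = e"
    using ea_comp[of "ginv g" g] by (auto simp: ginv_left ea_id)
  show "\<forall>e\<in>{e. rng E e = gcod G g}. ea g (ea (ginv g) e) = e"
    using ea_comp[of g "ginv g"] by (auto simp: ginv_right ea_id)
qed (use act_edge(2) in auto)

locale finite_action = self_similar_action E G act
  for E :: "('v::finite, 'e::finite) digraph" and G :: "('g, 'v) groupoid"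
    and act :: "'g \<Rightarrow> ('v, 'e) path \<Rightarrow> ('v, 'e) path"

text \<open>The maximum \<open>z\<close> of \<open>x\<close> over orbits is subharmonic, because a
  maximizing \<open>g\<close> carries edges to edges and its restrictions carry sources to sources.
  If the multiple \<open>c z\<close> touches \<open>x\<close> from below, then
  \<open>x - c z\<close> is superharmonic with a zero, so \<open>x = c z\<close>; and
  \<open>z\<close> is constant on orbits.\<close>

lemma (in finite_action) eigenvector_invariant:
  assumes sc: "strongly_connected E" and x: "\<And>v. 0 < x v" "\<And>v. esum E x v = r * x v"
  shows "x (gcod G g) = x (gdom G g)"
proof -
  define orb where "orb v = {x (gcod G g) | g. gdom G g = v}" for v
  define z where "z v = Max (orb v)" for v
  have fin: "finite (orb v)" for v
    by (rule finite_subset[of _ "range x"]) (auto simp: orb_def)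
  have "x v \<in> orb v" for v
    unfolding orb_def using gdom_id[of v] gcod_id[of v] by (auto intro!: exI[of _ "gid G v"])
  then have ne: "orb v \<noteq> {}" for v by blast
  have x_le: "x (gcod G g) \<le> z (gdom G g)" for g
    unfolding z_def by (rule Max_ge[OF fin]) (auto simp: orb_def)
  have z_attained: "\<exists>g. gdom G g = v \<and> z v = x (gcod G g)" for v
    using Max_in[OF fin[of v] ne[of v]] by (auto simp: z_def orb_def)
  have z_pos: "0 < z v" for v using x_le[of "gid G v"] x(1)[of v] by (simp add: gdom_id gcod_id)
  have z_le: "z (gcod G g) \<le> z (gdom G g)" for g
  proof -
    obtain h where h: "gdom G h = gcod G g" "z (gcod G g) = x (gcod G h)" using z_attained by blast
    then show ?thesis using x_le[of "gcomp G h g"] by (simp add: gdom_comp gcod_comp)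
  qed
  have z_sub: "r * z v \<le> esum E z v" for v
  proof -
    obtain g where g: "gdom G g = v" "z v = x (gcod G g)" using z_attained by blast
    have "r * z v = (\<Sum>e\<in>{e. rng E e = gcod G g}. x (src E e))" using x(2) g by (simp add: esum_def)
    also have "\<dots> = (\<Sum>e\<in>{e. rng E e = v}. x (src E (ea g e)))"
      using sum.reindex_bij_betw[OF bij_betw_ea[of g], of "\<lambda>e. x (src E e)"] g by simp
    also have "\<dots> \<le> (\<Sum>e\<in>{e. rng E e = v}. z (src E e))"
    proof (rule sum_mono)
      fix e assume "e \<in> {e. rng E e = v}"
      then show "x (src E (ea g e)) \<le> z (src E e)"
        using x_le[of "rs g e"] g by (simp add: gdom_rs gcod_rs)
    qed
    finally show ?thesis by (simp add: esum_def)
  qed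
  obtain v0 where v0: "\<And>v. 0 \<le> x v - x v0 / z v0 * z v"
    using ex_min_ratio[where x = z and m = x, OF z_pos] by blast
  define c where "c = x v0 / z v0"
  have c: "0 < c" using x(1) z_pos by (simp add: c_def)
  have "x v - c * z v = 0" for v
  proof (rule superharmonic_zero[OF sc, of _ r v0])
    show "x v0 - c * z v0 = 0" using z_pos[of v0] by (simp add: c_def)
    show "esum E (\<lambda>v. x v - c * z v) v \<le> r * (x v - c * z v)" for v
      using mult_left_mono[OF z_sub[of v], of c] c by (simp add: esum_diff_scale x(2) algebra_simps)
  qed (use v0 in \<open>simp add: c_def\<close>)
  then have xz: "x v = c * z v" for v by simp
  have "z (gcod G g) = z (gdom G g)" using z_le[of g] z_le[of "ginv g"] by simp
  then show ?thesis by (simp add: xz)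
qed


section \<open>The trace-like functional of the Perron-Frobenius eigenvector\<close>

lemma cnj_of_bool: "cnj (of_bool b) = of_bool b"
  by (cases b) auto

lemma of_real_of_bool: "complex_of_real (of_bool b) = of_bool b"
  by (cases b) auto

lemma sum_nonneg_Reals: "(\<And>i. i \<in> A \<Longrightarrow> f i \<in> \<real>\<^sub>\<ge>\<^sub>0) \<Longrightarrow> sum f A \<in> \<real>\<^sub>\<ge>\<^sub>0"
  for f :: "'i \<Rightarrow> complex"
  by (induction A rule: infinite_finite_induct) (auto intro: nonneg_Reals_add_I)

locale perron_action = finite_action E G act
  for E :: "('v::finite, 'e::finite) digraph" and G :: "('g, 'v) groupoid"
    and act :: "'g \<Rightarrow> ('v, 'e) path \<Rightarrow> ('v, 'e) path" +
  fixes x :: "'v \<Rightarrow> real" and r :: real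
  assumes strongly_connected: "strongly_connected E"
    and no_sources: "no_sources E"
    and x_pos: "0 < x v"
    and x_eigen: "esum E x v = r * x v"
    and x_sum: "sum x UNIV = 1"
begin

lemma x_invariant: "x (gcod G g) = x (gdom G g)"
  by (rule eigenvector_invariant[OF strongly_connected x_pos x_eigen])

lemma ex_edge: "\<exists>e. rng E e = v"
proof -
  obtain \<mu> where "\<mu> \<in> paths_from E v 1" using no_sources unfolding no_sources_def by blast
  then show ?thesis by (cases \<mu>) (auto simp: in_paths_from_iff length_Suc_conv)
qed

lemma r_pos: "0 < r"
proof -
  obtain v :: 'v where True by simp
  obtain e where "rng E e = v" using ex_edge by blast
  then have "0 < esum E x v" unfolding esum_def by (intro sum_pos x_pos) auto
  then show ?thesis using x_pos[of v] by (simp add: x_eigen zero_less_mult_iff)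
qed

definition pt :: "'e list \<times> 'v \<Rightarrow> 'e list \<times> 'g" where
  "pt q = (fst q, gid G (snd q))"

text \<open>The paths of length \<open>k\<close>, each with its source. An empty edge list does not
  determine the source, so it is recorded.\<close>

definition base :: "nat \<Rightarrow> ('e list \<times> 'v) set" where
  "base k = {q. vld (pt q) \<and> length (fst q) = k}"

lemma finite_base: "finite (base k)"
proof (rule finite_subset)
  show "base k \<subseteq> {es. set es \<subseteq> UNIV \<and> length es = k} \<times> UNIV" by (auto simp: base_def)
  show "finite ({es :: 'e list. set es \<subseteq> UNIV \<and> length es = k} \<times> (UNIV :: 'v set))"
    by (intro finite_cartesian_product finite_lists_length_eq) auto
qed

lemma base_0: "base 0 = (\<lambda>v. ([], v)) ` UNIV"
  by (auto simp: base_def pt_def vld_def pr_def)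

lemma base_Suc: "base (Suc k) = (\<lambda>(q, e). (fst q @ [e], src E e)) ` Sigma (base k) (\<lambda>q. {e. rng E e = snd q})"
proof (intro equalityI subsetI)
  fix q assume "q \<in> base (Suc k)"
  then obtain es e v where q: "q = (es @ [e], v)" "length es = k" "vld (es @ [e], gid G v)"
    by (cases q) (auto simp: base_def pt_def length_Suc_conv_rev)
  have "is_walk E (pr (es @ [e], gid G v)) (es @ [e]) v"
    using q(3) by (simp add: vld_def gcod_id)
  then have w: "is_walk E (pr (es @ [e], gid G v)) es (rng E e)" "v = src E e" by (auto simp: is_walk_append)
  then have "(es, rng E e) \<in> base k"
    using q by (auto simp: base_def pt_def gcod_id intro!: vldI)
  then show "q \<in> (\<lambda>(q, e). (fst q @ [e], src E e)) ` Sigma (base k) (\<lambda>q. {e. rng E e = snd q})"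
    using q w by force
next
  fix q assume "q \<in> (\<lambda>(q, e). (fst q @ [e], src E e)) ` Sigma (base k) (\<lambda>q. {e. rng E e = snd q})"
  then obtain p e where p: "p \<in> base k" "rng E e = snd p" "q = (fst p @ [e], src E e)" by auto
  then have "is_walk E (pr (pt p)) (fst p @ [e]) (gcod G (gid G (src E e)))"
    by (auto simp: base_def vld_def pt_def gcod_id is_walk_append)
  then show "q \<in> base (Suc k)" using p by (auto simp: base_def pt_def dest: vldI)
qed

lemma sum_base_Suc:
  "(\<Sum>q\<in>base (Suc k). F q) = (\<Sum>q\<in>base k. \<Sum>e\<in>{e. rng E e = snd q}. F (fst q @ [e], src E e))"
proof -
  have inj: "inj_on (\<lambda>(q, e). (fst q @ [e], src E e)) (Sigma (base k) (\<lambda>q. {e. rng E e = snd q}))"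
    by (auto simp: inj_on_def)
  show ?thesis
    unfolding base_Suc sum.reindex[OF inj]
    by (subst sum.Sigma) (auto simp: finite_base case_prod_beta)
qed

lemma sum_base_x: "(\<Sum>q\<in>base k. x (snd q)) = r ^ k"
proof (induction k)
  case 0
  show ?case by (simp add: base_0 sum.reindex inj_on_def x_sum)
next
  case (Suc k)
  have "(\<Sum>q\<in>base (Suc k). x (snd q)) = (\<Sum>q\<in>base k. r * x (snd q))"
    by (simp add: sum_base_Suc x_eigen[unfolded esum_def])
  then show ?case by (simp add: Suc flip: sum_distrib_left)
qed

text \<open>\<open>of_bool\<close> is the diagonal matrix entry of \<open>w\<close> at the basis
  vector \<open>pt q\<close>. The weights \<open>x (snd q) / r ^ k\<close> sum to 1, so this is a
  convex combination of vector states.\<close>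

definition fixw :: "nat \<Rightarrow> ('v, 'e, 'g) generator star_word \<Rightarrow> real" where
  "fixw k w = (\<Sum>q\<in>base k. of_bool (wact w (pt q) = Some (pt q)) * x (snd q)) / r ^ k"

text \<open>A fixed path remains fixed after an edge is appended, and the extensions of a path with
  source \<open>v\<close> have total weight \<open>r * x v\<close>.\<close>

lemma fixw_mono: "fixw k w \<le> fixw (Suc k) w"
proof -
  have step: "of_bool (wact w (pt q) = Some (pt q)) * (r * x (snd q)) \<le>
     (\<Sum>e\<in>{e. rng E e = snd q}. of_bool (wact w (pt (fst q @ [e], src E e)) =
        Some (pt (fst q @ [e], src E e))) * x (src E e))" if q: "q \<in> base k" for q
  proof (cases "wact w (pt q) = Some (pt q)")
    case True
    have "wact w (pt (fst q @ [e], src E e)) = Some (pt (fst q @ [e], src E e))" if e: "rng E e = snd q" for e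
    proof -
      have x: "ext [e] (pt q) = pt (fst q @ [e], src E e)"
        using e by (simp add: ext_def pt_def ea_id rs_id)
      show ?thesis
        using wact_ext[OF True, of "[e]" "src E e"] q e unfolding x by (auto simp: base_def pt_def gdom_id)
    qed
    then show ?thesis by (simp add: True x_eigen[unfolded esum_def, symmetric])
  qed (simp add: sum_nonneg x_pos less_imp_le)
  have "r * (\<Sum>q\<in>base k. of_bool (wact w (pt q) = Some (pt q)) * x (snd q)) \<le>
     (\<Sum>q\<in>base (Suc k). of_bool (wact w (pt q) = Some (pt q)) * x (snd q))"
    using sum_mono[OF step] by (simp add: sum_base_Suc sum_distrib_left mult.left_commute)
  then show ?thesis using r_pos by (simp add: fixw_def field_simps)
qed

lemma fixw_le_1: "fixw k w \<le> 1"
proof -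
  have "(\<Sum>q\<in>base k. of_bool (wact w (pt q) = Some (pt q)) * x (snd q)) \<le> (\<Sum>q\<in>base k. x (snd q))"
    by (intro sum_mono) (simp add: x_pos less_imp_le)
  then show ?thesis using r_pos by (simp add: fixw_def sum_base_x)
qed

definition fixl :: "('v, 'e, 'g) generator star_word \<Rightarrow> real" where
  "fixl w = lim (\<lambda>k. fixw k w)"

lemma fixw_tendsto: "(\<lambda>k. fixw k w) \<longlonglongrightarrow> fixl w"
proof -
  have "incseq (\<lambda>k. fixw k w)" by (rule incseq_SucI) (rule fixw_mono)
  then obtain l where "(\<lambda>k. fixw k w) \<longlonglongrightarrow> l"
    using incseq_convergent[of "\<lambda>k. fixw k w" 1] fixw_le_1 by blast
  then show ?thesis by (simp add: fixl_def limI)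
qed

definition omega :: "('v, 'e, 'g) generator free_alg \<Rightarrow> complex" where
  "omega = word_ext (\<lambda>w. of_real (fixl w))"

lemma omega_mon: "omega (mon w) = of_real (fixl w)"
  by (simp add: omega_def)

sublocale om: free_functional omega
  unfolding omega_def by (rule free_functional_word_ext)

text \<open>Grouping the terms by the common value \<open>p\<close> turns the double sum into a sum
  of squared moduli.\<close>

lemma sum_same_value_nonneg:
  fixes a :: "'i \<Rightarrow> complex"
  assumes K: "finite K"
  shows "(\<Sum>v\<in>K. \<Sum>w\<in>K. of_bool (\<exists>p. f v = Some p \<and> f w = Some p) * (cnj (a v) * a w)) \<in> \<real>\<^sub>\<ge>\<^sub>0"
proof -
  let ?S = "\<Union>v\<in>K. set_option (f v)"
  have fin: "finite ?S" using K by auto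
  have "of_bool (\<exists>p. f v = Some p \<and> f w = Some p) * (cnj (a v) * a w) =
      (\<Sum>p\<in>?S. (of_bool (f v = Some p) * cnj (a v)) * (of_bool (f w = Some p) * a w))" if "v \<in> K" for v w
  proof (cases "f v")
    case (Some p0)
    then have p0: "p0 \<in> ?S" using that by force
    have "(\<Sum>p\<in>?S. (of_bool (f v = Some p) * cnj (a v)) * (of_bool (f w = Some p) * a w)) =
       (\<Sum>p\<in>?S. if p = p0 then cnj (a v) * (of_bool (f w = Some p0) * a w) else 0)"
      by (intro sum.cong) (auto simp: Some)
    then show ?thesis using p0 fin Some by (auto simp: sum.delta)
  qed simp
  then have "(\<Sum>v\<in>K. \<Sum>w\<in>K. of_bool (\<exists>p. f v = Some p \<and> f w = Some p) * (cnj (a v) * a w)) =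
     (\<Sum>v\<in>K. \<Sum>w\<in>K. \<Sum>p\<in>?S. (of_bool (f v = Some p) * cnj (a v)) * (of_bool (f w = Some p) * a w))"
    by (intro sum.cong refl) auto
  also have "\<dots> = (\<Sum>v\<in>K. \<Sum>p\<in>?S. \<Sum>w\<in>K. (of_bool (f v = Some p) * cnj (a v)) * (of_bool (f w = Some p) * a w))"
    by (intro sum.cong refl sum.swap)
  also have "\<dots> = (\<Sum>p\<in>?S. \<Sum>v\<in>K. \<Sum>w\<in>K. (of_bool (f v = Some p) * cnj (a v)) * (of_bool (f w = Some p) * a w))"
    by (rule sum.swap)
  also have "\<dots> = (\<Sum>p\<in>?S. cnj (\<Sum>v\<in>K. of_bool (f v = Some p) * a v) * (\<Sum>w\<in>K. of_bool (f w = Some p) * a w))"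
    by (intro sum.cong refl) (simp add: sum_product cnj_of_bool)
  also have "\<dots> = (\<Sum>p\<in>?S. of_real ((cmod (\<Sum>v\<in>K. of_bool (f v = Some p) * a v))\<^sup>2))"
    by (intro sum.cong refl) (simp only: complex_norm_square mult.commute)
  also have "\<dots> = of_real (\<Sum>p\<in>?S. (cmod (\<Sum>v\<in>K. of_bool (f v = Some p) * a v))\<^sup>2)" by simp
  also have "\<dots> \<in> \<real>\<^sub>\<ge>\<^sub>0" by (simp only: nonneg_Reals_of_real_iff sum_nonneg zero_le_power2)
  finally show ?thesis .
qed

lemma fixw_positive: "word_ext (\<lambda>w. of_real (fixw k w)) (free_star a * a) \<in> \<real>\<^sub>\<ge>\<^sub>0"
proof -
  let ?\<phi> = "word_ext (\<lambda>w. of_real (fixw k w))"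
  interpret f: free_functional ?\<phi> by (rule free_functional_word_ext)
  let ?K = "Poly_Mapping.keys a" and ?a = "Poly_Mapping.lookup a"
  have s: "free_star a = (\<Sum>v\<in>?K. free_scale (cnj (?a v)) (mon (word_star v)))"
    by (subst free_alg_expand[of a]) (simp only: free_star_sum free_star_scale free_star_mon)
  have "?\<phi> (free_star a * a) = ?\<phi> ((\<Sum>v\<in>?K. free_scale (cnj (?a v)) (mon (word_star v))) * (\<Sum>w\<in>?K. free_scale (?a w) (mon w)))"
    by (simp only: s free_alg_expand[of a, symmetric])
  also have "\<dots> = (\<Sum>v\<in>?K. \<Sum>w\<in>?K. cnj (?a v) * (?a w * of_real (fixw k (word_star v + w))))"
    by (simp only: sum_product f.sum free_scale_mult_left free_scale_mult_right f.scale mon_add[symmetric] word_ext_mon mult.assoc mult.left_commute)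
  also have "\<dots> = (\<Sum>v\<in>?K. \<Sum>w\<in>?K. \<Sum>q\<in>base k. of_real (x (snd q) / r ^ k) *
      (of_bool (\<exists>p. wact v (pt q) = Some p \<and> wact w (pt q) = Some p) * (cnj (?a v) * ?a w)))"
  proof (intro sum.cong refl)
    fix v w
    \<comment> \<open>Adjoint words act as inverses, so the product fixes \<open>pt q\<close>
      exactly when both words send it to the same point.\<close>
    have "wact (word_star v + w) (pt q) = Some (pt q) \<longleftrightarrow> (\<exists>p. wact v (pt q) = Some p \<and> wact w (pt q) = Some p)" for q
      by (auto simp: wact_add bind_eq_Some_conv wact_star)
    then show "cnj (?a v) * (?a w * of_real (fixw k (word_star v + w))) = (\<Sum>q\<in>base k. of_real (x (snd q) / r ^ k) *
      (of_bool (\<exists>p. wact v (pt q) = Some p \<and> wact w (pt q) = Some p) * (cnj (?a v) * ?a w)))"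
      by (simp add: fixw_def sum_distrib_left sum_divide_distrib of_real_of_bool mult_ac)
  qed
  also have "\<dots> = (\<Sum>q\<in>base k. of_real (x (snd q) / r ^ k) * (\<Sum>v\<in>?K. \<Sum>w\<in>?K.
      of_bool (\<exists>p. wact v (pt q) = Some p \<and> wact w (pt q) = Some p) * (cnj (?a v) * ?a w)))"
    by (simp only: sum_distrib_left) (subst sum.swap[of _ "base k"], intro sum.cong refl sum.swap)
  also have "\<dots> \<in> \<real>\<^sub>\<ge>\<^sub>0"
    by (intro sum_nonneg_Reals nonneg_Reals_mult_I sum_same_value_nonneg)
      (simp_all only: nonneg_Reals_of_real_iff, simp_all add: x_pos r_pos less_imp_le)
  finally show ?thesis .
qed

lemma word_ext_fixw_tendsto: "(\<lambda>k. word_ext (\<lambda>w. of_real (fixw k w)) a) \<longlonglongrightarrow> omega a"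
  unfolding omega_def word_ext_def
  by (intro tendsto_sum tendsto_mult tendsto_const tendsto_of_real fixw_tendsto)

lemma omega_pos: "omega (free_star a * a) \<in> \<real>\<^sub>\<ge>\<^sub>0"
proof (rule Lim_in_closed_set[OF closed_nonneg_Reals_complex _ _ word_ext_fixw_tendsto])
  show "\<forall>\<^sub>F k in sequentially. word_ext (\<lambda>w. of_real (fixw k w)) (free_star a * a) \<in> \<real>\<^sub>\<ge>\<^sub>0"
    by (intro always_eventually allI fixw_positive)
qed simp

text \<open>A relation may be checked on long paths only: for large \<open>k\<close> the word
  \<open>b\<close> cannot shorten a path of length \<open>k\<close> below \<open>n\<close>, so the
  exceptional points do not influence the limit.\<close>

lemma omega_eqv_sum:
  assumes eq: "\<And>\<xi> \<eta>. vld \<xi> \<Longrightarrow> n \<le> length (fst \<xi>) \<Longrightarrow>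
      (of_bool (wact u \<xi> = Some \<eta>) :: real) = (\<Sum>i\<in>I. of_bool (wact (f i) \<xi> = Some \<eta>))"
  shows "eqv omega (mon u) (\<Sum>i\<in>I. mon (f i))"
proof (rule om.eqvI_mon)
  fix a b
  \<comment> \<open>\<open>T t q\<close> meets in the middle: \<open>b\<close> is applied forward to
    \<open>pt q\<close>, the adjoint of \<open>a\<close> backward, and \<open>t\<close> must connect
    the two resulting points.\<close>
  define T :: "('v, 'e, 'g) generator star_word \<Rightarrow> 'e list \<times> 'v \<Rightarrow> real" where
    "T t q = (case wact b (pt q) of None \<Rightarrow> 0 | Some \<xi> \<Rightarrow>
       (case wact (word_star a) (pt q) of None \<Rightarrow> 0 | Some \<eta> \<Rightarrow> of_bool (wact t \<xi> = Some \<eta>)))" for t q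
  have T: "of_bool (wact (a + t + b) (pt q) = Some (pt q)) = T t q" for t q
  proof -
    have "wact a \<eta> = Some (pt q) \<longleftrightarrow> wact (word_star a) (pt q) = Some \<eta>" for \<eta> by (simp add: wact_star)
    then show ?thesis
      by (cases "wact b (pt q)"; cases "wact (word_star a) (pt q)")
        (auto simp: T_def wact_add bind_eq_Some_conv)
  qed
  have "fixw k (a + u + b) = (\<Sum>i\<in>I. fixw k (a + f i + b))" if k: "k \<ge> n + length (letters b)" for k
  proof -
    have "T u q = (\<Sum>i\<in>I. T (f i) q)" if q: "q \<in> base k" for q
    proof (cases "wact b (pt q)")
      case (Some \<xi>)
      have "vld \<xi>" "length (fst \<xi>) \<ge> n"
        using wact_Some(1)[OF Some] wact_length[OF Some] deg_ge[of b] q k by (auto simp: base_def pt_def)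
      then show ?thesis using eq[of \<xi>] by (cases "wact (word_star a) (pt q)") (simp_all add: T_def Some)
    qed (simp add: T_def)
    then have "(\<Sum>q\<in>base k. T u q * x (snd q)) = (\<Sum>q\<in>base k. (\<Sum>i\<in>I. T (f i) q) * x (snd q))"
      by (intro sum.cong) auto
    also have "\<dots> = (\<Sum>i\<in>I. \<Sum>q\<in>base k. T (f i) q * x (snd q))"
      unfolding sum_distrib_right by (rule sum.swap)
    finally show ?thesis by (simp add: fixw_def T sum_divide_distrib)
  qed
  then have "\<forall>\<^sub>F k in sequentially. fixw k (a + u + b) = (\<Sum>i\<in>I. fixw k (a + f i + b))"
    unfolding eventually_sequentially by blast
  then have "(\<lambda>k. \<Sum>i\<in>I. fixw k (a + f i + b)) \<longlonglongrightarrow> fixl (a + u + b)"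
    by (rule Lim_transform_eventually[OF fixw_tendsto])
  moreover have "(\<lambda>k. \<Sum>i\<in>I. fixw k (a + f i + b)) \<longlonglongrightarrow> (\<Sum>i\<in>I. fixl (a + f i + b))"
    by (intro tendsto_sum fixw_tendsto)
  ultimately have "fixl (a + u + b) = (\<Sum>i\<in>I. fixl (a + f i + b))" by (rule LIMSEQ_unique)
  then show "omega (mon a * mon u * mon b) = omega (mon a * (\<Sum>i\<in>I. mon (f i)) * mon b)"
    by (simp add: sum_distrib_left sum_distrib_right om.sum omega_mon flip: mon_add)
qed

lemma omega_eqv:
  assumes "\<And>\<xi> \<eta>. vld \<xi> \<Longrightarrow> wact u \<xi> = Some \<eta> \<longleftrightarrow> wact t \<xi> = Some \<eta>"
  shows "eqv omega (mon u) (mon t)"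
  using omega_eqv_sum[where n = 0 and u = u and I = "{()}" and f = "\<lambda>_. t"] assms by simp

lemma omega_eqv_0:
  assumes "\<And>\<xi> \<eta>. vld \<xi> \<Longrightarrow> wact u \<xi> \<noteq> Some \<eta>"
  shows "eqv omega (mon u) 0"
  using omega_eqv_sum[where n = 0 and u = u and I = "{}" and f = "\<lambda>_. 0"] assms by simp

lemma wact_inj: "wact w \<xi> = Some \<zeta> \<Longrightarrow> wact w \<eta> = Some \<zeta> \<Longrightarrow> \<xi> = \<eta>"
  using wact_star[of w \<zeta> \<xi>] wact_star[of w \<zeta> \<eta>] by simp

sublocale om: gns_functional omega
proof
  show "omega (free_star a * a) \<in> \<real>\<^sub>\<ge>\<^sub>0" for a by (rule omega_pos)
  fix w
  \<comment> \<open>A word followed by its adjoint is the identity on the domain of the word, hence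
    idempotent.\<close>
  have initial: "wact (word_star w + w) \<xi> = Some \<eta> \<longleftrightarrow> \<xi> = \<eta> \<and> wact w \<xi> \<noteq> None" for \<xi> \<eta>
    by (auto simp: wact_add bind_eq_Some_conv wact_star dest: wact_inj)
  have "wact (word_star w + w + (word_star w + w)) \<xi> = Some \<eta> \<longleftrightarrow> wact (word_star w + w) \<xi> = Some \<eta>" for \<xi> \<eta>
    using initial by (auto simp: wact_add[of "word_star w + w"] bind_eq_Some_conv)
  then show "eqv omega (mon (word_star w) * mon w * (mon (word_star w) * mon w)) (mon (word_star w) * mon w)"
    by (simp only: mon_add[symmetric]) (rule omega_eqv)
qed

lemma omega_1: "omega 1 = 1"
proof -
  have "fixw k 0 = 1" for k using r_pos by (simp add: fixw_def sum_base_x)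
  then show ?thesis
    using LIMSEQ_unique[OF fixw_tendsto[of 0], of 1] omega_mon[of 0] by (simp add: mon_0)
qed

text \<open>\<open>w\<close> sends \<open>s_mu p_v\<close> to some \<open>s_nu u_h\<close>.
  Forgetting \<open>h\<close> is right multiplication by its inverse, which brings the point back to
  the form counted by \<open>base\<close>.\<close>

definition shift :: "('v, 'e, 'g) generator star_word \<Rightarrow> 'e list \<times> 'v \<Rightarrow> 'e list \<times> 'v" where
  "shift w q = (let \<eta> = the (wact w (pt q)) in (fst \<eta>, gcod G (snd \<eta>)))"

text \<open>Right multiplication by \<open>ginv h\<close> commutes with words, so it turns the loop
  of \<open>u + w\<close> at \<open>q\<close> into a loop of \<open>w + u\<close> at the shifted
  point. The weight survives because \<open>x\<close> is constant on orbits.\<close>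

lemma shift:
  assumes q: "q \<in> base k" and fx: "wact (u + w) (pt q) = Some (pt q)"
  shows "shift w q \<in> base (nat (int k + deg w))" "wact (w + u) (pt (shift w q)) = Some (pt (shift w q))"
    "shift u (shift w q) = q" "x (snd (shift w q)) = x (snd q)"
proof -
  obtain es h where eh: "wact w (pt q) = Some (es, h)" "wact u (es, h) = Some (pt q)"
    using fx by (auto simp: wact_add bind_eq_Some_conv)
  have vq: "vld (pt q)" using q by (simp add: base_def)
  have v: "vld (es, h)" "gdom G h = snd q" using wact_Some[OF eh(1) vq] by (auto simp: pt_def gdom_id)
  have s: "shift w q = (es, gcod G h)" by (simp add: shift_def eh)
  have vs: "vld (es, gid G (gcod G h))" using v(1) by (auto simp: vld_def gcod_id pr_def)
  show "shift w q \<in> base (nat (int k + deg w))"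
    using wact_length[OF eh(1)] q vs by (auto simp: base_def s pt_def)
  have c: "gcod G (ginv h) = gdom G (snd (es, h))" by simp
  have "wact u (es, gcomp G h (ginv h)) = Some (fst q, gcomp G (gid G (snd q)) (ginv h))"
    using wact_right_mult[OF eh(2) v(1) c] by (simp add: pt_def)
  then have u: "wact u (pt (es, gcod G h)) = Some (fst q, ginv h)"
    using comp_id_left[of "ginv h"] v(2) by (simp add: pt_def ginv_right)
  then show "shift u (shift w q) = q" unfolding s by (simp add: shift_def v(2))
  have "wact w (fst q, gcomp G (gid G (snd q)) (ginv h)) = Some (es, gcomp G h (ginv h))"
    using wact_right_mult[OF eh(1) vq, of "ginv h"] v(2) by (simp add: pt_def gdom_id)
  then have "wact w (fst q, ginv h) = Some (es, gid G (gcod G h))"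
    using comp_id_left[of "ginv h"] v(2) by (simp add: ginv_right)
  then show "wact (w + u) (pt (shift w q)) = Some (pt (shift w q))"
    using u by (simp add: s wact_add) (simp add: pt_def)
  show "x (snd (shift w q)) = x (snd q)" using v(2) x_invariant[of h] by (simp add: s)
qed

lemma fixw_0_deg: assumes "deg w \<noteq> 0" shows "fixw k w = 0"
proof -
  have "wact w (pt q) \<noteq> Some (pt q)" for q using wact_length[of w "pt q" "pt q"] assms by auto
  then show ?thesis by (simp add: fixw_def)
qed

text \<open>\<open>shift w\<close> is a bijection between the fixed points of the two cyclic
  arrangements, with inverse \<open>shift u\<close>. It changes the level by \<open>deg w\<close>,
  and the factor compares the two normalizations by powers of \<open>r\<close>. In nonzero total
  degree both sides vanish.\<close>

lemma fixw_trace: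
  assumes k: "0 \<le> int k + deg w"
  shows "fixw k (u + w) = r powi deg w * fixw (nat (int k + deg w)) (w + u)"
proof (cases "deg (u + w) = 0")
  case True
  let ?k = "nat (int k + deg w)"
  have k': "nat (int ?k + deg u) = k" using True k by (simp add: deg_add)
  have "(\<Sum>q\<in>{q \<in> base k. wact (u + w) (pt q) = Some (pt q)}. x (snd q)) =
    (\<Sum>q\<in>{q \<in> base ?k. wact (w + u) (pt q) = Some (pt q)}. x (snd q))"
    by (rule sum.reindex_bij_witness[of _ "shift u" "shift w"])
      (simp_all add: shift[of _ k u w] shift[of _ ?k w u, unfolded k'])
  moreover have "fixw k t * r ^ k = (\<Sum>q\<in>{q \<in> base k. wact t (pt q) = Some (pt q)}. x (snd q))" for k t
  proof -
    have "(\<Sum>q\<in>base k. of_bool (wact t (pt q) = Some (pt q)) * x (snd q)) =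
        (\<Sum>q\<in>base k. if wact t (pt q) = Some (pt q) then x (snd q) else 0)"
      by (rule sum.cong) auto
    then show ?thesis using r_pos by (simp add: fixw_def sum.inter_filter[OF finite_base])
  qed
  ultimately have "fixw k (u + w) * r ^ k = fixw ?k (w + u) * r ^ ?k" by (simp only:)
  moreover have "r ^ ?k = r powi deg w * r ^ k"
  proof -
    have "r ^ ?k = r powi (int k + deg w)" using k by (simp add: power_int_def)
    also have "\<dots> = r powi int k * r powi deg w" using r_pos by (intro power_int_add) auto
    finally show ?thesis by (simp add: mult.commute)
  qed
  ultimately show ?thesis using r_pos by simp
next
  case False
  then show ?thesis by (simp add: fixw_0_deg deg_add add.commute)
qed

lemma omega_trace: "omega (mon u * mon w) = of_real (r powi deg w) * omega (mon w * mon u)"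
proof -
  have "filterlim (\<lambda>k. nat (int k + deg w)) at_top sequentially"
    unfolding filterlim_at_top eventually_sequentially
  proof
    fix Z
    show "\<exists>N. \<forall>n\<ge>N. Z \<le> nat (int n + deg w)" by (rule exI[of _ "nat (int Z - deg w)"]) auto
  qed
  then have "(\<lambda>k. r powi deg w * fixw (nat (int k + deg w)) (w + u)) \<longlonglongrightarrow> r powi deg w * fixl (w + u)"
    by (intro tendsto_mult_left filterlim_compose[OF fixw_tendsto])
  moreover have "\<forall>\<^sub>F k in sequentially. r powi deg w * fixw (nat (int k + deg w)) (w + u) = fixw k (u + w)"
    unfolding eventually_sequentially by (rule exI[of _ "nat (- deg w)"]) (auto intro!: fixw_trace[symmetric])
  ultimately have "(\<lambda>k. fixw k (u + w)) \<longlonglongrightarrow> r powi deg w * fixl (w + u)"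
    by (rule Lim_transform_eventually)
  then have "fixl (u + w) = r powi deg w * fixl (w + u)" using fixw_tendsto LIMSEQ_unique by blast
  then show ?thesis by (simp add: omega_mon flip: mon_add)
qed

lemma omega_0_deg: "deg w \<noteq> 0 \<Longrightarrow> omega (mon w) = 0"
  using LIMSEQ_unique[OF fixw_tendsto[of w], of 0] by (simp add: fixw_0_deg omega_mon)

end


section \<open>The relations of the Toeplitz and Cuntz-Pimsner algebras\<close>

abbreviation "gP v \<equiv> free_gen (GenP v)"
abbreviation "gS e \<equiv> free_gen (GenS e)"
abbreviation "gU g \<equiv> free_gen (GenU g)"

text \<open>Those relations of the Toeplitz algebra that are equations between free elements. The
  Cuntz-Krieger inequality is an order relation and is treated through
  \<open>ck_defect\<close>.\<close>

inductive_set toeplitz_rel ::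
  "('v::finite, 'e::finite) digraph \<Rightarrow> ('g, 'v) groupoid \<Rightarrow>
   ('g \<Rightarrow> ('v, 'e) path \<Rightarrow> ('v, 'e) path) \<Rightarrow>
   (('v, 'e, 'g) generator free_alg \<times> ('v, 'e, 'g) generator free_alg) set"
  for E G act where
  P_idem: "(gP v * gP v, gP v) \<in> toeplitz_rel E G act"
| P_star: "(free_star (gP v), gP v) \<in> toeplitz_rel E G act"
| P_orth: "v \<noteq> w \<Longrightarrow> (gP v * gP w, 0) \<in> toeplitz_rel E G act"
| P_sum: "((\<Sum>v\<in>UNIV. gP v), 1) \<in> toeplitz_rel E G act"
| S_isom: "(free_star (gS e) * gS e, gP (src E e)) \<in> toeplitz_rel E G act"
| U_unit: "(gU (gid G v), gP v) \<in> toeplitz_rel E G act"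
| U_initial: "(free_star (gU g) * gU g, gP (gdom G g)) \<in> toeplitz_rel E G act"
| U_final: "(gU g * free_star (gU g), gP (gcod G g)) \<in> toeplitz_rel E G act"
| U_comp: "gdom G g = gcod G h \<Longrightarrow> (gU g * gU h, gU (gcomp G g h)) \<in> toeplitz_rel E G act"
| U_orth: "gdom G g \<noteq> gcod G h \<Longrightarrow> (gU g * gU h, 0) \<in> toeplitz_rel E G act"
| US: "gdom G g = rng E e \<Longrightarrow>
    (gU g * gS e, gS (edge_act E act g e) * gU (restrict_edge E G act g e)) \<in> toeplitz_rel E G act"
| US_orth: "gdom G g \<noteq> rng E e \<Longrightarrow> (gU g * gS e, 0) \<in> toeplitz_rel E G act"

abbreviation ck_sum :: "('v, 'e::finite) digraph \<Rightarrow> 'v \<Rightarrow> ('v, 'e, 'g) generator free_alg" where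
  "ck_sum E v \<equiv> (\<Sum>e\<in>{e. rng E e = v}. gS e * free_star (gS e))"

abbreviation lett :: "'x \<Rightarrow> bool \<Rightarrow> 'x star_word" where
  "lett y b \<equiv> Word [(y, b)]"

lemma free_gen_mon: "free_gen y = mon (lett y False)" "free_star (mon (lett y False)) = mon (lett y True)"
  by (simp_all add: free_gen_def mon_def free_star_single word_star_def)

context perron_action
begin

lemma wact_lett: "wact (lett y False) \<xi> = gact y \<xi>"
  and wact_lett_star: "wact (lett y True) \<eta> = Some \<xi> \<longleftrightarrow> gact y \<xi> = Some \<eta>"
  using lact_star[of y False \<eta> \<xi>] by (simp_all add: wact_def) (simp_all add: lact_def)

lemma wact_lett_eq: "wact (lett y False) = gact y"
  by (intro HOL.ext wact_lett)

lemma gact_U_onto: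
  assumes "vld \<xi>" "pr \<xi> = gcod G g"
  shows "\<exists>\<zeta>. gact (GenU g) \<zeta> = Some \<xi>"
proof -
  have "Option.bind (gact (GenU (ginv g)) \<xi>) (gact (GenU g)) = gact (GenP (gcod G g)) \<xi>"
    by (simp only: gact_U_comp gcod_ginv ginv_right gact_U_id)
  moreover have "gact (GenP (gcod G g)) \<xi> = Some \<xi>" using assms by simp
  ultimately show ?thesis unfolding bind_eq_Some_conv by (metis bind_eq_Some_conv)
qed

lemma gact_U_pr: "gact (GenU g) \<zeta> = Some \<xi> \<Longrightarrow> pr \<xi> = gcod G g"
  by (auto intro: pr_eqI[OF gact_U_walk(2)] split: if_splits)

lemma gact_U_dom: "gact (GenU g) \<xi> = Some \<eta> \<Longrightarrow> pr \<xi> = gdom G g"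
  by (auto split: if_splits)

lemma gact_US:
  assumes "gdom G g = rng E e"
  shows "Option.bind (gact (GenS e) \<xi>) (gact (GenU g)) =
    Option.bind (gact (GenU (rs g e)) \<xi>) (gact (GenS (ea g e)))"
proof (cases "vld \<xi> \<and> pr \<xi> = src E e")
  case True
  have d: "pr \<xi> = gdom G (rs g e)" using assms True by (simp add: gdom_rs)
  have "gact (GenS e) \<xi> = Some (e # fst \<xi>, snd \<xi>)" using True by simp
  then have "vld (e # fst \<xi>, snd \<xi>)" by (rule gact_Some(2))
  moreover have "gact (GenU (rs g e)) \<xi> = Some (la (rs g e) (fst \<xi>), gcomp G (lr (rs g e) (fst \<xi>)) (snd \<xi>))" (is "_ = Some ?\<eta>")
    using True d by simp
  then have "vld ?\<eta>" "pr ?\<eta> = gcod G (rs g e)" using gact_Some(2) gact_U_pr by blast+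
  ultimately show ?thesis using True assms d by (simp add: gcod_rs pr_def[of "(e # _, _)"])
qed (use assms in \<open>auto simp: gdom_rs\<close>)

lemma omega_toeplitz_rel: "(a, b) \<in> toeplitz_rel E G act \<Longrightarrow> eqv omega a b"
proof (induction rule: toeplitz_rel.induct)
  case (P_idem v)
  show ?case unfolding free_gen_mon mon_add[symmetric]
    by (rule omega_eqv) (auto simp: wact_add bind_eq_Some_conv wact_lett split: if_splits)
next
  case (P_star v)
  show ?case unfolding free_gen_mon mon_add[symmetric]
    by (rule omega_eqv) (auto simp: wact_lett wact_lett_star split: if_splits)
next
  case (P_orth v w)
  then show ?case unfolding free_gen_mon mon_add[symmetric]
    by (intro omega_eqv_0) (auto simp: wact_add bind_eq_Some_conv wact_lett split: if_splits)
next
  case P_sum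
  have "eqv omega (mon 0) (\<Sum>v\<in>UNIV. mon (lett (GenP v) False))"
  proof (rule omega_eqv_sum)
    fix \<xi> \<eta> assume v: "vld \<xi>"
    have "(\<Sum>v\<in>UNIV. of_bool (wact (lett (GenP v) False) \<xi> = Some \<eta>)) =
       (\<Sum>v\<in>UNIV. if v = pr \<xi> then of_bool (\<xi> = \<eta>) else (0::real))"
      by (rule sum.cong) (use v in \<open>auto simp: wact_lett split: if_splits\<close>)
    then show "(of_bool (wact 0 \<xi> = Some \<eta>) :: real) = (\<Sum>v\<in>UNIV. of_bool (wact (lett (GenP v) False) \<xi> = Some \<eta>))"
      by simp
  qed
  then show ?case unfolding free_gen_mon mon_0 by (rule eqv_sym)
next
  case (S_isom e)
  show ?case unfolding free_gen_mon mon_add[symmetric]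
    by (rule omega_eqv) (auto simp: wact_add bind_eq_Some_conv wact_lett wact_lett_star split: if_splits)
next
  case (U_unit v)
  show ?case unfolding free_gen_mon mon_add[symmetric]
    by (rule omega_eqv) (simp only: wact_lett gact_U_id)
next
  case (U_initial g)
  show ?case unfolding free_gen_mon mon_add[symmetric]
  proof (rule omega_eqv)
    fix \<xi> \<eta> assume "vld \<xi>"
    have "wact (lett (GenU g) True + lett (GenU g) False) \<xi> = Some \<eta> \<longleftrightarrow>
      (\<exists>\<zeta>. gact (GenU g) \<xi> = Some \<zeta> \<and> gact (GenU g) \<eta> = Some \<zeta>)"
      by (simp only: wact_add bind_eq_Some_conv wact_lett wact_lett_star)
    also have "\<dots> \<longleftrightarrow> \<xi> = \<eta> \<and> (\<exists>\<zeta>. gact (GenU g) \<xi> = Some \<zeta>)"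
      using gact_inj by blast
    finally show "wact (lett (GenU g) True + lett (GenU g) False) \<xi> = Some \<eta> \<longleftrightarrow> wact (lett (GenP (gdom G g)) False) \<xi> = Some \<eta>"
      by (auto simp: wact_lett)
  qed
next
  case (U_final g)
  show ?case unfolding free_gen_mon mon_add[symmetric]
  proof (rule omega_eqv)
    fix \<xi> \<eta> assume v: "vld \<xi>"
    have "wact (lett (GenU g) False + lett (GenU g) True) \<xi> = Some \<eta> \<longleftrightarrow>
      (\<exists>\<zeta>. gact (GenU g) \<zeta> = Some \<xi> \<and> gact (GenU g) \<zeta> = Some \<eta>)"
      by (simp only: wact_add bind_eq_Some_conv wact_lett wact_lett_star)
    also have "\<dots> \<longleftrightarrow> \<xi> = \<eta> \<and> pr \<xi> = gcod G g"
      using gact_U_onto[OF v] gact_U_pr by (metis option.inject)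
    finally show "wact (lett (GenU g) False + lett (GenU g) True) \<xi> = Some \<eta> \<longleftrightarrow> wact (lett (GenP (gcod G g)) False) \<xi> = Some \<eta>"
      using v by (auto simp: wact_lett)
  qed
next
  case (U_comp g h)
  show ?case unfolding free_gen_mon mon_add[symmetric]
    by (rule omega_eqv) (simp only: wact_add wact_lett_eq gact_U_comp[OF U_comp])
next
  case (U_orth g h)
  show ?case unfolding free_gen_mon mon_add[symmetric]
    by (rule omega_eqv_0) (use U_orth gact_U_pr[of h] in \<open>force simp: wact_add wact_lett bind_eq_Some_conv simp del: gact.simps(3) dest: gact_U_dom\<close>)
next
  case (US g e)
  have "wact (lett (GenU g) False + lett (GenS e) False) \<xi> =
      wact (lett (GenS (ea g e)) False + lett (GenU (rs g e)) False) \<xi>" for \<xi>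
    by (simp only: wact_add wact_lett_eq gact_US[OF US])
  then show ?case unfolding free_gen_mon mon_add[symmetric]
    by (intro omega_eqv) simp
next
  case (US_orth g e)
  then show ?case unfolding free_gen_mon mon_add[symmetric]
    by (intro omega_eqv_0) (auto simp: wact_add wact_lett bind_eq_Some_conv pr_def[of "(e # _, _)"])
qed

text \<open>On a nonempty path only the first edge \<open>e\<close> contributes, through
  \<open>s_e s_e*\<close>. The relation fails on empty paths, hence the threshold
  \<open>n = 1\<close> in \<open>omega_eqv_sum\<close>.\<close>

lemma omega_ck: "eqv omega (gP v) (ck_sum E v)"
  unfolding free_gen_mon mon_add[symmetric]
proof (rule omega_eqv_sum)
  fix \<xi> \<eta> assume v: "vld \<xi>" and l: "1 \<le> length (fst \<xi>)"
  obtain e es where es: "fst \<xi> = e # es" using l by (cases "fst \<xi>") auto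
  then obtain g where xi: "\<xi> = (e # es, g)" by (cases \<xi>) auto
  have pr: "pr \<xi> = rng E e" by (simp add: pr_def es)
  have "is_walk E (src E e) es (gcod G g)" using v by (simp add: vld_def xi pr_def)
  then have v': "vld (es, g)" "pr (es, g) = src E e" by (auto intro: vldI pr_eqI)
  have w: "wact (lett (GenS f) False + lett (GenS f) True) \<xi> = Some \<eta> \<longleftrightarrow> f = e \<and> \<xi> = \<eta>" for f
    using v' by (auto simp: wact_add wact_lett wact_lett_star bind_eq_Some_conv xi split: if_splits)
  have "(\<Sum>f\<in>{f. rng E f = v}. of_bool (wact (lett (GenS f) False + lett (GenS f) True) \<xi> = Some \<eta>)) =
     (\<Sum>f\<in>{f. rng E f = v}. if f = e then of_bool (\<xi> = \<eta>) else (0 :: real))"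
    by (rule sum.cong) (auto simp: w)
  then show "(of_bool (wact (lett (GenP v) False) \<xi> = Some \<eta>) :: real) =
     (\<Sum>f\<in>{f. rng E f = v}. of_bool (wact (lett (GenS f) False + lett (GenS f) True) \<xi> = Some \<eta>))"
    using v pr by (auto simp: wact_lett sum.delta)
qed

text \<open>Identifies the sequence behind \<open>c_g\<close> with a monotone bounded one:
  \<open>u_g\<close> fixes the point of a path exactly when \<open>g\<close> fixes the path and its
  restriction there is a unit.\<close>

lemma fixw_U:
  "fixw k (lett (GenU g) False) = (\<Sum>v\<in>UNIV. real (card (fixed_paths E G act g k v)) * x v) / r ^ k"
proof -
  let ?F = "{q \<in> base k. gact (GenU g) (pt q) = Some (pt q)}"
  have iff: "(es, v) \<in> ?F \<longleftrightarrow> (gdom G g, es) \<in> fixed_paths E G act g k v" for es v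
  proof
    assume "(es, v) \<in> ?F"
    then have *: "vld (es, gid G v)" "length es = k" "pr (es, gid G v) = gdom G g"
      "la g es = es" "gcomp G (lr g es) (gid G v) = gid G v" "gact (GenU g) (es, gid G v) = Some (es, gid G v)"
      by (auto simp: base_def pt_def split: if_splits)
    have w: "is_walk E (gdom G g) es v" using *(1,3) by (simp add: vld_def gcod_id)
    have "lr g es = gid G v" using *(5) comp_id_right[of "lr g es"] walk_lr(1)[OF w] by simp
    moreover have "gcod G g = gdom G g" using gact_U_pr[OF *(6)] *(3) by simp
    ultimately show "(gdom G g, es) \<in> fixed_paths E G act g k v"
      using w *(2,4) act_walk[OF w]
      by (simp add: fixed_paths_def paths_from_to_def path_len_def restrict_path_def)
  next
    assume "(gdom G g, es) \<in> fixed_paths E G act g k v"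
    then have *: "is_walk E (gdom G g) es v" "length es = k" "act g (gdom G g, es) = (gdom G g, es)" "lr g es = gid G v"
      by (auto simp: fixed_paths_def paths_from_to_def path_len_def restrict_path_def)
    have "la g es = es" using act_walk[OF *(1)] *(3) by simp
    moreover have "gcomp G (gid G v) (gid G v) = gid G v" using comp_id_right[of "gid G v"] by (simp add: gdom_id)
    moreover have "vld (es, gid G v)" "pr (es, gid G v) = gdom G g" using *(1) by (auto intro: vldI pr_eqI simp: gcod_id)
    ultimately show "(es, v) \<in> ?F" using * by (simp add: base_def pt_def)
  qed
  have iff1: "(gdom G g, es) \<in> fixed_paths E G act g k v"
    if "(es, v) \<in> base k" "gact (GenU g) (pt (es, v)) = Some (pt (es, v))" for es v
    using iff[of es v] that by simp
  have iff2: "(es, v) \<in> base k \<and> gact (GenU g) (pt (es, v)) = Some (pt (es, v)) \<and> u = gdom G g"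
    if "(u, es) \<in> fixed_paths E G act g k v" for u es v
    using iff[of es v] that by (auto simp: fixed_paths_def paths_from_to_def simp del: gact.simps)
  have fp: "fst \<mu> = gdom G g" if "\<mu> \<in> fixed_paths E G act g k v" for \<mu> v
    using that by (simp add: fixed_paths_def paths_from_to_def)
  have fin: "finite (fixed_paths E G act g k v)" for v
  proof (rule finite_subset)
    show "fixed_paths E G act g k v \<subseteq> (\<lambda>q. (gdom G g, fst q)) ` base k"
    proof
      fix \<mu> assume m: "\<mu> \<in> fixed_paths E G act g k v"
      then have "\<mu> = (gdom G g, snd \<mu>)" using fp[OF m] by (metis prod.collapse)
      moreover then have "(snd \<mu>, v) \<in> base k" using iff[of "snd \<mu>" v] m by auto
      ultimately show "\<mu> \<in> (\<lambda>q. (gdom G g, fst q)) ` base k" by force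
    qed
  qed (simp add: finite_base)
  have "(\<Sum>q\<in>base k. of_bool (wact (lett (GenU g) False) (pt q) = Some (pt q)) * x (snd q)) =
     (\<Sum>q\<in>base k. if gact (GenU g) (pt q) = Some (pt q) then x (snd q) else 0)"
    by (intro sum.cong) (auto simp: wact_lett)
  also have "\<dots> = (\<Sum>q\<in>?F. x (snd q))" by (simp only: sum.inter_filter[OF finite_base])
  also have "\<dots> = (\<Sum>(v, \<mu>)\<in>Sigma UNIV (fixed_paths E G act g k). x v)"
    by (rule sum.reindex_bij_witness[of _ "\<lambda>(v, \<mu>). (snd \<mu>, v)" "\<lambda>q. (snd q, (gdom G g, fst q))"])
      (auto simp del: gact.simps dest: fp iff1 iff2)
  also have "\<dots> = (\<Sum>v\<in>UNIV. \<Sum>\<mu>\<in>fixed_paths E G act g k v. x v)"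
    by (rule sum.Sigma[symmetric]) (simp_all add: fin)
  finally show ?thesis by (simp add: fixw_def)
qed

end


section \<open>States on unital C*-algebras\<close>

context cstar_algebra
begin

lemma ring_A: "ring A"
  by unfold_locales

lemma A_one_closed [simp]: "\<one> \<in> carrier A"
  by (rule ring.ring_simprules(6)[OF ring_A])

lemma A_zero_closed [simp]: "\<zero> \<in> carrier A"
  by (rule ring.ring_simprules(2)[OF ring_A])

lemma A_r_one [simp]: "x \<in> carrier A \<Longrightarrow> x \<otimes> \<one> = x"
  by (rule monoid.r_one[OF ring.is_monoid[OF ring_A]])

lemma A_l_one [simp]: "x \<in> carrier A \<Longrightarrow> \<one> \<otimes> x = x"
  by (rule monoid.l_one[OF ring.is_monoid[OF ring_A]])

lemma A_r_neg: "x \<in> carrier A \<Longrightarrow> x \<oplus> \<ominus> x = \<zero>"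
  by (rule abelian_group.r_neg[OF ring.is_abelian_group[OF ring_A]])

lemma in_complex_ring [simp]: "z \<in> carrier complex_ring"
  by (simp add: complex_ring_def)

lemma scl_closed [simp]: "x \<in> carrier A \<Longrightarrow> z \<odot> x \<in> carrier A"
  by (rule smult_closed) simp_all

lemma scl_add_left: "x \<in> carrier A \<Longrightarrow> (y + z) \<odot> x = y \<odot> x \<oplus> z \<odot> x"
  using smult_l_distr[of y z x] by (simp add: complex_ring_def)

lemma scl_add: "x \<in> carrier A \<Longrightarrow> y \<in> carrier A \<Longrightarrow> z \<odot> (x \<oplus> y) = z \<odot> x \<oplus> z \<odot> y"
  by (rule smult_r_distr) simp_all

lemma scl_scl: "x \<in> carrier A \<Longrightarrow> y \<odot> (z \<odot> x) = (y * z) \<odot> x"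
  using smult_assoc1[of y z x] by (simp add: complex_ring_def)

lemma scl_1: "x \<in> carrier A \<Longrightarrow> 1 \<odot> x = x"
  using smult_one[of x] by (simp add: complex_ring_def)

lemma scl_0: "x \<in> carrier A \<Longrightarrow> 0 \<odot> x = \<zero>"
  using cnorm_smult[of x 0] cnorm_eq_0[of "0 \<odot> x"] by simp

lemma scl_minus_1: "x \<in> carrier A \<Longrightarrow> (-1) \<odot> x = \<ominus> x"
proof -
  assume x: "x \<in> carrier A"
  have "(-1) \<odot> x \<oplus> x = ((-1) + 1) \<odot> x" using x by (simp only: scl_add_left scl_1)
  then have "(-1) \<odot> x \<oplus> x = \<zero>" using x by (simp add: scl_0)
  then show ?thesis using x abelian_group.minus_equality[OF ring.is_abelian_group[OF ring_A]] scl_closed[OF x] by metis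
qed

lemma scl_minus: "x \<in> carrier A \<Longrightarrow> y \<in> carrier A \<Longrightarrow> z \<odot> (x \<ominus> y) = z \<odot> x \<ominus> z \<odot> y"
  by (simp add: a_minus_def scl_add scl_scl flip: scl_minus_1)

lemma cnorm_0 [simp]: "cnorm A \<zero> = 0"
  by (simp add: cnorm_eq_0)

lemma cnorm_uminus: "x \<in> carrier A \<Longrightarrow> cnorm A (\<ominus> x) = cnorm A x"
  using cnorm_smult[of x "-1"] by (simp add: scl_minus_1)

lemma cnorm_nonneg: "x \<in> carrier A \<Longrightarrow> 0 \<le> cnorm A x"
  using cnorm_add[of x "\<ominus> x"] by (simp add: cnorm_uminus A_r_neg)

lemma cnorm_commute: "x \<in> carrier A \<Longrightarrow> y \<in> carrier A \<Longrightarrow> cnorm A (x \<ominus> y) = cnorm A (y \<ominus> x)"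
proof -
  assume xy: "x \<in> carrier A" "y \<in> carrier A"
  then have "\<ominus> (x \<ominus> y) = y \<ominus> x" by algebra
  then show ?thesis using cnorm_uminus[of "x \<ominus> y"] xy by simp
qed

lemma minus_minus_add:
  "x \<in> carrier A \<Longrightarrow> y \<in> carrier A \<Longrightarrow> z \<in> carrier A \<Longrightarrow> (x \<ominus> y) \<oplus> (y \<ominus> z) = x \<ominus> z"
  by algebra

lemma cnorm_triangle:
  "x \<in> carrier A \<Longrightarrow> y \<in> carrier A \<Longrightarrow> z \<in> carrier A \<Longrightarrow>
    cnorm A (x \<ominus> z) \<le> cnorm A (x \<ominus> y) + cnorm A (y \<ominus> z)"
  using cnorm_add[of "x \<ominus> y" "y \<ominus> z"] by (simp add: minus_minus_add)

lemma cnorm_star: "x \<in> carrier A \<Longrightarrow> cnorm A (star A x) = cnorm A x"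
proof -
  have *: "cnorm A x \<le> cnorm A (star A x)" if x: "x \<in> carrier A" for x
  proof (cases "cnorm A x = 0")
    case True
    then show ?thesis using cnorm_nonneg[OF star_closed[OF x]] by simp
  next
    case False
    have "cnorm A x * cnorm A x \<le> cnorm A (star A x) * cnorm A x"
      using cstar_identity[OF x] cnorm_mult[OF star_closed[OF x] x] by (simp add: power2_eq_square)
    then show ?thesis using False cnorm_nonneg[OF x] by (metis mult_le_cancel_right_pos order_le_less)
  qed
  assume x: "x \<in> carrier A"
  show ?thesis using *[OF x] *[OF star_closed[OF x]] by (simp add: star_star x)
qed

lemma star_one: "star A \<one> = \<one>"
proof -
  have "star A (star A \<one> \<otimes> \<one>) = star A \<one> \<otimes> star A (star A \<one>)"
    by (rule star_mult) (simp_all add: star_closed)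
  then show ?thesis by (simp add: star_star star_closed)
qed

lemma star_minus: "x \<in> carrier A \<Longrightarrow> y \<in> carrier A \<Longrightarrow> star A (x \<ominus> y) = star A x \<ominus> star A y"
proof -
  assume "x \<in> carrier A" "y \<in> carrier A"
  then have "star A (x \<oplus> (-1) \<odot> y) = star A x \<oplus> (-1) \<odot> star A y"
    by (simp add: star_add star_smult)
  then show ?thesis using \<open>x \<in> carrier A\<close> \<open>y \<in> carrier A\<close> by (simp add: a_minus_def scl_minus_1 star_closed)
qed

lemma cnorm_eqI: "x \<in> carrier A \<Longrightarrow> y \<in> carrier A \<Longrightarrow> cnorm A (x \<ominus> y) = 0 \<Longrightarrow> x = y"
proof -
  assume xy: "x \<in> carrier A" "y \<in> carrier A" and 0: "cnorm A (x \<ominus> y) = 0"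
  have "x = (x \<ominus> y) \<oplus> y" using xy by algebra
  then show ?thesis using cnorm_eq_0[of "x \<ominus> y"] xy 0 by simp
qed

lemma tendsto_unique:
  assumes "x \<in> carrier A" "y \<in> carrier A" "f \<longlonglongrightarrow> 0" "\<And>n. cnorm A (x \<ominus> y) \<le> f n"
  shows "x = y"
proof -
  have "cnorm A (x \<ominus> y) \<le> 0"
    by (rule LIMSEQ_le_const[OF assms(3)]) (use assms(4) in auto)
  then show ?thesis using assms(1,2) cnorm_nonneg[of "x \<ominus> y"] cnorm_eqI by auto
qed

section \<open>Square roots near the unit\<close>

context
  fixes h assumes h: "h \<in> carrier A" "star A h = h" "cnorm A h < 1"
begin

primrec sqrt_iter :: "nat \<Rightarrow> 'a" where
  "sqrt_iter 0 = \<zero>"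
| "sqrt_iter (Suc n) = (1/2) \<odot> (h \<oplus> sqrt_iter n \<otimes> sqrt_iter n)"

text \<open>Since \<open>x^2 - y^2 = x (x - y) + (x - y) y\<close>, the iteration contracts with
  factor \<open>cnorm A h\<close> on the ball of radius \<open>cnorm A h\<close>.\<close>

lemma half_square_diff:
  assumes "x \<in> carrier A" "y \<in> carrier A" "cnorm A x \<le> cnorm A h" "cnorm A y \<le> cnorm A h"
  shows "cnorm A ((1/2) \<odot> (h \<oplus> x \<otimes> x) \<ominus> (1/2) \<odot> (h \<oplus> y \<otimes> y)) \<le> cnorm A h * cnorm A (x \<ominus> y)"
proof -
  have "(h \<oplus> x \<otimes> x) \<ominus> (h \<oplus> y \<otimes> y) = x \<otimes> (x \<ominus> y) \<oplus> (x \<ominus> y) \<otimes> y"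
    using assms h(1) by algebra
  then have "cnorm A ((1/2) \<odot> (h \<oplus> x \<otimes> x) \<ominus> (1/2) \<odot> (h \<oplus> y \<otimes> y)) =
     1/2 * cnorm A (x \<otimes> (x \<ominus> y) \<oplus> (x \<ominus> y) \<otimes> y)"
    using assms h(1) by (simp add: cnorm_smult flip: scl_minus)
  also have "\<dots> \<le> 1/2 * (cnorm A x * cnorm A (x \<ominus> y) + cnorm A (x \<ominus> y) * cnorm A y)"
    using assms by (intro mult_left_mono order_trans[OF cnorm_add] add_mono cnorm_mult) auto
  also have "\<dots> \<le> 1/2 * (cnorm A h * cnorm A (x \<ominus> y) + cnorm A (x \<ominus> y) * cnorm A h)"
    using assms by (intro mult_left_mono add_mono mult_right_mono) (auto simp: cnorm_nonneg)
  finally show ?thesis by (simp add: mult.commute)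
qed

lemma sqrt_iter: "sqrt_iter n \<in> carrier A" "star A (sqrt_iter n) = sqrt_iter n" "cnorm A (sqrt_iter n) \<le> cnorm A h"
proof -
  have "star A \<zero> = \<zero>" using star_smult[of \<one> 0] by (simp add: scl_0 star_closed)
  then have "sqrt_iter n \<in> carrier A \<and> star A (sqrt_iter n) = sqrt_iter n \<and> cnorm A (sqrt_iter n) \<le> cnorm A h"
  proof (induction n)
    case (Suc n)
    then have z: "sqrt_iter n \<in> carrier A" "star A (sqrt_iter n) = sqrt_iter n" "cnorm A (sqrt_iter n) \<le> cnorm A h" by auto
    have "cnorm A (h \<oplus> sqrt_iter n \<otimes> sqrt_iter n) \<le> cnorm A h + cnorm A (sqrt_iter n) * cnorm A (sqrt_iter n)"
      using z h by (intro order_trans[OF cnorm_add] add_mono cnorm_mult) auto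
    also have "\<dots> \<le> cnorm A h + cnorm A h * 1"
      using z h cnorm_nonneg[of "sqrt_iter n"] cnorm_nonneg[of h] by (intro add_mono mult_mono) auto
    finally show ?case using z h by (simp add: star_add star_mult star_smult cnorm_smult)
  qed (use h in \<open>auto simp: cnorm_nonneg\<close>)
  then show "sqrt_iter n \<in> carrier A" "star A (sqrt_iter n) = sqrt_iter n" "cnorm A (sqrt_iter n) \<le> cnorm A h"
    by auto
qed

lemma sqrt_iter_diff: "cnorm A (sqrt_iter (n + k) \<ominus> sqrt_iter n) \<le> cnorm A h ^ n"
proof (induction n)
  case 0
  have "sqrt_iter k \<ominus> \<zero> = sqrt_iter k" using sqrt_iter(1)[of k] by algebra
  then show ?case using sqrt_iter(3)[of k] h(3) by simp
next
  case (Suc n)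
  have "cnorm A (sqrt_iter (Suc n + k) \<ominus> sqrt_iter (Suc n)) \<le> cnorm A h * cnorm A (sqrt_iter (n + k) \<ominus> sqrt_iter n)"
    using half_square_diff[of "sqrt_iter (n + k)" "sqrt_iter n"] sqrt_iter by simp
  also have "\<dots> \<le> cnorm A h * cnorm A h ^ n" by (intro mult_left_mono Suc.IH cnorm_nonneg h)
  finally show ?case by simp
qed

text \<open>The square root of \<open>1 - h\<close> is \<open>1 - z\<close> for the fixed point \<open>z\<close> of the contraction \<open>z \<mapsto> (h + z\<^sup>2) / 2\<close>.\<close>

lemma ex_sqrt: "\<exists>y\<in>carrier A. star A y = y \<and> y \<otimes> y = \<one> \<ominus> h"
proof -
  let ?s = "cnorm A h" and ?f = "\<lambda>z. (1/2) \<odot> (h \<oplus> z \<otimes> z)"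
  have s: "0 \<le> ?s" "?s < 1" using h cnorm_nonneg by auto
  have s0: "(\<lambda>n. ?s ^ n) \<longlonglongrightarrow> 0" using s by (intro LIMSEQ_realpow_zero) auto
  have "\<exists>z\<in>carrier A. (\<lambda>n. cnorm A (sqrt_iter n \<ominus> z)) \<longlonglongrightarrow> 0"
  proof (rule complete[OF sqrt_iter(1)], intro allI impI)
    fix \<epsilon> :: real assume e: "0 < \<epsilon>"
    obtain N where N: "?s ^ N < \<epsilon>" using order_tendstoD(2)[OF s0 e] by (auto simp: eventually_sequentially)
    have *: "cnorm A (sqrt_iter m \<ominus> sqrt_iter n) < \<epsilon>" if "n \<ge> N" "m \<ge> n" for m n
      using sqrt_iter_diff[of n "m - n"] that N power_decreasing[of N n ?s] s by auto
    have "cnorm A (sqrt_iter m \<ominus> sqrt_iter n) < \<epsilon>" if "m \<ge> N" "n \<ge> N" for m n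
      using *[of n m] *[of m n] cnorm_commute[OF sqrt_iter(1)[of m] sqrt_iter(1)[of n]] that by (cases "m \<ge> n") auto
    then show "\<exists>N. \<forall>m\<ge>N. \<forall>n\<ge>N. cnorm A (sqrt_iter m \<ominus> sqrt_iter n) < \<epsilon>" by blast
  qed
  then obtain z where z: "z \<in> carrier A" "(\<lambda>n. cnorm A (sqrt_iter n \<ominus> z)) \<longlonglongrightarrow> 0" by blast
  have z': "(\<lambda>n. cnorm A (z \<ominus> sqrt_iter n)) \<longlonglongrightarrow> 0" using z sqrt_iter(1) by (simp add: cnorm_commute)
  \<comment> \<open>The radius bound passes to the limit, so that \<open>half_square_diff\<close>
    applies to \<open>z\<close> itself.\<close>
  have zs: "cnorm A z \<le> ?s"
  proof (rule LIMSEQ_le_const[OF tendsto_add[OF z' tendsto_const[of ?s], simplified]])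
    have "cnorm A z \<le> cnorm A (z \<ominus> sqrt_iter n) + ?s" for n
    proof -
      have "(z \<ominus> sqrt_iter n) \<oplus> sqrt_iter n = z" using z(1) sqrt_iter(1)[of n] by algebra
      then show ?thesis
        using cnorm_add[of "z \<ominus> sqrt_iter n" "sqrt_iter n"] z(1) sqrt_iter[of n] by simp
    qed
    then show "\<exists>N. \<forall>n\<ge>N. cnorm A z \<le> cnorm A (z \<ominus> sqrt_iter n) + ?s" by blast
  qed
  have star_z: "star A z = z"
  proof (rule tendsto_unique[OF star_closed[OF z(1)] z(1) tendsto_add_zero[OF z' z(2)]])
    fix n
    have "cnorm A (star A z \<ominus> sqrt_iter n) = cnorm A (z \<ominus> sqrt_iter n)"
      using cnorm_star[of "z \<ominus> sqrt_iter n"] z(1) sqrt_iter[of n] by (simp add: star_minus)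
    then show "cnorm A (star A z \<ominus> z) \<le> cnorm A (z \<ominus> sqrt_iter n) + cnorm A (sqrt_iter n \<ominus> z)"
      using cnorm_triangle[OF star_closed[OF z(1)] sqrt_iter(1)[of n] z(1)] by simp
  qed
  have fz: "?f z \<in> carrier A" using z h by simp
  have "z = ?f z"
  proof (rule tendsto_unique[OF z(1) fz])
    have a: "(\<lambda>n. cnorm A (z \<ominus> sqrt_iter (Suc n))) \<longlonglongrightarrow> 0" using z' by (rule LIMSEQ_Suc)
    show "(\<lambda>n. cnorm A (z \<ominus> sqrt_iter (Suc n)) + ?s * cnorm A (sqrt_iter n \<ominus> z)) \<longlonglongrightarrow> 0"
      by (intro tendsto_add_zero a tendsto_mult_right_zero z(2))
    show "cnorm A (z \<ominus> ?f z) \<le> cnorm A (z \<ominus> sqrt_iter (Suc n)) + ?s * cnorm A (sqrt_iter n \<ominus> z)" for n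
      using half_square_diff[OF sqrt_iter(1)[of n] z(1) sqrt_iter(3)[of n] zs]
        cnorm_triangle[OF z(1) sqrt_iter(1)[of "Suc n"] fz] by simp
  qed
  then have "z \<oplus> z = ?f z \<oplus> ?f z" by simp
  also have "\<dots> = h \<oplus> z \<otimes> z" using z h scl_add_left[of "h \<oplus> z \<otimes> z" "1/2" "1/2"] by (simp add: scl_1)
  finally have zz: "z \<oplus> z = h \<oplus> z \<otimes> z" .
  have "(x \<ominus> z) \<otimes> (x \<ominus> z) = x \<otimes> x \<ominus> (x \<otimes> z \<oplus> z \<otimes> x) \<oplus> z \<otimes> z" if "x \<in> carrier A" for x
    using z(1) that by algebra
  from this[of \<one>] have "(\<one> \<ominus> z) \<otimes> (\<one> \<ominus> z) = \<one> \<ominus> (z \<oplus> z) \<oplus> z \<otimes> z" using z(1) by simp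
  also have "\<dots> = \<one> \<ominus> h" unfolding zz using z(1) h(1) by algebra
  finally show ?thesis using z(1) star_z by (intro bexI[of _ "\<one> \<ominus> z"]) (auto simp: star_minus star_one)
qed

end

section \<open>Automatic continuity of states\<close>

context
  fixes \<phi> assumes state: "is_state A \<phi>"
begin

lemma state_add: "a \<in> carrier A \<Longrightarrow> b \<in> carrier A \<Longrightarrow> \<phi> (a \<oplus> b) = \<phi> a + \<phi> b"
  and state_scale: "a \<in> carrier A \<Longrightarrow> \<phi> (z \<odot> a) = z * \<phi> a"
  and state_pos: "a \<in> carrier A \<Longrightarrow> \<phi> (star A a \<otimes> a) \<in> \<real>\<^sub>\<ge>\<^sub>0"
  and state_1: "\<phi> \<one> = 1"
  using state by (auto simp: is_state_def)

lemma state_minus: "a \<in> carrier A \<Longrightarrow> b \<in> carrier A \<Longrightarrow> \<phi> (a \<ominus> b) = \<phi> a - \<phi> b"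
  using state_add[of a "(-1) \<odot> b"] state_scale[of b "-1"] by (simp add: a_minus_def scl_minus_1)

lemma state_form: assumes a: "a \<in> carrier A" and b: "b \<in> carrier A"
  shows "\<phi> (star A b \<otimes> a) = cnj (\<phi> (star A a \<otimes> b))"
    and "(cmod (\<phi> (star A a \<otimes> b)))\<^sup>2 \<le> Re (\<phi> (star A a \<otimes> a)) * Re (\<phi> (star A b \<otimes> b))"
proof -
  have "\<phi> (star A a \<otimes> a) + z * \<phi> (star A a \<otimes> b) + cnj z * \<phi> (star A b \<otimes> a) + of_real ((cmod z)\<^sup>2) * \<phi> (star A b \<otimes> b) \<in> \<real>\<^sub>\<ge>\<^sub>0" for z
  proof -
    have "star A (a \<oplus> z \<odot> b) \<otimes> (a \<oplus> z \<odot> b) =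
       (star A a \<otimes> a \<oplus> z \<odot> (star A a \<otimes> b)) \<oplus> (cnj z \<odot> (star A b \<otimes> a) \<oplus> (cnj z * z) \<odot> (star A b \<otimes> b))"
    proof -
      have "(u \<oplus> v) \<otimes> (w \<oplus> y) = (u \<otimes> w \<oplus> u \<otimes> y) \<oplus> (v \<otimes> w \<oplus> v \<otimes> y)"
        if "u \<in> carrier A" "v \<in> carrier A" "w \<in> carrier A" "y \<in> carrier A" for u v w y
        using that by algebra
      then show ?thesis
        using a b by (simp add: star_add star_smult smult_mult_left smult_mult_right scl_scl
            star_closed mult.commute[of z])
    qed
    then have "\<phi> (star A (a \<oplus> z \<odot> b) \<otimes> (a \<oplus> z \<odot> b)) =
       \<phi> (star A a \<otimes> a) + z * \<phi> (star A a \<otimes> b) + cnj z * \<phi> (star A b \<otimes> a) + (cnj z * z) * \<phi> (star A b \<otimes> b)"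
      using a b by (simp add: state_add state_scale star_closed)
    then show ?thesis using state_pos[of "a \<oplus> z \<odot> b"] a b by (simp only: complex_norm_square mult.commute) (simp add: mult.commute)
  qed
  from nonneg_Reals_sesquilinear[OF this state_pos[OF a] state_pos[OF b]]
  show "\<phi> (star A b \<otimes> a) = cnj (\<phi> (star A a \<otimes> b))"
    "(cmod (\<phi> (star A a \<otimes> b)))\<^sup>2 \<le> Re (\<phi> (star A a \<otimes> a)) * Re (\<phi> (star A b \<otimes> b))" .
qed

text \<open>\<open>is_state\<close> has no continuity clause. For \<open>cnorm A a < 1\<close> the
  element \<open>1 - a* a\<close> is a square of a self-adjoint \<open>y\<close>, so positivity
  bounds the value at \<open>a* a\<close> by 1, and Cauchy-Schwarz against the unit bounds the value
  at \<open>a\<close>.\<close>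

lemma state_le_1: assumes a: "a \<in> carrier A" "cnorm A a < 1" shows "cmod (\<phi> a) \<le> 1"
proof -
  let ?h = "star A a \<otimes> a"
  have h: "?h \<in> carrier A" "star A ?h = ?h" using a by (simp_all add: star_closed star_mult star_star)
  have "(cnorm A a)\<^sup>2 < 1" using a(2) cnorm_nonneg[OF a(1)] by (simp add: power_less_one_iff)
  then have "cnorm A ?h < 1" using a by (simp add: cstar_identity)
  from ex_sqrt[OF h this] obtain y where y: "y \<in> carrier A" "star A y = y" "y \<otimes> y = \<one> \<ominus> ?h" by blast
  have "\<phi> (star A y \<otimes> y) = 1 - \<phi> ?h" using y h by (simp add: state_minus state_1)
  then have "Re (\<phi> ?h) \<le> 1" using state_pos[OF y(1)] by (auto simp: complex_nonneg_Reals_iff)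
  then have "(cmod (\<phi> a))\<^sup>2 \<le> 1\<^sup>2"
    using state_form(2)[OF A_one_closed a(1)] a by (simp add: star_one state_1)
  then show ?thesis by (rule power2_le_imp_le) simp
qed

lemma state_le_cnorm: assumes a: "a \<in> carrier A" shows "cmod (\<phi> a) \<le> cnorm A a"
proof (rule dense_ge)
  fix t assume t: "cnorm A a < t"
  then have t0: "0 < t" using cnorm_nonneg[OF a] by simp
  have "cmod (\<phi> (of_real (1 / t) \<odot> a)) \<le> 1"
    by (rule state_le_1) (use a t t0 in \<open>simp_all add: cnorm_smult norm_divide\<close>)
  then show "cmod (\<phi> a) \<le> t" using a t0 by (simp add: state_scale norm_mult norm_divide)
qed

end

end


section \<open>Completions of the free *-algebra\<close>

context free_seminorm
begin

lemma to_c_closed [simp]: "to_completion N a \<in> carrier (cstar_completion N)"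
  by (simp add: to_completion_def carrier_completion)

lemma to_c_mult: "to_completion N a \<otimes>\<^bsub>cstar_completion N\<^esub> to_completion N b = to_completion N (a * b)"
  and to_c_add: "to_completion N a \<oplus>\<^bsub>cstar_completion N\<^esub> to_completion N b = to_completion N (a + b)"
  and to_c_minus: "to_completion N a \<ominus>\<^bsub>cstar_completion N\<^esub> to_completion N b = to_completion N (a - b)"
  and to_c_scale: "z \<odot>\<^bsub>cstar_completion N\<^esub> to_completion N a = to_completion N (free_scale z a)"
  and to_c_star: "star (cstar_completion N) (to_completion N a) = to_completion N (free_star a)"
  and to_c_1: "\<one>\<^bsub>cstar_completion N\<^esub> = to_completion N 1"
  and to_c_0: "\<zero>\<^bsub>cstar_completion N\<^esub> = to_completion N 0"
  by (simp_all add: to_completion_def mult_class add_class minus_class smult_class star_class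
      one_completion zero_completion)

lemma to_c_eq_iff: "to_completion N a = to_completion N b \<longleftrightarrow> N (a - b) = 0"
  by (simp add: to_completion_def class_eq_iff LIMSEQ_const_iff)

lemma to_c_finsum:
  assumes "finite S"
  shows "finsum (cstar_completion N) (\<lambda>i. to_completion N (f i)) S = to_completion N (sum f S)"
proof -
  interpret ring "cstar_completion N" by (rule ring_completion)
  show ?thesis using assms
    by (induction S rule: finite_induct) (simp_all add: finsum_insert to_c_add to_c_0)
qed

lemma to_c_dense:
  assumes "y \<in> carrier (cstar_completion N)" "0 < \<epsilon>"
  shows "\<exists>a. cnorm (cstar_completion N) (y \<ominus>\<^bsub>cstar_completion N\<^esub> to_completion N a) < \<epsilon>"
proof -
  obtain xs where xs: "xs \<in> cauchy_seqs N" "y = cauchy_class N xs"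
    using assms(1) by (auto simp: carrier_completion)
  obtain M where M: "\<forall>m\<ge>M. \<forall>n\<ge>M. N (xs m - xs n) < \<epsilon> / 2"
    using cauchyD[OF xs(1), of "\<epsilon> / 2"] assms(2) by auto
  have d: "(\<lambda>n. xs n - xs M) \<in> cauchy_seqs N" using xs(1) by simp
  have "cnorm (cstar_completion N) (y \<ominus>\<^bsub>cstar_completion N\<^esub> to_completion N (xs M)) =
      cnorm (cstar_completion N) (cauchy_class N (\<lambda>n. xs n - xs M))"
    using xs by (simp add: to_completion_def minus_class)
  also have "\<dots> \<le> \<epsilon> / 2"
    by (rule LIMSEQ_le_const2[OF cnorm_class_lim[OF d]]) (use M in \<open>auto intro!: exI[of _ M] less_imp_le\<close>)
  also have "\<dots> < \<epsilon>" using assms(2) by simp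
  finally show ?thesis by blast
qed

definition cext :: "('x free_alg \<Rightarrow> complex) \<Rightarrow> (nat \<Rightarrow> 'x free_alg) set \<Rightarrow> complex" where
  "cext \<phi> y = lim (\<lambda>n. \<phi> ((SOME xs. xs \<in> cauchy_seqs N \<and> y = cauchy_class N xs) n))"

text \<open>Boundedness makes the values along a Cauchy sequence converge and sends null sequences
  to 0, so the limit does not depend on the representative picked by \<open>SOME\<close>.\<close>

lemma cext_lim:
  assumes \<phi>: "free_functional \<phi>" "\<And>a. cmod (\<phi> a) \<le> K * N a" and xs: "xs \<in> cauchy_seqs N"
  shows "(\<lambda>n. \<phi> (xs n)) \<longlonglongrightarrow> cext \<phi> (cauchy_class N xs)"
proof -
  interpret free_functional \<phi> by (rule \<phi>(1))
  define ys where "ys = (SOME ys. ys \<in> cauchy_seqs N \<and> cauchy_class N xs = cauchy_class N ys)"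
  have ys: "ys \<in> cauchy_seqs N" "cauchy_class N xs = cauchy_class N ys"
    using someI[of "\<lambda>ys. ys \<in> cauchy_seqs N \<and> cauchy_class N xs = cauchy_class N ys" xs] xs
    by (auto simp: ys_def)
  \<comment> \<open>\<open>\<bar>K\<bar> + 1\<close> is a positive Lipschitz constant, whatever the
    sign of \<open>K\<close>.\<close>
  have K: "cmod (\<phi> a - \<phi> b) \<le> (\<bar>K\<bar> + 1) * N (a - b)" for a b
  proof -
    have "K * N (a - b) \<le> (\<bar>K\<bar> + 1) * N (a - b)" by (intro mult_right_mono) auto
    then show ?thesis using \<phi>(2)[of "a - b"] by (simp add: diff)
  qed
  have "Cauchy (\<lambda>n. \<phi> (ys n))"
    unfolding Cauchy_def dist_norm
  proof (intro allI impI)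
    fix \<epsilon> :: real assume e: "0 < \<epsilon>"
    obtain M where M: "\<forall>m\<ge>M. \<forall>n\<ge>M. N (ys m - ys n) < \<epsilon> / (\<bar>K\<bar> + 1)"
      using cauchyD[OF ys(1), of "\<epsilon> / (\<bar>K\<bar> + 1)"] e by auto
    have "cmod (\<phi> (ys m) - \<phi> (ys n)) < \<epsilon>" if "m \<ge> M" "n \<ge> M" for m n
    proof -
      have "(\<bar>K\<bar> + 1) * N (ys m - ys n) < (\<bar>K\<bar> + 1) * (\<epsilon> / (\<bar>K\<bar> + 1))"
        using M that by (intro mult_strict_left_mono) auto
      then show ?thesis using K[of "ys m" "ys n"] by simp
    qed
    then show "\<exists>M. \<forall>m\<ge>M. \<forall>n\<ge>M. cmod (\<phi> (ys m) - \<phi> (ys n)) < \<epsilon>" by blast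
  qed
  then have l: "(\<lambda>n. \<phi> (ys n)) \<longlonglongrightarrow> cext \<phi> (cauchy_class N xs)"
    by (simp add: cext_def ys_def[symmetric] Cauchy_convergent_iff convergent_LIMSEQ_iff)
  have "(\<lambda>n. N (xs n - ys n)) \<longlonglongrightarrow> 0" using class_eq_iff[OF xs ys(1)] ys(2) by simp
  then have "(\<lambda>n. (\<bar>K\<bar> + 1) * N (xs n - ys n)) \<longlonglongrightarrow> 0" by (rule tendsto_mult_right_zero)
  then have "(\<lambda>n. \<phi> (xs n) - \<phi> (ys n)) \<longlonglongrightarrow> 0"
    by (rule Lim_null_comparison[rotated]) (use K in auto)
  from tendsto_add[OF this l] show ?thesis by simp
qed

end

section \<open>Quotients of C*-algebras\<close>

lemma (in cstar_algebra) A_l_neg: "x \<in> carrier A \<Longrightarrow> \<ominus> x \<oplus> x = \<zero>"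
  by (rule abelian_group.l_neg[OF ring.is_abelian_group[OF ring_A]])

lemma (in cstar_algebra) minus_add_cancel: "x \<in> carrier A \<Longrightarrow> y \<in> carrier A \<Longrightarrow> (x \<ominus> y) \<oplus> y = x"
  by algebra

lemma (in cstar_algebra) idealI':
  assumes "J \<subseteq> carrier A" "\<zero> \<in> J" "\<And>a b. a \<in> J \<Longrightarrow> b \<in> J \<Longrightarrow> a \<oplus> b \<in> J"
    and l: "\<And>a y. a \<in> J \<Longrightarrow> y \<in> carrier A \<Longrightarrow> y \<otimes> a \<in> J"
    and r: "\<And>a y. a \<in> J \<Longrightarrow> y \<in> carrier A \<Longrightarrow> a \<otimes> y \<in> J"
  shows "ideal J A"
proof (rule idealI[OF ring_A])
  have "\<ominus> a \<in> J" if a: "a \<in> J" for a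
  proof -
    have ac: "a \<in> carrier A" using a assms(1) by blast
    have "((-1) \<odot> \<one>) \<otimes> a = \<ominus> a"
      using smult_mult_left[of "\<one>" a "-1"] ac by (simp add: scl_minus_1)
    then show ?thesis using l[OF a, of "(-1) \<odot> \<one>"] by simp
  qed
  then show "subgroup J (add_monoid A)"
    using assms(1-3) by (intro group.subgroupI[OF abelian_group.a_group[OF ring.is_abelian_group[OF ring_A]]]) (auto simp: a_inv_def)
qed (use l r in auto)

text \<open>The assumption \<open>star_I\<close> makes the adjoint of a coset well defined; for the
  Cuntz ideal it is supplied by \<open>star_cuntz_ideal\<close>.\<close>

locale cstar_quotient = cstar_algebra +
  fixes I
  assumes ideal_I: "ideal I A" and star_I: "a \<in> I \<Longrightarrow> star A a \<in> I"
begin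

interpretation Id: ideal I A by (rule ideal_I)

abbreviation "Q \<equiv> cstar_quot A I"

definition q :: "'a \<Rightarrow> 'a set" where
  "q a = I +> a"

lemma q_eq_iff: "a \<in> carrier A \<Longrightarrow> b \<in> carrier A \<Longrightarrow> q a = q b \<longleftrightarrow> a \<ominus> b \<in> I"
proof -
  assume a: "a \<in> carrier A" and b: "b \<in> carrier A"
  have "a \<ominus> b \<in> I \<longleftrightarrow> a \<in> q b" using Id.a_rcos_module_minus[OF ring_A b a] by (simp add: q_def)
  moreover have "a \<in> q b \<longleftrightarrow> q a = q b"
    using Id.a_repr_independence'[of a b] Id.a_rcos_self[OF a] b unfolding q_def by metis
  ultimately show ?thesis by simp
qed

lemma q_memD: "y \<in> q a \<Longrightarrow> a \<in> carrier A \<Longrightarrow> y \<in> carrier A \<and> q y = q a"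
  using Id.a_repr_independence'[of y a] Id.a_elemrcos_carrier unfolding q_def by auto

lemma q_self: "a \<in> carrier A \<Longrightarrow> a \<in> q a"
  unfolding q_def by (rule Id.a_rcos_self)

lemma carrier_Q: "carrier Q = q ` carrier A"
  by (auto simp: cstar_quot_def FactRing_def A_RCOSETS_def' q_def)

lemma q_closed [simp]: "a \<in> carrier A \<Longrightarrow> q a \<in> carrier Q"
  by (simp add: carrier_Q)

lemma q_mult: "a \<in> carrier A \<Longrightarrow> b \<in> carrier A \<Longrightarrow> q a \<otimes>\<^bsub>Q\<^esub> q b = q (a \<otimes> b)"
  by (simp add: cstar_quot_def FactRing_def q_def Id.rcoset_mult_add)

lemma q_add: "a \<in> carrier A \<Longrightarrow> b \<in> carrier A \<Longrightarrow> q a \<oplus>\<^bsub>Q\<^esub> q b = q (a \<oplus> b)"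
  by (simp add: cstar_quot_def FactRing_def q_def Id.a_rcos_sum)

lemma q_one: "\<one>\<^bsub>Q\<^esub> = q \<one>"
  by (simp add: cstar_quot_def FactRing_def q_def)

lemma q_zero: "\<zero>\<^bsub>Q\<^esub> = q \<zero>"
proof -
  have "q \<zero> = I" unfolding q_def 
    by (rule abelian_group.a_coset_join2[OF ring.is_abelian_group[OF ring_A]])
      (auto intro: Id.a_subgroup Id.zero_closed)
  then show ?thesis by (simp add: cstar_quot_def FactRing_def)
qed

lemma q_scale: assumes a: "a \<in> carrier A" shows "z \<odot>\<^bsub>Q\<^esub> q a = q (z \<odot> a)"
proof -
  have "q (z \<odot> y) = q (z \<odot> a)" if y: "y \<in> q a" for y
  proof -
    have yc: "y \<in> carrier A" "y \<ominus> a \<in> I" using q_memD[OF y a] q_eq_iff[of y a] a by auto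
    have "z \<odot> (y \<ominus> a) = (z \<odot> \<one>) \<otimes> (y \<ominus> a)" using yc a by (simp add: smult_mult_left)
    also have "\<dots> \<in> I" using yc by (intro Id.I_l_closed) auto
    finally show ?thesis using yc a by (simp add: q_eq_iff scl_minus)
  qed
  then have "(\<Union>y\<in>q a. q (z \<odot> y)) = q (z \<odot> a)" using q_self[OF a] by blast
  then show ?thesis by (simp add: cstar_quot_def q_def)
qed

lemma q_star: assumes a: "a \<in> carrier A" shows "star Q (q a) = q (star A a)"
proof -
  have "q (star A y) = q (star A a)" if y: "y \<in> q a" for y
  proof -
    have yc: "y \<in> carrier A" "y \<ominus> a \<in> I" using q_memD[OF y a] q_eq_iff[of y a] a by auto
    then show ?thesis using star_I[OF yc(2)] a by (simp add: q_eq_iff star_minus star_closed)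
  qed
  then have "(\<Union>y\<in>q a. q (star A y)) = q (star A a)" using q_self[OF a] by blast
  then show ?thesis by (simp add: cstar_quot_def q_def)
qed

lemma ring_Q: "ring Q"
proof (rule ringI)
  show "abelian_group Q"
  proof (rule abelian_groupI)
    fix x assume "x \<in> carrier Q"
    then obtain a where a: "a \<in> carrier A" "x = q a" by (auto simp: carrier_Q)
    show "\<exists>y\<in>carrier Q. y \<oplus>\<^bsub>Q\<^esub> x = \<zero>\<^bsub>Q\<^esub>"
      using a by (intro bexI[of _ "q (\<ominus> a)"]) (auto simp: q_add q_zero A_l_neg)
  qed (auto simp: carrier_Q q_add q_zero ring.ring_simprules(7,8,10,22)[OF ring_A])
  show "Group.monoid Q" by (rule monoidI) (auto simp: carrier_Q q_mult q_one ring.ring_simprules(11)[OF ring_A])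
qed (auto simp: carrier_Q q_add q_mult ring.ring_simprules(13,23)[OF ring_A])

lemma q_minus: assumes "a \<in> carrier A" "b \<in> carrier A" shows "q a \<ominus>\<^bsub>Q\<^esub> q b = q (a \<ominus> b)"
proof -
  interpret Q: ring Q by (rule ring_Q)
  have "\<ominus>\<^bsub>Q\<^esub> q b = q (\<ominus> b)"
    by (rule Q.minus_equality) (use assms in \<open>auto simp: q_add q_zero A_l_neg\<close>)
  then show ?thesis using assms by (simp add: a_minus_def q_add)
qed

lemma cnorm_bdd: "a \<in> carrier A \<Longrightarrow> bdd_below (cnorm A ` q a)"
  using q_memD cnorm_nonneg by (intro bdd_belowI2[of _ 0]) blast

lemma cnorm_Q_def: "cnorm Q y = (INF x\<in>y. cnorm A x)"
  by (simp add: cstar_quot_def)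

lemma cnorm_q_le: "a \<in> carrier A \<Longrightarrow> cnorm Q (q a) \<le> cnorm A a"
  unfolding cnorm_Q_def by (rule cINF_lower[OF cnorm_bdd q_self])

lemma cnorm_q_nonneg: "a \<in> carrier A \<Longrightarrow> 0 \<le> cnorm Q (q a)"
  unfolding cnorm_Q_def by (rule cINF_greatest) (use q_self q_memD cnorm_nonneg in blast)+

text \<open>The quotient norm is an infimum over the coset, so a strict bound lifts to a
  representative.\<close>

lemma cnorm_Q_less:
  assumes "y \<in> carrier Q" "cnorm Q y < \<epsilon>"
  obtains a where "a \<in> carrier A" "q a = y" "cnorm A a < \<epsilon>"
proof -
  obtain b where b: "b \<in> carrier A" "y = q b" using assms(1) by (auto simp: carrier_Q)
  have "\<exists>a\<in>q b. cnorm A a < \<epsilon>"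
    using assms(2) cINF_less_iff[of "q b" "cnorm A" \<epsilon>] q_self[OF b(1)] cnorm_bdd[OF b(1)]
    unfolding cnorm_Q_def b(2) by blast
  then show thesis using that q_memD b by blast
qed

text \<open>Pulling states back to \<open>A\<close> makes the bound \<open>state_le_cnorm\<close>
  available in the quotient through representatives.\<close>

lemma state_q: "is_state Q \<phi> \<Longrightarrow> is_state A (\<lambda>a. \<phi> (q a))"
  unfolding is_state_def carrier_Q by (simp add: star_closed q_add q_scale q_mult q_star q_one)

text \<open>Vanishing on \<open>I\<close> makes the value at a chosen member of a coset independent
  of the choice.\<close>

lemma state_descends:
  assumes st: "is_state A \<phi>" and 0: "\<And>a. a \<in> I \<Longrightarrow> \<phi> a = 0"
  obtains \<psi> where "is_state Q \<psi>" "\<And>a. a \<in> carrier A \<Longrightarrow> \<psi> (q a) = \<phi> a"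
proof -
  define \<psi> where "\<psi> y = \<phi> (SOME a. a \<in> y)" for y
  have \<psi>: "\<psi> (q a) = \<phi> a" if a: "a \<in> carrier A" for a
  proof -
    have "(SOME b. b \<in> q a) \<in> q a" using q_self[OF a] by (rule someI)
    then have b: "(SOME b. b \<in> q a) \<in> carrier A" "(SOME b. b \<in> q a) \<ominus> a \<in> I"
      using q_memD[OF _ a] q_eq_iff[OF _ a] by blast+
    then show ?thesis using 0[OF b(2)] state_minus[OF st b(1) a] by (simp add: \<psi>_def)
  qed
  have "is_state Q \<psi>"
    unfolding is_state_def carrier_Q
    by (simp add: q_add q_scale q_mult q_star q_one \<psi> star_closed
        state_add[OF st] state_scale[OF st] state_pos[OF st] state_1[OF st])
  then show thesis using \<psi> that by blast
qed

end

section \<open>The universal algebras\<close>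

context finite_action
begin

abbreviation "T \<equiv> toeplitz_alg E G act"
abbreviation "N \<equiv> toeplitz_norm E G act"
abbreviation "CA \<equiv> cuntz_alg E G act"
abbreviation "\<tau> \<equiv> to_completion N"
abbreviation "ck_defect v \<equiv> gP v - ck_sum E v :: ('v, 'e, 'g) generator free_alg"

sublocale Tn: free_seminorm N
  by unfold_locales (rule cstar_seminorm_toeplitz_norm)

sublocale T: cstar_algebra T
  by (rule cstar_algebra_toeplitz_alg)

lemmas tau_hom = Tn.to_c_mult[folded toeplitz_alg_def] Tn.to_c_add[folded toeplitz_alg_def]
  Tn.to_c_minus[folded toeplitz_alg_def] Tn.to_c_scale[folded toeplitz_alg_def]
  Tn.to_c_star[folded toeplitz_alg_def] Tn.to_c_1[folded toeplitz_alg_def] Tn.to_c_0[folded toeplitz_alg_def]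

lemma tau_closed [simp]: "\<tau> a \<in> carrier T"
  unfolding toeplitz_alg_def by simp

lemma toeplitz_seminorm_rel:
  assumes S: "S \<in> toeplitz_seminorms E G act" and rel: "(a, b) \<in> toeplitz_rel E G act"
  shows "S (a - b) = 0"
proof -
  interpret S: free_seminorm S using S by unfold_locales (simp add: toeplitz_seminorms_def)
  let ?t = "to_completion S"
  note hom = S.to_c_mult S.to_c_star S.to_c_1 S.to_c_0 S.to_c_closed
  have rep: "is_toeplitz_rep E G act (cstar_completion S) (\<lambda>g. ?t (gU g)) (\<lambda>v. ?t (gP v)) (\<lambda>e. ?t (gS e))"
    using S by (simp add: toeplitz_seminorms_def)
  have fs: "(\<Oplus>\<^bsub>cstar_completion S\<^esub>v\<in>UNIV. ?t (gP v)) = ?t (\<Sum>v\<in>UNIV. gP v)"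
    by (rule S.to_c_finsum) simp
  note R = rep[unfolded is_toeplitz_rep_def is_unitary_rep_def is_tck_family_def is_projection_def hom fs]
  have "?t a = ?t b"
    using rel R by (cases rule: toeplitz_rel.cases) (simp_all add: if_distrib[of ?t, symmetric])
  then show ?thesis by (simp add: S.to_c_eq_iff)
qed

lemma toeplitz_norm_rel: "(a, b) \<in> toeplitz_rel E G act \<Longrightarrow> N (a - b) = 0"
proof (rule antisym)
  assume rel: "(a, b) \<in> toeplitz_rel E G act"
  show "N (a - b) \<le> 0"
    unfolding toeplitz_norm_def
    by (rule cSUP_least) (use zero_in_toeplitz_seminorms toeplitz_seminorm_rel[OF _ rel] in fastforce)+
qed simp

lemma tau_rel: "(a, b) \<in> toeplitz_rel E G act \<Longrightarrow> \<tau> a = \<tau> b"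
  by (simp add: Tn.to_c_eq_iff toeplitz_norm_rel)

text \<open>By \<open>pos\<close> the defect \<open>d\<close> equals \<open>d* d\<close> in the
  completion, so \<open>d\<close> itself is the witness for the order relation
  \<open>cstar_le\<close>.\<close>

lemma toeplitz_seminormI:
  assumes S: "cstar_seminorm S" and rel: "\<And>a b. (a, b) \<in> toeplitz_rel E G act \<Longrightarrow> S (a - b) = 0"
    and pos: "\<And>v. S (ck_defect v - free_star (ck_defect v) * ck_defect v) = 0"
  shows "S \<in> toeplitz_seminorms E G act"
proof -
  interpret S: free_seminorm S by unfold_locales (rule S)
  let ?t = "to_completion S"
  note hom = S.to_c_mult S.to_c_star S.to_c_1 S.to_c_0
  have fs: "(\<Oplus>\<^bsub>cstar_completion S\<^esub>i\<in>I. ?t (f i)) = ?t (\<Sum>i\<in>I. f i)" if "finite I"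
    for f :: "'i \<Rightarrow> _" and I by (rule S.to_c_finsum[OF that])
  have t: "?t a = ?t b" if "(a, b) \<in> toeplitz_rel E G act" for a b
    using rel[OF that] by (simp add: S.to_c_eq_iff)
  have tp: "?t (ck_defect v) = ?t (free_star (ck_defect v) * ck_defect v)" for v
    using pos by (simp only: S.to_c_eq_iff)
  have t1: "?t (free_star (gU (gid G v))) = ?t (gP v)" for v
    using arg_cong[OF t[OF toeplitz_rel.U_unit[of G v E act]], of "star (cstar_completion S)"]
      t[OF toeplitz_rel.P_star[of v E G act]] by (simp only: S.to_c_star)
  have t2: "?t (gU (gid G v) * gU (gid G v)) = ?t (gP v)" for v
    using t[OF toeplitz_rel.U_unit[of G v E act]] t[OF toeplitz_rel.P_idem[of v E G act]]
    by (simp only: S.to_c_mult[symmetric])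
  have "cstar_le (cstar_completion S) (?t (ck_sum E v)) (?t (gP v))" for v
    unfolding cstar_le_def cstar_positive_def S.to_c_minus
    by (rule bexI[of _ "?t (ck_defect v)"]) (simp only: S.to_c_star S.to_c_mult, rule tp, rule S.to_c_closed)
  then have "is_toeplitz_rep E G act (cstar_completion S) (\<lambda>g. ?t (gU g)) (\<lambda>v. ?t (gP v)) (\<lambda>e. ?t (gS e))"
    unfolding is_toeplitz_rep_def is_unitary_rep_def is_tck_family_def is_projection_def hom
    by (simp add: fs t1 t2 t[OF toeplitz_rel.P_idem] t[OF toeplitz_rel.P_star] t[OF toeplitz_rel.P_orth]
        t[OF toeplitz_rel.P_sum] t[OF toeplitz_rel.S_isom] t[OF toeplitz_rel.U_unit]
        t[OF toeplitz_rel.U_initial] t[OF toeplitz_rel.U_final] t[OF toeplitz_rel.U_comp]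
        t[OF toeplitz_rel.U_orth] t[OF toeplitz_rel.US] t[OF toeplitz_rel.US_orth] hom)
  then show ?thesis using S by (simp add: toeplitz_seminorms_def)
qed

definition ck_elts :: "('v, 'e, 'g) toeplitz_elem set" where
  "ck_elts = {\<tau> (ck_defect v) | v. True}"

lemma cuntz_ideal_eq: "cuntz_ideal E G act = \<Inter>{I. ideal I T \<and> cstar_closed T I \<and> ck_elts \<subseteq> I}"
proof -
  have "(\<Oplus>\<^bsub>T\<^esub>e\<in>{e. rng E e = v}. \<tau> (gS e) \<otimes>\<^bsub>T\<^esub> star T (\<tau> (gS e))) = \<tau> (ck_sum E v)" for v
    unfolding tau_hom unfolding toeplitz_alg_def by (rule Tn.to_c_finsum) simp
  then show ?thesis
    by (simp add: cuntz_ideal_def cstar_ideal_gen_def ck_elts_def Let_def toeplitz_gen_def tau_hom)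
qed

lemma ideal_cuntz_ideal: "ideal (cuntz_ideal E G act) T"
  unfolding cuntz_ideal_eq
proof (rule ring.i_Intersect[OF T.ring_A])
  have "ideal (carrier T) T" by (rule ring.oneideal[OF T.ring_A])
  moreover have "cstar_closed T (carrier T)" by (simp add: cstar_closed_def)
  ultimately show "{I. ideal I T \<and> cstar_closed T I \<and> ck_elts \<subseteq> I} \<noteq> {}"
    by (auto simp: ck_elts_def intro!: exI[of _ "carrier T"])
qed auto

lemma cuntz_ideal_subset: "ideal J T \<Longrightarrow> cstar_closed T J \<Longrightarrow> ck_elts \<subseteq> J \<Longrightarrow> cuntz_ideal E G act \<subseteq> J"
  unfolding cuntz_ideal_eq by blast

lemma closed_cuntz_ideal: "cstar_closed T (cuntz_ideal E G act)"
  unfolding cstar_closed_def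
proof (intro allI impI)
  fix xs y assume "(\<forall>n. xs n \<in> cuntz_ideal E G act) \<and> y \<in> carrier T \<and> (\<lambda>n. cnorm T (xs n \<ominus>\<^bsub>T\<^esub> y)) \<longlonglongrightarrow> 0"
  then show "y \<in> cuntz_ideal E G act" unfolding cuntz_ideal_eq cstar_closed_def by blast
qed

lemma star_ck_elts: "a \<in> ck_elts \<Longrightarrow> star T a = a"
proof -
  assume "a \<in> ck_elts"
  then obtain v where a: "a = \<tau> (ck_defect v)" by (auto simp: ck_elts_def)
  have "\<tau> (free_star (gP v)) = \<tau> (gP v)" by (rule tau_rel[OF toeplitz_rel.P_star])
  then show ?thesis
    unfolding a tau_hom(5) by (simp add: free_star_diff free_star_sum free_star_mult flip: tau_hom(3))
qed

text \<open>The elements whose adjoint lies in the ideal form a closed ideal; it contains the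
  generators because they are self-adjoint.\<close>

lemma star_cuntz_ideal: assumes "a \<in> cuntz_ideal E G act" shows "star T a \<in> cuntz_ideal E G act"
proof -
  let ?I = "cuntz_ideal E G act"
  interpret I: ideal ?I T by (rule ideal_cuntz_ideal)
  define J where "J = {a \<in> carrier T. star T a \<in> ?I}"
  have "ideal J T"
  proof (rule T.idealI')
    show "\<zero>\<^bsub>T\<^esub> \<in> J" using T.star_minus[of "\<zero>\<^bsub>T\<^esub>" "\<zero>\<^bsub>T\<^esub>"] I.zero_closed
      by (simp add: J_def tau_hom)
  qed (auto simp: J_def T.star_add T.star_mult T.star_closed intro: I.a_closed I.I_l_closed I.I_r_closed)
  moreover have "cstar_closed T J"
    unfolding cstar_closed_def
  proof (intro allI impI)
    fix xs y assume *: "(\<forall>n. xs n \<in> J) \<and> y \<in> carrier T \<and> (\<lambda>n. cnorm T (xs n \<ominus>\<^bsub>T\<^esub> y)) \<longlonglongrightarrow> 0"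
    then have xs: "\<And>n. xs n \<in> carrier T" "\<And>n. star T (xs n) \<in> ?I" by (auto simp: J_def)
    have "cnorm T (star T (xs n) \<ominus>\<^bsub>T\<^esub> star T y) = cnorm T (xs n \<ominus>\<^bsub>T\<^esub> y)" for n
      using T.cnorm_star[of "xs n \<ominus>\<^bsub>T\<^esub> y"] xs(1) * by (simp add: T.star_minus)
    then have "(\<lambda>n. cnorm T (star T (xs n) \<ominus>\<^bsub>T\<^esub> star T y)) \<longlonglongrightarrow> 0" using * by simp
    then have "star T y \<in> ?I"
      using closed_cuntz_ideal[unfolded cstar_closed_def, rule_format, of "\<lambda>n. star T (xs n)" "star T y"]
        xs(2) T.star_closed * by simp
    then show "y \<in> J" using * by (simp add: J_def)
  qed
  moreover have "ck_elts \<subseteq> J"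
  proof
    fix a assume a: "a \<in> ck_elts"
    then have "a \<in> ?I" unfolding cuntz_ideal_eq by blast
    then show "a \<in> J" using star_ck_elts[OF a] I.Icarr by (simp add: J_def)
  qed
  ultimately have "?I \<subseteq> J" by (rule cuntz_ideal_subset)
  then have "a \<in> J" using assms by (rule subsetD)
  then show ?thesis unfolding J_def by simp
qed

end


section \<open>The canonical map from the free *-algebra to the Cuntz-Pimsner algebra\<close>

context finite_action
begin

lemma cuntz_quotient: "cstar_quotient T (cuntz_ideal E G act)"
proof (rule cstar_quotient.intro)
  show "cstar_algebra T" by (rule cstar_algebra_toeplitz_alg)
  show "cstar_quotient_axioms T (cuntz_ideal E G act)"
  proof (rule cstar_quotient_axioms.intro)
    show "ideal (cuntz_ideal E G act) T" by (rule ideal_cuntz_ideal)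
    show "star T a \<in> cuntz_ideal E G act" if "a \<in> cuntz_ideal E G act" for a
      using that by (rule star_cuntz_ideal)
  qed
qed

sublocale Q: cstar_quotient T "cuntz_ideal E G act"
  by (rule cuntz_quotient)

lemma CA_eq: "CA = cstar_quot T (cuntz_ideal E G act)"
  by (simp add: cuntz_alg_def)

abbreviation "q \<equiv> Q.q"

definition \<kappa> :: "('v, 'e, 'g) generator free_alg \<Rightarrow> ('v, 'e, 'g) cuntz_elem" where
  "\<kappa> a = q (\<tau> a)"

lemma kappa_hom: "\<kappa> a \<otimes>\<^bsub>CA\<^esub> \<kappa> b = \<kappa> (a * b)" "\<kappa> a \<oplus>\<^bsub>CA\<^esub> \<kappa> b = \<kappa> (a + b)" "\<kappa> a \<ominus>\<^bsub>CA\<^esub> \<kappa> b = \<kappa> (a - b)"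
  "z \<odot>\<^bsub>CA\<^esub> \<kappa> a = \<kappa> (free_scale z a)" "star CA (\<kappa> a) = \<kappa> (free_star a)" "\<one>\<^bsub>CA\<^esub> = \<kappa> 1"
  by (simp_all add: \<kappa>_def CA_eq Q.q_mult Q.q_add Q.q_minus Q.q_scale Q.q_star Q.q_one tau_hom)

lemma kappa_closed [simp]: "\<kappa> a \<in> carrier CA"
  by (simp add: \<kappa>_def CA_eq)

lemma kappa_rel: "(a, b) \<in> toeplitz_rel E G act \<Longrightarrow> \<kappa> a = \<kappa> b"
  by (simp add: \<kappa>_def tau_rel)

lemma kappa_ck: "\<kappa> (gP v) = \<kappa> (ck_sum E v)"
proof -
  have "\<tau> (ck_defect v) \<in> ck_elts" by (auto simp: ck_elts_def)
  then have "\<tau> (ck_defect v) \<in> cuntz_ideal E G act" unfolding cuntz_ideal_eq by blast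
  then show ?thesis by (simp add: \<kappa>_def Q.q_eq_iff tau_hom)
qed

lemma cuntz_gen_kappa: "cuntz_gen E G act y = \<kappa> (free_gen y)"
  by (simp add: cuntz_gen_def \<kappa>_def Q.q_def toeplitz_gen_def)

lemma tau_dense:
  assumes "t \<in> carrier T" "0 < \<epsilon>"
  obtains a where "cnorm T (t \<ominus>\<^bsub>T\<^esub> \<tau> a) < \<epsilon>"
  using Tn.to_c_dense[of t \<epsilon>] assms unfolding toeplitz_alg_def by blast

text \<open>Words span a dense subspace: approximating a representative leaves an error controlled
  by \<open>K\<close>. The bound is stated in the norm of \<open>T\<close>, where pulled-back states
  are contractive.\<close>

lemma bounded_functional_zero:
  assumes add: "\<And>a b. a \<in> carrier CA \<Longrightarrow> b \<in> carrier CA \<Longrightarrow> \<theta> (a \<oplus>\<^bsub>CA\<^esub> b) = \<theta> a + \<theta> b"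
    and scale: "\<And>a z. a \<in> carrier CA \<Longrightarrow> \<theta> (z \<odot>\<^bsub>CA\<^esub> a) = z * \<theta> a"
    and bounded: "\<And>t. t \<in> carrier T \<Longrightarrow> cmod (\<theta> (q t)) \<le> K * cnorm T t"
    and zero: "\<And>w. \<theta> (\<kappa> (mon w)) = 0"
    and y: "y \<in> carrier CA"
  shows "\<theta> y = 0"
proof -
  interpret f: free_functional "\<lambda>a. \<theta> (\<kappa> a)"
    by unfold_locales (simp_all add: add scale flip: kappa_hom(2,4))
  have \<theta>\<kappa>: "\<theta> (\<kappa> a) = 0" for a using f.expand[of a] zero by simp
  obtain t where t: "t \<in> carrier T" "y = q t" using y by (auto simp: CA_eq Q.carrier_Q)
  have "cmod (\<theta> y) \<le> \<epsilon>" if e: "0 < \<epsilon>" for \<epsilon>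
  proof -
    obtain a where a: "cnorm T (t \<ominus>\<^bsub>T\<^esub> \<tau> a) < \<epsilon> / (\<bar>K\<bar> + 1)"
      using tau_dense[OF t(1), of "\<epsilon> / (\<bar>K\<bar> + 1)"] e by auto
    let ?d = "t \<ominus>\<^bsub>T\<^esub> \<tau> a"
    have d: "?d \<in> carrier T" using t by simp
    have "?d \<oplus>\<^bsub>T\<^esub> \<tau> a = t"
      by (rule T.minus_add_cancel[OF t(1) tau_closed])
    then have "y = q ?d \<oplus>\<^bsub>CA\<^esub> \<kappa> a" using t d by (simp add: CA_eq Q.q_add \<kappa>_def)
    moreover have "q ?d \<in> carrier CA" using d by (simp add: CA_eq)
    ultimately have "\<theta> y = \<theta> (q ?d)" using add[OF _ kappa_closed, of "q ?d" a] by (simp only: \<theta>\<kappa> add_0_right)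
    then have "cmod (\<theta> y) \<le> K * cnorm T ?d" using bounded[OF d] by simp
    also have "\<dots> \<le> (\<bar>K\<bar> + 1) * cnorm T ?d" using T.cnorm_nonneg[OF d] by (intro mult_right_mono) auto
    also have "\<dots> \<le> (\<bar>K\<bar> + 1) * (\<epsilon> / (\<bar>K\<bar> + 1))" using a by (intro mult_left_mono) auto
    finally show ?thesis by simp
  qed
  then have "cmod (\<theta> y) \<le> 0" by (rule field_le_epsilon[of _ 0, simplified])
  then show ?thesis by simp
qed

lemma states_eqI:
  assumes st: "is_state CA \<phi>" "is_state CA \<psi>" and eq: "\<And>w. \<phi> (\<kappa> (mon w)) = \<psi> (\<kappa> (mon w))" and y: "y \<in> carrier CA"
  shows "\<phi> y = \<psi> y"
proof -
  have "\<phi> y - \<psi> y = 0"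
  proof (rule bounded_functional_zero[OF _ _ _ _ y, of "\<lambda>y. \<phi> y - \<psi> y" 2])
    fix t assume t: "t \<in> carrier T"
    have "cmod (\<phi> (q t)) \<le> cnorm T t" "cmod (\<psi> (q t)) \<le> cnorm T t"
      using T.state_le_cnorm[OF Q.state_q t] st by (simp_all add: CA_eq)
    then show "cmod (\<phi> (q t) - \<psi> (q t)) \<le> 2 * cnorm T t" using norm_triangle_ineq4[of "\<phi> (q t)" "\<psi> (q t)"] by simp
  qed (use st eq in \<open>auto simp: is_state_def right_diff_distrib\<close>)
  then show ?thesis by simp
qed

lemma state_kappa_functional:
  assumes st: "is_state CA \<phi>"
  shows "pos_functional (\<lambda>a. \<phi> (\<kappa> a))"
    and "(a, b) \<in> toeplitz_rel E G act \<Longrightarrow> eqv (\<lambda>a. \<phi> (\<kappa> a)) a b"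
    and "eqv (\<lambda>a. \<phi> (\<kappa> a)) (gP v) (ck_sum E v)"
    and "\<phi> (\<kappa> 1) = 1"
proof -
  show "pos_functional (\<lambda>a. \<phi> (\<kappa> a))"
    using st by unfold_locales (simp_all add: is_state_def flip: kappa_hom)
  show "\<phi> (\<kappa> 1) = 1" using st by (simp add: is_state_def flip: kappa_hom)
  have eqv: "eqv (\<lambda>a. \<phi> (\<kappa> a)) a b" if "\<kappa> a = \<kappa> b" for a b
    using that by (simp add: eqv_def flip: kappa_hom(1))
  show "(a, b) \<in> toeplitz_rel E G act \<Longrightarrow> eqv (\<lambda>a. \<phi> (\<kappa> a)) a b"
    by (rule eqv[OF kappa_rel])
  show "eqv (\<lambda>a. \<phi> (\<kappa> a)) (gP v) (ck_sum E v)" by (rule eqv[OF kappa_ck])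
qed

end

section \<open>The Perron-Frobenius state\<close>

context perron_action
begin

lemma omega_ck_defect: "eqv omega (ck_defect v) 0"
  using omega_ck by (simp only: om.eqv_diff_iff)

text \<open>Equivalence for \<open>omega\<close> becomes a vanishing value of \<open>gns\<close>.
  The defect \<open>d\<close> is equivalent to 0, and so is \<open>d* d\<close>, which settles the
  order relation.\<close>

lemma gns_in_toeplitz_seminorms: "om.gns \<in> toeplitz_seminorms E G act"
proof (rule toeplitz_seminormI[OF om.cstar_seminorm_gns])
  show "om.gns (a - b) = 0" if "(a, b) \<in> toeplitz_rel E G act" for a b
    using omega_toeplitz_rel[OF that] by (intro om.gns_eqv_0) (simp only: om.eqv_diff_iff)
  fix v
  have "eqv omega (free_star (ck_defect v) * ck_defect v) 0"
    using eqv_mult[OF eqv_refl omega_ck_defect, of "free_star (ck_defect v)" v] by simp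
  from om.eqv_diff[OF omega_ck_defect[of v] this]
  show "om.gns (ck_defect v - free_star (ck_defect v) * ck_defect v) = 0"
    by (intro om.gns_eqv_0) simp
qed

text \<open>\<open>gns\<close> is one of the seminorms under the supremum, and the vector
  \<open>1\<close> has norm 1.\<close>

lemma omega_le: "cmod (omega a) \<le> 1 * N a"
proof -
  have "cmod (omega a) \<le> om.gns a"
    using om.functional_le_gns[of a] by (simp add: om.hn_square omega_1)
  also have "\<dots> \<le> N a"
    unfolding toeplitz_norm_def by (rule cSUP_upper[OF gns_in_toeplitz_seminorms bdd_above_toeplitz_seminorms])
  finally show ?thesis by simp
qed

definition omT :: "('v, 'e, 'g) toeplitz_elem \<Rightarrow> complex" where
  "omT = Tn.cext omega"

lemma omT_lim: "xs \<in> cauchy_seqs N \<Longrightarrow> (\<lambda>n. omega (xs n)) \<longlonglongrightarrow> omT (cauchy_class N xs)"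
  unfolding omT_def by (rule Tn.cext_lim[OF om.free_functional_axioms omega_le])

lemma T_cases:
  assumes "y \<in> carrier T"
  obtains xs where "xs \<in> cauchy_seqs N" "y = cauchy_class N xs"
  using assms by (auto simp: toeplitz_alg_def Tn.carrier_completion)

lemma omT_tau: "omT (\<tau> a) = omega a"
  using LIMSEQ_unique[OF omT_lim[OF Tn.cauchy_const[of a]] tendsto_const] by (simp add: to_completion_def)

lemma state_omT: "is_state T omT"
  unfolding is_state_def
proof (intro conjI ballI allI)
  fix a assume "a \<in> carrier T"
  then obtain xs where xs: "xs \<in> cauchy_seqs N" "a = cauchy_class N xs" by (rule T_cases)
  show "omT (z \<odot>\<^bsub>T\<^esub> a) = z * omT a" for z
    using LIMSEQ_unique[OF omT_lim[OF Tn.cauchy_scale[OF xs(1)], unfolded om.scale] tendsto_mult_left[OF omT_lim[OF xs(1)]]] xs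
    by (simp add: toeplitz_alg_def Tn.smult_class om.scale)
  have "(\<lambda>n. omega (free_star (xs n) * xs n)) \<longlonglongrightarrow> omT (star T a \<otimes>\<^bsub>T\<^esub> a)"
    using omT_lim[of "\<lambda>n. free_star (xs n) * xs n"] xs by (simp add: toeplitz_alg_def Tn.star_class Tn.mult_class)
  from Lim_in_closed_set[OF closed_nonneg_Reals_complex _ _ this]
  show "omT (star T a \<otimes>\<^bsub>T\<^esub> a) \<in> \<real>\<^sub>\<ge>\<^sub>0" by (simp add: omega_pos)
  fix b assume "b \<in> carrier T"
  then obtain ys where ys: "ys \<in> cauchy_seqs N" "b = cauchy_class N ys" by (rule T_cases)
  show "omT (a \<oplus>\<^bsub>T\<^esub> b) = omT a + omT b"
    using LIMSEQ_unique[OF omT_lim[OF Tn.cauchy_add[OF xs(1) ys(1)], unfolded om.add] tendsto_add[OF omT_lim[OF xs(1)] omT_lim[OF ys(1)]]] xs ys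
    by (simp add: toeplitz_alg_def Tn.add_class om.add)
next
  show "omT \<one>\<^bsub>T\<^esub> = 1" by (simp add: tau_hom omT_tau omega_1)
qed

text \<open>The elements that \<open>omT\<close> annihilates under all two-sided multiplications
  form a closed ideal. It contains the generators because each defect is equivalent to 0 for
  \<open>omega\<close>.\<close>

lemma omT_cuntz_ideal:
  assumes "a \<in> cuntz_ideal E G act"
  shows "omT a = 0"
proof -
  define J where "J = {a \<in> carrier T. \<forall>y\<in>carrier T. \<forall>z\<in>carrier T. omT (y \<otimes>\<^bsub>T\<^esub> a \<otimes>\<^bsub>T\<^esub> z) = 0}"
  note T_simps = ring.ring_simprules[OF T.ring_A]
  note st = T.state_add[OF state_omT] T.state_minus[OF state_omT] T.state_le_cnorm[OF state_omT]
  have zero: "omT \<zero>\<^bsub>T\<^esub> = 0" by (simp add: tau_hom omT_tau)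
  have "ideal J T"
  proof (rule T.idealI')
    show "\<zero>\<^bsub>T\<^esub> \<in> J" by (simp add: J_def zero)
    show "a \<oplus>\<^bsub>T\<^esub> b \<in> J" if "a \<in> J" "b \<in> J" for a b
      using that by (simp add: J_def T_simps(23) T_simps(13) st)
    show "y \<otimes>\<^bsub>T\<^esub> a \<in> J" if "a \<in> J" "y \<in> carrier T" for a y
    proof -
      have "omT (u \<otimes>\<^bsub>T\<^esub> (y \<otimes>\<^bsub>T\<^esub> a) \<otimes>\<^bsub>T\<^esub> z) = omT ((u \<otimes>\<^bsub>T\<^esub> y) \<otimes>\<^bsub>T\<^esub> a \<otimes>\<^bsub>T\<^esub> z)"
        if "u \<in> carrier T" "z \<in> carrier T" for u z
        using that \<open>a \<in> J\<close> \<open>y \<in> carrier T\<close> by (simp add: J_def T_simps(11))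
      then show ?thesis using that by (simp add: J_def)
    qed
    show "a \<otimes>\<^bsub>T\<^esub> y \<in> J" if "a \<in> J" "y \<in> carrier T" for a y
    proof -
      have "omT (u \<otimes>\<^bsub>T\<^esub> (a \<otimes>\<^bsub>T\<^esub> y) \<otimes>\<^bsub>T\<^esub> z) = omT (u \<otimes>\<^bsub>T\<^esub> a \<otimes>\<^bsub>T\<^esub> (y \<otimes>\<^bsub>T\<^esub> z))"
        if "u \<in> carrier T" "z \<in> carrier T" for u z
        using that \<open>a \<in> J\<close> \<open>y \<in> carrier T\<close> by (simp add: J_def T_simps(11))
      then show ?thesis using that by (simp add: J_def)
    qed
  qed (auto simp: J_def)
  moreover have "cstar_closed T J"
    unfolding cstar_closed_def
  proof (intro allI impI)
    fix xs a assume *: "(\<forall>n. xs n \<in> J) \<and> a \<in> carrier T \<and> (\<lambda>n. cnorm T (xs n \<ominus>\<^bsub>T\<^esub> a)) \<longlonglongrightarrow> 0"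
    then have xs: "\<And>n. xs n \<in> carrier T" by (simp add: J_def)
    have "omT (y \<otimes>\<^bsub>T\<^esub> a \<otimes>\<^bsub>T\<^esub> z) = 0" if yz: "y \<in> carrier T" "z \<in> carrier T" for y z
    proof -
      have le: "cmod (omT (y \<otimes>\<^bsub>T\<^esub> a \<otimes>\<^bsub>T\<^esub> z)) \<le> cnorm T y * cnorm T (xs n \<ominus>\<^bsub>T\<^esub> a) * cnorm T z" for n
      proof -
        let ?d = "xs n \<ominus>\<^bsub>T\<^esub> a"
        have d: "?d \<in> carrier T" using xs * by simp
        have "xs n \<in> J" using * by blast
        then have "omT (y \<otimes>\<^bsub>T\<^esub> xs n \<otimes>\<^bsub>T\<^esub> z) = 0" using yz by (simp add: J_def)
        moreover have "y \<otimes>\<^bsub>T\<^esub> ?d \<otimes>\<^bsub>T\<^esub> z = (y \<otimes>\<^bsub>T\<^esub> xs n \<otimes>\<^bsub>T\<^esub> z) \<ominus>\<^bsub>T\<^esub> (y \<otimes>\<^bsub>T\<^esub> a \<otimes>\<^bsub>T\<^esub> z)"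
          using xs[of n] * yz by (simp add: T_simps(14) T_simps(23) T_simps(13) T_simps(27) T_simps(26))
        ultimately have "cmod (omT (y \<otimes>\<^bsub>T\<^esub> a \<otimes>\<^bsub>T\<^esub> z)) = cmod (omT (y \<otimes>\<^bsub>T\<^esub> ?d \<otimes>\<^bsub>T\<^esub> z))"
          using xs[of n] * yz by (simp add: st)
        also have "\<dots> \<le> cnorm T (y \<otimes>\<^bsub>T\<^esub> ?d \<otimes>\<^bsub>T\<^esub> z)" by (rule st(3)) (use d yz in simp)
        also have "\<dots> \<le> cnorm T (y \<otimes>\<^bsub>T\<^esub> ?d) * cnorm T z" by (rule T.cnorm_mult) (use d yz in simp_all)
        also have "\<dots> \<le> cnorm T y * cnorm T ?d * cnorm T z"
          using T.cnorm_mult[OF yz(1) d] T.cnorm_nonneg[OF yz(2)] by (rule mult_right_mono)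
        finally show ?thesis .
      qed
      have "(\<lambda>n. cnorm T y * cnorm T (xs n \<ominus>\<^bsub>T\<^esub> a) * cnorm T z) \<longlonglongrightarrow> 0"
        using * by (intro tendsto_mult_left_zero tendsto_mult_right_zero) blast
      then have "cmod (omT (y \<otimes>\<^bsub>T\<^esub> a \<otimes>\<^bsub>T\<^esub> z)) \<le> 0"
        by (rule LIMSEQ_le_const) (use le in auto)
      then show ?thesis by simp
    qed
    then show "a \<in> J" using * by (simp add: J_def)
  qed
  moreover have "ck_elts \<subseteq> J"
  proof
    fix a assume "a \<in> ck_elts"
    then obtain v where a: "a = \<tau> (ck_defect v)" by (auto simp: ck_elts_def)
    have "omT (y \<otimes>\<^bsub>T\<^esub> a \<otimes>\<^bsub>T\<^esub> z) = 0" if yz: "y \<in> carrier T" "z \<in> carrier T" for y z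
    proof -
      obtain ys where ys: "ys \<in> cauchy_seqs N" "y = cauchy_class N ys" using yz(1) by (rule T_cases)
      obtain zs where zs: "zs \<in> cauchy_seqs N" "z = cauchy_class N zs" using yz(2) by (rule T_cases)
      have c: "(\<lambda>n. ys n * ck_defect v * zs n) \<in> cauchy_seqs N"
        using Tn.cauchy_mult[OF Tn.cauchy_mult[OF ys(1) Tn.cauchy_const] zs(1)] .
      have "y \<otimes>\<^bsub>T\<^esub> a \<otimes>\<^bsub>T\<^esub> z = cauchy_class N (\<lambda>n. ys n * ck_defect v * zs n)"
        unfolding a ys(2) zs(2) to_completion_def toeplitz_alg_def
        by (simp only: Tn.mult_class ys(1) zs(1) Tn.cauchy_const Tn.cauchy_mult)
      moreover have "omega (ys n * ck_defect v * zs n) = 0" for n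
        using omega_ck_defect[of v] unfolding eqv_def by simp
      ultimately show ?thesis using LIMSEQ_unique[OF omT_lim[OF c]] by simp
    qed
    then show "a \<in> J" by (simp add: J_def a)
  qed
  ultimately have "cuntz_ideal E G act \<subseteq> J" by (rule cuntz_ideal_subset)
  then have "a \<in> J" using assms by (rule subsetD)
  then have "omT (\<one>\<^bsub>T\<^esub> \<otimes>\<^bsub>T\<^esub> a \<otimes>\<^bsub>T\<^esub> \<one>\<^bsub>T\<^esub>) = 0" "a \<in> carrier T"
    using T.A_one_closed unfolding J_def by blast+
  then show ?thesis by simp
qed

lemma ex_perron_state:
  obtains \<psi> where "is_state CA \<psi>" "\<And>a. \<psi> (\<kappa> a) = omega a"
proof -
  obtain \<psi> where "is_state CA \<psi>" "\<And>a. a \<in> carrier T \<Longrightarrow> \<psi> (q a) = omT a"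
    using Q.state_descends[OF state_omT omT_cuntz_ideal] unfolding CA_eq by blast
  then show thesis using that by (simp add: \<kappa>_def omT_tau)
qed

end


section \<open>Trace-like functionals on the Cuntz-Pimsner algebra\<close>

definition sw :: "'e list \<Rightarrow> ('v, 'e, 'g) generator star_word" where
  "sw es = Word (map (\<lambda>e. (GenS e, False)) es)"

definition Sw :: "'e list \<Rightarrow> ('v, 'e, 'g) generator free_alg" where
  "Sw es = mon (sw es)"

lemma cancel_aux: "a - (a + b) + b = (0 :: 'a :: ab_group_add)"
  by simp

lemma option_eqI:
  assumes "\<And>y. a = Some y \<longleftrightarrow> b = Some y"
  shows "a = b"
proof (cases a)
  case None
  then show ?thesis using assms[of "the b"] by (cases b) auto
next
  case (Some y)
  then show ?thesis using assms[of y] by simp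
qed

lemma Sw_Nil [simp]: "Sw [] = 1"
  by (simp add: Sw_def sw_def flip: zero_star_word_def mon_0)

lemma Sw_append: "Sw (xs @ ys) = Sw xs * Sw ys"
  by (simp add: Sw_def sw_def plus_star_word_def flip: mon_add)

lemma Sw_Cons: "Sw (e # es) = gS e * Sw es"
  by (simp add: Sw_def sw_def plus_star_word_def free_gen_mon flip: mon_add)

text \<open>Common description of \<open>omega\<close> and of a KMS state composed with
  \<open>\<kappa>\<close>, with \<open>c\<close> in the role of \<open>exp \<beta>\<close>. The
  values of the state in part (1) and the comparison in part (2) both follow from these
  properties.\<close>

locale ck_functional = perron_action E G act x r + pos_functional \<phi>
  for E :: "('v::finite, 'e::finite) digraph" and G :: "('g, 'v) groupoid"
    and act :: "'g \<Rightarrow> ('v, 'e) path \<Rightarrow> ('v, 'e) path" and x :: "'v \<Rightarrow> real" and r :: real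
    and \<phi> :: "('v, 'e, 'g) generator free_alg \<Rightarrow> complex" +
  fixes c :: real
  assumes rel: "(a, b) \<in> toeplitz_rel E G act \<Longrightarrow> eqv \<phi> a b"
    and ck: "eqv \<phi> (gP v) (ck_sum E v)"
    and one: "\<phi> 1 = 1"
    and c_pos: "0 < c"
    and trace: "\<phi> (mon u * mon w) = of_real (c powi deg w) * \<phi> (mon w * mon u)"
    and gauge: "deg w \<noteq> 0 \<Longrightarrow> \<phi> (mon w) = 0"
begin

abbreviation eq (infix "\<sim>" 50) where "a \<sim> b \<equiv> eqv \<phi> a b"

lemma deg_sw: "deg (sw es) = int (length es)"
  by (induction es) (simp_all add: deg_def sw_def)

lemma mult_l: "a \<sim> b \<Longrightarrow> z * a \<sim> z * b" and mult_r: "a \<sim> b \<Longrightarrow> a * z \<sim> b * z"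
  by (auto intro: eqv_mult)

lemma PP: "gP v * gP v \<sim> gP v" by (rule rel[OF toeplitz_rel.P_idem])
lemma P_star: "free_star (gP v) \<sim> gP v" by (rule rel[OF toeplitz_rel.P_star])
lemma SS: "free_star (gS e) * gS e \<sim> gP (src E e)" by (rule rel[OF toeplitz_rel.S_isom])
lemma U_id: "gU (gid G v) \<sim> gP v" by (rule rel[OF toeplitz_rel.U_unit])

lemma P_U: "gP v * gU g \<sim> (if v = gcod G g then gU g else 0)"
proof -
  have "gP v * gU g \<sim> gU (gid G v) * gU g" by (rule mult_r[OF eqv_sym[OF U_id]])
  also have "\<dots> \<sim> (if v = gcod G g then gU g else 0)"
    using rel[OF toeplitz_rel.U_comp[of G "gid G v" g E act]] rel[OF toeplitz_rel.U_orth[of G "gid G v" g E act]]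
    by (auto simp: gdom_id comp_id_left)
  finally show ?thesis .
qed

lemma U_P: "gU g * gP (gdom G g) \<sim> gU g"
proof -
  have "gU g * gP (gdom G g) \<sim> gU g * gU (gid G (gdom G g))" by (rule mult_l[OF eqv_sym[OF U_id]])
  also have "\<dots> \<sim> gU g"
    using rel[OF toeplitz_rel.U_comp[of G g "gid G (gdom G g)" E act]] by (simp add: gcod_id comp_id_right)
  finally show ?thesis .
qed

text \<open>For \<open>d = s - s p\<close> the four terms of \<open>d* d\<close> are all equivalent
  to \<open>p\<close> and cancel, so \<open>d\<close> is null by \<open>eqv_0I\<close>.\<close>

lemma S_P: "gS e * gP (src E e) \<sim> gS e"
proof -
  let ?p = "gP (src E e) :: ('v, 'e, 'g) generator free_alg" and ?s = "gS e :: ('v, 'e, 'g) generator free_alg"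
  have "free_star (?s - ?s * ?p) * (?s - ?s * ?p) =
     (free_star ?s * ?s - free_star ?s * ?s * ?p) - (free_star ?p * (free_star ?s * ?s) - free_star ?p * (free_star ?s * ?s) * ?p)"
    by (simp add: free_star_diff free_star_mult left_diff_distrib right_diff_distrib mult.assoc)
  also have "\<dots> \<sim> (?p - ?p) - (?p - ?p)"
  proof (intro eqv_diff)
    have pp: "free_star ?p * (free_star ?s * ?s) \<sim> ?p"
      by (rule eqv_trans[OF eqv_mult[OF P_star SS] PP])
    show "free_star ?s * ?s * ?p \<sim> ?p" by (rule eqv_trans[OF mult_r[OF SS] PP])
    show "free_star ?p * (free_star ?s * ?s) * ?p \<sim> ?p" by (rule eqv_trans[OF mult_r[OF pp] PP])
    show "free_star ?p * (free_star ?s * ?s) \<sim> ?p" by (rule pp)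
  qed (rule SS)
  finally have "free_star (?s - ?s * ?p) * (?s - ?s * ?p) \<sim> 0" by simp
  then have "\<phi> (free_star ((?s - ?s * ?p) * y) * ((?s - ?s * ?p) * y)) = 0" for y
    by (simp add: eqv_def free_star_mult mult.assoc)
  then have "?s - ?s * ?p \<sim> 0" by (rule eqv_0I)
  then show ?thesis by (simp only: eqv_diff_iff) (rule eqv_sym)
qed

text \<open>Put \<open>d = s_e - p s_e\<close> and \<open>z_f = s_f* s_e\<close>. Compressing the
  Cuntz-Krieger relation by \<open>s_e\<close> gives \<open>s_e* p s_e\<close> as the sum of all
  \<open>z_f* z_f\<close>, whose term at \<open>f = e\<close> is \<open>s_e* s_e\<close>. Hence
  \<open>d* d\<close> plus the sum of \<open>z_f* z_f\<close> over the other edges is null, and each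
  positive term vanishes separately.\<close>

lemma S_range_orth:
  shows P_S_self: "gP (rng E e) * gS e \<sim> gS e"
    and S_orth_aux: "rng E f = rng E e \<Longrightarrow> f \<noteq> e \<Longrightarrow> free_star (gS f) * gS e \<sim> 0"
proof -
  let ?p = "gP (rng E e) :: ('v, 'e, 'g) generator free_alg" and ?s = "gS e :: ('v, 'e, 'g) generator free_alg"
  let ?F = "{f. rng E f = rng E e} - {e}"
  let ?z = "\<lambda>f. free_star (gS f) * ?s" and ?d = "?s - ?p * ?s"
  have E: "free_star ?d * ?d = (free_star ?s * ?s - free_star ?s * (?p * ?s)) -
      (free_star ?s * (free_star ?p * ?s) - free_star ?s * (free_star ?p * ?p * ?s))"
    by (simp add: free_star_diff free_star_mult left_diff_distrib right_diff_distrib mult.assoc)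
  have "free_star ?d * ?d \<sim> (free_star ?s * ?s - free_star ?s * (?p * ?s)) - (free_star ?s * (?p * ?s) - free_star ?s * (?p * ?s))"
    unfolding E
    by (intro eqv_diff eqv_refl mult_l mult_r P_star eqv_trans[OF mult_r[OF P_star] PP])
  then have d: "free_star ?d * ?d \<sim> free_star ?s * ?s - free_star ?s * (?p * ?s)"
    by (simp only: diff_self diff_zero)
  have a1: "free_star ?s * (?p * ?s) \<sim> free_star ?s * (ck_sum E (rng E e) * ?s)"
    by (intro mult_l mult_r ck)
  have e1: "free_star ?s * (ck_sum E (rng E e) * ?s) = (\<Sum>f\<in>{f. rng E f = rng E e}. free_star (?z f) * ?z f)"
    by (simp add: sum_distrib_left sum_distrib_right free_star_mult mult.assoc)
  have e2: "(\<Sum>f\<in>{f. rng E f = rng E e}. free_star (?z f) * ?z f) = free_star (?z e) * ?z e + (\<Sum>f\<in>?F. free_star (?z f) * ?z f)"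
    by (rule sum.remove) auto
  have a2: "free_star (?z e) * ?z e + (\<Sum>f\<in>?F. free_star (?z f) * ?z f) \<sim> free_star ?s * ?s + (\<Sum>f\<in>?F. free_star (?z f) * ?z f)"
  proof (intro eqv_add eqv_refl)
    have "free_star (?z e) * ?z e \<sim> free_star (gP (src E e)) * gP (src E e)"
      by (rule eqv_mult[OF eqv_star[OF SS] SS])
    also have "\<dots> \<sim> gP (src E e)" by (rule eqv_trans[OF mult_r[OF P_star] PP])
    also have "\<dots> \<sim> free_star ?s * ?s" by (rule eqv_sym[OF SS])
    finally show "free_star (?z e) * ?z e \<sim> free_star ?s * ?s" .
  qed
  note a3 = eqv_trans[OF a1[unfolded e1 e2] a2]
  have "free_star ?d * ?d + (\<Sum>f\<in>?F. free_star (?z f) * ?z f) \<sim>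
     free_star ?s * ?s - (free_star ?s * ?s + (\<Sum>f\<in>?F. free_star (?z f) * ?z f)) + (\<Sum>f\<in>?F. free_star (?z f) * ?z f)"
    by (intro eqv_add eqv_refl eqv_trans[OF d] eqv_diff a3)
  then have tot: "free_star ?d * ?d + (\<Sum>f\<in>?F. free_star (?z f) * ?z f) \<sim> 0"
    by (simp only: cancel_aux)
  have zero: "Re (\<phi> (free_star (?d * y) * (?d * y))) = 0"
      "\<And>f. f \<in> ?F \<Longrightarrow> Re (\<phi> (free_star (?z f * y) * (?z f * y))) = 0" for y
  proof -
    have "\<phi> (free_star y * (free_star ?d * ?d + (\<Sum>f\<in>?F. free_star (?z f) * ?z f)) * y) = 0"
      using tot by (simp add: eqv_def)
    moreover have "free_star y * (free_star ?d * ?d + (\<Sum>f\<in>?F. free_star (?z f) * ?z f)) * y =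
       free_star (?d * y) * (?d * y) + (\<Sum>f\<in>?F. free_star (?z f * y) * (?z f * y))"
      by (simp only: distrib_left distrib_right sum_distrib_left sum_distrib_right free_star_mult mult.assoc)
    ultimately have s: "Re (\<phi> (free_star (?d * y) * (?d * y))) + (\<Sum>f\<in>?F. Re (\<phi> (free_star (?z f * y) * (?z f * y)))) = 0"
      by (simp only: add sum Re_sum[symmetric] plus_complex.sel(1)[symmetric]) simp
    have nn: "0 \<le> (\<Sum>f\<in>?F. Re (\<phi> (free_star (?z f * y) * (?z f * y))))" by (intro sum_nonneg Re_pos)
    show "Re (\<phi> (free_star (?d * y) * (?d * y))) = 0" using s nn Re_pos[of "?d * y"] by linarith
    then have "(\<Sum>f\<in>?F. Re (\<phi> (free_star (?z f * y) * (?z f * y)))) = 0" using s by simp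
    then show "Re (\<phi> (free_star (?z f * y) * (?z f * y))) = 0" if "f \<in> ?F" for f
      using that sum_nonneg_eq_0_iff[of ?F "\<lambda>f. Re (\<phi> (free_star (?z f * y) * (?z f * y)))"] Re_pos by auto
  qed
  have "?d \<sim> 0" by (rule eqv_0I) (simp only: complex_eq_iff zero Im_pos zero_complex.sel simp_thms)
  then show "?p * ?s \<sim> ?s" by (simp only: eqv_diff_iff) (rule eqv_sym)
  show "free_star (gS f) * ?s \<sim> 0" if "rng E f = rng E e" "f \<noteq> e"
    by (rule eqv_0I) (use that in \<open>simp only: complex_eq_iff zero Im_pos zero_complex.sel simp_thms mem_Collect_eq Diff_iff insert_iff empty_iff\<close>)
qed

lemma P_S: "gP v * gS e \<sim> (if v = rng E e then gS e else 0)"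
proof (cases "v = rng E e")
  case False
  have "gP v * gS e \<sim> gP v * (gP (rng E e) * gS e)" by (rule mult_l[OF eqv_sym[OF P_S_self]])
  also have "\<dots> = (gP v * gP (rng E e)) * gS e" by (simp add: mult.assoc)
  also have "\<dots> \<sim> 0 * gS e" by (rule mult_r[OF rel[OF toeplitz_rel.P_orth[OF False]]])
  finally show ?thesis using False by simp
qed (simp add: P_S_self)

lemma S_orth: "free_star (gS f) * gS e \<sim> (if f = e then gP (src E e) else 0)"
proof (cases "rng E f = rng E e")
  case True
  then show ?thesis using SS S_orth_aux by auto
next
  case False
  have "free_star (gS f) * gS e \<sim> free_star (gP (rng E f) * gS f) * gS e"
    by (rule mult_r[OF eqv_sym[OF eqv_star[OF P_S_self]]])
  also have "\<dots> = free_star (gS f) * (free_star (gP (rng E f)) * gS e)" by (simp add: free_star_mult mult.assoc)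
  also have "\<dots> \<sim> free_star (gS f) * (gP (rng E f) * gS e)" by (intro mult_l mult_r P_star)
  also have "\<dots> \<sim> free_star (gS f) * 0" using mult_l[OF P_S[of "rng E f" e]] False by simp
  finally show ?thesis using False by auto
qed

lemma U_star: "free_star (gU h) \<sim> gU (ginv h)"
proof -
  have "gU (ginv h) \<sim> gU (ginv h) * gP (gcod G h)" using eqv_sym[OF U_P[of "ginv h"]] by simp
  also have "\<dots> \<sim> gU (ginv h) * (gU h * free_star (gU h))" by (rule mult_l[OF eqv_sym[OF rel[OF toeplitz_rel.U_final]]])
  also have "\<dots> = (gU (ginv h) * gU h) * free_star (gU h)" by (simp add: mult.assoc)
  also have "\<dots> \<sim> gU (gid G (gdom G h)) * free_star (gU h)"
    using mult_r[OF rel[OF toeplitz_rel.U_comp[of G "ginv h" h E act]]] by (simp add: ginv_left)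
  also have "\<dots> \<sim> free_star (gP (gdom G h)) * free_star (gU h)"
    by (rule mult_r[OF eqv_trans[OF U_id eqv_sym[OF P_star]]])
  also have "\<dots> = free_star (gU h * gP (gdom G h))" by (simp add: free_star_mult)
  also have "\<dots> \<sim> free_star (gU h)" by (rule eqv_star[OF U_P])
  finally show ?thesis by (rule eqv_sym)
qed

text \<open>The free element for which a point stands. Through it the partial action becomes left
  multiplication modulo \<open>\<sim>\<close>, with \<open>None\<close> read as 0 by
  \<open>Tho\<close>.\<close>

definition Th :: "'e list \<times> 'g \<Rightarrow> ('v, 'e, 'g) generator free_alg" where
  "Th \<xi> = Sw (fst \<xi>) * gU (snd \<xi>)"

definition Tho :: "('e list \<times> 'g) option \<Rightarrow> ('v, 'e, 'g) generator free_alg" where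
  "Tho o' = (case o' of None \<Rightarrow> 0 | Some \<xi> \<Rightarrow> Th \<xi>)"

lemma P_Th: "gP v * Th \<xi> \<sim> (if pr \<xi> = v then Th \<xi> else 0)"
proof (cases "fst \<xi>")
  case Nil
  then show ?thesis using P_U[of v "snd \<xi>"] by (auto simp: Th_def pr_def)
next
  case (Cons e es)
  have "gP v * Th \<xi> = gP v * gS e * (Sw es * gU (snd \<xi>))" by (simp add: Th_def Cons Sw_Cons mult.assoc)
  also have "\<dots> \<sim> (if v = rng E e then gS e else 0) * (Sw es * gU (snd \<xi>))" by (rule mult_r[OF P_S])
  finally show ?thesis by (auto simp: Th_def Cons Sw_Cons mult.assoc pr_def)
qed

text \<open>Induction along the path: the relation \<open>US\<close> moves the unitary past one edge
  and leaves the restriction behind.\<close>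

lemma U_Th: "vld \<xi> \<Longrightarrow> gU h * Th \<xi> \<sim> Tho (gact (GenU h) \<xi>)"
proof -
  have "is_walk E v es (gcod G g) \<Longrightarrow>
     gU h * (Sw es * gU g) \<sim> (if v = gdom G h then Sw (la h es) * gU (gcomp G (lr h es) g) else 0)" for v es g
  proof (induction es arbitrary: v h)
    case Nil
    then show ?case
      using rel[OF toeplitz_rel.U_comp[of G h g E act]] rel[OF toeplitz_rel.U_orth[of G h g E act]] by auto
  next
    case (Cons e es)
    then have e: "rng E e = v" and w: "is_walk E (src E e) es (gcod G g)" by auto
    have a: "gU h * (Sw (e # es) * gU g) = gU h * gS e * (Sw es * gU g)" by (simp add: Sw_Cons mult.assoc)
    show ?case
    proof (cases "v = gdom G h")
      case True
      have "gU h * gS e * (Sw es * gU g) \<sim> gS (ea h e) * gU (rs h e) * (Sw es * gU g)"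
        by (rule mult_r[OF rel[OF toeplitz_rel.US]]) (use True e in simp)
      also have "\<dots> = gS (ea h e) * (gU (rs h e) * (Sw es * gU g))" by (simp add: mult.assoc)
      also have "\<dots> \<sim> gS (ea h e) * (Sw (la (rs h e) es) * gU (gcomp G (lr (rs h e) es) g))"
        using mult_l[OF Cons.IH[OF w, of "rs h e"]] True e by (simp add: gdom_rs)
      finally show ?thesis unfolding a using True by (simp add: Sw_Cons mult.assoc)
    next
      case False
      have "gU h * gS e * (Sw es * gU g) \<sim> 0 * (Sw es * gU g)"
        by (rule mult_r[OF rel[OF toeplitz_rel.US_orth]]) (use False e in simp)
      then show ?thesis unfolding a using False by simp
    qed
  qed
  note * = this
  assume v: "vld \<xi>"
  show ?thesis using *[of "pr \<xi>" "fst \<xi>" "snd \<xi>"] v by (auto simp: Th_def Tho_def vld_def)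
qed

lemma gen_Th: "vld \<xi> \<Longrightarrow> free_gen y * Th \<xi> \<sim> Tho (gact y \<xi>)"
proof (cases y)
  case (GenP v)
  then show "vld \<xi> \<Longrightarrow> free_gen y * Th \<xi> \<sim> Tho (gact y \<xi>)" using P_Th[of v \<xi>] by (auto simp: Tho_def)
next
  case (GenU h)
  then show "vld \<xi> \<Longrightarrow> free_gen y * Th \<xi> \<sim> Tho (gact y \<xi>)" using U_Th by (simp del: gact.simps)
next
  case (GenS e)
  assume v: "vld \<xi>"
  have "gS e * Th \<xi> \<sim> gS e * gP (src E e) * Th \<xi>" by (rule mult_r[OF eqv_sym[OF S_P]])
  also have "\<dots> = gS e * (gP (src E e) * Th \<xi>)" by (simp add: mult.assoc)
  also have "\<dots> \<sim> gS e * (if pr \<xi> = src E e then Th \<xi> else 0)" by (rule mult_l[OF P_Th])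
  finally show ?thesis using v by (auto simp: GenS Tho_def Th_def Sw_Cons mult.assoc)
qed

lemma lact_U_star: "lact (GenU h, True) \<xi> = gact (GenU (ginv h)) \<xi>"
proof (rule option_eqI)
  show "lact (GenU h, True) \<xi> = Some \<eta> \<longleftrightarrow> gact (GenU (ginv h)) \<xi> = Some \<eta>" for \<eta>
  proof -
    have "gact (GenU h) \<eta> = Some \<xi>" if "gact (GenU (ginv h)) \<xi> = Some \<eta>"
    proof -
      have "Option.bind (gact (GenU (ginv h)) \<xi>) (gact (GenU h)) = gact (GenP (gcod G h)) \<xi>"
        by (simp only: gact_U_comp gcod_ginv ginv_right gact_U_id)
      moreover have "gact (GenP (gcod G h)) \<xi> = Some \<xi>" using gact_U_dom[OF that] gact_Some(1)[OF that] by simp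
      ultimately show ?thesis using that by (simp del: gact.simps)
    qed
    then show ?thesis
      using lact_star[of "GenU h" False \<xi> \<eta>] gact_U_inverse[of h \<eta> \<xi>] by (auto simp: lact_def simp del: gact.simps)
  qed
qed

text \<open>The length condition is for the letter \<open>s_e*\<close>: on an empty path the partial
  action gives \<open>None\<close>, although \<open>s_e* u_g\<close> need not vanish.\<close>

lemma letter_Th:
  assumes v: "vld \<xi>" and len: "1 \<le> length (fst \<xi>)"
  shows "mon (Word [l]) * Th \<xi> \<sim> Tho (lact l \<xi>)"
proof (cases "snd l")
  case False
  then have "mon (Word [l]) = free_gen (fst l)" by (cases l) (simp add: free_gen_mon)
  then show ?thesis using gen_Th[OF v] False by (simp add: lact_def)
next
  case True
  then have m: "mon (Word [l]) = free_star (free_gen (fst l))" by (cases l) (simp add: free_gen_mon)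
  show ?thesis
  proof (cases "fst l")
    case (GenP u)
    have "lact l \<xi> = gact (GenP u) \<xi>"
    proof (rule option_eqI)
      show "lact l \<xi> = Some \<eta> \<longleftrightarrow> gact (GenP u) \<xi> = Some \<eta>" for \<eta>
        using lact_star[of "GenP u" False \<xi> \<eta>] True GenP by (cases l) (auto simp: lact_def split: if_splits)
    qed
    then show ?thesis using eqv_trans[OF mult_r[OF P_star] gen_Th[OF v, of "GenP u"]] m GenP by simp
  next
    case (GenU h)
    then have "lact l \<xi> = gact (GenU (ginv h)) \<xi>" using lact_U_star True by (cases l) simp
    then show ?thesis using eqv_trans[OF mult_r[OF U_star] U_Th[OF v]] m GenU by (simp del: gact.simps)
  next
    case (GenS e)
    obtain f es where es: "fst \<xi> = f # es" using len by (cases "fst \<xi>") auto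
    define g where "g = snd \<xi>"
    have xi: "\<xi> = (f # es, g)" using es by (simp add: g_def prod_eq_iff)
    have w: "is_walk E (src E f) es (gcod G g)" using v by (simp add: vld_def xi pr_def)
    have v': "vld (es, g)" "pr (es, g) = src E f" using w by (auto intro: vldI pr_eqI)
    have "lact l \<xi> = (if e = f then Some (es, g) else None)"
    proof (rule option_eqI)
      show "lact l \<xi> = Some \<eta> \<longleftrightarrow> (if e = f then Some (es, g) else None) = Some \<eta>" for \<eta>
        using lact_star[of "GenS e" False \<xi> \<eta>] True GenS v'
        by (cases l; cases \<eta>) (auto simp: lact_def xi split: if_splits)
    qed
    moreover have "free_star (gS e) * Th \<xi> \<sim> (if e = f then Th (es, g) else 0)"
    proof -
      have "free_star (gS e) * Th \<xi> = free_star (gS e) * gS f * Th (es, g)"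
        by (simp add: xi Th_def Sw_Cons mult.assoc)
      also have "\<dots> \<sim> (if e = f then gP (src E f) else 0) * Th (es, g)" by (rule mult_r[OF S_orth])
      also have "\<dots> \<sim> (if e = f then Th (es, g) else 0)" using P_Th[of "src E f" "(es, g)"] v' by auto
      finally show ?thesis .
    qed
    ultimately show ?thesis using m GenS by (auto simp: Tho_def)
  qed
qed

lemma word_Th:
  assumes v: "vld \<xi>" and len: "length (letters w) \<le> length (fst \<xi>)"
  shows "mon w * Th \<xi> \<sim> Tho (wact w \<xi>)"
proof -
  have "length ls \<le> length (fst \<xi>) \<Longrightarrow> mon (Word ls) * Th \<xi> \<sim> Tho (lwact ls \<xi>)" for ls
  proof (induction ls)
    case Nil
    then show ?case by (simp add: Tho_def mon_0 flip: zero_star_word_def)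
  next
    case (Cons l ls)
    have m: "mon (Word (l # ls)) = mon (Word [l]) * mon (Word ls)"
      by (simp add: plus_star_word_def flip: mon_add)
    have IH: "mon (Word ls) * Th \<xi> \<sim> Tho (lwact ls \<xi>)" using Cons by simp
    have "mon (Word (l # ls)) * Th \<xi> = mon (Word [l]) * (mon (Word ls) * Th \<xi>)" by (simp add: m mult.assoc)
    also have "\<dots> \<sim> mon (Word [l]) * Tho (lwact ls \<xi>)" by (rule mult_l[OF IH])
    also have "\<dots> \<sim> Tho (lwact (l # ls) \<xi>)"
    proof (cases "lwact ls \<xi>")
      case (Some \<eta>)
      then have "wact (Word ls) \<xi> = Some \<eta>" by (simp add: wact_def)
      then have "vld \<eta>" "1 \<le> length (fst \<eta>)"
        using wact_Some(1)[of "Word ls" \<xi> \<eta>] wact_length[of "Word ls" \<xi> \<eta>] deg_ge[of "Word ls"] v Cons.prems by auto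
      from letter_Th[OF this, of l] show ?thesis by (simp add: Some Tho_def)
    qed (simp add: Tho_def)
    finally show ?case .
  qed
  from this[of "letters w"] show ?thesis using len by (simp add: wact_def)
qed

end


definition Sp :: "('v, 'e) path \<Rightarrow> ('v, 'e, 'g) generator free_alg" where
  "Sp \<mu> = (if snd \<mu> = [] then gP (fst \<mu>) else Sw (snd \<mu>))"

section \<open>Values on words and on spanning elements\<close>

context ck_functional
begin

text \<open>Iterates the Cuntz-Krieger relation at the source of each path. Placed to the right of a
  word, sufficiently long paths bring it into the range of \<open>word_Th\<close>.\<close>

lemma unit_expand: "1 \<sim> (\<Sum>q\<in>base k. Th (pt q) * free_star (Th (pt q)))"
proof (induction k)
  case 0
  have "(\<Sum>q\<in>base 0. Th (pt q) * free_star (Th (pt q))) = (\<Sum>v\<in>UNIV. gU (gid G v) * free_star (gU (gid G v)))"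
    by (simp add: base_0 sum.reindex inj_on_def Th_def pt_def)
  also have "\<dots> \<sim> (\<Sum>v\<in>UNIV. gP v)"
    using rel[OF toeplitz_rel.U_final[of "gid G _"]] by (intro eqv_sum) (simp add: gcod_id)
  also have "\<dots> \<sim> 1" by (rule rel[OF toeplitz_rel.P_sum])
  finally show ?case by (rule eqv_sym)
next
  case (Suc k)
  have "Th (pt q) * free_star (Th (pt q)) \<sim>
     (\<Sum>e\<in>{e. rng E e = snd q}. Th (pt (fst q @ [e], src E e)) * free_star (Th (pt (fst q @ [e], src E e))))" for q
  proof -
    have Th: "Th (pt p) \<sim> Sw (fst p) * gP (snd p)" for p
      by (simp add: Th_def pt_def mult_l[OF U_id])
    have ThP: "Th (pt p) * free_star (Th (pt p)) \<sim> Sw (fst p) * gP (snd p) * free_star (Sw (fst p))" for p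
    proof -
      have "Th (pt p) * free_star (Th (pt p)) \<sim> Sw (fst p) * gP (snd p) * free_star (Sw (fst p) * gP (snd p))"
        by (rule eqv_mult[OF Th eqv_star[OF Th]])
      also have "\<dots> = Sw (fst p) * (gP (snd p) * free_star (gP (snd p))) * free_star (Sw (fst p))"
        by (simp add: free_star_mult mult.assoc)
      also have "\<dots> \<sim> Sw (fst p) * gP (snd p) * free_star (Sw (fst p))"
        by (intro mult_l mult_r eqv_trans[OF mult_l[OF P_star] PP])
      finally show ?thesis .
    qed
    have a: "Sw (fst q) * gP (snd q) * free_star (Sw (fst q)) \<sim> Sw (fst q) * ck_sum E (snd q) * free_star (Sw (fst q))"
      by (intro mult_l mult_r ck)
    have e: "Sw (fst q) * ck_sum E (snd q) * free_star (Sw (fst q)) = (\<Sum>e\<in>{e. rng E e = snd q}. Sw (fst q) * gS e * (free_star (gS e) * free_star (Sw (fst q))))"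
      by (simp add: sum_distrib_left sum_distrib_right mult.assoc)
    have b: "Sw (fst q) * ck_sum E (snd q) * free_star (Sw (fst q)) \<sim>
        (\<Sum>e\<in>{e. rng E e = snd q}. Th (pt (fst q @ [e], src E e)) * free_star (Th (pt (fst q @ [e], src E e))))"
      unfolding e
    proof (rule eqv_sum, rule eqv_sym)
      fix e
      have "Th (pt (fst q @ [e], src E e)) * free_star (Th (pt (fst q @ [e], src E e))) \<sim>
         Sw (fst q @ [e]) * gP (src E e) * free_star (Sw (fst q @ [e]))"
        using ThP[of "(fst q @ [e], src E e)"] by simp
      also have "\<dots> = Sw (fst q) * (gS e * gP (src E e)) * (free_star (gS e) * free_star (Sw (fst q)))"
        by (simp add: Sw_append Sw_Cons free_star_mult mult.assoc)
      also have "\<dots> \<sim> Sw (fst q) * gS e * (free_star (gS e) * free_star (Sw (fst q)))"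
        by (intro mult_l mult_r S_P)
      finally show "Th (pt (fst q @ [e], src E e)) * free_star (Th (pt (fst q @ [e], src E e))) \<sim>
         Sw (fst q) * gS e * (free_star (gS e) * free_star (Sw (fst q)))" .
    qed
    show ?thesis by (rule eqv_trans[OF ThP eqv_trans[OF a b]])
  qed
  then show ?case unfolding sum_base_Suc by (intro eqv_trans[OF Suc] eqv_sum)
qed

text \<open>\<open>trace\<close> turns the Cuntz-Krieger relation into \<open>B m = c m\<close> for
  the vector \<open>m\<close> of values at the vertex projections. It is nonnegative with sum 1, so
  Perron-Frobenius uniqueness fixes the vector and the eigenvalue at once; this is what determines
  the temperature.\<close>

lemma phi_P: "\<phi> (gP v) = of_real (x v)" and c_eq: "c = r"
proof -
  define m where "m v = Re (\<phi> (gP v))" for v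
  have "gP v \<sim> free_star (gP v) * gP v" for v
    by (rule eqv_trans[OF eqv_sym[OF PP] mult_r[OF eqv_sym[OF P_star]]])
  then have "\<phi> (gP v) = \<phi> (free_star (gP v) * gP v)" for v by (rule eqvD)
  then have pm: "\<phi> (gP v) = of_real (m v)" "0 \<le> m v" for v
    using Re_pos[of "gP v"] Im_pos[of "gP v"] by (simp_all add: m_def complex_eq_iff)
  have SS': "\<phi> (gS e * free_star (gS e)) = of_real (inverse c) * \<phi> (gP (src E e))" for e
  proof -
    have "\<phi> (mon (lett (GenS e) False) * mon (lett (GenS e) True)) =
       of_real (c powi (-1)) * \<phi> (mon (lett (GenS e) True) * mon (lett (GenS e) False))"
      using trace[of "lett (GenS e) False" "lett (GenS e) True"] by (simp add: deg_def)
    then show ?thesis using eqvD[OF SS[of e]] by (simp add: free_gen_mon power_int_minus)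
  qed
  have em: "esum E m v = c * m v" for v
  proof -
    have "of_real (m v) = (\<Sum>e\<in>{e. rng E e = v}. \<phi> (gS e * free_star (gS e)))"
      using eqvD[OF ck[of v]] by (simp only: sum pm)
    also have "\<dots> = of_real (inverse c * esum E m v)"
      by (simp add: SS' pm esum_def sum_distrib_left)
    finally have "m v = inverse c * esum E m v" by (simp only: of_real_eq_iff)
    then show ?thesis using c_pos by (simp add: field_simps)
  qed
  have sm: "sum m UNIV = 1"
  proof -
    have "(of_real (sum m UNIV) :: complex) = \<phi> (\<Sum>v\<in>UNIV. gP v)" by (simp only: sum pm of_real_sum)
    also have "\<dots> = \<phi> 1" by (rule eqvD[OF rel[OF toeplitz_rel.P_sum]])
    finally have "(of_real (sum m UNIV) :: complex) = of_real 1" by (simp only: one of_real_1)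
    then show ?thesis by (simp only: of_real_eq_iff)
  qed
  note u = perron_unique[where x = x and m = m and r = r and l = c, OF strongly_connected x_pos x_eigen x_sum pm(2) em sm]
  show "\<phi> (gP v) = of_real (x v)" "c = r" by (simp_all only: pm u)
qed

lemma phi_U_id: "\<phi> (gU (gid G v)) = of_real (x v)"
  using eqvD[OF U_id[of v]] by (simp add: phi_P)

lemma U_P_gen: "gU g * gP v \<sim> (if v = gdom G g then gU g else 0)"
proof (cases "v = gdom G g")
  case False
  have a: "gU g * gP v \<sim> gU g * gP (gdom G g) * gP v" by (rule mult_r[OF eqv_sym[OF U_P]])
  have b: "gU g * gP (gdom G g) * gP v \<sim> gU g * 0"
    unfolding mult.assoc by (rule mult_l[OF rel[OF toeplitz_rel.P_orth]]) (use False in simp)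
  show ?thesis using eqv_trans[OF a b] False by (simp only: mult_zero_right if_False)
qed (simp add: U_P)

text \<open>Degree 0 projections commute under \<open>\<phi>\<close>: moved from the right of
  \<open>u_g\<close> to its left, the domain projection annihilates it.\<close>

lemma phi_U_0: assumes "gdom G g \<noteq> gcod G g" shows "\<phi> (gU g) = 0"
proof -
  have "\<phi> (gU g) = \<phi> (gU g * gP (gdom G g))" by (rule eqvD[OF eqv_sym[OF U_P]])
  also have "\<dots> = \<phi> (gP (gdom G g) * gU g)"
    using trace[of "lett (GenU g) False" "lett (GenP (gdom G g)) False"] by (simp add: free_gen_mon deg_def)
  also have "\<dots> = 0" using eqvD[OF P_U[of "gdom G g" g]] assms by simp
  finally show ?thesis .
qed

text \<open>Inserting the Cuntz-Krieger sum on the right gives terms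
  \<open>s_(g.e) u_(g|e) s_e*\<close>. Cycling \<open>s_e*\<close> to the front costs
  \<open>1 / r\<close>, and there it meets \<open>s_(g.e)\<close>, so only edges fixed by
  \<open>g\<close> survive.\<close>

lemma phi_U_step:
  assumes g: "gdom G g = gcod G g"
  shows "\<phi> (gU g) = of_real (1 / r) * (\<Sum>e\<in>{e. rng E e = gdom G g}. if ea g e = e then \<phi> (gU (rs g e)) else 0)"
proof -
  have step: "\<phi> (gU g * (gS e * free_star (gS e))) = of_real (1 / r) * (if ea g e = e then \<phi> (gU (rs g e)) else 0)"
    if e: "rng E e = gdom G g" for e
  proof -
    have "gU g * gS e * free_star (gS e) \<sim> gS (ea g e) * gU (rs g e) * free_star (gS e)"
      by (rule mult_r[OF rel[OF toeplitz_rel.US]]) (use e in simp)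
    then have "\<phi> (gU g * (gS e * free_star (gS e))) = \<phi> (gS (ea g e) * gU (rs g e) * free_star (gS e))"
      using eqvD by (simp add: mult.assoc)
    also have "\<dots> = of_real (1 / r) * \<phi> (free_star (gS e) * gS (ea g e) * gU (rs g e))"
      using trace[of "lett (GenS (ea g e)) False + lett (GenU (rs g e)) False" "lett (GenS e) True"]
      by (simp add: free_gen_mon deg_def mon_add c_eq mult.assoc power_int_minus inverse_eq_divide)
    also have "\<phi> (free_star (gS e) * gS (ea g e) * gU (rs g e)) = \<phi> ((if e = ea g e then gP (src E (ea g e)) else 0) * gU (rs g e))"
      by (rule eqvD[OF mult_r[OF S_orth]])
    also have "\<dots> = (if ea g e = e then \<phi> (gU (rs g e)) else 0)"
    proof (cases "ea g e = e")
      case True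
      then have "gcod G (rs g e) = src E e" using e by (simp add: gcod_rs)
      then show ?thesis using eqvD[OF P_U[of "src E e" "rs g e"]] True by simp
    qed auto
    finally show ?thesis .
  qed
  have "\<phi> (gU g) = \<phi> (gU g * gP (gdom G g))" by (rule eqvD[OF eqv_sym[OF U_P]])
  also have "\<dots> = \<phi> (gU g * ck_sum E (gdom G g))" by (rule eqvD[OF mult_l[OF ck]])
  also have "\<dots> = (\<Sum>e\<in>{e. rng E e = gdom G g}. \<phi> (gU g * (gS e * free_star (gS e))))"
    by (simp only: sum_distrib_left sum)
  also have "\<dots> = (\<Sum>e\<in>{e. rng E e = gdom G g}. of_real (1 / r) * (if ea g e = e then \<phi> (gU (rs g e)) else 0))"
    by (rule sum.cong[OF refl]) (use step in blast)
  finally show ?thesis by (simp only: sum_distrib_left)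
qed

lemma Sw_star_Sw:
  "is_walk E u es' (gcod G h) \<Longrightarrow> length es = length es' \<Longrightarrow>
     free_star (Sw es) * (Sw es' * gU h) \<sim> (if es = es' then gU h else 0)"
proof (induction es arbitrary: es' u)
  case Nil
  then show ?case by simp
next
  case (Cons e es)
  then obtain f fs where es': "es' = f # fs" by (cases es') auto
  have w: "is_walk E (src E f) fs (gcod G h)" and l: "length es = length fs" using Cons.prems es' by auto
  have pr: "pr (fs, h) = src E f" by (rule pr_eqI[OF w])
  have eq: "free_star (Sw (e # es)) * (Sw es' * gU h) = free_star (Sw es) * (free_star (gS e) * gS f * Th (fs, h))"
    by (simp add: es' Sw_Cons free_star_mult Th_def mult.assoc)
  have 1: "free_star (gS e) * gS f * Th (fs, h) \<sim> (if e = f then gP (src E f) else 0) * Th (fs, h)"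
    by (rule mult_r[OF S_orth])
  have 2: "(if e = f then gP (src E f) else 0) * Th (fs, h) \<sim> (if e = f then Th (fs, h) else 0)"
    using P_Th[of "src E f" "(fs, h)"] pr by auto
  have 3: "free_star (Sw es) * (if e = f then Th (fs, h) else 0) \<sim> (if e # es = es' then gU h else 0)"
    using Cons.IH[OF w l] by (auto simp: es' Th_def)
  show ?case unfolding eq by (rule eqv_trans[OF mult_l[OF eqv_trans[OF 1 2]] 3])
qed

lemma deg_word_star: "deg (word_star w) = - deg w"
proof -
  have "gdeg (y, \<not> b) = - gdeg (y, b)" for y and b by (cases y) auto
  then have "sum_list (map gdeg (rev (map (\<lambda>(y, b). (y, \<not> b)) ls))) = - sum_list (map gdeg ls)" for ls
    by (induction ls) auto
  then show ?thesis by (simp add: deg_def word_star_def)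
qed

definition ptw :: "'e list \<times> 'v \<Rightarrow> ('v, 'e, 'g) generator star_word" where
  "ptw p = sw (fst p) + lett (GenU (gid G (snd p))) False"

lemma Th_pt: "Th (pt p) = mon (ptw p)"
  by (simp add: Th_def pt_def ptw_def mon_add Sw_def free_gen_mon)

text \<open>For \<open>w\<close> of degree 0 and a path long enough for \<open>word_Th\<close>, this
  is the value of \<open>\<phi>\<close> at \<open>t* w t\<close> with
  \<open>t = Th (pt p)\<close>.\<close>

definition coef :: "('v, 'e, 'g) generator star_word \<Rightarrow> 'e list \<times> 'v \<Rightarrow> complex" where
  "coef w p = (case wact w (pt p) of None \<Rightarrow> 0 | Some \<eta> \<Rightarrow>
     if fst \<eta> = fst p \<and> gcod G (snd \<eta>) = snd p then \<phi> (gU (snd \<eta>)) else 0)"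

text \<open>Inserting \<open>unit_expand\<close> to the right of \<open>w\<close> and cycling the
  adjoints to the front leaves \<open>coef\<close>. Taking \<open>k\<close> as the length of the
  word makes \<open>word_Th\<close> applicable. Since \<open>coef\<close> uses \<open>\<phi>\<close>
  only at elements \<open>u_g\<close>, these values determine \<open>\<phi>\<close> on words of
  degree 0.\<close>

lemma word_formula:
  assumes d: "deg w = 0"
  defines "k \<equiv> length (letters w)"
  shows "\<phi> (mon w) = (\<Sum>q\<in>base k. of_real (inverse r ^ k) * coef w q)"
proof -
  have "\<phi> (mon w * (Th (pt q) * free_star (Th (pt q)))) = of_real (inverse r ^ k) * coef w q" if q: "q \<in> base k" for q
  proof -
    have vq: "vld (pt q)" and lq: "length (fst (pt q)) = k" using q by (auto simp: base_def pt_def)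
    have dp: "deg (ptw q) = int k" using q by (simp add: ptw_def deg_add deg_sw base_def) (simp add: deg_def)
    have "\<phi> (mon (w + ptw q) * mon (word_star (ptw q))) =
        of_real (r powi (- int k)) * \<phi> (mon (word_star (ptw q)) * mon (w + ptw q))"
      using trace[of "w + ptw q" "word_star (ptw q)"] by (simp only: deg_word_star dp c_eq)
    then have "\<phi> (mon w * (Th (pt q) * free_star (Th (pt q)))) =
        of_real (inverse r ^ k) * \<phi> (free_star (Th (pt q)) * (mon w * Th (pt q)))"
      by (simp add: Th_pt mon_add free_star_mon mult.assoc power_int_minus power_inverse)
    also have "\<phi> (free_star (Th (pt q)) * (mon w * Th (pt q))) = \<phi> (free_star (Th (pt q)) * Tho (wact w (pt q)))"
      by (rule eqvD[OF mult_l[OF word_Th[OF vq]]]) (simp add: lq k_def)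
    also have "\<dots> = coef w q"
    proof (cases "wact w (pt q)")
      case (Some \<eta>)
      have ve: "vld \<eta>" "length (fst (pt q)) = length (fst \<eta>)"
        using wact_Some(1)[OF Some vq] wact_length[OF Some] d by auto
      have "free_star (Sw (fst q)) * Th \<eta> \<sim> (if fst q = fst \<eta> then gU (snd \<eta>) else 0)"
        using Sw_star_Sw[of "pr \<eta>" "fst \<eta>" "snd \<eta>" "fst q"] ve by (simp add: Th_def vld_def pt_def)
      moreover have "free_star (gU (gid G (snd q))) \<sim> gP (snd q)" by (rule eqv_trans[OF eqv_star[OF U_id] P_star])
      ultimately have "free_star (gU (gid G (snd q))) * (free_star (Sw (fst q)) * Th \<eta>) \<sim>
          gP (snd q) * (if fst q = fst \<eta> then gU (snd \<eta>) else 0)" by (intro eqv_mult)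
      moreover have "gP (snd q) * (if fst q = fst \<eta> then gU (snd \<eta>) else 0) \<sim>
          (if fst \<eta> = fst q \<and> gcod G (snd \<eta>) = snd q then gU (snd \<eta>) else 0)"
        using P_U[of "snd q" "snd \<eta>"] by auto
      ultimately have f: "free_star (gU (gid G (snd q))) * (free_star (Sw (fst q)) * Th \<eta>) \<sim>
          (if fst \<eta> = fst q \<and> gcod G (snd \<eta>) = snd q then gU (snd \<eta>) else 0)" by (rule eqv_trans)
      have "Th (pt q) = Sw (fst q) * gU (gid G (snd q))" by (simp add: Th_def pt_def)
      then show ?thesis
        using eqvD[OF f] by (simp add: Some Tho_def coef_def free_star_mult mult.assoc)
    qed (simp add: Tho_def coef_def)
    finally show ?thesis .
  qed
  then have "(\<Sum>q\<in>base k. \<phi> (mon w * (Th (pt q) * free_star (Th (pt q))))) = (\<Sum>q\<in>base k. of_real (inverse r ^ k) * coef w q)"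
    by (rule sum.cong[OF refl])
  moreover have "\<phi> (mon w * 1) = \<phi> (mon w * (\<Sum>q\<in>base k. Th (pt q) * free_star (Th (pt q))))"
    by (rule eqvD[OF mult_l[OF unit_expand]])
  ultimately show ?thesis by (simp add: sum_distrib_left sum)
qed

text \<open>Makes the source projection explicit, so that empty and nonempty paths are treated
  alike.\<close>

lemma Sp_eqv: "is_walk E v es a \<Longrightarrow> Sp (v, es) \<sim> Sw es * gP a"
proof (cases "es = []")
  case False
  assume w: "is_walk E v es a"
  obtain e fs where es: "es = fs @ [e]" using False by (metis rev_exhaust)
  then have "a = src E e" using w by (auto simp: is_walk_append)
  then show ?thesis using mult_l[OF eqv_sym[OF S_P[of e]], of "Sw fs"]
    by (simp add: Sp_def es Sw_append Sw_Cons mult.assoc)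
qed (simp add: Sp_def)

text \<open>\<open>gauge\<close> forces equal lengths. Then \<open>trace\<close> moves the adjoint
  path to the front, contributing the power of \<open>r\<close>, and it cancels against an equal
  path or gives 0.\<close>

lemma elt_value:
  assumes w: "is_walk E v es a" "is_walk E u fs b"
  shows "\<phi> (Sp (v, es) * gU g * free_star (Sp (u, fs))) =
     (if es = fs \<and> a = b \<and> gcod G g = a \<and> gdom G g = a then of_real (inverse r ^ length es) * \<phi> (gU g) else 0)"
proof -
  let ?m = "sw es + lett (GenP a) False + lett (GenU g) False + lett (GenP b) False"
  let ?n = "word_star (sw fs)"
  have "free_star (Sp (u, fs)) \<sim> gP b * free_star (Sw fs)"
    using eqv_trans[OF eqv_star[OF Sp_eqv[OF w(2)], unfolded free_star_mult] mult_r[OF P_star]] .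
  then have "Sp (v, es) * gU g * free_star (Sp (u, fs)) \<sim> Sw es * gP a * gU g * (gP b * free_star (Sw fs))"
    by (intro eqv_mult Sp_eqv[OF w(1)] eqv_refl)
  from eqvD[OF this] have 1: "\<phi> (Sp (v, es) * gU g * free_star (Sp (u, fs))) = \<phi> (mon ?m * mon ?n)"
    by (simp add: mon_add Sw_def free_gen_mon free_star_mon mult.assoc)
  have dm: "deg ?m = int (length es)" by (simp add: deg_add deg_sw) (simp add: deg_def)
  have dn: "deg ?n = - int (length fs)" by (simp add: deg_word_star deg_sw)
  show ?thesis
  proof (cases "length es = length fs")
    case False
    then have "\<phi> (mon (?m + ?n)) = 0" by (intro gauge) (simp add: deg_add[of ?m] dm dn)
    then show ?thesis using False by (auto simp: 1 simp flip: mon_add)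
  next
    case True
    have "\<phi> (mon ?m * mon ?n) = of_real (inverse r ^ length es) * \<phi> (mon ?n * mon ?m)"
      using trace[of ?m ?n] True by (simp only: dn c_eq) (simp add: power_int_minus power_inverse)
    also have "mon ?n * mon ?m = free_star (Sw fs) * (Sw es * gP a) * (gU g * gP b)"
      by (simp add: mon_add Sw_def free_gen_mon free_star_mon mult.assoc)
    also have "\<phi> \<dots> = \<phi> ((if fs = es then gU (gid G a) else 0) * (gU g * gP b))"
    proof (rule eqvD[OF mult_r])
      have "free_star (Sw fs) * (Sw es * gU (gid G a)) \<sim> (if fs = es then gU (gid G a) else 0)"
        by (rule Sw_star_Sw[of v]) (use w True in \<open>simp_all add: gcod_id\<close>)
      then show "free_star (Sw fs) * (Sw es * gP a) \<sim> (if fs = es then gU (gid G a) else 0)"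
        by (rule eqv_trans[OF mult_l[OF mult_l[OF eqv_sym[OF U_id]]]])
    qed
    also have "\<dots> = (if es = fs then \<phi> (gU (gid G a) * (gU g * gP b)) else 0)" by auto
    also have "\<phi> (gU (gid G a) * (gU g * gP b)) = (if gcod G g = a \<and> gdom G g = b then \<phi> (gU g) else 0)"
    proof -
      have "gU (gid G a) * (gU g * gP b) \<sim> gP a * (if b = gdom G g then gU g else 0)"
        by (rule eqv_mult[OF U_id U_P_gen])
      moreover have "gP a * (if b = gdom G g then gU g else 0) \<sim> (if gcod G g = a \<and> gdom G g = b then gU g else 0)"
        using P_U[of a g] by auto
      ultimately have "gU (gid G a) * (gU g * gP b) \<sim> (if gcod G g = a \<and> gdom G g = b then gU g else 0)"
        by (rule eqv_trans)
      from eqvD[OF this] show ?thesis by simp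
    qed
    finally show ?thesis using phi_U_0[of g] by (auto simp: 1)
  qed
qed

end

section \<open>Uniqueness\<close>

lemma phi_U_unique:
  assumes "ck_functional E G act x r \<phi> c" and "ck_functional E G act x r \<psi> c'"
    and fin: "\<And>g. g \<notin> range (gid G) \<Longrightarrow> finite (restrict_path E G act g ` vpaths E (gdom G g))"
  shows "\<phi> (gU g) = \<psi> (gU g)"
proof (rule ccontr)
  interpret p: ck_functional E G act x r \<phi> c by (rule assms(1))
  interpret s: ck_functional E G act x r \<psi> c' by (rule assms(2))
  assume neq: "\<phi> (gU g) \<noteq> \<psi> (gU g)"
  define D where "D h = cmod (\<phi> (gU h) - \<psi> (gU h))" for h
  have D_id: "D (gid G v) = 0" for v by (simp add: D_def p.phi_U_id s.phi_U_id)
  have D_off: "gdom G h \<noteq> gcod G h \<Longrightarrow> D h = 0" for h by (simp add: D_def p.phi_U_0 s.phi_U_0)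
  have D_step: "r * D h \<le> (\<Sum>e\<in>{e. rng E e = gdom G h}. if p.ea h e = e then D (p.rs h e) else 0)"
    if "gdom G h = gcod G h" for h
  proof -
    have "\<phi> (gU h) - \<psi> (gU h) = of_real (1 / r) *
       (\<Sum>e\<in>{e. rng E e = gdom G h}. if p.ea h e = e then \<phi> (gU (p.rs h e)) - \<psi> (gU (p.rs h e)) else 0)"
      unfolding p.phi_U_step[OF that] s.phi_U_step[OF that] right_diff_distrib[symmetric] sum_subtractf[symmetric]
      by (intro arg_cong[where f = "(*) _"] sum.cong) auto
    then have "r * D h = cmod (\<Sum>e\<in>{e. rng E e = gdom G h}. if p.ea h e = e then \<phi> (gU (p.rs h e)) - \<psi> (gU (p.rs h e)) else 0)"
      using p.r_pos by (simp add: D_def norm_mult norm_divide)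
    also have "\<dots> \<le> (\<Sum>e\<in>{e. rng E e = gdom G h}. cmod (if p.ea h e = e then \<phi> (gU (p.rs h e)) - \<psi> (gU (p.rs h e)) else 0))"
      by (rule norm_sum)
    also have "\<dots> = (\<Sum>e\<in>{e. rng E e = gdom G h}. if p.ea h e = e then D (p.rs h e) else 0)"
      by (intro sum.cong) (auto simp: D_def)
    finally show ?thesis .
  qed
  have Dg: "0 < D g" using neq by (simp add: D_def)
  define R where "R = {p.lr g es | es w. is_walk E (gdom G g) es w}"
  have "R = restrict_path E G act g ` vpaths E (gdom G g)"
  proof (intro equalityI subsetI)
    fix h assume "h \<in> R"
    then obtain es w where "h = p.lr g es" "is_walk E (gdom G g) es w" by (auto simp: R_def)
    then show "h \<in> restrict_path E G act g ` vpaths E (gdom G g)"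
      by (intro image_eqI[of _ _ "(gdom G g, es)"]) (auto simp: restrict_path_def in_vpaths_iff)
  next
    fix h assume "h \<in> restrict_path E G act g ` vpaths E (gdom G g)"
    then obtain \<mu> where "\<mu> \<in> vpaths E (gdom G g)" "h = restrict_path E G act g \<mu>" by blast
    then show "h \<in> R" by (cases \<mu>) (auto simp: R_def restrict_path_def in_vpaths_iff)
  qed
  \<comment> \<open>\<open>D\<close> vanishes at units and \<open>D g > 0\<close>, so
    \<open>g\<close> is not a unit and the finiteness hypothesis applies to it.\<close>
  then have finR: "finite R" using fin[of g] Dg D_id by (metis less_irrefl rangeE)
  have gR: "g \<in> R" unfolding R_def by (rule CollectI, rule exI[of _ "[]"]) auto
  have R_step: "p.rs h e \<in> R" if hR: "h \<in> R" and he: "rng E e = gdom G h" for h e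
  proof -
    obtain es w where es: "h = p.lr g es" "is_walk E (gdom G g) es w" using hR by (auto simp: R_def)
    then have "is_walk E (gdom G g) (es @ [e]) (src E e)"
      using he p.walk_lr(1)[OF es(2)] by (auto simp: is_walk_append)
    moreover have "p.rs h e = p.lr g (es @ [e])" using es by simp
    ultimately show ?thesis unfolding R_def by blast
  qed
  \<comment> \<open>Dividing by \<open>x\<close> turns \<open>D_step\<close> into an averaging
    inequality, because \<open>r * x v\<close> is the sum of \<open>x\<close> over the sources of
    the edges at \<open>v\<close>.\<close>
  define M where "M = Max ((\<lambda>h. D h / x (gdom G h)) ` R)"
  have M_le: "D h \<le> M * x (gdom G h)" if "h \<in> R" for h
  proof -
    have "D h / x (gdom G h) \<le> M" unfolding M_def by (rule Max_ge) (use finR that in auto)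
    then show ?thesis using p.x_pos[of "gdom G h"] by (simp add: pos_divide_le_eq)
  qed
  have "M * x (gdom G g) > 0" using M_le[OF gR] Dg by simp
  then have M: "0 < M" using p.x_pos[of "gdom G g"] by (simp add: zero_less_mult_iff)
  have "M \<in> (\<lambda>h. D h / x (gdom G h)) ` R" unfolding M_def by (rule Max_in) (use finR gR in auto)
  then obtain h where h: "h \<in> R" "M = D h / x (gdom G h)" by blast
  then have Dh: "D h = M * x (gdom G h)" using p.x_pos[of "gdom G h"] by simp
  have max: "gdom G h = gcod G h \<and> (\<forall>e. rng E e = gdom G h \<longrightarrow> p.ea h e = e \<and> D (p.rs h e) = M * x (src E e))"
    if "h \<in> R" "D h = M * x (gdom G h)" for h
  proof -
    have "0 < D h" using that(2) M p.x_pos by simp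
    then have dc: "gdom G h = gcod G h" using D_off by force
    let ?f = "\<lambda>e. if p.ea h e = e then D (p.rs h e) else 0" and ?S = "{e. rng E e = gdom G h}"
    have le: "?f e \<le> M * x (src E e)" if "e \<in> ?S" for e
      using M_le[OF R_step[OF \<open>h \<in> R\<close>, of e]] that p.gdom_rs[of e h] M p.x_pos[of "src E e"] by auto
    \<comment> \<open>The termwise bounds \<open>M * x (src E e)\<close> add up to exactly
      \<open>r * D h\<close>, so every term attains its bound. An edge moved by \<open>h\<close>
      would contribute 0 against a positive bound.\<close>
    have "(\<Sum>e\<in>?S. M * x (src E e)) = r * D h"
      using p.x_eigen[of "gdom G h"] that(2) by (simp add: esum_def sum_distrib_left[symmetric])
    also have "\<dots> \<le> sum ?f ?S" by (rule D_step[OF dc])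
    finally have "sum ?f ?S = (\<Sum>e\<in>?S. M * x (src E e))" using sum_mono[of ?S ?f "\<lambda>e. M * x (src E e)"] le by force
    then have eq: "?f e = M * x (src E e)" if "e \<in> ?S" for e
      by (rule sum_mono_inv) (use le that in auto)
    have "p.ea h e = e \<and> D (p.rs h e) = M * x (src E e)" if "rng E e = gdom G h" for e
      using eq[of e] that M p.x_pos[of "src E e"] by (auto split: if_splits)
    then show ?thesis using dc by blast
  qed
  \<comment> \<open>Maximality passes to restrictions, so the induction can follow any walk.\<close>
  have fixed: "p.la h es = es" if "h \<in> R" "D h = M * x (gdom G h)" "is_walk E (gdom G h) es w" for h es w
    using that
  proof (induction es arbitrary: h)
    case (Cons e es)
    then have e: "rng E e = gdom G h" and w: "is_walk E (src E e) es w" by auto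
    have m: "p.ea h e = e" "D (p.rs h e) = M * x (src E e)" using max[OF Cons.prems(1,2)] e by auto
    have "p.la (p.rs h e) es = es"
      by (rule Cons.IH[OF R_step[OF Cons.prems(1) e]]) (use m w e in \<open>simp_all add: p.gdom_rs\<close>)
    then show ?case using m by simp
  qed simp
  have "h = gid G (gdom G h)"
    by (rule p.eq_gidI) (use max[OF h(1) Dh] fixed[OF h(1) Dh] in auto)
  then have "D h = 0" using D_id by metis
  then show False using Dh M p.x_pos[of "gdom G h"] by simp
qed

lemma words_unique:
  assumes p: "ck_functional E G act x r \<phi> c" and s: "ck_functional E G act x r \<psi> c'"
    and U: "\<And>g. \<phi> (gU g) = \<psi> (gU g)"
  shows "\<phi> (mon w) = \<psi> (mon w)"
proof -
  interpret p: ck_functional E G act x r \<phi> c by (rule p)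
  interpret s: ck_functional E G act x r \<psi> c' by (rule s)
  have "p.coef w q = s.coef w q" for q
    by (simp add: p.coef_def s.coef_def U split: option.split)
  then show ?thesis
    using p.word_formula[of w] s.word_formula[of w] p.gauge[of w] s.gauge[of w] by (cases "p.deg w = 0") simp_all
qed


section \<open>Entire functions on strips\<close>

text \<open>The real line accumulates at 0, so the identity theorem applies; it carries identities
  from real to complex times.\<close>

lemma entire_eqI:
  assumes f: "f holomorphic_on UNIV" and g: "g holomorphic_on UNIV"
    and eq: "\<And>t::real. f (of_real t) = g (of_real t)"
  shows "f z = g z"
proof -
  have lim: "(0::complex) islimpt range of_real"
    unfolding islimpt_approachable
  proof (intro allI impI)
    fix e :: real assume "0 < e"
    then show "\<exists>x'\<in>range of_real. x' \<noteq> 0 \<and> dist x' (0::complex) < e"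
      by (intro bexI[OF _ rangeI[of of_real "e / 2"]]) (simp add: dist_norm del: of_real_divide)
  qed
  have "f z - g z = 0"
    by (rule analytic_continuation[of "\<lambda>z. f z - g z" UNIV "range of_real" 0 z])
      (use f g eq lim in \<open>auto intro!: holomorphic_intros\<close>)
  then show ?thesis by simp
qed

text \<open>For a primitive \<open>g\<close>, periodicity makes \<open>g (z + p) - g z\<close>
  constant. That constant is the integral along every horizontal segment of length \<open>p\<close>,
  so the contour may be shifted without integrating over vertical sides.\<close>

lemma periodic_entire_integral:
  assumes h: "h holomorphic_on UNIV" and per: "\<And>z. h (z + of_real p) = h z" and p: "0 \<le> p"
  obtains I where "\<And>w. ((\<lambda>t. h (of_real t + w)) has_integral I) {0..p}"
proof -
  have hd: "h field_differentiable at z" for z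
    using h by (simp add: holomorphic_on_def field_differentiable_def)
  have "\<exists>g. \<forall>z\<in>UNIV. (g has_field_derivative h z) (at z within UNIV)"
    by (rule holomorphic_convex_primitive[of UNIV "{}"])
      (use hd in \<open>auto intro: holomorphic_on_imp_continuous_on[OF h]\<close>)
  then obtain g where g: "\<And>z. (g has_field_derivative h z) (at z)" by auto
  have gs: "((\<lambda>z. g (z + w)) has_field_derivative h (z + w)) (at z)" for w z
    by (rule DERIV_chain'[of "\<lambda>z. z + w" 1 z UNIV g "h (z + w)", simplified])
      (auto intro!: derivative_eq_intros g)
  have "\<exists>c. \<forall>z\<in>UNIV. g (z + of_real p) - g z = c"
  proof (rule has_field_derivative_zero_constant)
    show "((\<lambda>z. g (z + of_real p) - g z) has_field_derivative 0) (at z within UNIV)" for z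
      using DERIV_diff[OF gs[of "of_real p" z] g[of z]] per by simp
  qed auto
  then obtain c where c: "\<And>z. g (z + of_real p) - g z = c" by auto
  have "((\<lambda>t. h (of_real t + w)) has_integral (g (of_real p + w) - g (of_real 0 + w))) {0..p}" for w
    by (rule fundamental_theorem_of_calculus[OF p]) (rule has_vector_derivative_real_field[OF gs])
  moreover have "g (of_real p + w) - g (of_real 0 + w) = c" for w
    using c[of w] by (simp add: add.commute)
  ultimately show thesis using that by metis
qed

locale dynamics_action = finite_action E G act
  for E :: "('v::finite, 'e::finite) digraph" and G :: "('g, 'v) groupoid"
    and act :: "'g \<Rightarrow> ('v, 'e) path \<Rightarrow> ('v, 'e) path" +
  fixes \<sigma> :: "real \<Rightarrow> ('v, 'e, 'g) cuntz_elem \<Rightarrow> ('v, 'e, 'g) cuntz_elem"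
  assumes dynamics: "is_dynamics (cuntz_alg E G act) \<sigma>"
    and sigma_elt: "\<mu> \<in> all_paths E \<Longrightarrow> \<nu> \<in> all_paths E \<Longrightarrow>
       \<sigma> t (cuntz_elt E G act \<mu> g \<nu>) =
         exp (\<i> * of_real t * (of_nat (path_len \<mu>) - of_nat (path_len \<nu>))) \<odot>\<^bsub>cuntz_alg E G act\<^esub> cuntz_elt E G act \<mu> g \<nu>"
begin

section \<open>The dynamics on words\<close>

lemma sigma_closed: "y \<in> carrier CA \<Longrightarrow> \<sigma> t y \<in> carrier CA"
  and sigma_mult: "y \<in> carrier CA \<Longrightarrow> z \<in> carrier CA \<Longrightarrow> \<sigma> t (y \<otimes>\<^bsub>CA\<^esub> z) = \<sigma> t y \<otimes>\<^bsub>CA\<^esub> \<sigma> t z"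
  and sigma_add: "y \<in> carrier CA \<Longrightarrow> z \<in> carrier CA \<Longrightarrow> \<sigma> t (y \<oplus>\<^bsub>CA\<^esub> z) = \<sigma> t y \<oplus>\<^bsub>CA\<^esub> \<sigma> t z"
  and sigma_one: "\<sigma> t \<one>\<^bsub>CA\<^esub> = \<one>\<^bsub>CA\<^esub>"
proof -
  have "\<sigma> t \<in> ring_hom CA CA" using dynamics by (simp add: is_dynamics_def ring_iso_def)
  then show "y \<in> carrier CA \<Longrightarrow> \<sigma> t y \<in> carrier CA"
    "y \<in> carrier CA \<Longrightarrow> z \<in> carrier CA \<Longrightarrow> \<sigma> t (y \<otimes>\<^bsub>CA\<^esub> z) = \<sigma> t y \<otimes>\<^bsub>CA\<^esub> \<sigma> t z"
    "y \<in> carrier CA \<Longrightarrow> z \<in> carrier CA \<Longrightarrow> \<sigma> t (y \<oplus>\<^bsub>CA\<^esub> z) = \<sigma> t y \<oplus>\<^bsub>CA\<^esub> \<sigma> t z"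
    "\<sigma> t \<one>\<^bsub>CA\<^esub> = \<one>\<^bsub>CA\<^esub>"
    by (simp_all add: ring_hom_closed ring_hom_mult ring_hom_add ring_hom_one)
qed

lemma sigma_scale: "y \<in> carrier CA \<Longrightarrow> \<sigma> t (z \<odot>\<^bsub>CA\<^esub> y) = z \<odot>\<^bsub>CA\<^esub> \<sigma> t y"
  and sigma_star: "y \<in> carrier CA \<Longrightarrow> \<sigma> t (star CA y) = star CA (\<sigma> t y)"
  and sigma_plus: "y \<in> carrier CA \<Longrightarrow> \<sigma> (t + s) y = \<sigma> t (\<sigma> s y)"
  using dynamics by (simp_all add: is_dynamics_def)

lemma cuntz_path_kappa: "cuntz_path E G act \<mu> = \<kappa> (Sp \<mu>)"
proof -
  have "foldr (\<lambda>e a. \<kappa> (gS e) \<otimes>\<^bsub>CA\<^esub> a) es \<one>\<^bsub>CA\<^esub> = \<kappa> (Sw es)" for es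
    by (induction es) (simp_all add: kappa_hom Sw_Cons)
  then show ?thesis by (simp add: cuntz_path_def Let_def cuntz_gen_kappa Sp_def)
qed

lemma cuntz_elt_kappa: "cuntz_elt E G act \<mu> g \<nu> = \<kappa> (Sp \<mu> * gU g * free_star (Sp \<nu>))"
  by (simp add: cuntz_elt_def Let_def cuntz_path_kappa cuntz_gen_kappa kappa_hom)

lemma tau_mult_cong: "\<tau> a = \<tau> b \<Longrightarrow> \<tau> c = \<tau> d \<Longrightarrow> \<tau> (a * c) = \<tau> (b * d)"
  and tau_minus_cong: "\<tau> a = \<tau> b \<Longrightarrow> \<tau> c = \<tau> d \<Longrightarrow> \<tau> (a - c) = \<tau> (b - d)"
  by (metis tau_hom(1), metis tau_hom(3))

lemma tau_P_star: "\<tau> (free_star (gP v)) = \<tau> (gP v)"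
  and tau_PP: "\<tau> (gP v * gP v) = \<tau> (gP v)"
  and tau_SS: "\<tau> (free_star (gS e) * gS e) = \<tau> (gP (src E e))"
  and tau_U_id: "\<tau> (gU (gid G v)) = \<tau> (gP v)"
  by (rule tau_rel[OF toeplitz_rel.P_star] tau_rel[OF toeplitz_rel.P_idem] tau_rel[OF toeplitz_rel.S_isom]
      tau_rel[OF toeplitz_rel.U_unit])+

text \<open>The terms of \<open>d* d\<close> cancel in the completion, and the C*-identity then
  gives norm 0 to \<open>d\<close>; it plays here the part of \<open>eqv_0I\<close>.\<close>

lemma tau_S_P: "\<tau> (gS e * gP (src E e)) = \<tau> (gS e)"
proof -
  let ?p = "gP (src E e) :: ('v, 'e, 'g) generator free_alg" and ?s = "gS e :: ('v, 'e, 'g) generator free_alg"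
  let ?d = "?s * ?p - ?s"
  have 1: "\<tau> (free_star ?p * (free_star ?s * ?s)) = \<tau> (?p * ?p)" by (rule tau_mult_cong[OF tau_P_star tau_SS])
  have 2: "\<tau> (free_star ?p * (free_star ?s * ?s) * ?p) = \<tau> (?p * ?p)"
    by (rule tau_mult_cong[OF trans[OF 1 tau_PP] refl])
  have 3: "\<tau> (free_star ?s * ?s * ?p) = \<tau> (?p * ?p)" by (rule tau_mult_cong[OF tau_SS refl])
  have "free_star ?d * ?d = (free_star ?p * (free_star ?s * ?s) * ?p - free_star ?p * (free_star ?s * ?s)) -
     (free_star ?s * ?s * ?p - free_star ?s * ?s)"
    by (simp add: free_star_diff free_star_mult left_diff_distrib right_diff_distrib mult.assoc)
  then have "\<tau> (free_star ?d * ?d) = \<tau> ((?p * ?p - ?p * ?p) - (?p * ?p - ?p * ?p))"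
    using tau_minus_cong[OF tau_minus_cong[OF 2 1] tau_minus_cong[OF 3 trans[OF tau_SS tau_PP[symmetric]]]] by (simp only:)
  then have "\<tau> (free_star ?d * ?d) = \<tau> 0" by (simp only: diff_self)
  then have "N (free_star ?d * ?d) = 0" by (simp only: Tn.to_c_eq_iff diff_zero)
  then have "N ?d = 0" by (simp add: Tn.N_star_self)
  then show ?thesis by (simp only: Tn.to_c_eq_iff)
qed

lemma kappa_cong: "\<tau> a = \<tau> b \<Longrightarrow> \<kappa> a = \<kappa> b"
  by (simp add: \<kappa>_def)

text \<open>With vertices or edges as paths, each generator is itself of the form
  \<open>s_mu u_g s_nu*\<close>, so the hypothesis on \<open>\<sigma>\<close> determines its
  evolution.\<close>

lemma sigma_gen: "\<sigma> t (\<kappa> (free_gen y)) = exp (\<i> * of_real t * of_int (gdeg (y, False))) \<odot>\<^bsub>CA\<^esub> \<kappa> (free_gen y)"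
proof (cases y)
  case (GenP v)
  have "\<tau> (gP v * gU (gid G v) * free_star (gP v)) = \<tau> (gP v * gP v * gP v)"
    by (intro tau_mult_cong tau_P_star tau_U_id refl)
  also have "\<dots> = \<tau> (gP v)" by (rule trans[OF tau_mult_cong[OF tau_PP refl] tau_PP])
  finally have "\<kappa> (gP v * gU (gid G v) * free_star (gP v)) = \<kappa> (gP v)" by (rule kappa_cong)
  then have "cuntz_elt E G act (v, []) (gid G v) (v, []) = \<kappa> (gP v)"
    by (simp only: cuntz_elt_kappa Sp_def fst_conv snd_conv if_True simp_thms)
  then show ?thesis
    using sigma_elt[of "(v, [])" "(v, [])" t "gid G v"] GenP by (simp add: in_all_paths_iff path_len_def)
next
  case (GenS e)
  have "\<tau> (gS e * gU (gid G (src E e)) * free_star (gP (src E e))) = \<tau> (gS e * gP (src E e) * gP (src E e))"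
    by (intro tau_mult_cong tau_P_star tau_U_id refl)
  also have "\<dots> = \<tau> (gS e)" by (rule trans[OF tau_mult_cong[OF tau_S_P refl] tau_S_P])
  finally have "\<kappa> (gS e * gU (gid G (src E e)) * free_star (gP (src E e))) = \<kappa> (gS e)" by (rule kappa_cong)
  then have "cuntz_elt E G act (rng E e, [e]) (gid G (src E e)) (src E e, []) = \<kappa> (gS e)"
    by (simp only: cuntz_elt_kappa Sp_def fst_conv snd_conv list.distinct if_True if_False simp_thms
        Sw_Cons Sw_Nil mult_1_right)
  then show ?thesis
    using sigma_elt[of "(rng E e, [e])" "(src E e, [])" t "gid G (src E e)"] GenS
    by (simp add: in_all_paths_iff path_len_def)
next
  case (GenU g)
  have "\<tau> (gP (gcod G g) * gU g * free_star (gP (gdom G g))) = \<tau> (gU (gid G (gcod G g)) * gU g * gU (gid G (gdom G g)))"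
    by (intro tau_mult_cong trans[OF tau_P_star] tau_U_id[symmetric] refl)
  also have "\<dots> = \<tau> (gU g * gU (gid G (gdom G g)))"
    using tau_rel[OF toeplitz_rel.U_comp[of G "gid G (gcod G g)" g E act]]
    by (intro tau_mult_cong refl) (simp add: gdom_id comp_id_left)
  also have "\<dots> = \<tau> (gU g)"
    using tau_rel[OF toeplitz_rel.U_comp[of G g "gid G (gdom G g)" E act]] by (simp add: gcod_id comp_id_right)
  finally have "\<kappa> (gP (gcod G g) * gU g * free_star (gP (gdom G g))) = \<kappa> (gU g)" by (rule kappa_cong)
  then have "cuntz_elt E G act (gcod G g, []) g (gdom G g, []) = \<kappa> (gU g)"
    by (simp only: cuntz_elt_kappa Sp_def fst_conv snd_conv if_True simp_thms)
  then show ?thesis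
    using sigma_elt[of "(gcod G g, [])" "(gdom G g, [])" t g] GenU by (simp add: in_all_paths_iff path_len_def)
qed

definition rot :: "('v, 'e, 'g) generator star_word \<Rightarrow> real \<Rightarrow> complex" where
  "rot w t = exp (\<i> * of_real t * of_int (deg w))"

lemma sigma_word: "\<sigma> t (\<kappa> (mon w)) = rot w t \<odot>\<^bsub>CA\<^esub> \<kappa> (mon w)"
proof -
  have "\<sigma> t (\<kappa> (mon (Word ls))) = rot (Word ls) t \<odot>\<^bsub>CA\<^esub> \<kappa> (mon (Word ls))" for ls
  proof (induction ls)
    case Nil
    then show ?case
      using sigma_one[of t] by (simp add: kappa_hom mon_0 rot_def flip: zero_star_word_def)
  next
    case (Cons l ls)
    have m: "mon (Word (l # ls)) = mon (Word [l]) * mon (Word ls)"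
      by (simp add: plus_star_word_def flip: mon_add)
    have "\<sigma> t (\<kappa> (mon (Word [l]))) = exp (\<i> * of_real t * of_int (gdeg l)) \<odot>\<^bsub>CA\<^esub> \<kappa> (mon (Word [l]))"
    proof (cases "snd l")
      case False
      then show ?thesis using sigma_gen[of t "fst l"] by (cases l) (simp add: free_gen_mon)
    next
      case True
      then obtain y where l: "l = (y, True)" by (cases l) auto
      have g: "gdeg (y, True) = - gdeg (y, False)" by (cases y) auto
      have "\<sigma> t (star CA (\<kappa> (free_gen y))) = star CA (exp (\<i> * of_real t * of_int (gdeg (y, False))) \<odot>\<^bsub>CA\<^esub> \<kappa> (free_gen y))"
        by (simp only: sigma_star kappa_closed sigma_gen)
      then show ?thesis
        by (simp add: l g kappa_hom free_star_scale free_gen_mon exp_cnj)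
    qed
    then show ?case
      by (simp add: m sigma_mult Cons.IH kappa_hom(4) rot_def deg_Cons[of l ls] free_scale_mult_left
          free_scale_mult_right free_scale_scale exp_add[symmetric] algebra_simps flip: kappa_hom(1))
        (simp add: kappa_hom free_scale_mult_left free_scale_mult_right free_scale_scale exp_add[symmetric] algebra_simps)
  qed
  from this[of "letters w"] show ?thesis by simp
qed

section \<open>Bounds for states\<close>

lemma CA_rep: assumes "y \<in> carrier CA" obtains a where "a \<in> carrier T" "y = q a"
  using assms by (auto simp: CA_eq Q.carrier_Q)

lemma CA_star_closed: "y \<in> carrier CA \<Longrightarrow> star CA y \<in> carrier CA"
  by (auto simp: CA_eq Q.carrier_Q Q.q_star T.star_closed)

lemma CA_star_star: "y \<in> carrier CA \<Longrightarrow> star CA (star CA y) = y"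
  by (auto simp: CA_eq Q.carrier_Q Q.q_star T.star_closed T.star_star)

lemma ring_CA: "ring CA"
  unfolding CA_eq by (rule Q.ring_Q)

lemma CA_mult_closed: "y \<in> carrier CA \<Longrightarrow> z \<in> carrier CA \<Longrightarrow> y \<otimes>\<^bsub>CA\<^esub> z \<in> carrier CA"
  by (rule ring.ring_simprules(5)[OF ring_CA])

lemma CA_scale_closed: "y \<in> carrier CA \<Longrightarrow> z \<odot>\<^bsub>CA\<^esub> y \<in> carrier CA"
  by (auto simp: CA_eq Q.carrier_Q Q.q_scale)

lemma CA_mult_scale: "y \<in> carrier CA \<Longrightarrow> z \<in> carrier CA \<Longrightarrow> y \<otimes>\<^bsub>CA\<^esub> (c \<odot>\<^bsub>CA\<^esub> z) = c \<odot>\<^bsub>CA\<^esub> (y \<otimes>\<^bsub>CA\<^esub> z)"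
  and CA_scale_mult: "y \<in> carrier CA \<Longrightarrow> z \<in> carrier CA \<Longrightarrow> (c \<odot>\<^bsub>CA\<^esub> y) \<otimes>\<^bsub>CA\<^esub> z = c \<odot>\<^bsub>CA\<^esub> (y \<otimes>\<^bsub>CA\<^esub> z)"
  by (auto simp: CA_eq Q.carrier_Q Q.q_scale Q.q_mult T.smult_mult_left T.smult_mult_right)

lemma state_sigma: "is_state CA \<phi> \<Longrightarrow> is_state CA (\<lambda>y. \<phi> (\<sigma> t y))"
  unfolding is_state_def
  by (simp add: sigma_add sigma_closed sigma_scale sigma_mult sigma_star sigma_one CA_star_closed)

lemma state_cauchy_schwarz:
  assumes st: "is_state CA \<phi>" and y: "y \<in> carrier CA" and z: "z \<in> carrier CA"
  shows "(cmod (\<phi> (star CA y \<otimes>\<^bsub>CA\<^esub> z)))\<^sup>2 \<le> Re (\<phi> (star CA y \<otimes>\<^bsub>CA\<^esub> y)) * Re (\<phi> (star CA z \<otimes>\<^bsub>CA\<^esub> z))"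
proof -
  obtain a b where ab: "a \<in> carrier T" "y = q a" "b \<in> carrier T" "z = q b" using CA_rep y z by metis
  show ?thesis
    using T.state_form(2)[OF Q.state_q[OF st[unfolded CA_eq]] ab(1,3)] ab
    by (simp add: CA_eq Q.q_star Q.q_mult T.star_closed)
qed

lemma state_square_le:
  assumes st: "is_state CA \<phi>" and a: "a \<in> carrier T"
  shows "Re (\<phi> (star CA (q a) \<otimes>\<^bsub>CA\<^esub> q a)) \<le> (cnorm T a)\<^sup>2"
proof -
  have "Re (\<phi> (star CA (q a) \<otimes>\<^bsub>CA\<^esub> q a)) \<le> cmod (\<phi> (q (star T a \<otimes>\<^bsub>T\<^esub> a)))"
    using a complex_Re_le_cmod by (simp add: CA_eq Q.q_star Q.q_mult T.star_closed)
  also have "\<dots> \<le> cnorm T (star T a \<otimes>\<^bsub>T\<^esub> a)"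
    by (rule T.state_le_cnorm[OF Q.state_q[OF st[unfolded CA_eq]]]) (rule ring.ring_simprules(5)[OF T.ring_A T.star_closed[OF a] a])
  finally show ?thesis using T.cstar_identity[OF a] by simp
qed

text \<open>Cauchy-Schwarz separates \<open>b\<close> from the evolved element. The bound is uniform
  in \<open>t\<close> because \<open>\<phi>\<close> composed with \<open>\<sigma> t\<close> is again
  a state.\<close>

lemma state_mult_bound:
  assumes st: "is_state CA \<phi>" and b: "b \<in> carrier CA"
  obtains K where "0 \<le> K"
    "\<And>t a. a \<in> carrier T \<Longrightarrow> cmod (\<phi> (b \<otimes>\<^bsub>CA\<^esub> \<sigma> t (q a))) \<le> K * cnorm T a"
    "\<And>t a. a \<in> carrier T \<Longrightarrow> cmod (\<phi> (\<sigma> t (q a) \<otimes>\<^bsub>CA\<^esub> b)) \<le> K * cnorm T a"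
    "\<And>a. a \<in> carrier T \<Longrightarrow> cmod (\<phi> (b \<otimes>\<^bsub>CA\<^esub> q a)) \<le> K * cnorm T a"
    "\<And>a. a \<in> carrier T \<Longrightarrow> cmod (\<phi> (q a \<otimes>\<^bsub>CA\<^esub> b)) \<le> K * cnorm T a"
proof -
  \<comment> \<open>The sum of both squares yields one constant for products on either side.\<close>
  define B where "B = Re (\<phi> (b \<otimes>\<^bsub>CA\<^esub> star CA b)) + Re (\<phi> (star CA b \<otimes>\<^bsub>CA\<^esub> b))"
  have pos: "0 \<le> Re (\<phi> (star CA y \<otimes>\<^bsub>CA\<^esub> y))" if "y \<in> carrier CA" for y
    using st that by (auto simp: is_state_def complex_nonneg_Reals_iff)
  have B1: "0 \<le> Re (\<phi> (b \<otimes>\<^bsub>CA\<^esub> star CA b))"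
    using pos[OF CA_star_closed[OF b]] b by (simp add: CA_star_star)
  have B2: "0 \<le> Re (\<phi> (star CA b \<otimes>\<^bsub>CA\<^esub> b))" by (rule pos[OF b])
  have B: "0 \<le> B" using B1 B2 by (simp add: B_def)
  have qc: "q a \<in> carrier CA" if "a \<in> carrier T" for a using that by (simp add: CA_eq)
  have l: "cmod (\<phi> (b \<otimes>\<^bsub>CA\<^esub> \<sigma> t (q a))) \<le> sqrt B * cnorm T a" if a: "a \<in> carrier T" for t a
  proof (rule power2_le_imp_le)
    have sa: "\<sigma> t (q a) \<in> carrier CA" by (rule sigma_closed[OF qc[OF a]])
    have "(cmod (\<phi> (b \<otimes>\<^bsub>CA\<^esub> \<sigma> t (q a))))\<^sup>2 \<le> Re (\<phi> (b \<otimes>\<^bsub>CA\<^esub> star CA b)) * Re (\<phi> (star CA (\<sigma> t (q a)) \<otimes>\<^bsub>CA\<^esub> \<sigma> t (q a)))"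
      using state_cauchy_schwarz[OF st CA_star_closed[OF b] sa] b by (simp add: CA_star_star)
    also have "\<phi> (star CA (\<sigma> t (q a)) \<otimes>\<^bsub>CA\<^esub> \<sigma> t (q a)) = \<phi> (\<sigma> t (star CA (q a) \<otimes>\<^bsub>CA\<^esub> q a))"
      using qc[OF a] by (simp add: sigma_mult sigma_star CA_star_closed)
    also have "Re (\<phi> (b \<otimes>\<^bsub>CA\<^esub> star CA b)) * Re \<dots> \<le> B * (cnorm T a)\<^sup>2"
      using state_square_le[OF state_sigma[OF st] a] B1 B2 pos[OF sa] qc[OF a]
      by (intro mult_mono) (auto simp: B_def sigma_mult sigma_star CA_star_closed)
    finally show "(cmod (\<phi> (b \<otimes>\<^bsub>CA\<^esub> \<sigma> t (q a))))\<^sup>2 \<le> (sqrt B * cnorm T a)\<^sup>2"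
      using B by (simp add: power_mult_distrib)
  qed (use B T.cnorm_nonneg[OF a] in simp)
  have r: "cmod (\<phi> (\<sigma> t (q a) \<otimes>\<^bsub>CA\<^esub> b)) \<le> sqrt B * cnorm T a" if a: "a \<in> carrier T" for t a
  proof (rule power2_le_imp_le)
    have a': "star T a \<in> carrier T" by (rule T.star_closed[OF a])
    have qa: "q a = star CA (q (star T a))" using a a' by (simp add: CA_eq Q.q_star T.star_star)
    have sa: "\<sigma> t (q (star T a)) \<in> carrier CA" by (rule sigma_closed[OF qc[OF a']])
    have "(cmod (\<phi> (\<sigma> t (q a) \<otimes>\<^bsub>CA\<^esub> b)))\<^sup>2 \<le>
        Re (\<phi> (star CA (\<sigma> t (q (star T a))) \<otimes>\<^bsub>CA\<^esub> \<sigma> t (q (star T a)))) * Re (\<phi> (star CA b \<otimes>\<^bsub>CA\<^esub> b))"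
      using state_cauchy_schwarz[OF st sa b] sigma_star[OF qc[OF a']] by (simp add: qa)
    also have "\<phi> (star CA (\<sigma> t (q (star T a))) \<otimes>\<^bsub>CA\<^esub> \<sigma> t (q (star T a))) = \<phi> (\<sigma> t (star CA (q (star T a)) \<otimes>\<^bsub>CA\<^esub> q (star T a)))"
      using qc[OF a'] by (simp add: sigma_mult sigma_star CA_star_closed)
    also have "Re \<dots> * Re (\<phi> (star CA b \<otimes>\<^bsub>CA\<^esub> b)) \<le> (cnorm T a)\<^sup>2 * B"
      using state_square_le[OF state_sigma[OF st] a'] B1 B2 pos[OF sa] qc[OF a'] T.cnorm_star[OF a]
      by (intro mult_mono) (auto simp: B_def sigma_mult sigma_star CA_star_closed)
    finally show "(cmod (\<phi> (\<sigma> t (q a) \<otimes>\<^bsub>CA\<^esub> b)))\<^sup>2 \<le> (sqrt B * cnorm T a)\<^sup>2"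
      using B by (simp add: power_mult_distrib mult.commute)
  qed (use B T.cnorm_nonneg[OF a] in simp)
  have s0: "\<sigma> 0 y = y" if "y \<in> carrier CA" for y using dynamics that by (simp add: is_dynamics_def)
  show thesis
    by (rule that[of "sqrt B"]) (use l r l[of _ 0] r[of _ 0] s0 qc B in auto)
qed

end


lemma entire_translate:
  assumes "f holomorphic_on UNIV"
  shows "(\<lambda>z. f (z + c)) holomorphic_on UNIV"
  using holomorphic_on_compose[of "\<lambda>z. z + c" UNIV f] holomorphic_on_subset[OF assms]
  by (simp add: o_def holomorphic_intros)

context dynamics_action
begin

section \<open>KMS states are traces up to a weight\<close>

lemma CA_uminus: "y \<in> carrier CA \<Longrightarrow> \<ominus>\<^bsub>CA\<^esub> y = (-1) \<odot>\<^bsub>CA\<^esub> y"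
proof -
  assume y: "y \<in> carrier CA"
  then obtain a where a: "a \<in> carrier T" "y = q a" by (rule CA_rep)
  have "(-1) \<odot>\<^bsub>CA\<^esub> y \<oplus>\<^bsub>CA\<^esub> y = \<zero>\<^bsub>CA\<^esub>"
    using a by (simp add: CA_eq Q.q_scale Q.q_add Q.q_zero T.scl_minus_1 T.A_l_neg)
  then show ?thesis
    using abelian_group.minus_equality[OF ring.is_abelian_group[OF ring_CA]] y CA_scale_closed by metis
qed

lemma submodule_CAI:
  assumes W: "W \<subseteq> carrier CA" "\<zero>\<^bsub>CA\<^esub> \<in> W" "\<And>y z. y \<in> W \<Longrightarrow> z \<in> W \<Longrightarrow> y \<oplus>\<^bsub>CA\<^esub> z \<in> W"
    and sc: "\<And>c y. y \<in> W \<Longrightarrow> c \<odot>\<^bsub>CA\<^esub> y \<in> W"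
  shows "submodule W complex_ring CA"
proof (rule submodule.intro)
  have "\<ominus>\<^bsub>CA\<^esub> y \<in> W" if "y \<in> W" for y using CA_uminus[of y] sc[OF that, of "-1"] W(1) that by auto
  then show "subgroup W (add_monoid CA)"
    using W by (intro group.subgroupI[OF abelian_group.a_group[OF ring.is_abelian_group[OF ring_CA]]])
      (auto simp: a_inv_def)
  show "submodule_axioms W complex_ring CA" by unfold_locales (rule sc)
qed

lemma submodule_add: "submodule W complex_ring CA \<Longrightarrow> y \<in> W \<Longrightarrow> z \<in> W \<Longrightarrow> y \<oplus>\<^bsub>CA\<^esub> z \<in> W"
  using subgroup.m_closed[OF submodule.axioms(1)] by fastforce

lemma submodule_scale: "submodule W complex_ring CA \<Longrightarrow> y \<in> W \<Longrightarrow> c \<odot>\<^bsub>CA\<^esub> y \<in> W"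
  using submodule.smult_closed[of W complex_ring CA c y] T.in_complex_ring by blast

lemma span_minimal: "submodule W complex_ring CA \<Longrightarrow> S \<subseteq> W \<Longrightarrow> cstar_span CA S \<subseteq> W"
  by (auto simp: cstar_span_def)

lemma CA_add_closed: "y \<in> carrier CA \<Longrightarrow> z \<in> carrier CA \<Longrightarrow> y \<oplus>\<^bsub>CA\<^esub> z \<in> carrier CA"
  by (rule ring.ring_simprules(1)[OF ring_CA])

lemma CA_zero_closed: "\<zero>\<^bsub>CA\<^esub> \<in> carrier CA"
  by (rule ring.ring_simprules(2)[OF ring_CA])

lemma carrier_submodule: "submodule (carrier CA) complex_ring CA"
  by (rule submodule_CAI) (auto simp: CA_add_closed CA_zero_closed CA_scale_closed)

lemma CA_distrib: "y \<in> carrier CA \<Longrightarrow> z \<in> carrier CA \<Longrightarrow> w \<in> carrier CA \<Longrightarrow>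
    w \<otimes>\<^bsub>CA\<^esub> (y \<oplus>\<^bsub>CA\<^esub> z) = w \<otimes>\<^bsub>CA\<^esub> y \<oplus>\<^bsub>CA\<^esub> w \<otimes>\<^bsub>CA\<^esub> z"
  "y \<in> carrier CA \<Longrightarrow> z \<in> carrier CA \<Longrightarrow> w \<in> carrier CA \<Longrightarrow>
    (y \<oplus>\<^bsub>CA\<^esub> z) \<otimes>\<^bsub>CA\<^esub> w = y \<otimes>\<^bsub>CA\<^esub> w \<oplus>\<^bsub>CA\<^esub> z \<otimes>\<^bsub>CA\<^esub> w"
  by (rule ring.ring_simprules(23)[OF ring_CA] ring.ring_simprules(13)[OF ring_CA]; assumption)+

lemma CA_null: "y \<in> carrier CA \<Longrightarrow> y \<otimes>\<^bsub>CA\<^esub> \<zero>\<^bsub>CA\<^esub> = \<zero>\<^bsub>CA\<^esub>"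
  "y \<in> carrier CA \<Longrightarrow> \<zero>\<^bsub>CA\<^esub> \<otimes>\<^bsub>CA\<^esub> y = \<zero>\<^bsub>CA\<^esub>"
  by (rule ring.ring_simprules(25)[OF ring_CA] ring.ring_simprules(24)[OF ring_CA]; assumption)+

lemma CA_zero_scale: "0 \<odot>\<^bsub>CA\<^esub> \<one>\<^bsub>CA\<^esub> = \<zero>\<^bsub>CA\<^esub>"
  by (simp add: CA_eq Q.q_one Q.q_scale Q.q_zero T.scl_0)

lemma CA_one_closed: "\<one>\<^bsub>CA\<^esub> \<in> carrier CA"
  by (rule ring.ring_simprules(6)[OF ring_CA])

lemma sigma_zero: "\<sigma> t \<zero>\<^bsub>CA\<^esub> = \<zero>\<^bsub>CA\<^esub>"
  using sigma_scale[OF CA_one_closed, of t 0] by (simp add: CA_zero_scale sigma_one)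

context
  fixes \<phi> :: "('v, 'e, 'g) cuntz_elem \<Rightarrow> complex"
  assumes st: "is_state CA \<phi>"
begin

lemma st_add: "y \<in> carrier CA \<Longrightarrow> z \<in> carrier CA \<Longrightarrow> \<phi> (y \<oplus>\<^bsub>CA\<^esub> z) = \<phi> y + \<phi> z"
  and st_scale: "y \<in> carrier CA \<Longrightarrow> \<phi> (c \<odot>\<^bsub>CA\<^esub> y) = c * \<phi> y"
  using st by (simp_all add: is_state_def)

lemma st_zero: "\<phi> \<zero>\<^bsub>CA\<^esub> = 0"
  using st_scale[OF CA_one_closed, of 0] by (simp add: CA_zero_scale)

text \<open>The KMS condition of a pair, expressed through a scalar entire function. In this form it
  is linear in each argument and passes to spans, whereas \<open>is_kms_state\<close> gives it only
  on the spanning set.\<close>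

definition kms_pair :: "real \<Rightarrow> ('v, 'e, 'g) cuntz_elem \<Rightarrow> ('v, 'e, 'g) cuntz_elem \<Rightarrow> bool" where
  "kms_pair \<beta> a b \<longleftrightarrow> (\<exists>F. F holomorphic_on UNIV \<and> (\<forall>t::real. F (of_real t) = \<phi> (b \<otimes>\<^bsub>CA\<^esub> \<sigma> t a)) \<and>
      F (\<i> * of_real \<beta>) = \<phi> (a \<otimes>\<^bsub>CA\<^esub> b))"

lemma kms_pair_submodule_right:
  assumes a: "a \<in> carrier CA"
  shows "submodule {b \<in> carrier CA. kms_pair \<beta> a b} complex_ring CA"
proof (rule submodule_CAI)
  show "\<zero>\<^bsub>CA\<^esub> \<in> {b \<in> carrier CA. kms_pair \<beta> a b}"
    using a by (auto simp: kms_pair_def CA_null CA_zero_closed sigma_closed st_zero intro!: exI[of _ "\<lambda>_. 0"])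
next
  fix y z assume "y \<in> {b \<in> carrier CA. kms_pair \<beta> a b}" "z \<in> {b \<in> carrier CA. kms_pair \<beta> a b}"
  then obtain F F' where F: "y \<in> carrier CA" "z \<in> carrier CA" "F holomorphic_on UNIV" "F' holomorphic_on UNIV"
    "\<And>t::real. F (of_real t) = \<phi> (y \<otimes>\<^bsub>CA\<^esub> \<sigma> t a)" "\<And>t::real. F' (of_real t) = \<phi> (z \<otimes>\<^bsub>CA\<^esub> \<sigma> t a)"
    "F (\<i> * of_real \<beta>) = \<phi> (a \<otimes>\<^bsub>CA\<^esub> y)" "F' (\<i> * of_real \<beta>) = \<phi> (a \<otimes>\<^bsub>CA\<^esub> z)"
    unfolding kms_pair_def by blast
  then have "kms_pair \<beta> a (y \<oplus>\<^bsub>CA\<^esub> z)"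
    unfolding kms_pair_def using a
    by (intro exI[of _ "\<lambda>w. F w + F' w"])
      (auto simp: CA_distrib sigma_closed st_add CA_mult_closed intro!: holomorphic_intros)
  then show "y \<oplus>\<^bsub>CA\<^esub> z \<in> {b \<in> carrier CA. kms_pair \<beta> a b}" using F CA_add_closed by simp
next
  fix c y assume "y \<in> {b \<in> carrier CA. kms_pair \<beta> a b}"
  then obtain F where F: "y \<in> carrier CA" "F holomorphic_on UNIV"
    "\<And>t::real. F (of_real t) = \<phi> (y \<otimes>\<^bsub>CA\<^esub> \<sigma> t a)" "F (\<i> * of_real \<beta>) = \<phi> (a \<otimes>\<^bsub>CA\<^esub> y)"
    unfolding kms_pair_def by blast
  then have "kms_pair \<beta> a (c \<odot>\<^bsub>CA\<^esub> y)"
    unfolding kms_pair_def using a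
    by (intro exI[of _ "\<lambda>w. c * F w"])
      (auto simp: CA_mult_scale CA_scale_mult sigma_closed st_scale CA_mult_closed intro!: holomorphic_intros)
  then show "c \<odot>\<^bsub>CA\<^esub> y \<in> {b \<in> carrier CA. kms_pair \<beta> a b}" using F CA_scale_closed by simp
qed auto

lemma kms_pair_submodule_left:
  assumes b: "b \<in> carrier CA"
  shows "submodule {a \<in> carrier CA. kms_pair \<beta> a b} complex_ring CA"
proof (rule submodule_CAI)
  show "\<zero>\<^bsub>CA\<^esub> \<in> {a \<in> carrier CA. kms_pair \<beta> a b}"
    using b by (auto simp: kms_pair_def CA_null CA_zero_closed sigma_zero st_zero intro!: exI[of _ "\<lambda>_. 0"])
next
  fix y z assume "y \<in> {a \<in> carrier CA. kms_pair \<beta> a b}" "z \<in> {a \<in> carrier CA. kms_pair \<beta> a b}"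
  then obtain F F' where F: "y \<in> carrier CA" "z \<in> carrier CA" "F holomorphic_on UNIV" "F' holomorphic_on UNIV"
    "\<And>t::real. F (of_real t) = \<phi> (b \<otimes>\<^bsub>CA\<^esub> \<sigma> t y)" "\<And>t::real. F' (of_real t) = \<phi> (b \<otimes>\<^bsub>CA\<^esub> \<sigma> t z)"
    "F (\<i> * of_real \<beta>) = \<phi> (y \<otimes>\<^bsub>CA\<^esub> b)" "F' (\<i> * of_real \<beta>) = \<phi> (z \<otimes>\<^bsub>CA\<^esub> b)"
    unfolding kms_pair_def by blast
  then have "kms_pair \<beta> (y \<oplus>\<^bsub>CA\<^esub> z) b"
    unfolding kms_pair_def using b
    by (intro exI[of _ "\<lambda>w. F w + F' w"])
      (auto simp: CA_distrib sigma_closed sigma_add st_add CA_mult_closed intro!: holomorphic_intros)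
  then show "y \<oplus>\<^bsub>CA\<^esub> z \<in> {a \<in> carrier CA. kms_pair \<beta> a b}" using F CA_add_closed by simp
next
  fix c y assume "y \<in> {a \<in> carrier CA. kms_pair \<beta> a b}"
  then obtain F where F: "y \<in> carrier CA" "F holomorphic_on UNIV"
    "\<And>t::real. F (of_real t) = \<phi> (b \<otimes>\<^bsub>CA\<^esub> \<sigma> t y)" "F (\<i> * of_real \<beta>) = \<phi> (y \<otimes>\<^bsub>CA\<^esub> b)"
    unfolding kms_pair_def by blast
  then have "kms_pair \<beta> (c \<odot>\<^bsub>CA\<^esub> y) b"
    unfolding kms_pair_def using b
    by (intro exI[of _ "\<lambda>w. c * F w"])
      (auto simp: CA_mult_scale CA_scale_mult sigma_closed sigma_scale st_scale CA_mult_closed intro!: holomorphic_intros)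
  then show "c \<odot>\<^bsub>CA\<^esub> y \<in> {a \<in> carrier CA. kms_pair \<beta> a b}" using F CA_scale_closed by simp
qed auto

text \<open>Multiplication by \<open>b\<close> followed by the state is bounded by norms of
  representatives and, taking infima, by the quotient norm. It therefore maps norm convergent
  difference quotients to convergent ones.\<close>

lemma entire_holomorphic:
  assumes f: "is_entire CA f" and b: "b \<in> carrier CA"
  shows "(\<lambda>z. \<phi> (b \<otimes>\<^bsub>CA\<^esub> f z)) holomorphic_on UNIV"
proof -
  obtain K where K: "0 \<le> K" "\<And>a. a \<in> carrier T \<Longrightarrow> cmod (\<phi> (b \<otimes>\<^bsub>CA\<^esub> q a)) \<le> K * cnorm T a"
    using state_mult_bound[OF st b] by metis
  have bound: "cmod (\<phi> (b \<otimes>\<^bsub>CA\<^esub> y)) \<le> (K + 1) * cnorm CA y" if y: "y \<in> carrier CA" for y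
  proof -
    have "cmod (\<phi> (b \<otimes>\<^bsub>CA\<^esub> y)) / (K + 1) \<le> cnorm CA y"
    proof (rule dense_ge)
      fix s assume "cnorm CA y < s"
      then obtain a where a: "a \<in> carrier T" "q a = y" "cnorm T a < s"
        using Q.cnorm_Q_less[of y s] y by (auto simp: CA_eq)
      have "cmod (\<phi> (b \<otimes>\<^bsub>CA\<^esub> y)) \<le> K * cnorm T a" using K(2)[OF a(1)] a(2) by simp
      also have "\<dots> \<le> (K + 1) * s"
        using K(1) a(3) T.cnorm_nonneg[OF a(1)] by (intro mult_mono) auto
      finally show "cmod (\<phi> (b \<otimes>\<^bsub>CA\<^esub> y)) / (K + 1) \<le> s" using K(1) by (simp add: pos_divide_le_eq mult.commute)
    qed
    then show ?thesis using K(1) by (simp add: pos_divide_le_eq mult.commute)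
  qed
  have fc: "f z \<in> carrier CA" for z using f by (simp add: is_entire_def)
  have minus: "\<phi> (b \<otimes>\<^bsub>CA\<^esub> (y \<ominus>\<^bsub>CA\<^esub> z)) = \<phi> (b \<otimes>\<^bsub>CA\<^esub> y) - \<phi> (b \<otimes>\<^bsub>CA\<^esub> z)"
    if "y \<in> carrier CA" "z \<in> carrier CA" for y z
    using that b by (simp add: a_minus_def CA_uminus CA_distrib CA_scale_closed CA_mult_scale st_add st_scale CA_mult_closed)
  have mc: "y \<ominus>\<^bsub>CA\<^esub> z \<in> carrier CA" if "y \<in> carrier CA" "z \<in> carrier CA" for y z
    using that by (simp add: a_minus_def CA_uminus CA_scale_closed CA_add_closed)
  have "((\<lambda>z. \<phi> (b \<otimes>\<^bsub>CA\<^esub> f z)) has_field_derivative \<phi> (b \<otimes>\<^bsub>CA\<^esub> D)) (at z)"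
    if D: "D \<in> carrier CA" "((\<lambda>h. cnorm CA (inverse h \<odot>\<^bsub>CA\<^esub> (f (z + h) \<ominus>\<^bsub>CA\<^esub> f z) \<ominus>\<^bsub>CA\<^esub> D)) \<longlongrightarrow> 0) (at 0)" for z D
    unfolding DERIV_def
  proof (rule LIM_zero_cancel, rule Lim_null_comparison)
    show "((\<lambda>h. (K + 1) * cnorm CA (inverse h \<odot>\<^bsub>CA\<^esub> (f (z + h) \<ominus>\<^bsub>CA\<^esub> f z) \<ominus>\<^bsub>CA\<^esub> D)) \<longlongrightarrow> 0) (at 0)"
      by (rule tendsto_mult_right_zero[OF D(2)])
    have "norm ((\<phi> (b \<otimes>\<^bsub>CA\<^esub> f (z + h)) - \<phi> (b \<otimes>\<^bsub>CA\<^esub> f z)) / h - \<phi> (b \<otimes>\<^bsub>CA\<^esub> D)) \<le>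
        (K + 1) * cnorm CA (inverse h \<odot>\<^bsub>CA\<^esub> (f (z + h) \<ominus>\<^bsub>CA\<^esub> f z) \<ominus>\<^bsub>CA\<^esub> D)" for h
    proof -
      let ?y = "inverse h \<odot>\<^bsub>CA\<^esub> (f (z + h) \<ominus>\<^bsub>CA\<^esub> f z) \<ominus>\<^bsub>CA\<^esub> D"
      have "\<phi> (b \<otimes>\<^bsub>CA\<^esub> ?y) = (\<phi> (b \<otimes>\<^bsub>CA\<^esub> f (z + h)) - \<phi> (b \<otimes>\<^bsub>CA\<^esub> f z)) / h - \<phi> (b \<otimes>\<^bsub>CA\<^esub> D)"
        using D(1) fc b by (simp add: minus mc CA_scale_closed CA_mult_scale st_scale CA_mult_closed divide_inverse mult.commute)
      then show ?thesis using bound[of ?y] D(1) fc mc CA_scale_closed by simp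
    qed
    then show "\<forall>\<^sub>F h in at 0. norm ((\<phi> (b \<otimes>\<^bsub>CA\<^esub> f (z + h)) - \<phi> (b \<otimes>\<^bsub>CA\<^esub> f z)) / h - \<phi> (b \<otimes>\<^bsub>CA\<^esub> D)) \<le>
        (K + 1) * cnorm CA (inverse h \<odot>\<^bsub>CA\<^esub> (f (z + h) \<ominus>\<^bsub>CA\<^esub> f z) \<ominus>\<^bsub>CA\<^esub> D)"
      by (rule always_eventually[OF allI])
  qed
  moreover have "\<exists>D\<in>carrier CA. ((\<lambda>h. cnorm CA (inverse h \<odot>\<^bsub>CA\<^esub> (f (z + h) \<ominus>\<^bsub>CA\<^esub> f z) \<ominus>\<^bsub>CA\<^esub> D)) \<longlongrightarrow> 0) (at 0)" for z
    using f by (simp add: is_entire_def)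
  ultimately show ?thesis unfolding holomorphic_on_open[OF open_UNIV] by blast
qed

text \<open>A word picks up an integral power of \<open>exp (\<i> t)\<close>, which is 1 after a
  full turn; the bounds of \<open>state_mult_bound\<close> extend this from words to all
  \<open>y\<close>.\<close>

lemma sigma_periodic:
  assumes b: "b \<in> carrier CA" and y: "y \<in> carrier CA"
  shows "\<phi> (b \<otimes>\<^bsub>CA\<^esub> \<sigma> (2 * pi) y) = \<phi> (b \<otimes>\<^bsub>CA\<^esub> y)"
proof -
  obtain K where K: "\<And>t a. a \<in> carrier T \<Longrightarrow> cmod (\<phi> (b \<otimes>\<^bsub>CA\<^esub> \<sigma> t (q a))) \<le> K * cnorm T a"
    "\<And>a. a \<in> carrier T \<Longrightarrow> cmod (\<phi> (b \<otimes>\<^bsub>CA\<^esub> q a)) \<le> K * cnorm T a"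
    using state_mult_bound[OF st b] by metis
  let ?\<theta> = "\<lambda>y. \<phi> (b \<otimes>\<^bsub>CA\<^esub> \<sigma> (2 * pi) y) - \<phi> (b \<otimes>\<^bsub>CA\<^esub> y)"
  have rot1: "rot w (2 * pi) = 1" for w
  proof -
    have "\<i> * of_real (2 * pi) * of_int (deg w) = (2 * of_int (deg w) * of_real pi) * \<i>" by simp
    then show ?thesis unfolding rot_def by (simp only: exp_eq_1) auto
  qed
  have "?\<theta> y = 0"
  proof (rule bounded_functional_zero[OF _ _ _ _ y, of ?\<theta> "2 * K"])
    fix a assume a: "a \<in> carrier T"
    show "cmod (?\<theta> (q a)) \<le> 2 * K * cnorm T a"
      using norm_triangle_ineq4[of "\<phi> (b \<otimes>\<^bsub>CA\<^esub> \<sigma> (2 * pi) (q a))" "\<phi> (b \<otimes>\<^bsub>CA\<^esub> q a)"] K(1)[OF a, of "2 * pi"] K(2)[OF a] by simp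
  next
    fix w
    show "?\<theta> (\<kappa> (mon w)) = 0"
      by (simp only: sigma_word rot1) (simp add: kappa_hom)
  qed (use b in \<open>simp_all add: sigma_add sigma_closed CA_distrib st_add CA_mult_closed sigma_scale CA_mult_scale st_scale algebra_simps\<close>)
  then show ?thesis by simp
qed

text \<open>The error is lifted to an element of \<open>T\<close> of small norm, the form in which
  \<open>state_mult_bound\<close> accepts it.\<close>

lemma CA_approx:
  assumes V: "V \<subseteq> carrier CA" and dense: "cstar_dense CA V" and y: "y \<in> carrier CA" and e: "0 < \<epsilon>"
  obtains v d where "v \<in> V" "d \<in> carrier T" "cnorm T d < \<epsilon>" "y = v \<oplus>\<^bsub>CA\<^esub> q d"
proof -
  obtain v where v: "v \<in> V" "cnorm CA (y \<ominus>\<^bsub>CA\<^esub> v) < \<epsilon>"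
    using dense y e unfolding cstar_dense_def by blast
  have vc: "v \<in> carrier CA" using v V by blast
  have d: "y \<ominus>\<^bsub>CA\<^esub> v \<in> carrier CA" by (rule ring.ring_simprules(4)[OF ring_CA y vc])
  obtain d where d: "d \<in> carrier T" "q d = y \<ominus>\<^bsub>CA\<^esub> v" "cnorm T d < \<epsilon>"
    using Q.cnorm_Q_less[OF d[unfolded CA_eq] v(2)[unfolded CA_eq]] by (auto simp: CA_eq)
  obtain a b where ab: "a \<in> carrier T" "y = q a" "b \<in> carrier T" "v = q b" using CA_rep y vc by metis
  have "b \<oplus>\<^bsub>T\<^esub> (a \<ominus>\<^bsub>T\<^esub> b) = a"
    using T.minus_add_cancel[OF ab(1,3)] ab ring.ring_simprules(10)[OF T.ring_A] ring.ring_simprules(4)[OF T.ring_A] by metis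
  then have "v \<oplus>\<^bsub>CA\<^esub> (y \<ominus>\<^bsub>CA\<^esub> v) = y"
    using ab ring.ring_simprules(4)[OF T.ring_A ab(1,3)] by (simp add: CA_eq Q.q_minus Q.q_add)
  then show thesis using that[OF v(1) d(1,3)] d(2) by simp
qed

lemma small_imp_zero:
  assumes "0 \<le> (C::real)" "\<And>\<epsilon>. 0 < \<epsilon> \<Longrightarrow> cmod z \<le> C * \<epsilon>"
  shows "z = 0"
proof -
  have "cmod z \<le> e" if "0 < e" for e
  proof -
    have "cmod z \<le> C * (e / (C + 1))" by (rule assms(2)) (use that assms(1) in simp)
    also have "\<dots> \<le> e" using that assms(1) by (simp add: field_simps)
    finally show ?thesis .
  qed
  then have "cmod z \<le> 0" by (rule field_le_epsilon[of _ 0, simplified])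
  then show ?thesis by simp
qed

text \<open>The word \<open>a0\<close> need not lie in \<open>V\<close>, so it is approximated by
  some \<open>a\<close> in \<open>V\<close>. The entire function \<open>F\<close> of
  \<open>a\<close> has period \<open>2 * pi\<close>, and its Fourier coefficient of order
  \<open>n\<close> can be read off on two lines: the real line gives nearly the value at
  \<open>b a0\<close>, the line at height \<open>\<beta>\<close> nearly
  \<open>exp (\<beta> n)\<close> times the value at \<open>a0 b\<close>.\<close>

lemma kms_word:
  assumes V: "submodule V complex_ring CA" "V \<subseteq> carrier CA" "cstar_dense CA V" "\<And>t. \<sigma> t ` V \<subseteq> V"
    and pair: "\<And>a b. a \<in> V \<Longrightarrow> b \<in> V \<Longrightarrow> kms_pair \<beta> a b"
    and y: "y \<in> carrier CA"
  shows "of_real (exp (\<beta> * of_int (deg w))) * \<phi> (\<kappa> (mon w) \<otimes>\<^bsub>CA\<^esub> y) = \<phi> (y \<otimes>\<^bsub>CA\<^esub> \<kappa> (mon w))"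
proof -
  define n where "n = deg w"
  define a0 where "a0 = \<kappa> (mon w)"
  have a0: "a0 \<in> carrier CA" by (simp add: a0_def)
  define E\<^sub>\<beta> where "E\<^sub>\<beta> = exp (\<beta> * of_int n)"
  have sig: "\<sigma> t a0 = exp (\<i> * of_real t * of_int n) \<odot>\<^bsub>CA\<^esub> a0" for t
    unfolding a0_def sigma_word rot_def n_def ..
  have main: "of_real E\<^sub>\<beta> * \<phi> (a0 \<otimes>\<^bsub>CA\<^esub> b) - \<phi> (b \<otimes>\<^bsub>CA\<^esub> a0) = 0" if bV: "b \<in> V" for b
  proof -
    have b: "b \<in> carrier CA" using bV V(2) by blast
    obtain K where K: "0 \<le> K"
      "\<And>t a. a \<in> carrier T \<Longrightarrow> cmod (\<phi> (b \<otimes>\<^bsub>CA\<^esub> \<sigma> t (q a))) \<le> K * cnorm T a"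
      "\<And>t a. a \<in> carrier T \<Longrightarrow> cmod (\<phi> (\<sigma> t (q a) \<otimes>\<^bsub>CA\<^esub> b)) \<le> K * cnorm T a"
      using state_mult_bound[OF st b] by metis
    show ?thesis
    proof (rule small_imp_zero)
      show "0 \<le> (E\<^sub>\<beta> + 1) * K" using K(1) by (simp add: E\<^sub>\<beta>_def)
      fix \<epsilon> :: real assume e: "0 < \<epsilon>"
      obtain a d where ad: "a \<in> V" "d \<in> carrier T" "cnorm T d < \<epsilon>" "a0 = a \<oplus>\<^bsub>CA\<^esub> q d"
        using CA_approx[OF V(2,3) a0 e] by blast
      have a: "a \<in> carrier CA" and qd: "q d \<in> carrier CA" using ad V(2) by (auto simp: CA_eq)
      obtain F where F: "F holomorphic_on UNIV" "\<And>t::real. F (of_real t) = \<phi> (b \<otimes>\<^bsub>CA\<^esub> \<sigma> t a)"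
        using pair[OF ad(1) bV] unfolding kms_pair_def by blast
      \<comment> \<open>The KMS condition gives \<open>F\<close> at \<open>\<i> \<beta>\<close>
        only. Applied to \<open>\<sigma> s a\<close>, which lies in \<open>V\<close> by invariance,
        and combined with the identity theorem, it gives \<open>F\<close> on the whole line.\<close>
      have Fshift: "F (of_real s + \<i> * of_real \<beta>) = \<phi> (\<sigma> s a \<otimes>\<^bsub>CA\<^esub> b)" for s :: real
      proof -
        have "\<sigma> s a \<in> V" using V(4) ad(1) by blast
        then obtain F' where F': "F' holomorphic_on UNIV" "\<And>t::real. F' (of_real t) = \<phi> (b \<otimes>\<^bsub>CA\<^esub> \<sigma> t (\<sigma> s a))"
          "F' (\<i> * of_real \<beta>) = \<phi> (\<sigma> s a \<otimes>\<^bsub>CA\<^esub> b)"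
          using pair[OF _ bV] unfolding kms_pair_def by blast
        have "F' z = F (z + of_real s)" for z
        proof (rule entire_eqI[OF F'(1)])
          show "(\<lambda>z. F (z + of_real s)) holomorphic_on UNIV"
            by (rule entire_translate[OF F(1)])
          show "F' (of_real t) = F (of_real t + of_real s)" for t
            using F(2)[of "t + s"] F'(2)[of t] sigma_plus[OF a, of t s] by simp
        qed
        then show ?thesis using F'(3) by (simp add: add.commute)
      qed
      \<comment> \<open>The factor undoes the rotation of a word of degree \<open>n\<close>, so
        \<open>H\<close> is nearly constant on each of the two lines.\<close>
      define H where "H z = F z * exp (- (\<i> * of_int n * z))" for z
      have Hh: "H holomorphic_on UNIV" unfolding H_def by (intro holomorphic_intros F(1))
      have Fper: "F (z + of_real (2 * pi)) = F z" for z
      proof (rule entire_eqI[of "\<lambda>z. F (z + of_real (2 * pi))"])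
        show "(\<lambda>z. F (z + of_real (2 * pi))) holomorphic_on UNIV"
          by (rule entire_translate[OF F(1)])
        show "F (of_real t + of_real (2 * pi)) = F (of_real t)" for t
          using F(2)[of "2 * pi + t"] F(2)[of t] sigma_plus[OF a, of "2 * pi" t]
            sigma_periodic[OF b sigma_closed[OF a, of t]] by (simp add: add.commute)
      qed (rule F(1))
      have Hper: "H (z + of_real (2 * pi)) = H z" for z
      proof -
        have "exp (- (\<i> * of_int n * (z + of_real (2 * pi)))) = exp (- (\<i> * of_int n * z)) * exp ((2 * of_int (- n) * of_real pi) * \<i>)"
          by (simp add: exp_add[symmetric] algebra_simps)
        also have "exp ((2 * of_int (- n) * of_real pi) * \<i>) = (1 :: complex)"
          using exp_integer_2pi[of "real_of_int (- n)"]
          by (simp only: of_real_mult of_real_numeral of_real_of_int_eq Ints_of_int simp_thms)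
        finally show ?thesis unfolding H_def Fper by simp
      qed
      \<comment> \<open>One integral for all heights; it is compared below at \<open>z = 0\<close>
        and at \<open>z = \<i> \<beta>\<close>.\<close>
      obtain I where I: "\<And>z. ((\<lambda>t. H (of_real t + z)) has_integral I) {0..2 * pi}"
        using periodic_entire_integral[of H "2 * pi"] Hh Hper by auto
      have bound: "cmod (I - of_real (2 * pi) * c) \<le> 2 * pi * B"
        if "0 \<le> B" "\<And>t. cmod (H (of_real t + z) - c) \<le> B" for z c B
      proof -
        have "((\<lambda>t. c) has_integral (of_real (2 * pi) * c)) {0..2 * pi}"
          using has_integral_const_real[of c 0 "2 * pi"] by (simp add: scaleR_conv_of_real)
        then have "((\<lambda>t. H (of_real t + z) - c) has_integral (I - of_real (2 * pi) * c)) {0..2 * pi}"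
          by (intro has_integral_diff I)
        from has_integral_bound_real[OF that(1) finite.emptyI this] that(2)
        show ?thesis by (simp add: mult.commute)
      qed
      have nexp: "cmod (exp (- (\<i> * of_int n * of_real t))) = 1" for t :: real
        by (simp add: norm_exp_eq_Re)
      have cancel: "exp (\<i> * of_real t * of_int n) * exp (- (\<i> * of_int n * of_real t)) = (1 :: complex)" for t :: real
        by (simp add: exp_add[symmetric] mult_ac)
      have Kd: "K * cnorm T d \<le> K * \<epsilon>" using K(1) ad(3) by (intro mult_left_mono) auto
      have b1: "cmod (H (of_real t + 0) - \<phi> (b \<otimes>\<^bsub>CA\<^esub> a0)) \<le> K * \<epsilon>" for t
      proof -
        have "\<phi> (b \<otimes>\<^bsub>CA\<^esub> \<sigma> t a0) = \<phi> (b \<otimes>\<^bsub>CA\<^esub> \<sigma> t a) + \<phi> (b \<otimes>\<^bsub>CA\<^esub> \<sigma> t (q d))"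
          using a qd b by (simp add: ad(4) sigma_add sigma_closed CA_distrib st_add CA_mult_closed)
        moreover have "\<phi> (b \<otimes>\<^bsub>CA\<^esub> \<sigma> t a0) = exp (\<i> * of_real t * of_int n) * \<phi> (b \<otimes>\<^bsub>CA\<^esub> a0)"
          using a0 b by (simp add: sig CA_mult_scale st_scale CA_mult_closed)
        ultimately have "F (of_real t) = exp (\<i> * of_real t * of_int n) * \<phi> (b \<otimes>\<^bsub>CA\<^esub> a0) - \<phi> (b \<otimes>\<^bsub>CA\<^esub> \<sigma> t (q d))"
          by (simp add: F(2))
        then have "H (of_real t) = (exp (\<i> * of_real t * of_int n) * exp (- (\<i> * of_int n * of_real t))) * \<phi> (b \<otimes>\<^bsub>CA\<^esub> a0)
            - \<phi> (b \<otimes>\<^bsub>CA\<^esub> \<sigma> t (q d)) * exp (- (\<i> * of_int n * of_real t))"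
          by (simp only: H_def left_diff_distrib right_diff_distrib mult_ac)
        then have "cmod (H (of_real t + 0) - \<phi> (b \<otimes>\<^bsub>CA\<^esub> a0)) = cmod (\<phi> (b \<otimes>\<^bsub>CA\<^esub> \<sigma> t (q d)))"
          by (simp only: cancel add_0_right) (simp add: norm_mult nexp)
        then show ?thesis using K(2)[OF ad(2), of t] Kd by simp
      qed
      have b2: "cmod (H (of_real t + \<i> * of_real \<beta>) - of_real E\<^sub>\<beta> * \<phi> (a0 \<otimes>\<^bsub>CA\<^esub> b)) \<le> E\<^sub>\<beta> * (K * \<epsilon>)" for t
      proof -
        have "\<phi> (\<sigma> t a0 \<otimes>\<^bsub>CA\<^esub> b) = \<phi> (\<sigma> t a \<otimes>\<^bsub>CA\<^esub> b) + \<phi> (\<sigma> t (q d) \<otimes>\<^bsub>CA\<^esub> b)"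
          using a qd b by (simp add: ad(4) sigma_add sigma_closed CA_distrib st_add CA_mult_closed)
        moreover have "\<phi> (\<sigma> t a0 \<otimes>\<^bsub>CA\<^esub> b) = exp (\<i> * of_real t * of_int n) * \<phi> (a0 \<otimes>\<^bsub>CA\<^esub> b)"
          using a0 b by (simp add: sig CA_scale_mult st_scale CA_mult_closed)
        ultimately have F1: "F (of_real t + \<i> * of_real \<beta>) = exp (\<i> * of_real t * of_int n) * \<phi> (a0 \<otimes>\<^bsub>CA\<^esub> b) - \<phi> (\<sigma> t (q d) \<otimes>\<^bsub>CA\<^esub> b)"
          by (simp add: Fshift)
        have e: "- (\<i> * of_int n * (of_real t + \<i> * of_real \<beta>)) = - (\<i> * of_int n * of_real t) + of_real (\<beta> * of_int n)"
          by (simp add: complex_eq_iff algebra_simps)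
        have ex: "exp (- (\<i> * of_int n * (of_real t + \<i> * of_real \<beta>))) = exp (- (\<i> * of_int n * of_real t)) * of_real E\<^sub>\<beta>"
          unfolding e by (simp only: exp_add E\<^sub>\<beta>_def exp_of_real)
        have "H (of_real t + \<i> * of_real \<beta>) = (exp (\<i> * of_real t * of_int n) * exp (- (\<i> * of_int n * of_real t))) * (of_real E\<^sub>\<beta> * \<phi> (a0 \<otimes>\<^bsub>CA\<^esub> b))
            - \<phi> (\<sigma> t (q d) \<otimes>\<^bsub>CA\<^esub> b) * exp (- (\<i> * of_int n * of_real t)) * of_real E\<^sub>\<beta>"
          unfolding H_def F1 ex by (simp only: left_diff_distrib right_diff_distrib mult_ac)
        then have "cmod (H (of_real t + \<i> * of_real \<beta>) - of_real E\<^sub>\<beta> * \<phi> (a0 \<otimes>\<^bsub>CA\<^esub> b)) = E\<^sub>\<beta> * cmod (\<phi> (\<sigma> t (q d) \<otimes>\<^bsub>CA\<^esub> b))"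
          by (simp only: cancel) (simp add: norm_mult nexp E\<^sub>\<beta>_def mult.commute)
        also have "\<dots> \<le> E\<^sub>\<beta> * (K * \<epsilon>)"
          using K(3)[OF ad(2), of t] Kd by (intro mult_left_mono) (auto simp: E\<^sub>\<beta>_def)
        finally show ?thesis .
      qed
      have Ke: "0 \<le> K * \<epsilon>" using K(1) e by simp
      have "cmod (of_real (2 * pi) * (of_real E\<^sub>\<beta> * \<phi> (a0 \<otimes>\<^bsub>CA\<^esub> b) - \<phi> (b \<otimes>\<^bsub>CA\<^esub> a0))) =
         cmod ((I - of_real (2 * pi) * \<phi> (b \<otimes>\<^bsub>CA\<^esub> a0)) - (I - of_real (2 * pi) * (of_real E\<^sub>\<beta> * \<phi> (a0 \<otimes>\<^bsub>CA\<^esub> b))))"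
        by (simp add: algebra_simps)
      also have "\<dots> \<le> 2 * pi * (K * \<epsilon>) + 2 * pi * (E\<^sub>\<beta> * (K * \<epsilon>))"
        by (intro order_trans[OF norm_triangle_ineq4] add_mono bound[of _ 0] bound[of _ "\<i> * of_real \<beta>"] b1 b2)
          (use Ke in \<open>auto simp: E\<^sub>\<beta>_def\<close>)
      finally have "2 * pi * cmod (of_real E\<^sub>\<beta> * \<phi> (a0 \<otimes>\<^bsub>CA\<^esub> b) - \<phi> (b \<otimes>\<^bsub>CA\<^esub> a0)) \<le> 2 * pi * ((E\<^sub>\<beta> + 1) * K * \<epsilon>)"
        by (simp only: norm_mult norm_of_real) (simp add: algebra_simps)
      then show "cmod (of_real E\<^sub>\<beta> * \<phi> (a0 \<otimes>\<^bsub>CA\<^esub> b) - \<phi> (b \<otimes>\<^bsub>CA\<^esub> a0)) \<le> (E\<^sub>\<beta> + 1) * K * \<epsilon>"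
        by (rule mult_left_le_imp_le) simp
    qed
  qed
  \<comment> \<open>A second approximation passes from \<open>b\<close> in \<open>V\<close> to an
    arbitrary \<open>y\<close>.\<close>
  obtain K where K: "0 \<le> K" "\<And>a. a \<in> carrier T \<Longrightarrow> cmod (\<phi> (a0 \<otimes>\<^bsub>CA\<^esub> q a)) \<le> K * cnorm T a"
    "\<And>a. a \<in> carrier T \<Longrightarrow> cmod (\<phi> (q a \<otimes>\<^bsub>CA\<^esub> a0)) \<le> K * cnorm T a"
    using state_mult_bound[OF st a0] by metis
  have "of_real E\<^sub>\<beta> * \<phi> (a0 \<otimes>\<^bsub>CA\<^esub> y) - \<phi> (y \<otimes>\<^bsub>CA\<^esub> a0) = 0"
  proof (rule small_imp_zero)
    show "0 \<le> (E\<^sub>\<beta> + 1) * K" using K(1) by (simp add: E\<^sub>\<beta>_def)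
    fix \<epsilon> :: real assume e: "0 < \<epsilon>"
    obtain v d where vd: "v \<in> V" "d \<in> carrier T" "cnorm T d < \<epsilon>" "y = v \<oplus>\<^bsub>CA\<^esub> q d"
      using CA_approx[OF V(2,3) y e] by blast
    have v: "v \<in> carrier CA" and qd: "q d \<in> carrier CA" using vd V(2) by (auto simp: CA_eq)
    have "of_real E\<^sub>\<beta> * \<phi> (a0 \<otimes>\<^bsub>CA\<^esub> y) - \<phi> (y \<otimes>\<^bsub>CA\<^esub> a0) =
        of_real E\<^sub>\<beta> * \<phi> (a0 \<otimes>\<^bsub>CA\<^esub> q d) - \<phi> (q d \<otimes>\<^bsub>CA\<^esub> a0)"
      using main[OF vd(1)] v qd a0 by (simp add: vd(4) CA_distrib st_add CA_mult_closed algebra_simps)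
    also have "cmod \<dots> \<le> E\<^sub>\<beta> * (K * cnorm T d) + K * cnorm T d"
      using K(2,3)[OF vd(2)] by (intro order_trans[OF norm_triangle_ineq4] add_mono)
        (auto simp: norm_mult E\<^sub>\<beta>_def intro!: mult_left_mono)
    also have "\<dots> = ((E\<^sub>\<beta> + 1) * K) * cnorm T d" by (simp add: algebra_simps)
    also have "\<dots> \<le> (E\<^sub>\<beta> + 1) * K * \<epsilon>"
      using vd(3) K(1) by (intro mult_left_mono) (auto simp: E\<^sub>\<beta>_def)
    finally show "cmod (of_real E\<^sub>\<beta> * \<phi> (a0 \<otimes>\<^bsub>CA\<^esub> y) - \<phi> (y \<otimes>\<^bsub>CA\<^esub> a0)) \<le> (E\<^sub>\<beta> + 1) * K * \<epsilon>" .
  qed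
  then show ?thesis by (simp add: a0_def E\<^sub>\<beta>_def n_def)
qed

end

end


context dynamics_action
begin

text \<open>The span of \<open>S\<close> is a dense invariant submodule, and \<open>kms_pair\<close>
  extends from \<open>S\<close> to it in one variable at a time.\<close>

lemma kms_trace:
  assumes kms: "is_kms_state CA \<sigma> \<beta> \<phi>" and y: "y \<in> carrier CA"
  shows "of_real (exp (\<beta> * of_int (deg w))) * \<phi> (\<kappa> (mon w) \<otimes>\<^bsub>CA\<^esub> y) = \<phi> (y \<otimes>\<^bsub>CA\<^esub> \<kappa> (mon w))"
proof -
  have st: "is_state CA \<phi>" using kms by (simp add: is_kms_state_def)
  obtain S where S0: "S \<subseteq> carrier CA \<and> cstar_dense CA (cstar_span CA S) \<and>
    (\<forall>t. \<sigma> t ` cstar_span CA S \<subseteq> cstar_span CA S) \<and>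
    (\<forall>a\<in>S. \<exists>f. is_entire_extension CA \<sigma> a f \<and>
       (\<forall>b\<in>S. \<phi> (a \<otimes>\<^bsub>CA\<^esub> b) = \<phi> (b \<otimes>\<^bsub>CA\<^esub> f (\<i> * of_real \<beta>))))"
    using conjunct1[OF conjunct2[OF kms[unfolded is_kms_state_def]]] by (rule exE)
  have S: "S \<subseteq> carrier CA" "cstar_dense CA (cstar_span CA S)" "\<And>t. \<sigma> t ` cstar_span CA S \<subseteq> cstar_span CA S"
    using S0 by simp_all
  have S4: "\<exists>f. is_entire_extension CA \<sigma> a f \<and> (\<forall>b\<in>S. \<phi> (a \<otimes>\<^bsub>CA\<^esub> b) = \<phi> (b \<otimes>\<^bsub>CA\<^esub> f (\<i> * of_real \<beta>)))"
    if "a \<in> S" for a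
    using S0[THEN conjunct2, THEN conjunct2, THEN conjunct2] that by (rule bspec)
  let ?V = "cstar_span CA S"
  have Vc: "?V \<subseteq> carrier CA" by (rule span_minimal[OF carrier_submodule S(1)])
  have inter: "submodule ?V complex_ring CA"
  proof (rule submodule_CAI[OF Vc])
    show "\<zero>\<^bsub>CA\<^esub> \<in> ?V"
      unfolding cstar_span_def
    proof (intro InterI, elim CollectE conjE)
      fix W assume "submodule W complex_ring CA"
      then show "\<zero>\<^bsub>CA\<^esub> \<in> W" using subgroup.one_closed[OF submodule.axioms(1)] by fastforce
    qed
  qed (auto simp: cstar_span_def submodule_add submodule_scale)
  have SS: "kms_pair \<phi> \<beta> a b" if a: "a \<in> S" and b: "b \<in> S" for a b
  proof -
    obtain f where f: "is_entire_extension CA \<sigma> a f" "\<phi> (a \<otimes>\<^bsub>CA\<^esub> b) = \<phi> (b \<otimes>\<^bsub>CA\<^esub> f (\<i> * of_real \<beta>))"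
      using S4[OF a] b by metis
    have "b \<in> carrier CA" using b S(1) by blast
    then show ?thesis
      using f entire_holomorphic[OF st, of f b] unfolding kms_pair_def[OF st] is_entire_extension_def
      by (intro exI[of _ "\<lambda>z. \<phi> (b \<otimes>\<^bsub>CA\<^esub> f z)"]) auto
  qed
  have SV: "kms_pair \<phi> \<beta> a b" if a: "a \<in> S" and b: "b \<in> ?V" for a b
    using span_minimal[OF kms_pair_submodule_right[OF st, of a \<beta>], of S] SS[OF a] S(1) a b by blast
  have VV: "kms_pair \<phi> \<beta> a b" if a: "a \<in> ?V" and b: "b \<in> ?V" for a b
    using span_minimal[OF kms_pair_submodule_left[OF st, of b \<beta>], of S] SV[OF _ b] S(1) Vc a b by blast
  show ?thesis by (rule kms_word[OF st inter Vc S(2,3) VV y])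
qed


end

lemma (in perron_action) ck_functional_omega: "ck_functional E G act x r omega r"
proof -
  have "pos_functional omega" by (rule om.pos_functional_axioms)
  then show ?thesis
    unfolding ck_functional_def ck_functional_axioms_def
    using perron_action_axioms omega_toeplitz_rel omega_ck omega_1 r_pos omega_trace omega_0_deg by blast
qed

section \<open>KMS states and functionals on words\<close>

locale perron_dynamics = perron_action E G act x r + dynamics_action E G act \<sigma>
  for E :: "('v::finite, 'e::finite) digraph" and G :: "('g, 'v) groupoid"
    and act :: "'g \<Rightarrow> ('v, 'e) path \<Rightarrow> ('v, 'e) path" and x :: "'v \<Rightarrow> real" and r :: real
    and \<sigma> :: "real \<Rightarrow> ('v, 'e, 'g) cuntz_elem \<Rightarrow> ('v, 'e, 'g) cuntz_elem"
begin

lemma ck_functional_kms: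
  assumes kms: "is_kms_state CA \<sigma> \<beta> \<phi>"
  shows "ck_functional E G act x r (\<lambda>a. \<phi> (\<kappa> a)) (exp \<beta>)"
proof -
  have st: "is_state CA \<phi>" using kms by (simp add: is_kms_state_def)
  note F = state_kappa_functional[OF st]
  have gauge: "\<phi> (\<kappa> (mon w)) = 0" if d: "deg w \<noteq> 0" for w
  proof (cases "\<beta> = 0")
    case True
    \<comment> \<open>At this time the word is multiplied by -1, so the invariance required at
      \<open>\<beta> = 0\<close> forces its value to vanish.\<close>
    define t where "t = pi / of_int (deg w)"
    have "\<i> * of_real t * of_int (deg w) = of_real pi * \<i>" using d by (simp add: t_def)
    then have "rot w t = -1" unfolding rot_def by (simp only: exp_pi_i)
    then have "\<phi> (\<sigma> t (\<kappa> (mon w))) = - \<phi> (\<kappa> (mon w))"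
      using st_scale[OF st kappa_closed, of "-1" "mon w"] by (simp add: sigma_word)
    moreover have "\<phi> (\<sigma> t (\<kappa> (mon w))) = \<phi> (\<kappa> (mon w))" using kms True by (simp add: is_kms_state_def)
    ultimately show ?thesis by simp
  next
    case False
    \<comment> \<open>With the unit in place of \<open>y\<close>, both sides are multiples of the
      same value, and the factors differ.\<close>
    have "of_real (exp (\<beta> * of_int (deg w))) * \<phi> (\<kappa> (mon w)) = \<phi> (\<kappa> (mon w))"
      using kms_trace[OF kms kappa_closed[of 1], of w] by (simp add: kappa_hom)
    then have "(of_real (exp (\<beta> * of_int (deg w))) - of_real 1) * \<phi> (\<kappa> (mon w)) = 0" by (simp add: left_diff_distrib)
    then show ?thesis using False d by (simp only: mult_eq_0_iff right_minus_eq of_real_eq_iff) simp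
  qed
  \<comment> \<open>\<open>kms_trace\<close> carries an exponential of \<open>deg u\<close>, the
    locale one of \<open>deg w\<close>. They are inverse to each other in total degree 0; in other
    degrees both values vanish.\<close>
  have trace: "\<phi> (\<kappa> (mon u * mon w)) = of_real (exp \<beta> powi deg w) * \<phi> (\<kappa> (mon w * mon u))" for u w
  proof (cases "deg u + deg w = 0")
    case True
    then have u: "deg u = - deg w" by simp
    have "of_real (exp (\<beta> * of_int (deg u))) * \<phi> (\<kappa> (mon u * mon w)) = \<phi> (\<kappa> (mon w * mon u))"
      using kms_trace[OF kms kappa_closed[of "mon w"], of u] by (simp add: kappa_hom)
    then have "of_real (exp \<beta> powi deg w) * \<phi> (\<kappa> (mon w * mon u)) =
        of_real (exp (of_int (deg w) * \<beta>) * exp (\<beta> * of_int (deg u))) * \<phi> (\<kappa> (mon u * mon w))"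
      by (simp only: of_real_mult mult.assoc exp_power_int)
    also have "exp (of_int (deg w) * \<beta>) * exp (\<beta> * of_int (deg u)) = 1"
      by (simp add: u exp_add[symmetric])
    finally show ?thesis by simp
  next
    case False
    then have "\<phi> (\<kappa> (mon (u + w))) = 0" "\<phi> (\<kappa> (mon (w + u))) = 0" by (intro gauge; simp add: deg_add)+
    then show ?thesis by (simp add: mon_add)
  qed
  show ?thesis
  proof (intro ck_functional.intro ck_functional_axioms.intro)
    show "perron_action E G act x r" by (rule perron_action_axioms)
    show "pos_functional (\<lambda>a. \<phi> (\<kappa> a))" by (rule F(1))
    show "eqv (\<lambda>a. \<phi> (\<kappa> a)) a b" if "(a, b) \<in> toeplitz_rel E G act" for a b using that by (rule F(2))
    show "eqv (\<lambda>a. \<phi> (\<kappa> a)) (gP v) (ck_sum E v)" for v by (rule F(3))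
    show "\<phi> (\<kappa> 1) = 1" by (rule F(4))
    show "0 < exp \<beta>" by simp
    show "\<phi> (\<kappa> (mon u * mon w)) = of_real (exp \<beta> powi deg w) * \<phi> (\<kappa> (mon w * mon u))" for u w
      by (rule trace)
    show "\<phi> (\<kappa> (mon w)) = 0" if "deg w \<noteq> 0" for w using that by (rule gauge)
  qed
qed

lemma kappa_in_submodule:
  assumes W: "submodule W complex_ring CA" "range (\<lambda>w. \<kappa> (mon w)) \<subseteq> W"
  shows "\<kappa> a \<in> W"
proof -
  have "\<zero>\<^bsub>CA\<^esub> \<in> W" using subgroup.one_closed[OF submodule.axioms(1)[OF W(1)]] by simp
  then have z: "\<kappa> 0 \<in> W" by (simp add: \<kappa>_def CA_eq Q.q_zero tau_hom)
  have "\<kappa> (\<Sum>w\<in>A. free_scale (f w) (mon w)) \<in> W" for A f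
  proof (induction A rule: infinite_finite_induct)
    case (insert w A)
    have "f w \<odot>\<^bsub>CA\<^esub> \<kappa> (mon w) \<in> W" by (rule submodule_scale[OF W(1)]) (use W(2) in auto)
    from submodule_add[OF W(1) this insert.IH] show ?case using insert.hyps by (simp add: kappa_hom)
  qed (simp_all add: z)
  then show ?thesis using free_alg_expand[of a] by metis
qed

lemma cnorm_kappa_le: "cnorm CA (\<kappa> a) \<le> N a" and cnorm_kappa_nonneg: "0 \<le> cnorm CA (\<kappa> a)"
proof -
  have "cnorm T (\<tau> a) = N a" unfolding toeplitz_alg_def by (rule cnorm_to_completion[OF cstar_seminorm_toeplitz_norm])
  then show "cnorm CA (\<kappa> a) \<le> N a" "0 \<le> cnorm CA (\<kappa> a)"
    using Q.cnorm_q_le[OF tau_closed[of a]] Q.cnorm_q_nonneg[OF tau_closed[of a]] by (simp_all add: \<kappa>_def CA_eq)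
qed

lemma entire_extension_word:
  "is_entire_extension CA \<sigma> (\<kappa> (mon w)) (\<lambda>z. exp (\<i> * z * of_int (deg w)) \<odot>\<^bsub>CA\<^esub> \<kappa> (mon w))"
proof -
  define e where "e z = exp (\<i> * z * of_int (deg w))" for z
  define e' where "e' z = \<i> * of_int (deg w) * e z" for z
  have de: "(e has_field_derivative e' z) (at z)" for z
    unfolding e_def e'_def by (auto intro!: derivative_eq_intros)
  have "((\<lambda>h. cnorm CA (inverse h \<odot>\<^bsub>CA\<^esub> (e (z + h) \<odot>\<^bsub>CA\<^esub> \<kappa> (mon w) \<ominus>\<^bsub>CA\<^esub> e z \<odot>\<^bsub>CA\<^esub> \<kappa> (mon w)) \<ominus>\<^bsub>CA\<^esub> e' z \<odot>\<^bsub>CA\<^esub> \<kappa> (mon w))) \<longlongrightarrow> 0) (at 0)" for z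
  proof (rule Lim_null_comparison)
    have "((\<lambda>h. (e (z + h) - e z) / h - e' z) \<longlongrightarrow> 0) (at 0)" using de[of z] by (simp add: DERIV_def LIM_zero)
    then show "((\<lambda>h. cmod ((e (z + h) - e z) / h - e' z) * N (mon w)) \<longlongrightarrow> 0) (at 0)"
      by (intro tendsto_mult_left_zero tendsto_norm_zero)
    have "norm (cnorm CA (inverse h \<odot>\<^bsub>CA\<^esub> (e (z + h) \<odot>\<^bsub>CA\<^esub> \<kappa> (mon w) \<ominus>\<^bsub>CA\<^esub> e z \<odot>\<^bsub>CA\<^esub> \<kappa> (mon w)) \<ominus>\<^bsub>CA\<^esub> e' z \<odot>\<^bsub>CA\<^esub> \<kappa> (mon w)))
        \<le> cmod ((e (z + h) - e z) / h - e' z) * N (mon w)" for h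
    proof -
      have scale_diff: "free_scale y a - free_scale z a = free_scale (y - z) a" for y z and a :: "('v, 'e, 'g) generator free_alg"
        by (simp add: free_scale_def single_diff left_diff_distrib)
      have "inverse h \<odot>\<^bsub>CA\<^esub> (e (z + h) \<odot>\<^bsub>CA\<^esub> \<kappa> (mon w) \<ominus>\<^bsub>CA\<^esub> e z \<odot>\<^bsub>CA\<^esub> \<kappa> (mon w)) \<ominus>\<^bsub>CA\<^esub> e' z \<odot>\<^bsub>CA\<^esub> \<kappa> (mon w) =
          \<kappa> (free_scale ((e (z + h) - e z) / h - e' z) (mon w))"
        by (simp add: kappa_hom scale_diff free_scale_scale divide_inverse mult.commute)
      then show ?thesis
        using cnorm_kappa_le[of "free_scale ((e (z + h) - e z) / h - e' z) (mon w)"]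
          cnorm_kappa_nonneg[of "free_scale ((e (z + h) - e z) / h - e' z) (mon w)"] by (simp add: Tn.N_scale)
    qed
    then show "\<forall>\<^sub>F h in at 0. norm (cnorm CA (inverse h \<odot>\<^bsub>CA\<^esub> (e (z + h) \<odot>\<^bsub>CA\<^esub> \<kappa> (mon w) \<ominus>\<^bsub>CA\<^esub> e z \<odot>\<^bsub>CA\<^esub> \<kappa> (mon w)) \<ominus>\<^bsub>CA\<^esub> e' z \<odot>\<^bsub>CA\<^esub> \<kappa> (mon w)))
        \<le> cmod ((e (z + h) - e z) / h - e' z) * N (mon w)" by (rule always_eventually[OF allI])
  qed
  then show ?thesis
    unfolding is_entire_extension_def is_entire_def e_def[symmetric]
    by (auto simp: CA_scale_closed sigma_word rot_def e_def intro!: bexI[of _ "e' _ \<odot>\<^bsub>CA\<^esub> \<kappa> (mon w)"])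
qed

text \<open>The words serve as analytic elements. At \<open>\<i> ln r\<close> the scalar of
  \<open>u\<close> is \<open>r\<close> to the power \<open>- deg u\<close>, which matches the factor
  in \<open>omega_trace\<close> when the total degree is 0; otherwise both sides vanish.\<close>

lemma kms_perron_state:
  assumes st: "is_state CA \<psi>" and \<psi>: "\<And>a. \<psi> (\<kappa> a) = omega a"
  shows "is_kms_state CA \<sigma> (ln r) \<psi>"
proof -
  let ?S = "range (\<lambda>w. \<kappa> (mon w))"
  have "cstar_dense CA (cstar_span CA ?S)"
    unfolding cstar_dense_def
  proof (intro ballI allI impI)
    fix y and \<epsilon> :: real assume "y \<in> carrier CA" and e: "0 < \<epsilon>"
    then obtain t where t: "t \<in> carrier T" "y = q t" using CA_rep by blast
    obtain a where a: "cnorm T (t \<ominus>\<^bsub>T\<^esub> \<tau> a) < \<epsilon>" using tau_dense[OF t(1) e] .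
    have "y \<ominus>\<^bsub>CA\<^esub> \<kappa> a = q (t \<ominus>\<^bsub>T\<^esub> \<tau> a)" using t by (simp add: CA_eq \<kappa>_def Q.q_minus)
    then have "cnorm CA (y \<ominus>\<^bsub>CA\<^esub> \<kappa> a) < \<epsilon>"
      using Q.cnorm_q_le[OF ring.ring_simprules(4)[OF T.ring_A t(1) tau_closed[of a]]] a by (simp add: CA_eq)
    moreover have "\<kappa> a \<in> cstar_span CA ?S" using kappa_in_submodule by (auto simp: cstar_span_def)
    ultimately show "\<exists>b\<in>cstar_span CA ?S. cnorm CA (y \<ominus>\<^bsub>CA\<^esub> b) < \<epsilon>" by blast
  qed
  moreover have "\<sigma> t ` cstar_span CA ?S \<subseteq> cstar_span CA ?S" for t
  proof (intro image_subsetI)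
    fix y assume y: "y \<in> cstar_span CA ?S"
    show "\<sigma> t y \<in> cstar_span CA ?S"
      unfolding cstar_span_def
    proof (intro InterI, elim CollectE conjE)
      fix W assume W: "submodule W complex_ring CA" "?S \<subseteq> W"
      have z: "\<zero>\<^bsub>CA\<^esub> \<in> W" using subgroup.one_closed[OF submodule.axioms(1)[OF W(1)]] by simp
      have "submodule {a \<in> carrier CA. \<sigma> t a \<in> W} complex_ring CA"
        by (rule submodule_CAI)
          (auto simp: sigma_zero z CA_zero_closed CA_add_closed CA_scale_closed sigma_add sigma_scale
            submodule_add[OF W(1)] submodule_scale[OF W(1)])
      moreover have "?S \<subseteq> {a \<in> carrier CA. \<sigma> t a \<in> W}"
        using W(2) submodule_scale[OF W(1)] by (auto simp: sigma_word)
      ultimately have "cstar_span CA ?S \<subseteq> {a \<in> carrier CA. \<sigma> t a \<in> W}" by (rule span_minimal)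
      then show "\<sigma> t y \<in> W" using y by blast
    qed
  qed
  moreover have "\<psi> (\<kappa> (mon u) \<otimes>\<^bsub>CA\<^esub> \<kappa> (mon w)) =
      \<psi> (\<kappa> (mon w) \<otimes>\<^bsub>CA\<^esub> (exp (\<i> * (\<i> * of_real (ln r)) * of_int (deg u)) \<odot>\<^bsub>CA\<^esub> \<kappa> (mon u)))" for u w
  proof -
    have "exp (\<i> * (\<i> * of_real (ln r)) * of_int (deg u)) = (of_real (exp (- (ln r * of_int (deg u)))) :: complex)"
    proof -
      have "\<i> * (\<i> * of_real (ln r)) * of_int (deg u) = (of_real (- (ln r * of_int (deg u))) :: complex)"
        by (simp add: complex_eq_iff)
      then show ?thesis by (simp only: exp_of_real)
    qed
    then have rhs: "\<psi> (\<kappa> (mon w) \<otimes>\<^bsub>CA\<^esub> (exp (\<i> * (\<i> * of_real (ln r)) * of_int (deg u)) \<odot>\<^bsub>CA\<^esub> \<kappa> (mon u))) =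
        of_real (exp (- (ln r * of_int (deg u)))) * omega (mon w * mon u)"
      by (simp only: CA_mult_scale kappa_closed kappa_hom(1) st_scale[OF st] \<psi>)
    show ?thesis
    proof (cases "deg u + deg w = 0")
      case True
      have "r powi deg w = exp (- (ln r * of_int (deg u)))"
      proof -
        have w: "deg w = - deg u" using True by simp
        have "r powi deg w = exp (ln r) powi deg w" using r_pos by simp
        also have "\<dots> = exp (of_int (deg w) * ln r)" by (rule exp_power_int)
        finally show ?thesis by (simp add: w mult.commute)
      qed
      then show ?thesis unfolding rhs by (simp add: kappa_hom \<psi> omega_trace[of u w])
    next
      case False
      then have "omega (mon (u + w)) = 0" "omega (mon (w + u)) = 0" by (intro omega_0_deg; simp add: deg_add)+
      then show ?thesis unfolding rhs by (simp add: kappa_hom \<psi> mon_add)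
    qed
  qed
  then have "\<forall>a\<in>?S. \<exists>f. is_entire_extension CA \<sigma> a f \<and>
      (\<forall>b\<in>?S. \<psi> (a \<otimes>\<^bsub>CA\<^esub> b) = \<psi> (b \<otimes>\<^bsub>CA\<^esub> f (\<i> * complex_of_real (ln r))))"
    using entire_extension_word by blast
  \<comment> \<open>The definition asks for invariance at \<open>\<beta> = 0\<close>, that is for
    \<open>r = 1\<close>. It holds for every \<open>r\<close>, because \<open>omega\<close> vanishes
    off degree 0.\<close>
  moreover have "\<psi> (\<sigma> t y) = \<psi> y" if "y \<in> carrier CA" for t y
  proof (rule states_eqI[OF state_sigma[OF st] st _ that])
    fix w
    show "\<psi> (\<sigma> t (\<kappa> (mon w))) = \<psi> (\<kappa> (mon w))"
      by (cases "deg w = 0") (simp_all add: sigma_word st_scale[OF st] \<psi> omega_0_deg rot_def)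
  qed
  moreover have "?S \<subseteq> carrier CA" by auto
  ultimately show ?thesis unfolding is_kms_state_def using st by blast
qed

end

theorem theorem8p3:
  fixes E :: "('v::finite, 'e::finite) digraph"
    and G :: "('g, 'v) groupoid"
    and act :: "'g \<Rightarrow> ('v, 'e) path \<Rightarrow> ('v, 'e) path"
    and x :: "real^'v"
    and \<sigma> :: "real \<Rightarrow> ('v, 'e, 'g) cuntz_elem \<Rightarrow> ('v, 'e, 'g) cuntz_elem"
  assumes "strongly_connected E"
    and "no_sources E"
    and "self_similar_action E G act"
    and "\<forall>v. x $ v > 0"
    and "vertex_matrix E *v x = spectral_radius (vertex_matrix E) *s x"
    and "(\<Sum>v\<in>UNIV. \<bar>x $ v\<bar>) = 1"
    and "is_dynamics (cuntz_alg E G act) \<sigma>"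
    and "\<forall>t. \<forall>\<mu>\<in>all_paths E. \<forall>g. \<forall>\<nu>\<in>all_paths E.
           \<sigma> t (cuntz_elt E G act \<mu> g \<nu>) =
             exp (\<i> * complex_of_real t * (of_nat (path_len \<mu>) - of_nat (path_len \<nu>)))
               \<odot>\<^bsub>cuntz_alg E G act\<^esub> cuntz_elt E G act \<mu> g \<nu>"
  shows "(\<forall>g. convergent (fixed_seq E G act x g)) \<and>
    (\<forall>v. fixed_lim E G act x (gid G v) = x $ v) \<and>
    (\<exists>\<psi>.
      (is_kms_state (cuntz_alg E G act) \<sigma> (ln (spectral_radius (vertex_matrix E))) \<psi> \<and>
       (\<forall>\<kappa>\<in>all_paths E. \<forall>\<eta>\<in>all_paths E. \<forall>g.
          \<psi> (cuntz_elt E G act \<kappa> g \<eta>) =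
            (if \<kappa> = \<eta> \<and> gdom G g = path_src E \<kappa> \<and> gcod G g = path_src E \<kappa>
             then complex_of_real
               (fixed_lim E G act x g / spectral_radius (vertex_matrix E) ^ path_len \<kappa>)
             else 0))) \<and>
      ((\<forall>g. g \<notin> range (gid G) \<longrightarrow> finite (restrict_path E G act g ` vpaths E (gdom G g))) \<longrightarrow>
       (\<forall>\<beta> \<phi>. is_kms_state (cuntz_alg E G act) \<sigma> \<beta> \<phi> \<longrightarrow>
          (\<forall>a\<in>carrier (cuntz_alg E G act). \<phi> a = \<psi> a))))"
proof -
  define \<rho> where "\<rho> = spectral_radius (vertex_matrix E)"
  interpret perron_dynamics E G act "\<lambda>v. x $ v" \<rho> \<sigma>
  proof (intro perron_dynamics.intro perron_action.intro dynamics_action.intro finite_action.intro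
      perron_action_axioms.intro dynamics_action_axioms.intro)
    show "esum E (\<lambda>v. x $ v) v = \<rho> * x $ v" for v
      using arg_cong[OF assms(5), of "\<lambda>y. y $ v"] by (simp add: vertex_matrix_mult \<rho>_def)
    show "(\<Sum>v\<in>UNIV. x $ v) = 1" using assms(4,6) by (simp add: less_imp_le)
  qed (use assms in auto)
  interpret om: ck_functional E G act "\<lambda>v. x $ v" \<rho> omega \<rho> by (rule ck_functional_omega)
  have seq: "fixed_seq E G act x g = (\<lambda>k. fixw k (lett (GenU g) False))" for g
    by (simp add: fixed_seq_def fixw_U fun_eq_iff flip: \<rho>_def)
  have lim: "fixed_lim E G act x g = fixl (lett (GenU g) False)" for g
    by (simp add: fixed_lim_def seq fixl_def)
  have om_U: "omega (gU g) = of_real (fixed_lim E G act x g)" for g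
    by (simp add: free_gen_mon omega_mon lim)
  have conv: "convergent (fixed_seq E G act x g)" for g
    unfolding seq by (rule convergentI[OF fixw_tendsto])
  \<comment> \<open>\<open>omega\<close> is itself a \<open>ck_functional\<close>, so its value at a
    unit is already determined by Perron-Frobenius uniqueness.\<close>
  have unit: "fixed_lim E G act x (gid G v) = x $ v" for v
    using om.phi_U_id[of v] by (simp only: om_U of_real_eq_iff)
  obtain \<psi> where st: "is_state CA \<psi>" and \<psi>: "\<And>a. \<psi> (\<kappa> a) = omega a" using ex_perron_state by blast
  have val: "\<psi> (cuntz_elt E G act \<mu> g \<eta>) =
      (if \<mu> = \<eta> \<and> gdom G g = path_src E \<mu> \<and> gcod G g = path_src E \<mu>
       then complex_of_real (fixed_lim E G act x g / spectral_radius (vertex_matrix E) ^ path_len \<mu>) else 0)"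
    if \<mu>: "\<mu> \<in> all_paths E" and \<eta>: "\<eta> \<in> all_paths E" for \<mu> \<eta> g
  proof -
    obtain v es a where m: "\<mu> = (v, es)" "is_walk E v es a" using \<mu> by (cases \<mu>) (auto simp: in_all_paths_iff)
    obtain u fs b where n: "\<eta> = (u, fs)" "is_walk E u fs b" using \<eta> by (cases \<eta>) (auto simp: in_all_paths_iff)
    have src: "path_src E \<mu> = a" using is_walk_src[OF m(2)] m(1) by simp
    \<comment> \<open>A nonempty edge list determines range and source. For an empty list both are
      the vertex itself, which \<open>a = b\<close> compares.\<close>
    have "es = fs \<and> a = b \<longleftrightarrow> \<mu> = \<eta>"
      using m n is_walk_src[OF m(2)] is_walk_src[OF n(2)] by (cases es) auto
    then have c: "es = fs \<and> a = b \<and> gcod G g = a \<and> gdom G g = a \<longleftrightarrow> \<mu> = \<eta> \<and> gdom G g = a \<and> gcod G g = a"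
      by blast
    have len: "path_len \<mu> = length es" by (simp add: m(1) path_len_def)
    have "\<psi> (cuntz_elt E G act \<mu> g \<eta>) = omega (Sp \<mu> * gU g * free_star (Sp \<eta>))"
      by (simp only: cuntz_elt_kappa \<psi>)
    also have "\<dots> = (if es = fs \<and> a = b \<and> gcod G g = a \<and> gdom G g = a
        then of_real (inverse \<rho> ^ length es) * omega (gU g) else 0)"
      unfolding m(1) n(1) by (rule om.elt_value[OF m(2) n(2)])
    finally show ?thesis
      unfolding c src len om_U \<rho>_def[symmetric] by (simp add: divide_inverse mult.commute power_inverse)
  qed
  have unique: "\<phi> a = \<psi> a"
    if fin: "\<forall>g. g \<notin> range (gid G) \<longrightarrow> finite (restrict_path E G act g ` vpaths E (gdom G g))"
      and kms: "is_kms_state CA \<sigma> \<beta> \<phi>" and a: "a \<in> carrier CA" for \<beta> \<phi> a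
  proof (rule states_eqI[OF _ st _ a])
    show "is_state CA \<phi>" using kms by (simp add: is_kms_state_def)
    note c = ck_functional_kms[OF kms] ck_functional_omega
    show "\<phi> (\<kappa> (mon w)) = \<psi> (\<kappa> (mon w))" for w
      unfolding \<psi> by (rule words_unique[OF c phi_U_unique[OF c]]) (use fin in blast)
  qed
  show ?thesis
  proof (intro conjI exI[of _ \<psi>] allI ballI impI)
    show "convergent (fixed_seq E G act x g)" for g by (rule conv)
    show "fixed_lim E G act x (gid G v) = x $ v" for v by (rule unit)
    show "is_kms_state CA \<sigma> (ln (spectral_radius (vertex_matrix E))) \<psi>"
      using kms_perron_state[OF st \<psi>] by (simp only: \<rho>_def)
  qed (rule val unique; assumption)+
qed


end
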